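(* Fix $r>0$ and let $P=P_r\subset\mathbb{R}^3$ be the isohedral triakis tetrahedron with parameter $r$ described in the context. For $k\in\{0,1,2,3\}$ let $G(k)$ be the symmetry group of the $k$-skeleton $P(k)$, let $\mathcal{H}_{P(k)}$ be the space of $P(k)$-harmonic functions and $\mathcal{H}_{G(k)}$ the space of $G(k)$-harmonic functions. Let $r_1=3.62398\cdots$ be the unique positive root of $$\chi_1(r)=r^6+2r^5+r^4-36r^3-45r^2-270r-405=0.$$ Then $\mathcal{H}_{P(k)}$ is strictly larger than $\mathcal{H}_{G(k)}$ if and only if $k=1$ and $r=r_1$. Moreover $$\mathcal{H}_{P(k)}=\begin{cases}\mathcal{H}_{\mathrm{B}_3} & \text{if either } k=1,\ r=r_1;\ \text{or } k\in\{0,2,3\},\ r=3,\\ \mathcal{H}_{\mathrm{A}_3} & \text{otherwise}.\end{cases}$$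
   Context: Let $T$ be the regular tetrahedron with vertices $\mathrm{A}=(1,-1,-1)$, $\mathrm{B}=(-1,1,-1)$, $\mathrm{C}=(-1,-1,1)$, $\mathrm{D}=(1,1,1)$, centered at the origin. For $r>0$ put $\mathrm{a}=r(\mathrm{B}+\mathrm{C}+\mathrm{D})/3$, $\mathrm{b}=r(\mathrm{A}+\mathrm{C}+\mathrm{D})/3$, $\mathrm{c}=r(\mathrm{A}+\mathrm{B}+\mathrm{D})/3$, $\mathrm{d}=r(\mathrm{A}+\mathrm{B}+\mathrm{C})/3$ (so $\mathrm{d}$ lies on the ray from the origin through the center $\mathrm{d}'$ of face $\mathrm{ABC}$ with $|\mathrm{d}|:|\mathrm{d}'|=r:1$). The isohedral triakis tetrahedron $P$ is obtained from $T$ by adjoining (if $r>1$) or excavating (if $r<1$) on each face the pyramid with apex the corresponding point among $\mathrm{a},\mathrm{b},\mathrm{c},\mathrm{d}$. Combinatorially, for every $r>0$ (even when some faces are coplanar, e.g. $r=1$ or $r=3$) $P$ has the 8 vertices $\mathrm{A},\mathrm{B},\mathrm{C},\mathrm{D},\mathrm{a},\mathrm{b},\mathrm{c},\mathrm{d}$; the 18 edges consisting of the 6 edges of $T$ and the 12 segments $\mathrm{X}\mathrm{y}$ joining a vertex $\mathrm{X}$ of $T$ to an apex $\mathrm{y}$ with $\mathrm{y}$ not the apex over the face opposite to $\mathrm{X}$ (i.e. $\mathrm{Ab},\mathrm{Ac},\mathrm{Ad},\mathrm{Ba},\mathrm{Bc},\mathrm{Bd},\mathrm{Ca},\mathrm{Cb},\mathrm{Cd},\mathrm{Da},\mathrm{Db},\mathrm{Dc}$);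 and the 12 triangular faces $\mathrm{ABc},\mathrm{ABd},\mathrm{ACb},\mathrm{ACd},\mathrm{ADb},\mathrm{ADc},\mathrm{BCa},\mathrm{BCd},\mathrm{BDa},\mathrm{BDc},\mathrm{CDa},\mathrm{CDb}$. The $k$-skeleton $P(k)$ is the union of the $k$-dimensional faces ($P(0)$ the vertex set, $P(1)$ the union of edges, $P(2)$ the union of the triangular faces, $P(3)$ the solid polyhedron). $G(k)$ is the group of orthogonal transformations of $\mathbb{R}^3$ mapping $P(k)$ onto itself. A continuous function $f$ on $\mathbb{R}^3$ is $P(k)$-harmonic if $f(x)=\frac{1}{|P(k)|}\int_{P(k)}f(x+ry)\,d\mu_k(y)$ for all $x\in\mathbb{R}^3$ and all $r>0$, where $\mu_k$ is $k$-dimensional Euclidean (Hausdorff) measure on $P(k)$ and $|P(k)|=\mu_k(P(k))$; $\mathcal{H}_{P(k)}$ is the set of such functions. For a subgroup $G\subset O(3)$, a $G$-harmonic function is a distribution solution $f$ of $\varphi(\partial)f=0$ for every $G$-invariant polynomial $\varphi$ with $\varphi(0)=0$, where $\partial=(\partial/\partial x_1,\partial/\partial x_2,\partial/\partial x_3)$; $\mathcal{H}_G$ denotes the set of these. $W(\mathrm{A}_3)$ is the symmetry group of $T$ (order 24) and $W(\mathrm{B}_3)$ is the symmetry group of the cube with vertices $(\pm1,\pm1,\pm1)$ (the group of signed permutation matrices, order 48); $\mathcal{H}_{\mathrm{A}_3}:=\mathcal{H}_{W(\mathrm{A}_3)}$ and $\mathcal{H}_{\mathrm{B}_3}:=\mathcal{H}_{W(\mathrm{B}_3)}$.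 *)

theory Defs
  imports
    "HOL-Analysis.Analysis"
    "HOL-Library.Poly_Mapping"
    "HOL-Library.FuncSet"
begin

section \<open>The isohedral triakis tetrahedron and its skeletons\<close>

text \<open>The indices 0, 1, 2, 3 stand for A, B, C, D. The apex with index \<open>i\<close> lies over the face of the
  tetrahedron opposite to the vertex with index \<open>i\<close>.\<close>

definition tet_vertex :: "nat \<Rightarrow> real ^ 3" where
  "tet_vertex i =
     [vector [1, -1, -1], vector [-1, 1, -1], vector [-1, -1, 1], vector [1, 1, 1]] ! i"

definition tet_apex :: "real \<Rightarrow> nat \<Rightarrow> real ^ 3" where
  "tet_apex r i = (r / 3) *\<^sub>R (\<Sum>j \<in> {..<4} - {i}. tet_vertex j)"

definition tetrahedron :: "(real ^ 3) set" where
  "tetrahedron = convex hull (tet_vertex ` {..<4})"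

definition pyramid :: "real \<Rightarrow> nat \<Rightarrow> (real ^ 3) set" where
  "pyramid r i = convex hull (insert (tet_apex r i) (tet_vertex ` ({..<4} - {i})))"

definition triakis_vertices :: "real \<Rightarrow> (real ^ 3) set" where
  "triakis_vertices r = tet_vertex ` {..<4} \<union> tet_apex r ` {..<4}"

definition triakis_edges :: "real \<Rightarrow> (real ^ 3) set set" where
  "triakis_edges r =
     {closed_segment (tet_vertex i) (tet_vertex j) | i j. i < 4 \<and> j < 4 \<and> i \<noteq> j} \<union>
     {closed_segment (tet_vertex i) (tet_apex r j) | i j. i < 4 \<and> j < 4 \<and> i \<noteq> j}"

definition triakis_faces :: "real \<Rightarrow> (real ^ 3) set set" where
  "triakis_faces r =
     {convex hull {tet_vertex i, tet_vertex j, tet_apex r k} | i j k.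
        i < 4 \<and> j < 4 \<and> k < 4 \<and> i \<noteq> j \<and> k \<noteq> i \<and> k \<noteq> j}"

text \<open>For \<open>r = 1\<close> the pyramids are flat and the solid is the tetrahedron itself. In the excavated case
  the closure restores the part of the boundary that is removed together with the closed pyramids.\<close>

definition triakis_solid :: "real \<Rightarrow> (real ^ 3) set" where
  "triakis_solid r =
     (if r \<ge> 1 then tetrahedron \<union> (\<Union>i<4. pyramid r i)
      else closure (tetrahedron - (\<Union>i<4. pyramid r i)))"

definition skeleton :: "real \<Rightarrow> nat \<Rightarrow> (real ^ 3) set" where
  "skeleton r k =
     (if k = 0 then triakis_vertices r
      else if k = 1 then \<Union> (triakis_edges r)
      else if k = 2 then \<Union> (triakis_faces r)
      else triakis_solid r)"


section \<open>Symmetry groups\<close>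

definition symmetry_group :: "(real ^ 3) set \<Rightarrow> (real ^ 3 \<Rightarrow> real ^ 3) set" where
  "symmetry_group S = {g. orthogonal_transformation g \<and> g ` S = S}"

definition W_A3 :: "(real ^ 3 \<Rightarrow> real ^ 3) set" where
  "W_A3 = symmetry_group tetrahedron"

definition W_B3 :: "(real ^ 3 \<Rightarrow> real ^ 3) set" where
  "W_B3 = symmetry_group (convex hull {x. \<forall>i. x $ i = 1 \<or> x $ i = -1})"


section \<open>Hausdorff measure\<close>

text \<open>The factor \<open>unit_ball_vol k / 2 ^ k\<close> is the normalization under which the \<open>k\<close>-dimensional
  Hausdorff measure is the Euclidean \<open>k\<close>-volume. The empty set is treated separately because of
  \<open>0 ^ 0 = 1\<close>, and boundedness is required because \<open>diameter\<close> is meaningless for unbounded sets.\<close>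

definition hausdorff_weight :: "nat \<Rightarrow> 'a::metric_space set \<Rightarrow> ennreal" where
  "hausdorff_weight k U =
     (if U = {} then 0 else ennreal (unit_ball_vol (real k) / 2 ^ k * diameter U ^ k))"

definition hausdorff_premeasure :: "nat \<Rightarrow> real \<Rightarrow> 'a::metric_space set \<Rightarrow> ennreal" where
  "hausdorff_premeasure k \<delta> A =
     (INF U \<in> {U :: nat \<Rightarrow> 'a set. A \<subseteq> (\<Union>n. U n) \<and> (\<forall>n. bounded (U n) \<and> diameter (U n) \<le> \<delta>)}.
        suminf (\<lambda>n. hausdorff_weight k (U n)))"

definition hausdorff_outer_measure :: "nat \<Rightarrow> 'a::metric_space set \<Rightarrow> ennreal" where
  "hausdorff_outer_measure k A = (SUP \<delta> \<in> {0<..}. hausdorff_premeasure k \<delta> A)"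

definition hausdorff_measure :: "nat \<Rightarrow> 'a::metric_space measure" where
  "hausdorff_measure k = measure_of UNIV (sets borel) (hausdorff_outer_measure k)"


section \<open>Functions with the mean value property\<close>

definition skeleton_harmonic :: "real \<Rightarrow> nat \<Rightarrow> (real ^ 3 \<Rightarrow> real) set" where
  "skeleton_harmonic r k =
     {f. continuous_on UNIV f \<and>
         (\<forall>x. \<forall>s>0. f x =
            1 / measure (hausdorff_measure k) (skeleton r k) *
            set_lebesgue_integral (hausdorff_measure k) (skeleton r k) (\<lambda>y. f (x + s *\<^sub>R y)))}"


section \<open>Distributions\<close>

definition partial_deriv :: "3 \<Rightarrow> (real ^ 3 \<Rightarrow> real) \<Rightarrow> real ^ 3 \<Rightarrow> real" where
  "partial_deriv i f x = frechet_derivative f (at x) (axis i 1)"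

definition partial_derivs :: "3 list \<Rightarrow> (real ^ 3 \<Rightarrow> real) \<Rightarrow> real ^ 3 \<Rightarrow> real" where
  "partial_derivs is f = foldr partial_deriv is f"

definition smooth_function :: "(real ^ 3 \<Rightarrow> real) \<Rightarrow> bool" where
  "smooth_function f \<longleftrightarrow> (\<forall>is x. partial_derivs is f differentiable (at x))"

definition supp :: "(real ^ 3 \<Rightarrow> real) \<Rightarrow> (real ^ 3) set" where
  "supp f = closure {x. f x \<noteq> 0}"

definition test_functions :: "(real ^ 3 \<Rightarrow> real) set" where
  "test_functions = {\<psi>. smooth_function \<psi> \<and> compact (supp \<psi>)}"

text \<open>A distribution is a functional on the test functions; it takes the value \<open>undefined\<close> elsewhere,
  so that equality of distributions is equality in HOL. Continuity is expressed by the usual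
  seminorm estimates on compact sets.\<close>

definition distributions :: "((real ^ 3 \<Rightarrow> real) \<Rightarrow> real) set" where
  "distributions =
     {u \<in> extensional test_functions.
        (\<forall>\<phi>\<in>test_functions. \<forall>\<psi>\<in>test_functions. \<forall>a b.
           u (\<lambda>x. a * \<phi> x + b * \<psi> x) = a * u \<phi> + b * u \<psi>) \<and>
        (\<forall>K. compact K \<longrightarrow> (\<exists>C N. \<forall>\<psi>\<in>test_functions. supp \<psi> \<subseteq> K \<longrightarrow>
           \<bar>u \<psi>\<bar> \<le> C * (\<Sum>is | length is \<le> N. SUP x. \<bar>partial_derivs is \<psi> x\<bar>)))}"

definition distribution_of :: "(real ^ 3 \<Rightarrow> real) \<Rightarrow> (real ^ 3 \<Rightarrow> real) \<Rightarrow> real" where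
  "distribution_of f = (\<lambda>\<psi>\<in>test_functions. \<integral>x. f x * \<psi> x \<partial>lborel)"

definition distribution_deriv ::
    "3 \<Rightarrow> ((real ^ 3 \<Rightarrow> real) \<Rightarrow> real) \<Rightarrow> (real ^ 3 \<Rightarrow> real) \<Rightarrow> real" where
  "distribution_deriv i u = (\<lambda>\<psi>\<in>test_functions. - u (partial_deriv i \<psi>))"


section \<open>Polynomials and harmonic distributions of a group\<close>

text \<open>Polynomials in three variables are finitely supported families of coefficients indexed by
  exponents. In the type \<open>3\<close> the numerals 1, 2, 3 denote the three distinct elements.\<close>

type_synonym poly3 = "(3 \<Rightarrow>\<^sub>0 nat) \<Rightarrow>\<^sub>0 real"

definition poly3_eval :: "poly3 \<Rightarrow> real ^ 3 \<Rightarrow> real" where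
  "poly3_eval p x =
     (\<Sum>m \<in> Poly_Mapping.keys p. Poly_Mapping.lookup p m * (\<Prod>i\<in>UNIV. x $ i ^ Poly_Mapping.lookup m i))"

definition distribution_monom_deriv ::
    "(3 \<Rightarrow>\<^sub>0 nat) \<Rightarrow> ((real ^ 3 \<Rightarrow> real) \<Rightarrow> real) \<Rightarrow> (real ^ 3 \<Rightarrow> real) \<Rightarrow> real" where
  "distribution_monom_deriv m u =
     (distribution_deriv 1 ^^ Poly_Mapping.lookup m 1)
       ((distribution_deriv 2 ^^ Poly_Mapping.lookup m 2)
         ((distribution_deriv 3 ^^ Poly_Mapping.lookup m 3) u))"

definition poly3_deriv :: "poly3 \<Rightarrow> ((real ^ 3 \<Rightarrow> real) \<Rightarrow> real) \<Rightarrow> (real ^ 3 \<Rightarrow> real) \<Rightarrow> real" where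
  "poly3_deriv p u =
     (\<lambda>\<psi>\<in>test_functions.
        \<Sum>m \<in> Poly_Mapping.keys p. Poly_Mapping.lookup p m * distribution_monom_deriv m u \<psi>)"

definition invariant_poly :: "(real ^ 3 \<Rightarrow> real ^ 3) set \<Rightarrow> poly3 \<Rightarrow> bool" where
  "invariant_poly G p \<longleftrightarrow> (\<forall>g\<in>G. \<forall>x. poly3_eval p (g x) = poly3_eval p x)"

definition group_harmonic :: "(real ^ 3 \<Rightarrow> real ^ 3) set \<Rightarrow> ((real ^ 3 \<Rightarrow> real) \<Rightarrow> real) set" where
  "group_harmonic G =
     {u \<in> distributions. \<forall>p. invariant_poly G p \<and> poly3_eval p 0 = 0 \<longrightarrow>
        poly3_deriv p u = (\<lambda>\<psi>\<in>test_functions. 0)}"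


section \<open>The critical parameter\<close>

definition chi1 :: "real \<Rightarrow> real" where
  "chi1 r = r ^ 6 + 2 * r ^ 5 + r ^ 4 - 36 * r ^ 3 - 45 * r\<^sup>2 - 270 * r - 405"

definition r1 :: real where
  "r1 = (THE r. r > 0 \<and> chi1 r = 0)"

end

theory Submission
  imports Defs "HOL-Computational_Algebra.Polynomial"
begin

text \<open>A continuous function has the mean value property for a compactly supported probability measure
  \<open>P\<close> iff it is annihilated by all the operators \<open>M\<^sub>m(\<partial>)\<close> with \<open>m > 0\<close>, where \<open>M\<^sub>m(\<xi>)\<close> is the integral of
  \<open>\<langle>y, \<xi>\<rangle>\<^sup>m\<close> with respect to \<open>P\<close>: this is Taylor's formula for smooth functions, and mollification extends it
  to continuous ones. For the normalized Hausdorff measure of a skeleton the polynomials \<open>M\<^sub>m\<close> are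
  invariant under \<open>W(A\<^sub>3)\<close>, hence polynomials in \<open>p\<^sub>2 = x\<^sup>2 + y\<^sup>2 + z\<^sup>2\<close>, \<open>xyz\<close> and \<open>p\<^sub>4 = x\<^sup>4 + y\<^sup>4 + z\<^sup>4\<close>. Here
  \<open>M\<^sub>2\<close> is a nonzero multiple of \<open>p\<^sub>2\<close>, \<open>M\<^sub>4\<close> contributes \<open>p\<^sub>4\<close>, and \<open>M\<^sub>3\<close> is a multiple of \<open>xyz\<close>. If \<open>M\<^sub>3 \<noteq> 0\<close>,
  the ideal generated by all \<open>M\<^sub>m\<close> is therefore the one of \<open>W(A\<^sub>3)\<close>. If \<open>M\<^sub>3 = 0\<close>, then \<open>M\<^sub>6\<close> contributes
  \<open>(xyz)\<^sup>2\<close>, while the odd \<open>M\<^sub>m\<close> lie in the ideal anyway, and one obtains the ideal of \<open>W(B\<^sub>3)\<close>.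

  The integral of the \<open>m\<close>-th power of a linear form over a simplex is a multiple of the complete homogeneous
  symmetric polynomial of its values at the vertices, which makes the coefficients of \<open>M\<^sub>m\<close> explicit functions
  of \<open>r\<close>. That of \<open>xyz\<close> vanishes for \<open>k = 0, 2, 3\<close> only at \<open>r = 3\<close>, where the skeleton is
  centrally symmetric, and for \<open>k = 1\<close> only at \<open>r = r\<^sub>1\<close>. In the latter case \<open>M\<^sub>5\<close> is a nonzero multiple of
  \<open>xyz p\<^sub>2\<close>, so that \<open>xyz\<close> is still invariant under the symmetry group and the inclusion is strict.\<close>

section \<open>Hausdorff measure of affine images\<close>

text \<open>The two sides of the theorem live in different spaces, functions and distributions. They
  meet because both ideals contain every monomial of degree 16: a distribution annihilated by either
  of them is a polynomial, for which Taylor's formula is exact. Ideals are handled dually, as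
  relations between the values of a functional on the derivatives of a test function. The Hausdorff
  measures of cells are never computed. On an affine cell the measure is an unknown multiple of
  Lebesgue measure, by uniqueness of Haar measure. All faces are congruent, so are all cells of the
  solid, and the edges are similar to each other; hence one unknown constant is common to all cells
  of a skeleton and cancels in the mean value. Only the edges mix two lengths, one of them a square
  root in r. Squaring it away produces \<open>chi1\<close> times a positive quadratic factor, at the
  price of a sign that has to be checked at the root. The symmetry groups of the skeletons are not
  determined. It is enough that they contain W(A_3), that they contain -1 for r = 3 and k \<noteq>
  1, and that at r = \<open>r1\<close> the group of the edge skeleton preserves M_4 and M_5.\<close>

lemma hausdorff_weight_empty [simp]: "hausdorff_weight k {} = 0"
  by (simp add: hausdorff_weight_def)

section \<open>Covers, subadditivity and separated sets\<close>

lemma hausdorff_premeasure_le: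
  assumes "A \<subseteq> (\<Union>n. U n)" "\<And>n. bounded (U n)" "\<And>n. diameter (U n) \<le> \<delta>"
  shows "hausdorff_premeasure k \<delta> A \<le> (suminf (\<lambda>n. hausdorff_weight k (U n)))"
  unfolding hausdorff_premeasure_def using assms by (intro INF_lower) auto

lemma hausdorff_premeasure_empty: "\<delta> \<ge> 0 \<Longrightarrow> hausdorff_premeasure k \<delta> {} = 0"
  using hausdorff_premeasure_le[of "{}" "\<lambda>_. {}" \<delta> k] by auto

lemma hausdorff_premeasure_mono:
  assumes "A \<subseteq> B"
  shows "hausdorff_premeasure k \<delta> A \<le> hausdorff_premeasure k \<delta> B"
  unfolding hausdorff_premeasure_def using assms by (intro INF_superset_mono) auto

lemma hausdorff_premeasure_antimono:
  assumes "\<delta> \<le> \<epsilon>"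
  shows "hausdorff_premeasure k \<epsilon> A \<le> hausdorff_premeasure k \<delta> A"
  unfolding hausdorff_premeasure_def using assms by (intro INF_superset_mono) (auto intro: order_trans)

lemma hausdorff_premeasure_less_obtains:
  assumes "hausdorff_premeasure k \<delta> A < c"
  obtains U where "A \<subseteq> (\<Union>n. U n)" "\<And>n. bounded (U n)" "\<And>n. diameter (U n) \<le> \<delta>"
    "(suminf (\<lambda>n. hausdorff_weight k (U n))) < c"
  using assms unfolding hausdorff_premeasure_def by (auto simp: INF_less_iff)

lemma hausdorff_premeasure_UN:
  fixes A :: "nat \<Rightarrow> 'a::metric_space set"
  shows "hausdorff_premeasure k \<delta> (\<Union>i. A i) \<le> (suminf (\<lambda>i. hausdorff_premeasure k \<delta> (A i)))"
proof (rule ennreal_le_epsilon)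
  fix e :: real assume e: "e > 0" and fin: "(suminf (\<lambda>i. hausdorff_premeasure k \<delta> (A i))) < top"
  have fini: "hausdorff_premeasure k \<delta> (A i) < top" for i
    using fin by (meson ennreal_suminf_lessD)
  define d where "d i = ennreal (e * (1/2) ^ Suc i)" for i
  have "\<exists>U. A i \<subseteq> (\<Union>n. U n) \<and> (\<forall>n. bounded (U n) \<and> diameter (U n) \<le> \<delta>) \<and>
      (suminf (\<lambda>n. hausdorff_weight k (U n))) < hausdorff_premeasure k \<delta> (A i) + d i" for i
  proof -
    have "hausdorff_premeasure k \<delta> (A i) < hausdorff_premeasure k \<delta> (A i) + d i"
      using fini[of i] e by (simp add: d_def ennreal_less_top less_top[symmetric] )
    from hausdorff_premeasure_less_obtains[OF this] show ?thesis by metis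
  qed
  then obtain U where U: "\<And>i. A i \<subseteq> (\<Union>n. U i n)" "\<And>i n. bounded (U i n)"
      "\<And>i n. diameter (U i n) \<le> \<delta>"
      "\<And>i. (suminf (\<lambda>n. hausdorff_weight k (U i n))) < hausdorff_premeasure k \<delta> (A i) + d i"
    by metis
  define V where "V n = (case prod_decode n of (i, j) \<Rightarrow> U i j)" for n
  have "(\<Union>i. A i) \<subseteq> (\<Union>n. V n)"
  proof safe
    fix x i assume "x \<in> A i"
    then obtain j where "x \<in> U i j" using U(1) by blast
    then have "x \<in> V (prod_encode (i, j))" by (simp add: V_def)
    then show "x \<in> (\<Union>n. V n)" by blast
  qed
  then have "hausdorff_premeasure k \<delta> (\<Union>i. A i) \<le> (suminf (\<lambda>n. hausdorff_weight k (V n)))"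
    by (intro hausdorff_premeasure_le) (auto simp: V_def U split: prod.split)
  also have "\<dots> = (suminf (\<lambda>i. suminf (\<lambda>j. hausdorff_weight k (U i j))))"
    using suminf_ennreal_2dimen[of "\<lambda>i. suminf (\<lambda>j. hausdorff_weight k (U i j))" "\<lambda>(i, j). hausdorff_weight k (U i j)"]
    by (simp add: V_def o_def split_def)
  also have "\<dots> \<le> (suminf (\<lambda>i. hausdorff_premeasure k \<delta> (A i) + d i))"
    by (intro suminf_le summableI less_imp_le U(4))
  also have "\<dots> = (suminf (\<lambda>i. hausdorff_premeasure k \<delta> (A i))) + (suminf (\<lambda>i. d i))"
    by (intro suminf_add[symmetric] summableI)
  also have "(suminf (\<lambda>i. d i)) = ennreal e"
    unfolding d_def using e power_half_series
    by (intro suminf_ennreal_eq) (auto dest: sums_mult[of _ _ e])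
  finally show "hausdorff_premeasure k \<delta> (\<Union>i. A i) \<le> (suminf (\<lambda>i. hausdorff_premeasure k \<delta> (A i))) + ennreal e" .
qed

lemma hausdorff_premeasure_le_outer:
  "\<delta> > 0 \<Longrightarrow> hausdorff_premeasure k \<delta> A \<le> hausdorff_outer_measure k A"
  unfolding hausdorff_outer_measure_def by (intro SUP_upper) auto

lemma hausdorff_outer_measure_le:
  "(\<And>\<delta>. \<delta> > 0 \<Longrightarrow> hausdorff_premeasure k \<delta> A \<le> c) \<Longrightarrow> hausdorff_outer_measure k A \<le> c"
  unfolding hausdorff_outer_measure_def by (intro SUP_least) auto

lemma hausdorff_outer_measure_empty [simp]: "hausdorff_outer_measure k {} = 0"
  using hausdorff_outer_measure_le[of k "{}" 0] by (simp add: hausdorff_premeasure_empty)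

lemma hausdorff_outer_measure_mono:
  assumes "A \<subseteq> B"
  shows "hausdorff_outer_measure k A \<le> hausdorff_outer_measure k B"
  unfolding hausdorff_outer_measure_def
  using hausdorff_premeasure_mono[OF assms] by (intro SUP_mono) blast

lemma hausdorff_outer_measure_UN:
  "hausdorff_outer_measure k (\<Union>i::nat. A i) \<le> (suminf (\<lambda>i. hausdorff_outer_measure k (A i)))"
proof (rule hausdorff_outer_measure_le)
  fix \<delta> :: real assume "\<delta> > 0"
  then show "hausdorff_premeasure k \<delta> (\<Union> (range A)) \<le> (suminf (\<lambda>i. hausdorff_outer_measure k (A i)))"
    by (intro order_trans[OF hausdorff_premeasure_UN] suminf_le summableI hausdorff_premeasure_le_outer)
qed

lemma hausdorff_outer_measure_space: "outer_measure_space UNIV (hausdorff_outer_measure k)"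
  by (auto simp: outer_measure_space_def positive_def increasing_def countably_subadditive_def
      intro!: hausdorff_outer_measure_mono hausdorff_outer_measure_UN)

lemma hausdorff_outer_measure_Un:
  "hausdorff_outer_measure k (A \<union> B) \<le> hausdorff_outer_measure k A + hausdorff_outer_measure k B"
proof -
  interpret sigma_algebra UNIV "UNIV :: 'a set set"
    using sigma_algebra_Pow[of UNIV] by simp
  have "subadditive UNIV (hausdorff_outer_measure k :: 'a set \<Rightarrow> _)"
    using hausdorff_outer_measure_space[of k] countably_subadditive_subadditive
    unfolding outer_measure_space_def by blast
  then have *: "X \<inter> Y = {} \<Longrightarrow> hausdorff_outer_measure k (X \<union> Y) \<le> hausdorff_outer_measure k X + hausdorff_outer_measure k Y"
    for X Y :: "'a set" by (auto simp: subadditive_def)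
  have "hausdorff_outer_measure k (A \<union> (B - A)) \<le> hausdorff_outer_measure k A + hausdorff_outer_measure k (B - A)"
    by (rule *) auto
  also have "\<dots> \<le> hausdorff_outer_measure k A + hausdorff_outer_measure k B"
    by (intro add_left_mono hausdorff_outer_measure_mono) auto
  finally show ?thesis by simp
qed

text \<open>A set of diameter at most \<delta> < e cannot meet both A and B, so each cover of the
  union splits into a cover of A and one of B, the discarded sets being replaced by {}.\<close>

lemma hausdorff_premeasure_separated:
  assumes "\<And>x y. x \<in> A \<Longrightarrow> y \<in> B \<Longrightarrow> dist x y \<ge> e" "\<delta> < e"
  shows "hausdorff_premeasure k \<delta> A + hausdorff_premeasure k \<delta> B \<le> hausdorff_premeasure k \<delta> (A \<union> B)"
  unfolding hausdorff_premeasure_def[of k \<delta> "A \<union> B"]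
proof (rule INF_greatest, safe)
  fix U :: "nat \<Rightarrow> 'a set"
  assume U: "A \<union> B \<subseteq> (\<Union>n. U n)" "\<forall>n. bounded (U n) \<and> diameter (U n) \<le> \<delta>"
  define V where "V n = (if U n \<inter> A = {} then {} else U n)" for n
  define W where "W n = (if U n \<inter> B = {} then {} else U n)" for n
  \<comment> \<open>The replacement of U n by {} respects the diameter bound only for \<delta> \<ge>
    0, which follows from the existence of the cover.\<close>
  have \<delta>: "\<delta> \<ge> 0" using U(2) diameter_ge_0 order_trans by blast
  have "hausdorff_premeasure k \<delta> A + hausdorff_premeasure k \<delta> B
      \<le> (suminf (\<lambda>n. hausdorff_weight k (V n))) + (suminf (\<lambda>n. hausdorff_weight k (W n)))"
    using U \<delta> by (intro add_mono hausdorff_premeasure_le) (force simp: V_def W_def)+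
  also have "\<dots> = (suminf (\<lambda>n. hausdorff_weight k (V n) + hausdorff_weight k (W n)))"
    by (intro suminf_add summableI)
  also have "\<dots> \<le> (suminf (\<lambda>n. hausdorff_weight k (U n)))"
  proof (intro suminf_le summableI)
    fix n
    have "U n \<inter> A = {} \<or> U n \<inter> B = {}"
    proof (rule ccontr)
      assume "\<not> ?thesis"
      then obtain x y where xy: "x \<in> U n" "x \<in> A" "y \<in> U n" "y \<in> B" by blast
      have "dist x y \<le> diameter (U n)" using xy U(2) by (intro diameter_bounded_bound) auto
      then show False using assms xy U(2) by (metis le_less_trans not_le order_trans)
    qed
    then show "hausdorff_weight k (V n) + hausdorff_weight k (W n) \<le> hausdorff_weight k (U n)"
      by (auto simp: V_def W_def)
  qed
  finally show "hausdorff_premeasure k \<delta> A + hausdorff_premeasure k \<delta> B \<le> (suminf (\<lambda>n. hausdorff_weight k (U n)))" .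
qed

lemma hausdorff_outer_measure_separated:
  assumes "\<And>x y. x \<in> A \<Longrightarrow> y \<in> B \<Longrightarrow> dist x y \<ge> e" "e > 0"
  shows "hausdorff_outer_measure k A + hausdorff_outer_measure k B \<le> hausdorff_outer_measure k (A \<union> B)"
proof -
  \<comment> \<open>Two independent mesh sizes, so that the two suprema over \<delta> and \<delta>'
    can be taken one after the other.\<close>
  have *: "hausdorff_premeasure k \<delta> A + hausdorff_premeasure k \<delta>' B \<le> hausdorff_outer_measure k (A \<union> B)"
    if "\<delta> > 0" "\<delta>' > 0" for \<delta> \<delta>'
  proof -
    define d where "d = min (min \<delta> \<delta>') (e / 2)"
    have d: "d > 0" "d < e" "d \<le> \<delta>" "d \<le> \<delta>'" using that assms(2) by (auto simp: d_def min_def)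
    have "hausdorff_premeasure k \<delta> A + hausdorff_premeasure k \<delta>' B
        \<le> hausdorff_premeasure k d A + hausdorff_premeasure k d B"
      using d by (intro add_mono hausdorff_premeasure_antimono)
    also have "\<dots> \<le> hausdorff_premeasure k d (A \<union> B)"
      using assms d by (intro hausdorff_premeasure_separated)
    also have "\<dots> \<le> hausdorff_outer_measure k (A \<union> B)"
      using d by (intro hausdorff_premeasure_le_outer)
    finally show ?thesis .
  qed
  have "hausdorff_outer_measure k A + hausdorff_premeasure k \<delta>' B \<le> hausdorff_outer_measure k (A \<union> B)"
    if "\<delta>' > 0" for \<delta>'
    unfolding hausdorff_outer_measure_def[of k A] using * that
    by (subst ennreal_SUP_add_left[symmetric]) (auto intro!: SUP_least)
  then show ?thesis
    unfolding hausdorff_outer_measure_def[of k B]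
    by (subst ennreal_SUP_add_right) (auto intro!: SUP_least)
qed

text \<open>Caratheodory's criterion: the shells at distance about \<open>1 / n\<close> from \<open>C\<close> with indices of
  equal parity are separated from each other, so their measures are summable.\<close>

lemma hausdorff_caratheodory_closed:
  assumes "closed C"
  shows "hausdorff_outer_measure k (A \<inter> C) + hausdorff_outer_measure k (A - C) \<le> hausdorff_outer_measure k A"
proof (cases "C = {} \<or> hausdorff_outer_measure k A = top")
  case True
  then show ?thesis by (auto simp: )
next
  case False
  then have ne: "C \<noteq> {}" and fin: "hausdorff_outer_measure k A < top"
    by (auto simp: less_top)
  define E where "E n = {x \<in> A. infdist x C \<ge> 1 / Suc n}" for n :: nat
  define D where "D n = {x \<in> A. infdist x C \<ge> 1 / Suc (Suc n) \<and> infdist x C < 1 / Suc n}" for n :: nat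
  let ?H = "hausdorff_outer_measure k"
  have sum_le: "(\<Sum>i<N. ?H (D (2 * i + p))) \<le> ?H (\<Union>i<N. D (2 * i + p))" for N p
  proof (induction N)
    case (Suc N)
    \<comment> \<open>The gap between the shell 2N + p and all earlier shells of the same parity:
      the shell with index 2N + p - 1 lies in between. For N = 0 there is no earlier shell, and with
      p = 0 the value would be 1/0 - 1 = -1 because 1/0 = 0.\<close>
    define e where "e = 1 / real (2 * N + p) - 1 / real (2 * N + p + 1)"
    show ?case
    proof (cases "N = 0")
      case False
      have "1 / real (2 * N + p + 1) < 1 / real (2 * N + p)"
        using False by (intro divide_strict_left_mono) auto
      then have "e > 0" by (simp add: e_def)
      have "(\<Sum>i<Suc N. ?H (D (2 * i + p))) = (\<Sum>i<N. ?H (D (2 * i + p))) + ?H (D (2 * N + p))"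
        by simp
      also have "\<dots> \<le> ?H (\<Union>i<N. D (2 * i + p)) + ?H (D (2 * N + p))"
        by (intro add_mono Suc.IH order_refl)
      also have "\<dots> \<le> ?H ((\<Union>i<N. D (2 * i + p)) \<union> D (2 * N + p))"
      proof (rule hausdorff_outer_measure_separated[of _ _ e])
        fix x y assume "x \<in> (\<Union>i<N. D (2 * i + p))" and y: "y \<in> D (2 * N + p)"
        then obtain i where i: "i < N" "x \<in> D (2 * i + p)" by auto
        have "1 / real (2 * N + p) \<le> 1 / real (Suc (Suc (2 * i + p)))"
          using i by (intro divide_left_mono) auto
        also have "\<dots> \<le> infdist x C" using i by (auto simp: D_def)
        finally have "1 / real (2 * N + p) \<le> infdist x C" .
        moreover have "infdist y C < 1 / real (2 * N + p + 1)" using y by (auto simp: D_def)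
        moreover have "infdist x C \<le> infdist y C + dist x y" by (rule infdist_triangle)
        ultimately show "dist x y \<ge> e" by (simp add: e_def)
      qed fact
      also have "\<dots> = ?H (\<Union>i<Suc N. D (2 * i + p))" by (simp add: lessThan_Suc Un_commute)
      finally show ?thesis .
    qed (simp add: lessThan_Suc)
  qed simp
  have sum_fin: "(suminf (\<lambda>i. ?H (D (2 * i + p)))) < top" for p
  proof -
    have "(suminf (\<lambda>i. ?H (D (2 * i + p)))) \<le> ?H A"
    proof (rule suminf_le_const[OF summableI])
      fix N
      show "(\<Sum>i<N. ?H (D (2 * i + p))) \<le> ?H A"
        by (rule order_trans[OF sum_le hausdorff_outer_measure_mono]) (auto simp: D_def)
    qed
    then show ?thesis using fin by simp
  qed
  have cover: "A - C \<subseteq> E (2*n) \<union> ((\<Union>i. D (2 * (i + n) + 0)) \<union> (\<Union>i. D (2 * (i + n) + 1)))" for n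
  proof
    fix x assume x: "x \<in> A - C"
    then have "infdist x C > 0"
      using assms ne by (metis DiffD2 in_closed_iff_infdist_zero infdist_nonneg less_le)
    then obtain m :: nat where m: "1 / Suc m < infdist x C"
      by (metis inverse_eq_divide reals_Archimedean)
    \<comment> \<open>m0 is the first index with x in \<open>E m0\<close>. Either it is at most 2n,
      and then x lies in \<open>E (2*n)\<close>, or x lies in the shell with index m0 - 1 \<ge>
      2n.\<close>
    define m0 where "m0 = (LEAST m. 1 / real (Suc m) \<le> infdist x C)"
    have m0: "1 / Suc m0 \<le> infdist x C"
      unfolding m0_def by (rule LeastI[of _ m]) (use m in simp)
    show "x \<in> E (2*n) \<union> ((\<Union>i. D (2 * (i + n) + 0)) \<union> (\<Union>i. D (2 * (i + n) + 1)))"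
    proof (cases "m0 \<le> 2*n")
      case True
      have "1 / real (Suc (2*n)) \<le> 1 / real (Suc m0)" using True by (intro divide_left_mono) auto
      with m0 x show ?thesis by (auto simp: E_def)
    next
      case False
      then obtain j where j: "m0 = Suc j" "2 * n \<le> j" by (cases m0) auto
      have "infdist x C < 1 / Suc j"
        using not_less_Least[of j "\<lambda>m. 1 / real (Suc m) \<le> infdist x C"] j
        unfolding m0_def[symmetric] by linarith
      then have xj: "x \<in> D j" using m0 j x by (auto simp: D_def)
      define i where "i = j div 2 - n"
      have "j = 2 * (i + n) + 0 \<or> j = 2 * (i + n) + 1" using j unfolding i_def by presburger
      then show ?thesis
      proof
        assume "j = 2 * (i + n) + 0"
        with xj have "x \<in> D (2 * (i + n) + 0)" by simp
        then show ?thesis by blast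
      next
        assume "j = 2 * (i + n) + 1"
        with xj have "x \<in> D (2 * (i + n) + 1)" by simp
        then show ?thesis by blast
      qed
    qed
  qed
  define t where "t p n = (suminf (\<lambda>i. ?H (D (2 * (i + n) + p))))" for p n
  have t0: "(t p \<longlongrightarrow> 0) sequentially" for p
  proof -
    have "(\<lambda>n. suminf (\<lambda>i. (\<lambda>i. ?H (D (2 * i + p))) (i + n))) \<longlonglongrightarrow> 0"
    proof -
      \<comment> \<open>The tails are compared over the reals: the total is finite, so the series is
        summable there and its tails tend to 0.\<close>
      define h where "h i = enn2real (?H (D (2 * i + p)))" for i
      have Hh: "?H (D (2 * i + p)) = ennreal (h i)" for i
        using ennreal_suminf_lessD[OF sum_fin[of p], of i] by (simp add: h_def)
      have hnn: "h i \<ge> 0" for i by (simp add: h_def)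
      have sm: "summable h"
        using sum_fin[of p] unfolding Hh by (intro summable_suminf_not_top) (auto simp: h_def)
      have "(\<lambda>n. suminf (\<lambda>i. h (i + n))) \<longlonglongrightarrow> 0"
        using suminf_exist_split2[OF sm] by simp
      moreover have "(suminf (\<lambda>i. ?H (D (2 * (i + n) + p)))) = ennreal (suminf (\<lambda>i. h (i + n)))" for n
        unfolding Hh using summable_ignore_initial_segment[OF sm, of n]
        by (intro suminf_ennreal2) (simp_all add: hnn)
      ultimately show ?thesis by (simp add: tendsto_ennrealI flip: ennreal_0)
    qed
    then show ?thesis by (simp add: t_def[abs_def])
  qed
  have "?H (A \<inter> C) + ?H (A - C) \<le> ?H A + (t 0 n + t 1 n)" for n
  proof -
    have "?H (A - C) \<le> ?H (E (2*n)) + (?H (\<Union>i. D (2 * (i + n) + 0)) + ?H (\<Union>i. D (2 * (i + n) + 1)))"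
      by (intro order_trans[OF hausdorff_outer_measure_mono[OF cover[of n]]]
          order_trans[OF hausdorff_outer_measure_Un] add_left_mono hausdorff_outer_measure_Un)
    also have "\<dots> \<le> ?H (E (2*n)) + (t 0 n + t 1 n)"
      unfolding t_def by (intro add_mono order_refl hausdorff_outer_measure_UN)
    finally have "?H (A \<inter> C) + ?H (A - C) \<le> (?H (A \<inter> C) + ?H (E (2*n))) + (t 0 n + t 1 n)"
      by (simp add: add.assoc add_left_mono)
    also have "?H (A \<inter> C) + ?H (E (2*n)) \<le> ?H ((A \<inter> C) \<union> E (2*n))"
    proof (rule hausdorff_outer_measure_separated[of _ _ "1 / Suc (2*n)"])
      fix x y assume "x \<in> A \<inter> C" "y \<in> E (2*n)"
      then have "1 / Suc (2*n) \<le> infdist y C" "infdist y C \<le> dist y x"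
        by (auto simp: E_def intro: infdist_le)
      then show "dist x y \<ge> 1 / Suc (2*n)" by (simp add: dist_commute)
    qed simp
    also have "\<dots> \<le> ?H A" by (intro hausdorff_outer_measure_mono) (auto simp: E_def)
    finally show ?thesis by (simp add: add_right_mono)
  qed
  moreover have "(\<lambda>n. ?H A + (t 0 n + t 1 n)) \<longlonglongrightarrow> ?H A + (0 + 0)"
    by (intro tendsto_add tendsto_const t0)
  ultimately show ?thesis
    by (intro LIMSEQ_le_const[of "\<lambda>n. ?H A + (t 0 n + t 1 n)"]) auto
qed

section \<open>The Hausdorff measure on Borel sets\<close>

lemma sets_hausdorff_measure [simp, measurable_cong]: "sets (hausdorff_measure k) = sets borel"
  unfolding hausdorff_measure_def using sets.sigma_sets_eq[of borel] by (simp add: sets_measure_of_conv)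

lemma space_hausdorff_measure [simp]: "space (hausdorff_measure k) = UNIV"
  unfolding hausdorff_measure_def by (simp add: space_measure_of_conv)

text \<open>\<open>measure_of\<close> returns the prescribed function only when that function is a
  measure on the given sigma-algebra. Caratheodory's lemma provides this on the lambda system of the
  outer measure; the latter contains the closed sets and therefore all Borel sets.\<close>

lemma emeasure_hausdorff_measure:
  assumes "A \<in> sets borel"
  shows "emeasure (hausdorff_measure k) A = hausdorff_outer_measure k A"
proof -
  interpret U: sigma_algebra UNIV "UNIV :: 'a set set"
    using sigma_algebra_Pow[of UNIV] by simp
  let ?L = "lambda_system UNIV UNIV (hausdorff_outer_measure k :: 'a set \<Rightarrow> _)"
  have ms: "measure_space UNIV ?L (hausdorff_outer_measure k)"
    by (rule U.caratheodory_lemma[OF hausdorff_outer_measure_space])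
  have "Collect closed \<subseteq> ?L"
  proof
    fix C :: "'a set" assume "C \<in> Collect closed"
    then have "hausdorff_outer_measure k (X \<inter> C) + hausdorff_outer_measure k (X - C) = hausdorff_outer_measure k X" for X
      using hausdorff_outer_measure_Un[of k "X \<inter> C" "X - C"]
      by (intro antisym hausdorff_caratheodory_closed) (auto simp: Int_Diff_Un)
    then show "C \<in> ?L" by (simp add: U.lambda_system_eq)
  qed
  then have "sets borel \<subseteq> ?L"
    unfolding borel_eq_closed
    using sigma_algebra.sigma_sets_subset[of UNIV ?L] ms by (auto simp: measure_space_def)
  then have "measure_space UNIV (sets borel) (hausdorff_outer_measure k :: 'a set \<Rightarrow> _)"
    using measure_down[OF ms] sets.sigma_algebra_axioms[of borel] by simp
  then show ?thesis
    unfolding hausdorff_measure_def using assms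
    by (intro emeasure_measure_of_sigma) (auto simp: measure_space_def)
qed

section \<open>Lipschitz maps and similarities\<close>

lemma diameter_image_le:
  fixes f :: "'a::metric_space \<Rightarrow> 'b::metric_space"
  assumes lip: "\<And>x y. x \<in> A \<Longrightarrow> y \<in> A \<Longrightarrow> dist (f x) (f y) \<le> c * dist x y" and "c \<ge> 0" "bounded A"
  shows "bounded (f ` A)" "diameter (f ` A) \<le> c * diameter A"
proof -
  have le: "dist (f x) (f y) \<le> c * diameter A" if "x \<in> A" "y \<in> A" for x y
    using lip[OF that] diameter_bounded_bound[OF assms(3) that] assms(2)
    by (meson mult_left_mono order_trans)
  show "bounded (f ` A)" unfolding bounded_two_points using le by blast
  show "diameter (f ` A) \<le> c * diameter A"
  proof (cases "A = {}")
    case False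
    then show ?thesis unfolding diameter_def[of "f ` A"] using le by (auto intro!: cSUP_least)
  qed (simp add: diameter_def)
qed

lemma hausdorff_premeasure_lipschitz:
  fixes f :: "'a::metric_space \<Rightarrow> 'b::metric_space"
  assumes lip: "\<And>x y. x \<in> A \<Longrightarrow> y \<in> A \<Longrightarrow> dist (f x) (f y) \<le> c * dist x y" and c: "c > 0"
  shows "hausdorff_premeasure k (c * \<delta>) (f ` A) \<le> ennreal (c ^ k) * hausdorff_premeasure k \<delta> A"
proof -
  \<comment> \<open>With the factor moved to the left, the right side is a bare infimum and
    \<open>INF_greatest\<close> applies. Covers are intersected with A before taking images because
    f is Lipschitz only there.\<close>
  have "ennreal ((1 / c) ^ k) * hausdorff_premeasure k (c * \<delta>) (f ` A) \<le> hausdorff_premeasure k \<delta> A"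
    unfolding hausdorff_premeasure_def[of k \<delta> A]
  proof (rule INF_greatest, safe)
    fix U :: "nat \<Rightarrow> 'a set"
    assume U: "A \<subseteq> (\<Union>n. U n)" "\<forall>n. bounded (U n) \<and> diameter (U n) \<le> \<delta>"
    have bU: "bounded (U n \<inter> A)" and dU: "diameter (U n \<inter> A) \<le> diameter (U n)" for n
      using U(2) by (auto intro: bounded_subset diameter_subset)
    have b: "bounded (f ` (U n \<inter> A))" and d: "diameter (f ` (U n \<inter> A)) \<le> c * diameter (U n)" for n
      using diameter_image_le[of "U n \<inter> A" f c] lip c bU dU[of n]
      by (auto intro: order_trans mult_left_mono)
    have "hausdorff_premeasure k (c * \<delta>) (f ` A) \<le> (suminf (\<lambda>n. hausdorff_weight k (f ` (U n \<inter> A))))"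
    proof (rule hausdorff_premeasure_le)
      fix n show "diameter (f ` (U n \<inter> A)) \<le> c * \<delta>"
        using d[of n] U(2) c by (meson less_imp_le mult_left_mono order_trans)
    qed (use U b in \<open>auto, blast\<close>)
    also have "\<dots> \<le> (suminf (\<lambda>n. ennreal (c ^ k) * hausdorff_weight k (U n)))"
    proof (intro suminf_le summableI)
      fix n
      have "diameter (f ` (U n \<inter> A)) ^ k \<le> c ^ k * diameter (U n) ^ k"
        using power_mono[OF d[of n], of k] b by (simp add: power_mult_distrib diameter_ge_0)
      then have "unit_ball_vol (real k) / 2 ^ k * diameter (f ` (U n \<inter> A)) ^ k
          \<le> c ^ k * (unit_ball_vol (real k) / 2 ^ k * diameter (U n) ^ k)"
        by (subst mult.left_commute) (intro mult_left_mono, auto)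
      then show "hausdorff_weight k (f ` (U n \<inter> A)) \<le> ennreal (c ^ k) * hausdorff_weight k (U n)"
        using c by (auto simp: hausdorff_weight_def ennreal_leI simp flip: ennreal_mult')
    qed
    also have "\<dots> = ennreal (c ^ k) * (suminf (\<lambda>n. hausdorff_weight k (U n)))"
      by (rule ennreal_suminf_cmult)
    finally have "ennreal ((1 / c) ^ k) * hausdorff_premeasure k (c * \<delta>) (f ` A)
        \<le> ennreal ((1 / c) ^ k) * (ennreal (c ^ k) * (suminf (\<lambda>n. hausdorff_weight k (U n))))"
      by (rule mult_left_mono) simp
    then show "ennreal ((1 / c) ^ k) * hausdorff_premeasure k (c * \<delta>) (f ` A) \<le> (suminf (\<lambda>n. hausdorff_weight k (U n)))"
      using c by (simp add: mult.assoc[symmetric] ennreal_mult'[symmetric] power_divide)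
  qed
  then have "ennreal (c ^ k) * (ennreal ((1 / c) ^ k) * hausdorff_premeasure k (c * \<delta>) (f ` A))
      \<le> ennreal (c ^ k) * hausdorff_premeasure k \<delta> A"
    by (rule mult_left_mono) simp
  then show ?thesis
    using c by (simp add: mult.assoc[symmetric] ennreal_mult'[symmetric] power_divide)
qed

lemma hausdorff_outer_measure_lipschitz:
  fixes f :: "'a::metric_space \<Rightarrow> 'b::metric_space"
  assumes lip: "\<And>x y. x \<in> A \<Longrightarrow> y \<in> A \<Longrightarrow> dist (f x) (f y) \<le> c * dist x y" and c: "c > 0"
  shows "hausdorff_outer_measure k (f ` A) \<le> ennreal (c ^ k) * hausdorff_outer_measure k A"
proof (rule hausdorff_outer_measure_le)
  fix \<delta> :: real assume \<delta>: "\<delta> > 0"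
  have "hausdorff_premeasure k (c * (\<delta> / c)) (f ` A) \<le> ennreal (c ^ k) * hausdorff_premeasure k (\<delta> / c) A"
    by (rule hausdorff_premeasure_lipschitz[OF lip c])
  also have "\<dots> \<le> ennreal (c ^ k) * hausdorff_outer_measure k A"
    using \<delta> c by (intro mult_left_mono hausdorff_premeasure_le_outer) auto
  finally show "hausdorff_premeasure k \<delta> (f ` A) \<le> ennreal (c ^ k) * hausdorff_outer_measure k A"
    using c by simp
qed

lemma hausdorff_outer_measure_similarity:
  fixes f :: "'a::metric_space \<Rightarrow> 'b::metric_space"
  assumes sim: "\<And>x y. x \<in> A \<Longrightarrow> y \<in> A \<Longrightarrow> dist (f x) (f y) = c * dist x y" and c: "c > 0"
  shows "hausdorff_outer_measure k (f ` A) = ennreal (c ^ k) * hausdorff_outer_measure k A"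
proof (rule antisym)
  show "hausdorff_outer_measure k (f ` A) \<le> ennreal (c ^ k) * hausdorff_outer_measure k A"
    using assms by (intro hausdorff_outer_measure_lipschitz) auto
  have inj: "inj_on f A" using sim c by (auto simp: inj_on_def) (metis dist_eq_0_iff mult_eq_0_iff less_irrefl)
  define g where "g = the_inv_into A f"
  have g: "g (f x) = x" if "x \<in> A" for x using the_inv_into_f_f[OF inj that] by (simp add: g_def)
  have "hausdorff_outer_measure k (g ` (f ` A)) \<le> ennreal ((1 / c) ^ k) * hausdorff_outer_measure k (f ` A)"
    using sim c by (intro hausdorff_outer_measure_lipschitz) (auto simp: g)
  also have "g ` (f ` A) = A" by (simp add: image_image g)
  finally have "ennreal (c ^ k) * hausdorff_outer_measure k A
      \<le> ennreal (c ^ k) * (ennreal ((1 / c) ^ k) * hausdorff_outer_measure k (f ` A))"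
    by (rule mult_left_mono) simp
  then show "ennreal (c ^ k) * hausdorff_outer_measure k A \<le> hausdorff_outer_measure k (f ` A)"
    using c by (simp add: mult.assoc[symmetric] ennreal_mult'[symmetric] power_divide)
qed

section \<open>Comparison with Lebesgue measure\<close>

lemma hausdorff_premeasure_finite_UN:
  assumes "finite I" "\<delta> \<ge> 0"
  shows "hausdorff_premeasure k \<delta> (\<Union>i\<in>I. A i) \<le> (\<Sum>i\<in>I. hausdorff_premeasure k \<delta> (A i))"
  using assms(1)
proof (induction I)
  case (insert j I)
  define B where "B n = (if n = 0 then A j else if n = 1 then (\<Union>i\<in>I. A i) else {})" for n :: nat
  have "(\<Union>i\<in>insert j I. A i) = (\<Union>n. B n)"
    by (auto simp: B_def split: if_splits)
  also have "hausdorff_premeasure k \<delta> (\<Union>n. B n) \<le> (suminf (\<lambda>n. hausdorff_premeasure k \<delta> (B n)))"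
    by (rule hausdorff_premeasure_UN)
  also have "\<dots> = (\<Sum>n\<in>{0,1}. hausdorff_premeasure k \<delta> (B n))"
    using assms(2) by (intro suminf_finite) (auto simp: B_def hausdorff_premeasure_empty)
  also have "\<dots> \<le> (\<Sum>i\<in>insert j I. hausdorff_premeasure k \<delta> (A i))"
    using insert by (simp add: B_def add_left_mono)
  finally show ?case .
qed (simp add: hausdorff_premeasure_empty assms)

text \<open>Halving the unit cube in every direction gives \<open>2 ^ DIM\<close> copies scaled by \<open>1 / 2\<close>, so the
  premeasure of the cube does not increase when \<open>\<delta>\<close> is halved.\<close>

lemma hausdorff_unit_cube_finite:
  "hausdorff_outer_measure DIM('a) (cbox 0 One :: 'a::euclidean_space set) < top"
proof -
  let ?B = "cbox 0 One :: 'a set" and ?k = "DIM('a)"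
  define f where "f D x = (1/2) *\<^sub>R (x + \<Sum>D)" for D :: "'a set" and x
  have B: "x \<in> ?B \<longleftrightarrow> (\<forall>b\<in>Basis. 0 \<le> x \<bullet> b \<and> x \<bullet> b \<le> 1)" for x :: 'a
    by (simp add: mem_box)
  have cov: "?B \<subseteq> (\<Union>D\<in>Pow Basis. f D ` ?B)"
  proof
    fix x assume x: "x \<in> ?B"
    define D where "D = {b\<in>Basis. x \<bullet> b > 1/2}"
    define y where "y = 2 *\<^sub>R x - \<Sum>D"
    have "\<Sum>D \<bullet> b = (if b \<in> D then 1 else 0)" if "b \<in> Basis" for b
    proof -
      have fD: "finite D" unfolding D_def by simp
      have "\<Sum>D \<bullet> b = (\<Sum>c\<in>D. if c = b then 1 else 0)"
        unfolding inner_sum_left using that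
        by (intro sum.cong) (auto simp: inner_Basis D_def)
      then show ?thesis using fD by simp
    qed
    then have "y \<in> ?B" using x unfolding B y_def by (auto simp: inner_diff_left D_def)
    moreover have "f D y = x" by (simp add: f_def y_def)
    moreover have "D \<in> Pow Basis" by (auto simp: D_def)
    ultimately show "x \<in> (\<Union>D\<in>Pow Basis. f D ` ?B)" by blast
  qed
  have half: "hausdorff_premeasure ?k \<delta> ?B \<le> hausdorff_premeasure ?k (2 * \<delta>) ?B" if "\<delta> > 0" for \<delta>
  proof -
    have "hausdorff_premeasure ?k \<delta> ?B \<le> hausdorff_premeasure ?k \<delta> (\<Union>D\<in>Pow Basis. f D ` ?B)"
      by (rule hausdorff_premeasure_mono[OF cov])
    also have "\<dots> \<le> (\<Sum>D\<in>Pow Basis. hausdorff_premeasure ?k \<delta> (f D ` ?B))"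
      using that by (intro hausdorff_premeasure_finite_UN) auto
    also have "\<dots> \<le> (\<Sum>D\<in>Pow (Basis::'a set). ennreal ((1/2) ^ ?k) * hausdorff_premeasure ?k (2 * \<delta>) ?B)"
    proof (rule sum_mono)
      fix D
      have "hausdorff_premeasure ?k ((1/2) * (2 * \<delta>)) (f D ` ?B)
          \<le> ennreal ((1/2) ^ ?k) * hausdorff_premeasure ?k (2 * \<delta>) ?B"
        by (rule hausdorff_premeasure_lipschitz)
          (auto simp: f_def dist_norm scaleR_right_diff_distrib[symmetric])
      then show "hausdorff_premeasure ?k \<delta> (f D ` ?B)
          \<le> ennreal ((1/2) ^ ?k) * hausdorff_premeasure ?k (2 * \<delta>) ?B" by simp
    qed
    also have "\<dots> = hausdorff_premeasure ?k (2 * \<delta>) ?B"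
    proof -
      have "of_nat (2 ^ ?k) * ennreal ((1/2) ^ ?k) = ennreal (real (2 ^ ?k) * (1/2) ^ ?k)"
        by (metis ennreal_mult' ennreal_of_nat_eq_real_of_nat of_nat_0_le_iff)
      also have "\<dots> = 1" by (simp add: power_divide)
      finally show ?thesis by (simp add: card_Pow mult.assoc[symmetric])
    qed
    finally show ?thesis .
  qed
  have "hausdorff_outer_measure ?k ?B \<le> hausdorff_weight ?k ?B"
  proof (rule hausdorff_outer_measure_le)
    fix \<delta> :: real assume \<delta>: "\<delta> > 0"
    \<comment> \<open>Halving is iterated backwards until the mesh exceeds the diameter of the cube;
      then the cube alone is an admissible cover, which bounds all premeasures by its
      weight.\<close>
    have *: "hausdorff_premeasure ?k \<delta> ?B \<le> hausdorff_premeasure ?k (2 ^ n * \<delta>) ?B" for n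
    proof (induction n)
      case (Suc n)
      then show ?case using half[of "2 ^ n * \<delta>"] \<delta> by (auto simp: mult.assoc intro: order_trans)
    qed simp
    obtain n where n: "diameter ?B / \<delta> < 2 ^ n"
      using real_arch_pow[of 2 "diameter ?B / \<delta>"] by auto
    have d: "diameter ?B \<le> 2 ^ n * \<delta>" using n \<delta> by (simp add: field_simps)
    have "hausdorff_premeasure ?k (2 ^ n * \<delta>) ?B
        \<le> (suminf (\<lambda>m. hausdorff_weight ?k (if m = (0::nat) then ?B else {})))"
      using d \<delta> by (intro hausdorff_premeasure_le) auto
    also have "\<dots> = (\<Sum>m\<in>{0}. hausdorff_weight ?k (if m = (0::nat) then ?B else {}))"
      by (intro suminf_finite) auto
    finally have "hausdorff_premeasure ?k (2 ^ n * \<delta>) ?B \<le> hausdorff_weight ?k ?B"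
      by simp
    with *[of n] show "hausdorff_premeasure ?k \<delta> ?B \<le> hausdorff_weight ?k ?B"
      using order_trans by blast
  qed
  also have "\<dots> < top" by (simp add: hausdorff_weight_def)
  finally show ?thesis .
qed

text \<open>A covering set of diameter d lies in a ball of radius d around one of its points, and
  the volume of that ball is exactly 2^k times the weight of the set. The bound serves to show that
  cells have positive Hausdorff measure.\<close>

lemma lborel_le_hausdorff_outer_measure:
  fixes A :: "'a::euclidean_space set"
  shows "emeasure lborel A \<le> ennreal (2 ^ DIM('a)) * hausdorff_outer_measure DIM('a) A"
proof (cases "A \<in> sets borel")
  case A: True
  let ?k = "DIM('a)"
  have "ennreal ((1/2) ^ ?k) * emeasure lborel A \<le> hausdorff_premeasure ?k 1 A"
    unfolding hausdorff_premeasure_def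
  proof (rule INF_greatest, safe)
    fix U :: "nat \<Rightarrow> 'a set"
    assume U: "A \<subseteq> (\<Union>n. U n)" "\<forall>n. bounded (U n) \<and> diameter (U n) \<le> 1"
    define V where "V n = (if U n = {} then {} else cball (SOME x. x \<in> U n) (diameter (U n)))" for n
    have UV: "U n \<subseteq> V n" for n
    proof
      fix x assume x: "x \<in> U n"
      then have "(SOME x. x \<in> U n) \<in> U n" by (rule someI)
      then have "dist (SOME x. x \<in> U n) x \<le> diameter (U n)"
        using x U(2) by (intro diameter_bounded_bound) auto
      then show "x \<in> V n" using x by (auto simp: V_def)
    qed
    have "A \<subseteq> (\<Union>n. V n)" by (rule order_trans[OF U(1)]) (intro UN_mono subset_refl UV)
    then have "emeasure lborel A \<le> emeasure lborel (\<Union>n. V n)"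
      by (intro emeasure_mono) (auto simp: V_def)
    also have "\<dots> \<le> (suminf (\<lambda>n. emeasure lborel (V n)))"
      by (intro emeasure_subadditive_countably) (auto simp: V_def)
    also have "\<dots> = (suminf (\<lambda>n. ennreal (2 ^ ?k) * hausdorff_weight ?k (U n)))"
      using U(2) by (intro suminf_cong)
        (auto simp: V_def hausdorff_weight_def emeasure_cball diameter_ge_0 ennreal_mult'[symmetric])
    also have "\<dots> = ennreal (2 ^ ?k) * (suminf (\<lambda>n. hausdorff_weight ?k (U n)))"
      by (rule ennreal_suminf_cmult)
    finally have "ennreal ((1/2) ^ ?k) * emeasure lborel A
        \<le> ennreal ((1/2) ^ ?k) * (ennreal (2 ^ ?k) * (suminf (\<lambda>n. hausdorff_weight ?k (U n))))"
      by (rule mult_left_mono) simp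
    then show "ennreal ((1/2) ^ ?k) * emeasure lborel A \<le> (suminf (\<lambda>n. hausdorff_weight ?k (U n)))"
      by (simp add: mult.assoc[symmetric] ennreal_mult'[symmetric] power_divide)
  qed
  also have "\<dots> \<le> hausdorff_outer_measure ?k A" by (rule hausdorff_premeasure_le_outer) simp
  finally have "ennreal (2 ^ ?k) * (ennreal ((1/2) ^ ?k) * emeasure lborel A)
      \<le> ennreal (2 ^ ?k) * hausdorff_outer_measure ?k A"
    by (rule mult_left_mono) simp
  then show ?thesis by (simp add: mult.assoc[symmetric] ennreal_mult'[symmetric] power_divide)
qed (simp add: emeasure_notin_sets)

text \<open>Uniqueness of the Haar measure: integrate \<open>1\<^sub>A(x) * 1\<^sub>B(x + y)\<close> over the product in both orders.\<close>

lemma translation_invariant_measure_unique: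
  fixes M :: "'a::euclidean_space measure"
  assumes sets_M [measurable_cong]: "sets M = sets borel" and sf: "sigma_finite_measure M"
    and inv: "\<And>t A. A \<in> sets borel \<Longrightarrow> emeasure M ((\<lambda>x. x + t) -` A) = emeasure M A"
    and [measurable]: "A \<in> sets borel" "B \<in> sets borel"
  shows "emeasure M A * emeasure lborel B = emeasure M B * emeasure lborel A"
proof -
  interpret M: sigma_finite_measure M by fact
  interpret P: pair_sigma_finite M "lborel :: 'a measure" ..
  have space_M: "space M = UNIV" using sets_M sets_eq_imp_space_eq by fastforce
  have M_t: "distr M borel (\<lambda>x. x + t) = M" for t
  proof (rule measure_eqI)
    fix X assume "X \<in> sets (distr M borel (\<lambda>x. x + t))"
    then have "X \<in> sets borel" by simp
    then show "emeasure (distr M borel (\<lambda>x. x + t)) X = emeasure M X"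
      using inv[of X t] by (subst emeasure_distr) (auto simp: space_M)
  qed (simp add: sets_M)
  have L_t: "(\<integral>\<^sup>+y. g (y + t) \<partial>lborel) = (\<integral>\<^sup>+y. g y \<partial>lborel)"
    if [measurable]: "g \<in> borel_measurable borel" for g and t :: 'a
  proof -
    have "(\<integral>\<^sup>+y. g y \<partial>lborel) = (\<integral>\<^sup>+y. g y \<partial>distr lborel borel ((+) t))" by (simp add: lborel_distr_plus)
    also have "\<dots> = (\<integral>\<^sup>+y. g (t + y) \<partial>lborel)" by (subst nn_integral_distr) auto
    finally show ?thesis by (simp add: add.commute)
  qed
  have L_m: "(\<integral>\<^sup>+y. g (- y) \<partial>lborel) = (\<integral>\<^sup>+y. g y \<partial>lborel)"
    if [measurable]: "g \<in> borel_measurable borel" for g :: "'a \<Rightarrow> _"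
  proof -
    have "(\<integral>\<^sup>+y. g y \<partial>lborel) = (\<integral>\<^sup>+y. g y \<partial>distr lborel borel (\<lambda>y. - y))" 
      using lborel_affine[of "-1" "0::'a"] by (simp add: density_1)
    also have "\<dots> = (\<integral>\<^sup>+y. g (- y) \<partial>lborel)" by (subst nn_integral_distr) auto
    finally show ?thesis ..
  qed
  have M_s: "(\<integral>\<^sup>+x. g (x + t) \<partial>M) = (\<integral>\<^sup>+x. g x \<partial>M)"
    if [measurable]: "g \<in> borel_measurable borel" for g and t
  proof -
    have "(\<integral>\<^sup>+x. g x \<partial>M) = (\<integral>\<^sup>+x. g x \<partial>distr M borel (\<lambda>x. x + t))" by (simp add: M_t)
    also have "\<dots> = (\<integral>\<^sup>+x. g (x + t) \<partial>M)" by (subst nn_integral_distr) auto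
    finally show ?thesis by simp
  qed
  let ?a = "indicator A :: 'a \<Rightarrow> ennreal" and ?b = "indicator B :: 'a \<Rightarrow> ennreal"
  have "emeasure M A * emeasure lborel B = (\<integral>\<^sup>+x. ?a x * (\<integral>\<^sup>+y. ?b y \<partial>lborel) \<partial>M)"
    by (simp add: nn_integral_multc)
  also have "\<dots> = (\<integral>\<^sup>+x. (\<integral>\<^sup>+y. ?a x * ?b (y + x) \<partial>lborel) \<partial>M)"
    by (intro nn_integral_cong) (simp add: nn_integral_cmult L_t[of ?b])
  also have "\<dots> = (\<integral>\<^sup>+y. (\<integral>\<^sup>+x. ?a x * ?b (y + x) \<partial>M) \<partial>lborel)"
    by (rule P.Fubini'[symmetric]) measurable
  also have "\<dots> = (\<integral>\<^sup>+y. (\<integral>\<^sup>+x. ?a (x - y) * ?b x \<partial>M) \<partial>lborel)"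
  proof (rule nn_integral_cong)
    fix y
    show "(\<integral>\<^sup>+x. ?a x * ?b (y + x) \<partial>M) = (\<integral>\<^sup>+x. ?a (x - y) * ?b x \<partial>M)"
      using M_s[of "\<lambda>x. ?a (x - y) * ?b x" y] by (simp add: add.commute)
  qed
  also have "\<dots> = (\<integral>\<^sup>+x. (\<integral>\<^sup>+y. ?a (x - y) * ?b x \<partial>lborel) \<partial>M)"
    by (rule P.Fubini') measurable
  also have "\<dots> = (\<integral>\<^sup>+x. ?b x * emeasure lborel A \<partial>M)"
  proof (rule nn_integral_cong)
    fix x
    have "(\<integral>\<^sup>+y. ?a (x - y) \<partial>lborel) = (\<integral>\<^sup>+y. ?a (x + y) \<partial>lborel)"
      using L_m[of "\<lambda>y. ?a (x + y)"] by simp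
    also have "\<dots> = (\<integral>\<^sup>+y. ?a y \<partial>lborel)"
      using L_t[of ?a x] by (simp add: add.commute)
    finally show "(\<integral>\<^sup>+y. ?a (x - y) * ?b x \<partial>lborel) = ?b x * emeasure lborel A"
      by (subst nn_integral_multc) (auto simp: mult.commute)
  qed
  also have "\<dots> = emeasure M B * emeasure lborel A" by (simp add: nn_integral_multc)
  finally show ?thesis .
qed

text \<open>Pulled back along the parametrization, H is translation invariant and finite on boxes,
  hence a multiple of Lebesgue measure. The factor is the measure of the image of the unit cube and
  does not depend on the base point p.\<close>

lemma affine_hausdorff_integral:
  fixes L :: "'a::euclidean_space \<Rightarrow> 'b::euclidean_space" and p :: 'b
  defines "H \<equiv> hausdorff_measure DIM('a) :: 'b measure"
  defines "c \<equiv> measure H (L ` cbox 0 One)"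
  assumes L: "linear L" "inj L"
  shows "c > 0"
    and "emeasure H (L ` cbox 0 One) = ennreal c"
    and "A \<in> sets borel \<Longrightarrow> (\<lambda>t. p + L t) ` A \<in> sets borel"
    and "A \<in> sets borel \<Longrightarrow> emeasure H ((\<lambda>t. p + L t) ` A) = ennreal c * emeasure lborel A"
    and "A \<in> sets borel \<Longrightarrow> h \<in> borel_measurable borel \<Longrightarrow>
      set_lebesgue_integral H ((\<lambda>t. p + L t) ` A) h
        = c * set_lebesgue_integral lborel A (\<lambda>t. h (p + L t) :: real)"
proof -
  obtain g where g: "linear g" "\<And>t. g (L t) = t"
    using linear_injective_left_inverse[OF L] by (auto simp: fun_eq_iff)
  define q where "q t = p + L t" for t
  define g' where "g' y = g (y - p)" for y
  have gq [simp]: "g' (q t) = t" for t by (simp add: g'_def q_def g)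
  have cL: "continuous_on S L" for S
    using L(1) by (simp add: linear_continuous_on linear_linear)
  have cg0: "continuous_on S g" for S
    using g(1) by (simp add: linear_continuous_on linear_linear)
  have cq: "continuous_on S q" for S
    unfolding q_def by (intro continuous_on_add continuous_on_const cL)
  have cg: "continuous_on S g'" for S
    unfolding g'_def
    by (rule continuous_on_compose2[OF cg0[of UNIV]]) (auto intro!: continuous_on_diff continuous_on_const continuous_on_id)
  have [measurable]: "q \<in> borel_measurable borel" "g' \<in> borel_measurable borel"
    using cq cg by (auto intro: borel_measurable_continuous_onI)
  \<comment> \<open>The affine subspace parametrized by q, written as an equalizer. This shows that
    it is closed, and it turns images under q into preimages under g' within R, which makes them
    Borel.\<close>
  define R where "R = {y. q (g' y) = y}"
  have R: "R = range q" by (force simp: R_def image_iff intro: sym)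
  have "closed R" unfolding R_def
    by (intro closed_Collect_eq continuous_on_compose2[OF cq cg] continuous_intros) auto
  then have R_borel [measurable]: "R \<in> sets borel" by simp
  have img: "q ` A = R \<inter> g' -` A" for A by (force simp: R_def image_iff intro: sym)
  have img_borel: "q ` A \<in> sets borel" if [measurable]: "A \<in> sets borel" for A
  proof -
    have "g' -` A \<in> sets borel" using measurable_sets[of g' borel borel A] by simp
    then show ?thesis unfolding img by simp
  qed
  then show "A \<in> sets borel \<Longrightarrow> (\<lambda>t. p + L t) ` A \<in> sets borel" by (simp add: q_def[abs_def])
  have sH [measurable_cong]: "sets H = sets borel" and spH: "space H = UNIV"
    by (simp_all add: H_def)
  have eH: "emeasure H X = hausdorff_outer_measure DIM('a) X" if "X \<in> sets borel" for X
    using that by (simp add: H_def emeasure_hausdorff_measure)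
  define N where "N = distr (restrict_space H R) borel g'"
  have g'_meas: "g' \<in> measurable (restrict_space H R) borel"
    by (intro measurable_restrict_space1) (simp add: measurable_cong_sets[OF sH refl])
  have eN: "emeasure N A = emeasure H (q ` A)" if "A \<in> sets borel" for A
  proof -
    have "emeasure N A = emeasure (restrict_space H R) (g' -` A \<inter> space (restrict_space H R))"
      unfolding N_def using that by (rule emeasure_distr[OF g'_meas])
    also have "\<dots> = emeasure H (q ` A)"
      by (subst emeasure_restrict_space) (auto simp: img space_restrict_space spH Int_commute sH intro!: arg_cong[where f="emeasure H"])
    finally show ?thesis .
  qed
  obtain K where K: "K > 0" "\<And>t. norm (L t) \<le> K * norm t"
    using linear_bounded_pos[OF L(1)] by blast
  obtain K' where K': "K' > 0" "\<And>t. norm (g t) \<le> K' * norm t"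
    using linear_bounded_pos[OF g(1)] by blast
  have Ldiff: "L x - L y = L (x - y)" for x y using L by (simp add: linear_diff)
  have fin: "emeasure N (cbox (- real n *\<^sub>R One) (real n *\<^sub>R One)) < top" for n
  proof -
    define s where "s t = q ((2 * real n) *\<^sub>R t - real n *\<^sub>R One)" for t
    have sub: "cbox (- real n *\<^sub>R One) (real n *\<^sub>R One) \<subseteq> (\<lambda>t. (2 * real n) *\<^sub>R t - real n *\<^sub>R (One::'a)) ` cbox 0 One"
    proof (cases "n = 0")
      case False
      show ?thesis
      proof
        fix x :: 'a assume "x \<in> cbox (- real n *\<^sub>R One) (real n *\<^sub>R One)"
        then have "(1 / (2 * real n)) *\<^sub>R (x + real n *\<^sub>R One) \<in> cbox 0 One"
          using False by (auto simp: mem_box inner_add_left field_simps)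
        moreover have "x = (2 * real n) *\<^sub>R ((1 / (2 * real n)) *\<^sub>R (x + real n *\<^sub>R One)) - real n *\<^sub>R One"
          using False by simp
        ultimately show "x \<in> (\<lambda>t. (2 * real n) *\<^sub>R t - real n *\<^sub>R (One::'a)) ` cbox 0 One" by blast
      qed
    qed (auto simp: image_constant_conv box_ne_empty)
    have "emeasure N (cbox (- real n *\<^sub>R One) (real n *\<^sub>R One)) = hausdorff_outer_measure DIM('a) (q ` cbox (- real n *\<^sub>R One) (real n *\<^sub>R One))"
      using img_borel by (subst eN) (auto simp: eH)
    also have "\<dots> \<le> hausdorff_outer_measure DIM('a) (s ` cbox 0 One)"
    proof -
      have "s ` cbox 0 One = q ` (\<lambda>t. (2 * real n) *\<^sub>R t - real n *\<^sub>R One) ` cbox 0 One"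
        by (simp add: s_def image_image)
      then show ?thesis using sub by (simp add: hausdorff_outer_measure_mono image_mono)
    qed
    \<comment> \<open>The factor 2n + 1 instead of 2n keeps the Lipschitz constant positive for n =
      0.\<close>
    also have "\<dots> \<le> ennreal ((K * (2 * real n + 1)) ^ DIM('a)) * hausdorff_outer_measure DIM('a) (cbox 0 One :: 'a set)"
    proof (rule hausdorff_outer_measure_lipschitz)
      fix x y :: 'a
      have "dist (s x) (s y) = norm (L ((2 * real n) *\<^sub>R (x - y)))"
        by (simp add: s_def q_def dist_norm Ldiff scaleR_right_diff_distrib)
      also have "\<dots> \<le> K * (2 * real n * norm (x - y))" using K(2)[of "(2 * real n) *\<^sub>R (x - y)"] by simp
      also have "\<dots> \<le> K * ((2 * real n + 1) * norm (x - y))"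
        using K(1) by (intro mult_left_mono mult_right_mono) auto
      finally show "dist (s x) (s y) \<le> K * (2 * real n + 1) * dist x y" by (simp add: dist_norm mult_ac)
    qed (use K in auto)
    also have "\<dots> < top" using hausdorff_unit_cube_finite[where 'a='a] by (simp add: ennreal_mult_less_top)
    finally show ?thesis .
  qed
  have sN: "sets N = sets borel" and spN: "space N = UNIV" by (simp_all add: N_def)
  have sfN: "sigma_finite_measure N"
  proof
    let ?F = "range (\<lambda>n::nat. cbox (- real n *\<^sub>R One) (real n *\<^sub>R One :: 'a))"
    have "x \<in> \<Union>?F" for x :: 'a
    proof -
      obtain n :: nat where n: "norm x \<le> real n" using real_arch_simple by blast
      have "x \<in> cbox (- real n *\<^sub>R One) (real n *\<^sub>R One)"
        using n Basis_le_norm[of _ x] unfolding mem_box by (fastforce simp: abs_le_iff)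
      then show ?thesis by blast
    qed
    then show "\<exists>F. countable F \<and> F \<subseteq> sets N \<and> \<Union>F = space N \<and> (\<forall>a\<in>F. emeasure N a \<noteq> \<infinity>)"
      using fin by (intro exI[of _ ?F]) (auto simp: sN spN less_top)
  qed
  have inv: "emeasure N ((\<lambda>x. x + t) -` A) = emeasure N A" if A: "A \<in> sets borel" for t A
  proof -
    have A': "(\<lambda>x. x + t) -` A \<in> sets borel"
      using measurable_sets[of "\<lambda>x. x + t" borel borel A] A by simp
    have "q ` A = (\<lambda>y. y + L t) ` (q ` ((\<lambda>x. x + t) -` A))"
    proof -
      have "A = (\<lambda>x. x + t) ` ((\<lambda>x. x + t) -` A)"
      proof safe
        fix x assume "x \<in> A"
        then have "x - t \<in> (\<lambda>x. x + t) -` A" "x = (x - t) + t" by auto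
        then show "x \<in> (\<lambda>x. x + t) ` ((\<lambda>x. x + t) -` A)" by blast
      qed
      then have "q ` A = q ` (\<lambda>x. x + t) ` ((\<lambda>x. x + t) -` A)" by (rule arg_cong)
      also have "\<dots> = (\<lambda>y. y + L t) ` (q ` ((\<lambda>x. x + t) -` A))"
        unfolding image_image by (simp only: q_def linear_add[OF L(1)] add.assoc)
      finally show ?thesis .
    qed
    then have "hausdorff_outer_measure DIM('a) (q ` A) = ennreal (1 ^ DIM('a)) * hausdorff_outer_measure DIM('a) (q ` ((\<lambda>x. x + t) -` A))"
      by (simp only:) (rule hausdorff_outer_measure_similarity, auto)
    then show ?thesis using A A' img_borel by (simp add: eN eH)
  qed
  have unit: "emeasure lborel (cbox 0 One :: 'a set) = 1"
    by (subst emeasure_lborel_cbox) auto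
  have eq0: "emeasure N A = emeasure N (cbox 0 One) * emeasure lborel A" if "A \<in> sets borel" for A
    using translation_invariant_measure_unique[OF sN sfN inv that, of "cbox 0 One"] by (simp add: unit)
  have cub: "emeasure N (cbox 0 One) = emeasure H (L ` cbox 0 One)"
  proof -
    have "q ` cbox 0 One = (\<lambda>y. p + y) ` (L ` cbox 0 One)" by (auto simp: q_def)
    then have 1: "hausdorff_outer_measure DIM('a) (q ` cbox 0 One) = ennreal (1 ^ DIM('a)) * hausdorff_outer_measure DIM('a) (L ` cbox 0 One)"
      by (simp only:) (rule hausdorff_outer_measure_similarity, auto)
    have "compact (L ` cbox 0 One)"
      by (intro compact_continuous_image cL) auto
    then have "L ` cbox 0 One \<in> sets borel" by (simp add: compact_imp_closed)
    then show ?thesis using 1 img_borel by (simp add: eN eH)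
  qed
  have cfin: "emeasure N (cbox 0 One) < top"
  proof -
    have "emeasure N (cbox 0 One) \<le> emeasure N (cbox (- real 1 *\<^sub>R One) (real 1 *\<^sub>R One))"
      by (intro emeasure_mono) (auto simp: sN subset_box)
    then show ?thesis using fin[of 1] by simp
  qed
  then show c1: "emeasure H (L ` cbox 0 One) = ennreal c"
    unfolding c_def cub[symmetric] measure_def by (simp add: cub)
  \<comment> \<open>The left inverse g is Lipschitz and carries the image back to the unit cube,
    whose Lebesgue measure is 1; so the image cannot be a null set.\<close>
  have "emeasure N (cbox 0 One) > 0"
  proof -
    have "(1::ennreal) \<le> ennreal (2 ^ DIM('a)) * hausdorff_outer_measure DIM('a) (cbox 0 One :: 'a set)"
      using lborel_le_hausdorff_outer_measure[of "cbox 0 One :: 'a set"] by (simp add: unit)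
    also have "(cbox 0 One :: 'a set) = g ` (L ` cbox 0 One)" by (simp add: image_image g)
    also have "ennreal (2 ^ DIM('a)) * hausdorff_outer_measure DIM('a) \<dots> \<le> ennreal (2 ^ DIM('a)) * (ennreal (K' ^ DIM('a)) * hausdorff_outer_measure DIM('a) (L ` cbox 0 One))"
    proof (intro mult_left_mono hausdorff_outer_measure_lipschitz)
      fix x y show "dist (g x) (g y) \<le> K' * dist x y"
        using K'(2)[of "x - y"] g(1) by (simp add: dist_norm linear_diff)
    qed (use K' in auto)
    finally have "hausdorff_outer_measure DIM('a) (L ` cbox 0 One) \<noteq> 0" by auto
    moreover have "compact (L ` cbox 0 One)"
      by (intro compact_continuous_image cL) auto
    then have "L ` cbox 0 One \<in> sets borel" by (simp add: compact_imp_closed)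
    ultimately show ?thesis unfolding cub by (simp add: eH zero_less_iff_neq_zero)
  qed
  then show "c > 0" unfolding cub c1 by simp
  have Nc: "emeasure N A = ennreal c * emeasure lborel A" if "A \<in> sets borel" for A
    using eq0[OF that] cub c1 by simp
  then show "A \<in> sets borel \<Longrightarrow> emeasure H ((\<lambda>t. p + L t) ` A) = ennreal c * emeasure lborel A"
    using eN by (simp add: q_def[abs_def])
  have N_eq: "N = density lborel (\<lambda>_. ennreal c)"
    by (rule measure_eqI) (auto simp: sN Nc emeasure_density nn_integral_cmult)
  assume A [measurable]: "A \<in> sets borel" and h [measurable]: "h \<in> borel_measurable borel"
  have [measurable]: "q ` A \<in> sets borel" by (rule img_borel) simp
  have "set_lebesgue_integral H (q ` A) h = (\<integral>y. indicator R y *\<^sub>R (indicator A (g' y) *\<^sub>R h (q (g' y))) \<partial>H)"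
    unfolding set_lebesgue_integral_def
    by (intro Bochner_Integration.integral_cong) (auto simp: img R_def indicator_def)
  also have "\<dots> = (\<integral>y. indicator A (g' y) *\<^sub>R h (q (g' y)) \<partial>restrict_space H R)"
    by (subst integral_restrict_space) (auto simp: spH sH)
  also have "\<dots> = (\<integral>t. indicator A t *\<^sub>R h (q t) \<partial>N)"
    unfolding N_def by (subst integral_distr[OF g'_meas]) auto
  also have "\<dots> = (\<integral>t. c *\<^sub>R (indicator A t *\<^sub>R h (q t)) \<partial>lborel)"
    unfolding N_eq using \<open>c > 0\<close> by (subst integral_density) auto
  also have "\<dots> = c * set_lebesgue_integral lborel A (\<lambda>t. h (q t))"
    unfolding set_lebesgue_integral_def by simp
  finally show "set_lebesgue_integral H ((\<lambda>t. p + L t) ` A) h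
      = c * set_lebesgue_integral lborel A (\<lambda>t. h (p + L t))"
    by (simp add: q_def[abs_def])
qed

section \<open>Smooth functions and distributions\<close>

lemma partial_derivs_simps [simp]:
  "partial_derivs [] f = f" "partial_derivs (i # is) f = partial_deriv i (partial_derivs is f)"
  by (simp_all add: partial_derivs_def)

text \<open>Any class of differentiable functions that is closed under partial derivatives consists
  of smooth functions. Exhibiting such a class replaces formulas for the iterated derivatives of
  products and composites.\<close>

lemma smooth_coinduct:
  assumes "f \<in> S" "\<And>h x. h \<in> S \<Longrightarrow> h differentiable (at x)" "\<And>h i. h \<in> S \<Longrightarrow> partial_deriv i h \<in> S"
  shows "smooth_function f"
proof -
  have "partial_derivs is f \<in> S" for "is"
    using assms by (induction "is") auto
  then show ?thesis using assms(2) by (auto simp: smooth_function_def)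
qed

lemma smooth_differentiable: "smooth_function f \<Longrightarrow> f differentiable (at x)"
  unfolding smooth_function_def using partial_derivs_simps(1) by metis

lemma smooth_partial_deriv:
  assumes "smooth_function f" shows "smooth_function (partial_deriv i f)"
proof -
  have "partial_derivs is (partial_deriv i f) = partial_derivs (is @ [i]) f" for "is"
    by (simp add: partial_derivs_def)
  then show ?thesis using assms unfolding smooth_function_def by presburger
qed

lemma smooth_continuous_on: "smooth_function f \<Longrightarrow> continuous_on S f"
  by (meson continuous_at_imp_continuous_on differentiable_imp_continuous_within smooth_differentiable)

lemma partial_deriv_eqI: "(f has_derivative D) (at x) \<Longrightarrow> partial_deriv i f x = D (axis i 1)"
  unfolding partial_deriv_def by (metis frechet_derivative_at)

lemma has_derivative_partials:
  assumes "f differentiable (at x)"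
  shows "(f has_derivative (\<lambda>v. \<Sum>i\<in>UNIV. v $ i * partial_deriv i f x)) (at x)"
proof -
  let ?D = "frechet_derivative f (at x)"
  have D: "(f has_derivative ?D) (at x)" using assms by (simp add: frechet_derivative_works)
  then have lin: "linear ?D" by (rule has_derivative_linear)
  have "?D v = (\<Sum>i\<in>UNIV. v $ i * partial_deriv i f x)" for v
  proof -
    have "?D v = ?D (\<Sum>i\<in>UNIV. v $ i *\<^sub>R axis i 1)"
      using basis_expansion[of v] by (simp add: scalar_mult_eq_scaleR)
    also have "\<dots> = (\<Sum>i\<in>UNIV. v $ i * partial_deriv i f x)"
      by (simp add: linear_sum[OF lin] linear_cmul[OF lin] partial_deriv_def)
    finally show ?thesis .
  qed
  then have "?D = (\<lambda>v. \<Sum>i\<in>UNIV. v $ i * partial_deriv i f x)" by blast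
  with D show ?thesis by simp
qed

lemma partial_deriv_const [simp]: "partial_deriv i (\<lambda>x. c) = (\<lambda>x. 0)"
  by (rule ext, subst partial_deriv_eqI[OF has_derivative_const]) simp

lemma partial_deriv_add:
  assumes "smooth_function f" "smooth_function g"
  shows "partial_deriv i (\<lambda>x. f x + g x) = (\<lambda>x. partial_deriv i f x + partial_deriv i g x)"
proof
  fix x
  show "partial_deriv i (\<lambda>x. f x + g x) x = partial_deriv i f x + partial_deriv i g x"
    using assms[THEN smooth_differentiable[of _ x], unfolded frechet_derivative_works]
    by (subst partial_deriv_eqI[OF has_derivative_add]) (auto simp: partial_deriv_def)
qed

lemma partial_deriv_cmult:
  assumes "smooth_function f"
  shows "partial_deriv i (\<lambda>x. c * f x) = (\<lambda>x. c * partial_deriv i f x)"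
proof
  fix x
  show "partial_deriv i (\<lambda>x. c * f x) x = c * partial_deriv i f x"
    using assms[THEN smooth_differentiable[of _ x], unfolded frechet_derivative_works]
    by (subst partial_deriv_eqI[OF has_derivative_mult_right]) (auto simp: partial_deriv_def)
qed

lemma partial_deriv_mult:
  assumes "f differentiable (at x)" "g differentiable (at x)"
  shows "partial_deriv i (\<lambda>x. f x * g x) x = f x * partial_deriv i g x + partial_deriv i f x * g x"
  using assms[unfolded frechet_derivative_works]
  by (subst partial_deriv_eqI[OF has_derivative_mult]) (auto simp: partial_deriv_def)

lemma smooth_const [simp]: "smooth_function (\<lambda>x. c)"
  by (rule smooth_coinduct[where S = "range (\<lambda>c x. c)"]) auto

lemma smooth_add:
  assumes "smooth_function f" "smooth_function g"
  shows "smooth_function (\<lambda>x. f x + g x)"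
proof (rule smooth_coinduct[where S = "{\<lambda>x. f x + g x | f g. smooth_function f \<and> smooth_function g}"])
  fix h x i assume "h \<in> {\<lambda>x. f x + g x | f g. smooth_function f \<and> smooth_function g}"
  then obtain f g where h: "h = (\<lambda>x. f x + g x)" "smooth_function f" "smooth_function g" by blast
  show "h differentiable at x" using h by (auto intro: smooth_differentiable differentiable_add)
  show "partial_deriv i h \<in> {\<lambda>x. f x + g x | f g. smooth_function f \<and> smooth_function g}"
    using h smooth_partial_deriv by (auto simp: partial_deriv_add)
qed (use assms in blast)

text \<open>The Leibniz rule leads from products to sums of products; this is the smallest class
  containing the products that it does not leave.\<close>

inductive_set product_closure :: "(real ^ 3 \<Rightarrow> real) set" where
  mult: "smooth_function f \<Longrightarrow> smooth_function g \<Longrightarrow> (\<lambda>x. f x * g x) \<in> product_closure"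
| add: "h \<in> product_closure \<Longrightarrow> k \<in> product_closure \<Longrightarrow> (\<lambda>x. h x + k x) \<in> product_closure"

lemma smooth_mult:
  assumes "smooth_function f" "smooth_function g"
  shows "smooth_function (\<lambda>x. f x * g x)"
proof -
  have *: "(\<forall>x. h differentiable at x) \<and> (\<forall>i. partial_deriv i h \<in> product_closure)"
    if "h \<in> product_closure" for h
    using that
  proof induction
    case (mult f g)
    have "partial_deriv i (\<lambda>x. f x * g x) = (\<lambda>x. f x * partial_deriv i g x + partial_deriv i f x * g x)" for i
      using mult by (auto intro: partial_deriv_mult smooth_differentiable)
    with mult show ?case
      by (auto intro!: product_closure.intros smooth_partial_deriv differentiable_mult
          intro: smooth_differentiable)
  next
    case (add h k)
    have "partial_deriv i (\<lambda>x. h x + k x) = (\<lambda>x. partial_deriv i h x + partial_deriv i k x)" for i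
    proof
      fix x show "partial_deriv i (\<lambda>x. h x + k x) x = partial_deriv i h x + partial_deriv i k x"
        using add frechet_derivative_works[of h "at x"] frechet_derivative_works[of k "at x"]
        by (subst partial_deriv_eqI[OF has_derivative_add]) (auto simp: partial_deriv_def)
    qed
    with add show ?case by (auto intro: product_closure.intros differentiable_add)
  qed
  show ?thesis
    by (rule smooth_coinduct[where S = product_closure]) (use * assms in \<open>auto intro: product_closure.intros\<close>)
qed

lemma smooth_cmult: "smooth_function f \<Longrightarrow> smooth_function (\<lambda>x. c * f x)"
  using smooth_mult[OF smooth_const] by blast

lemma smooth_diff: "smooth_function f \<Longrightarrow> smooth_function g \<Longrightarrow> smooth_function (\<lambda>x. f x - g x)"
  using smooth_add[of f "\<lambda>x. -1 * g x"] smooth_cmult[of g "-1"] by simp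

lemma smooth_sum:
  assumes "\<And>i. i \<in> I \<Longrightarrow> smooth_function (f i)"
  shows "smooth_function (\<lambda>x. \<Sum>i\<in>I. f i x)"
  using assms
  by (induction I rule: infinite_finite_induct) (auto intro: smooth_add)

lemma partial_deriv_sum:
  assumes "\<And>j. j \<in> I \<Longrightarrow> smooth_function (f j)"
  shows "partial_deriv i (\<lambda>x. \<Sum>j\<in>I. f j x) = (\<lambda>x. \<Sum>j\<in>I. partial_deriv i (f j) x)"
  using assms
  by (induction I rule: infinite_finite_induct) (auto simp: partial_deriv_add smooth_sum)

lemma partial_deriv_coord: "partial_deriv j (\<lambda>x. x $ i) = (\<lambda>x. if i = j then 1 else 0)"
proof
  fix x :: "real ^ 3"
  have "((\<lambda>x. x $ i) has_derivative (\<lambda>x. x $ i)) (at x)"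
    by (rule bounded_linear_imp_has_derivative) (rule bounded_linear_vec_nth)
  from partial_deriv_eqI[OF this] show "partial_deriv j (\<lambda>x. x $ i) x = (if i = j then 1 else 0)"
    by (simp add: axis_def)
qed

lemma smooth_coord: "smooth_function (\<lambda>x. x $ i)"
proof (rule smooth_coinduct[where S = "insert (\<lambda>x. x $ i) (range (\<lambda>c x. c))"])
  fix h :: "real ^ 3 \<Rightarrow> real" and x j assume h: "h \<in> insert (\<lambda>x. x $ i) (range (\<lambda>c x. c))"
  show "h differentiable at x"
    using h by (auto intro: bounded_linear_imp_differentiable bounded_linear_vec_nth)
  show "partial_deriv j h \<in> insert (\<lambda>x. x $ i) (range (\<lambda>c x. c))"
    using h by (auto simp: partial_deriv_coord)
qed simp

lemma smooth_power: "smooth_function f \<Longrightarrow> smooth_function (\<lambda>x. f x ^ n)"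
  by (induction n) (auto intro: smooth_mult)

text \<open>By the chain rule, a derivative of f(a + P x) is a linear combination of such composites
  with coefficients taken from P; hence the constant c and the closure under sums.\<close>

inductive_set affine_closure :: "(real ^ 3 \<Rightarrow> real ^ 3) \<Rightarrow> real ^ 3 \<Rightarrow> (real ^ 3 \<Rightarrow> real) set" for P a where
  comp: "smooth_function f \<Longrightarrow> (\<lambda>x. c * f (a + P x)) \<in> affine_closure P a"
| add: "h \<in> affine_closure P a \<Longrightarrow> k \<in> affine_closure P a \<Longrightarrow> (\<lambda>x. h x + k x) \<in> affine_closure P a"

lemma has_derivative_compose_affine:
  fixes P :: "real ^ 3 \<Rightarrow> real ^ 3"
  assumes "f differentiable at (a + P x)" "linear P"
  shows "((\<lambda>x. f (a + P x)) has_derivative (\<lambda>v. \<Sum>i\<in>UNIV. P v $ i * partial_deriv i f (a + P x))) (at x)"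
proof -
  have "((\<lambda>x. a + P x) has_derivative P) (at x)"
    using assms(2) linear_conv_bounded_linear[of P]
    by (auto intro!: derivative_eq_intros bounded_linear_imp_has_derivative)
  from has_derivative_compose[OF this has_derivative_partials[OF assms(1)]] show ?thesis .
qed

lemma smooth_compose_affine:
  assumes "smooth_function f" "linear P"
  shows "smooth_function (\<lambda>x. f (a + P x))"
proof -
  have *: "(\<forall>x. h differentiable at x) \<and> (\<forall>i. partial_deriv i h \<in> affine_closure P a)"
    if "h \<in> affine_closure P a" for h
    using that
  proof induction
    case (comp f c)
    have D: "((\<lambda>x. c * f (a + P x)) has_derivative (\<lambda>v. c * (\<Sum>i\<in>UNIV. P v $ i * partial_deriv i f (a + P x)))) (at x)" for x
      using comp assms(2)
      by (intro has_derivative_mult_right has_derivative_compose_affine smooth_differentiable)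
    have "partial_deriv i (\<lambda>x. c * f (a + P x)) =
        (\<lambda>x. (c * P (axis i 1) $ 1) * partial_deriv 1 f (a + P x) + ((c * P (axis i 1) $ 2) * partial_deriv 2 f (a + P x)
          + (c * P (axis i 1) $ 3) * partial_deriv 3 f (a + P x)))" for i
      by (rule ext, subst partial_deriv_eqI[OF D]) (simp add: sum_3 algebra_simps)
    then have "partial_deriv i (\<lambda>x. c * f (a + P x)) \<in> affine_closure P a" for i
      using comp by (simp only:) (intro affine_closure.intros smooth_partial_deriv)
    with D show ?case using differentiable_def by blast
  next
    case (add h k)
    have "partial_deriv i (\<lambda>x. h x + k x) = (\<lambda>x. partial_deriv i h x + partial_deriv i k x)" for i
    proof
      fix x show "partial_deriv i (\<lambda>x. h x + k x) x = partial_deriv i h x + partial_deriv i k x"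
        using add frechet_derivative_works[of h "at x"] frechet_derivative_works[of k "at x"]
        by (subst partial_deriv_eqI[OF has_derivative_add]) (auto simp: partial_deriv_def)
    qed
    with add show ?case by (auto intro: affine_closure.intros differentiable_add)
  qed
  show ?thesis
    by (rule smooth_coinduct[where S = "affine_closure P a"])
      (use * affine_closure.comp[OF assms(1), of 1 a P] in \<open>auto\<close>)
qed

lemma smooth_translate: "smooth_function f \<Longrightarrow> smooth_function (\<lambda>x. f (x + a))"
  using smooth_compose_affine[of f "\<lambda>x. x" a] by (simp add: add.commute linear_ident)

lemma partial_deriv_translate:
  assumes "smooth_function f"
  shows "partial_deriv i (\<lambda>x. f (x + a)) = (\<lambda>x. partial_deriv i f (x + a))"
proof
  fix x
  have "partial_deriv i (\<lambda>x. f (a + x)) x = (\<Sum>j\<in>UNIV. axis i 1 $ j * partial_deriv j f (a + x))"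
    using assms by (intro partial_deriv_eqI has_derivative_compose_affine[where P = "\<lambda>x. x"])
      (auto intro: smooth_differentiable linear_ident)
  also have "\<dots> = (\<Sum>j\<in>UNIV. if j = i then partial_deriv j f (a + x) else 0)"
    by (intro sum.cong) (auto simp: axis_def)
  finally show "partial_deriv i (\<lambda>x. f (x + a)) x = partial_deriv i f (x + a)"
    by (simp add: add.commute)
qed

text \<open>Integrals over segments parallel to an axis commute with differentiation. They yield the
  symmetry of mixed derivatives, integration by parts, and primitives of test functions.\<close>

definition line_int :: "real \<Rightarrow> real \<Rightarrow> 3 \<Rightarrow> (real ^ 3 \<Rightarrow> real) \<Rightarrow> real ^ 3 \<Rightarrow> real" where
  "line_int a b i f x = integral {a..b} (\<lambda>t. f (x + t *\<^sub>R axis i 1))"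

lemma continuous_on_line:
  fixes f :: "'a::real_normed_vector \<Rightarrow> 'b::topological_space"
  assumes "continuous_on UNIV f"
  shows "continuous_on S (\<lambda>t::real. f (x + t *\<^sub>R v))"
  by (rule continuous_on_compose2[OF assms])
    (auto intro!: continuous_on_add continuous_on_const continuous_on_scaleR continuous_on_id)

lemma has_derivative_line_int:
  assumes f: "smooth_function f"
  shows "(line_int a b i f has_derivative (\<lambda>v. \<Sum>j\<in>UNIV. v $ j * line_int a b i (partial_deriv j f) x)) (at x)"
proof -
  \<comment> \<open>The total derivative of the integrand as a \<open>blinfun\<close>, because the
    Leibniz rule asks for its joint continuity in y and t with respect to the operator norm.\<close>
  define F where "F y t = (\<Sum>j\<in>UNIV. partial_deriv j f (y + t *\<^sub>R axis i 1) *\<^sub>R blinfun_inner_right (axis j 1 :: real ^ 3))"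
    for y :: "real ^ 3" and t :: real
  have F_apply: "blinfun_apply (F y t) v = (\<Sum>j\<in>UNIV. v $ j * partial_deriv j f (y + t *\<^sub>R axis i 1))" for y t v
    by (simp add: F_def blinfun.sum_left blinfun.scaleR_left inner_axis' mult.commute)
  have der: "((\<lambda>y. f (y + t *\<^sub>R axis i 1)) has_derivative blinfun_apply (F y t)) (at y)" for y t
  proof -
    have "((\<lambda>y. f (t *\<^sub>R axis i 1 + y)) has_derivative (\<lambda>v. \<Sum>j\<in>UNIV. v $ j * partial_deriv j f (t *\<^sub>R axis i 1 + y))) (at y)"
      using has_derivative_compose_affine[where P = "\<lambda>x. x"] smooth_differentiable[OF f] linear_ident by blast
    then show ?thesis by (simp add: F_apply[abs_def] add.commute)
  qed
  have pc: "continuous_on UNIV (partial_deriv j f)" for j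
    by (intro smooth_continuous_on smooth_partial_deriv f)
  have cF: "continuous_on (UNIV \<times> cbox a b) (\<lambda>(y, t). F y t)"
    unfolding F_def case_prod_beta
    by (intro continuous_intros continuous_on_compose2[OF pc]) auto
  have "((\<lambda>y. integral (cbox a b) (\<lambda>t. f (y + t *\<^sub>R axis i 1))) has_derivative integral (cbox a b) (F x)) (at x within UNIV)"
  proof (rule leibniz_rule[OF _ _ cF])
    fix y show "(\<lambda>t. f (y + t *\<^sub>R axis i 1)) integrable_on cbox a b"
      using smooth_continuous_on[OF f] by (intro integrable_continuous continuous_on_line) auto
  qed (use der in auto)
  moreover have "integral (cbox a b) (F x) v = (\<Sum>j\<in>UNIV. v $ j * line_int a b i (partial_deriv j f) x)" for v
  proof -
    have iF: "F x integrable_on cbox a b"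
      unfolding F_def
      by (intro integrable_continuous continuous_intros continuous_on_line pc)
    have "integral (cbox a b) (F x) v = integral (cbox a b) (\<lambda>t. F x t v)"
      using integral_linear[OF iF blinfun.bounded_linear_left[of v]] by (simp add: o_def)
    also have "\<dots> = (\<Sum>j\<in>UNIV. v $ j * line_int a b i (partial_deriv j f) x)"
      unfolding F_apply line_int_def
      by (subst integral_sum) (auto intro!: integrable_continuous_real continuous_intros continuous_on_line pc)
    finally show ?thesis .
  qed
  then have "blinfun_apply (integral (cbox a b) (F x)) = (\<lambda>v. \<Sum>j\<in>UNIV. v $ j * line_int a b i (partial_deriv j f) x)"
    by blast
  ultimately show ?thesis by (simp add: line_int_def[abs_def])
qed

lemma partial_deriv_line_int:
  "smooth_function f \<Longrightarrow> partial_deriv j (line_int a b i f) = line_int a b i (partial_deriv j f)"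
proof
  fix x assume f: "smooth_function f"
  have "partial_deriv j (line_int a b i f) x = (\<Sum>k\<in>UNIV. axis j 1 $ k * line_int a b i (partial_deriv k f) x)"
    by (rule partial_deriv_eqI[OF has_derivative_line_int[OF f]])
  also have "\<dots> = (\<Sum>k\<in>UNIV. if k = j then line_int a b i (partial_deriv k f) x else 0)"
    by (intro sum.cong) (auto simp: axis_def)
  finally show "partial_deriv j (line_int a b i f) x = line_int a b i (partial_deriv j f) x" by simp
qed

lemma smooth_line_int:
  assumes "smooth_function f" shows "smooth_function (line_int a b i f)"
proof (rule smooth_coinduct[where S = "line_int a b i ` Collect smooth_function"])
  fix h x j assume "h \<in> line_int a b i ` Collect smooth_function"
  then obtain f where f: "h = line_int a b i f" "smooth_function f" by blast
  show "h differentiable at x" unfolding f(1) differentiable_def using has_derivative_line_int[OF f(2)] by blast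
  show "partial_deriv j h \<in> line_int a b i ` Collect smooth_function"
    using f by (auto simp: partial_deriv_line_int smooth_partial_deriv)
qed (use assms in blast)

lemma has_field_derivative_line:
  assumes "smooth_function f"
  shows "((\<lambda>t. f (x + t *\<^sub>R v)) has_field_derivative (\<Sum>i\<in>UNIV. v $ i * partial_deriv i f (x + t *\<^sub>R v))) (at t within S)"
proof -
  have 1: "((\<lambda>t. x + t *\<^sub>R v) has_derivative (\<lambda>t. t *\<^sub>R v)) (at t within S)"
    by (auto intro!: derivative_eq_intros)
  have "((\<lambda>t. f (x + t *\<^sub>R v)) has_derivative (\<lambda>s. \<Sum>i\<in>UNIV. (s *\<^sub>R v) $ i * partial_deriv i f (x + t *\<^sub>R v))) (at t within S)"
    using has_derivative_compose[OF 1 has_derivative_partials[OF smooth_differentiable[OF assms]]] .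
  moreover have "(\<lambda>s. \<Sum>i\<in>UNIV. (s *\<^sub>R v) $ i * partial_deriv i f (x + t *\<^sub>R v))
      = (*) (\<Sum>i\<in>UNIV. v $ i * partial_deriv i f (x + t *\<^sub>R v))"
    by (auto simp: fun_eq_iff sum_distrib_left mult_ac)
  ultimately show ?thesis by (simp add: has_field_derivative_def)
qed

lemma line_int_partial_deriv:
  assumes "smooth_function f" "a \<le> b"
  shows "line_int a b i (partial_deriv i f) x = f (x + b *\<^sub>R axis i 1) - f (x + a *\<^sub>R axis i 1)"
proof -
  have "((\<lambda>t. partial_deriv i f (x + t *\<^sub>R axis i 1)) has_integral f (x + b *\<^sub>R axis i 1) - f (x + a *\<^sub>R axis i 1)) {a..b}"
  proof (rule fundamental_theorem_of_calculus[OF assms(2)])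
    fix t
    have "(\<Sum>j\<in>UNIV. axis i 1 $ j * partial_deriv j f (x + t *\<^sub>R axis i 1))
        = (\<Sum>j\<in>UNIV. if j = i then partial_deriv j f (x + t *\<^sub>R axis i 1) else 0)"
      by (intro sum.cong) (auto simp: axis_def)
    then show "((\<lambda>t. f (x + t *\<^sub>R axis i 1)) has_vector_derivative partial_deriv i f (x + t *\<^sub>R axis i 1)) (at t within {a..b})"
      using has_field_derivative_line[OF assms(1), of x "axis i 1" t "{a..b}"]
      by (simp add: has_real_derivative_iff_has_vector_derivative)
  qed
  then show ?thesis unfolding line_int_def by (rule integral_unique)
qed

text \<open>Differentiation in direction j commutes with integration over segments in direction i.
  Applied to the i-derivative of f, this shows that the difference of the two mixed derivatives has
  integral 0 over every segment starting at x in direction i; being continuous, it vanishes at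
  x.\<close>

lemma partial_deriv_commute:
  assumes f: "smooth_function f"
  shows "partial_deriv i (partial_deriv j f) = partial_deriv j (partial_deriv i f)"
proof
  fix x
  let ?e = "axis i 1 :: real ^ 3"
  define g where "g t = partial_deriv j (partial_deriv i f) (x + t *\<^sub>R ?e) - partial_deriv i (partial_deriv j f) (x + t *\<^sub>R ?e)" for t
  have sm: "smooth_function (partial_deriv j (partial_deriv i f))" "smooth_function (partial_deriv i (partial_deriv j f))"
    using f by (simp_all add: smooth_partial_deriv)
  have cg: "continuous_on S g" for S
    unfolding g_def by (intro continuous_intros continuous_on_line smooth_continuous_on sm)
  have zero: "integral {0..L} g = 0" if "L \<ge> 0" for L
  proof -
    have "line_int 0 L i (partial_deriv i f) = (\<lambda>y. f (y + L *\<^sub>R ?e) - f y)"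
      using line_int_partial_deriv[OF f that, of i] by (auto simp: fun_eq_iff)
    then have "partial_deriv j (line_int 0 L i (partial_deriv i f)) x = partial_deriv j (\<lambda>y. f (y + L *\<^sub>R ?e) + -1 * f y) x"
      by simp
    also have "\<dots> = partial_deriv j f (x + L *\<^sub>R ?e) - partial_deriv j f x"
      unfolding partial_deriv_add[OF smooth_translate[OF f] smooth_cmult[OF f]]
        partial_deriv_cmult[OF f] partial_deriv_translate[OF f] by simp
    also have "\<dots> = line_int 0 L i (partial_deriv i (partial_deriv j f)) x"
      using line_int_partial_deriv[OF smooth_partial_deriv[OF f] that, of i j x] by simp
    finally have "line_int 0 L i (partial_deriv j (partial_deriv i f)) x = line_int 0 L i (partial_deriv i (partial_deriv j f)) x"
      using f by (simp add: partial_deriv_line_int smooth_partial_deriv)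
    then show ?thesis
      unfolding g_def line_int_def
      by (subst integral_diff) (auto intro!: integrable_continuous_real continuous_on_line smooth_continuous_on sm)
  qed
  have "((\<lambda>u. integral {0..u} g) has_vector_derivative g 0) (at 0 within {0..1})"
    by (rule integral_has_vector_derivative[OF cg]) simp
  then have "((\<lambda>u::real. 0) has_vector_derivative g 0) (at 0 within {0..1})"
    by (rule has_vector_derivative_transform[rotated 2]) (auto simp: zero)
  moreover have "((\<lambda>u::real. 0) has_vector_derivative (0::real)) (at 0 within {0..1})" by simp
  ultimately have "g 0 = 0"
    by (intro vector_derivative_unique_within[of 0 "{0..1::real}"])
       (auto simp: at_within_Icc_at_right)
  then show "partial_deriv i (partial_deriv j f) x = partial_deriv j (partial_deriv i f) x"
    by (simp add: g_def)
qed

section \<open>Test functions and integration by parts\<close>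

lemma test_function_iff: "\<psi> \<in> test_functions \<longleftrightarrow> smooth_function \<psi> \<and> bounded {x. \<psi> x \<noteq> 0}"
  by (auto simp: test_functions_def supp_def compact_closure)

lemma test_smooth: "\<psi> \<in> test_functions \<Longrightarrow> smooth_function \<psi>"
  by (simp add: test_function_iff)

lemma partial_deriv_zero_outside:
  assumes "x \<notin> closure {x. f x \<noteq> 0}" shows "partial_deriv i f x = 0"
proof -
  have 0: "((\<lambda>_. 0) has_derivative (\<lambda>_. 0)) (at x)" by simp
  have "(f has_derivative (\<lambda>_. 0)) (at x)"
    by (rule has_derivative_transform_within_open[OF 0, of "- closure {x. f x \<noteq> 0}"])
      (use assms closure_subset[of "{x. f x \<noteq> 0}"] in auto)
  from partial_deriv_eqI[OF this] show ?thesis .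
qed

lemma test_partial_deriv: "\<psi> \<in> test_functions \<Longrightarrow> partial_deriv i \<psi> \<in> test_functions"
  unfolding test_function_iff using partial_deriv_zero_outside[of _ \<psi> i]
  by (auto intro: smooth_partial_deriv bounded_subset[OF bounded_closure])

lemma test_mult: "smooth_function f \<Longrightarrow> \<psi> \<in> test_functions \<Longrightarrow> (\<lambda>x. f x * \<psi> x) \<in> test_functions"
  unfolding test_function_iff by (auto intro: smooth_mult elim!: bounded_subset)

lemma test_cmult: "\<psi> \<in> test_functions \<Longrightarrow> (\<lambda>x. c * \<psi> x) \<in> test_functions"
  by (rule test_mult) simp

lemma test_add:
  assumes "\<phi> \<in> test_functions" "\<psi> \<in> test_functions" shows "(\<lambda>x. \<phi> x + \<psi> x) \<in> test_functions"
proof -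
  have "{x. \<phi> x + \<psi> x \<noteq> 0} \<subseteq> {x. \<phi> x \<noteq> 0} \<union> {x. \<psi> x \<noteq> 0}" by auto
  then have "bounded {x. \<phi> x + \<psi> x \<noteq> 0}"
    by (rule bounded_subset[rotated]) (use assms in \<open>auto simp: test_function_iff\<close>)
  with assms show ?thesis by (auto simp: test_function_iff intro: smooth_add)
qed

lemma test_zero [simp]: "(\<lambda>x. 0) \<in> test_functions"
  by (simp add: test_function_iff)

lemma test_sum: "(\<And>i. i \<in> I \<Longrightarrow> f i \<in> test_functions) \<Longrightarrow> (\<lambda>x. \<Sum>i\<in>I. f i x) \<in> test_functions"
  by (induction I rule: infinite_finite_induct) (auto intro: test_add)

lemma test_support:
  assumes "\<psi> \<in> test_functions"
  obtains R where "R > 0" "\<And>x. norm x > R \<Longrightarrow> \<psi> x = 0"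
  using assms unfolding test_function_iff bounded_pos by (metis mem_Collect_eq not_less)

lemma integrable_compact_support:
  fixes g :: "'a::euclidean_space \<Rightarrow> real"
  assumes "continuous_on UNIV g" "\<And>x. norm x > R \<Longrightarrow> g x = 0"
  shows "integrable lborel g"
proof -
  have "integrable lborel (\<lambda>x. indicator (cball 0 R) x *\<^sub>R g x)"
    by (rule borel_integrable_compact) (auto intro: continuous_on_subset[OF assms(1)])
  also have "(\<lambda>x. indicator (cball 0 R) x *\<^sub>R g x) = g"
    using assms(2) by (fastforce simp: indicator_def)
  finally show ?thesis .
qed

lemma integrable_test_mult:
  assumes "continuous_on UNIV f" "\<psi> \<in> test_functions"
  shows "integrable lborel (\<lambda>x. f x * \<psi> x)"
proof -
  obtain R where "\<And>x. norm x > R \<Longrightarrow> \<psi> x = 0" using test_support[OF assms(2)] by blast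
  then show ?thesis
    by (intro integrable_compact_support[of _ R] continuous_intros assms smooth_continuous_on test_smooth) auto
qed

lemma integrable_test: "\<psi> \<in> test_functions \<Longrightarrow> integrable lborel \<psi>"
  using integrable_test_mult[of "\<lambda>_. 1" \<psi>] by simp

lemma lborel_integral_translate:
  fixes f :: "'a::euclidean_space \<Rightarrow> real"
  shows "(\<integral>x. f (x + a) \<partial>lborel) = (\<integral>x. f x \<partial>lborel)"
proof (cases "f \<in> borel_measurable borel")
  case True
  have "(\<integral>x. f x \<partial>lborel) = (\<integral>x. f x \<partial>distr lborel borel ((+) a))" by (simp add: lborel_distr_plus)
  also have "\<dots> = (\<integral>x. f (a + x) \<partial>lborel)" using True by (subst integral_distr) auto
  finally show ?thesis by (simp add: add.commute)
next
  case False
  have "(\<lambda>x. f (x + a)) \<notin> borel_measurable borel"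
  proof
    assume "(\<lambda>x. f (x + a)) \<in> borel_measurable borel"
    from measurable_compose[OF _ this, of "\<lambda>x. x - a" borel] False show False by simp
  qed
  with False show ?thesis by (metis (no_types) borel_measurable_integrable measurable_lborel2 not_integrable_integral_eq)
qed

text \<open>Fubini on the product of space and [0, 1]. Integrated first over the unit segment from x
  in direction i, the derivative gives \<psi>(x + e) - \<psi>(x), whose integral is 0 by translation
  invariance; integrated first over space, it gives the integral of the derivative itself.\<close>

lemma integral_partial_deriv_test:
  assumes \<psi>: "\<psi> \<in> test_functions"
  shows "(\<integral>x. partial_deriv i \<psi> x \<partial>lborel) = 0"
proof -
  let ?g = "partial_deriv i \<psi>" and ?e = "axis i 1 :: real ^ 3"
  have g: "?g \<in> test_functions" using \<psi> by (rule test_partial_deriv)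
  obtain R where R: "R > 0" "\<And>x. norm x > R \<Longrightarrow> ?g x = 0" using test_support[OF g] by blast
  have gc: "continuous_on UNIV ?g" by (intro smooth_continuous_on test_smooth g)
  \<comment> \<open>Radius R + 1: for t in [0, 1] the translated derivative vanishes outside that
    ball, so the ball indicator changes nothing and makes h a function on a compact set.\<close>
  define h where "h = (\<lambda>(x, t::real). indicator (cball 0 (R + 1) \<times> {0..1}) (x, t) *\<^sub>R ?g (x + t *\<^sub>R ?e))"
  have h_eq: "h (x, t) = indicator {0..1} t *\<^sub>R ?g (x + t *\<^sub>R ?e)" for x t
  proof (cases "t \<in> {0..1} \<and> norm x > R + 1")
    case True
    have "norm x \<le> norm (x + t *\<^sub>R ?e) + norm (t *\<^sub>R ?e)" by (metis add_diff_cancel_right' norm_triangle_ineq4)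
    with True have "norm (x + t *\<^sub>R ?e) > R" by (auto simp: norm_axis_1)
    then show ?thesis using R by (simp add: h_def)
  qed (auto simp: h_def indicator_def)
  have "integrable lborel h"
    unfolding h_def case_prod_beta prod.collapse
    by (rule borel_integrable_compact)
       (auto intro!: compact_Times continuous_on_compose2[OF gc] continuous_intros)
  then have int: "integrable (lborel \<Otimes>\<^sub>M lborel) (case_prod (\<lambda>x t. h (x, t)))"
    by (simp add: lborel_prod)
  have "(\<integral>t. (\<integral>x. h (x, t) \<partial>lborel) \<partial>lborel) = (\<integral>x. (\<integral>t. h (x, t) \<partial>lborel) \<partial>lborel)"
    by (rule lborel_pair.Fubini_integral[OF int])
  also have "(\<lambda>x. \<integral>t. h (x, t) \<partial>lborel) = (\<lambda>x. \<psi> (x + ?e) - \<psi> x)"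
  proof
    fix x
    have "(\<integral>t. h (x, t) \<partial>lborel) = line_int 0 1 i ?g x"
      unfolding h_eq line_int_def set_lebesgue_integral_def[symmetric]
      by (intro set_borel_integral_eq_integral(2))
         (use borel_integrable_compact[OF compact_Icc continuous_on_line[OF gc], of 0 1 x ?e]
           in \<open>simp add: set_integrable_def\<close>)
    also have "\<dots> = \<psi> (x + ?e) - \<psi> x"
      using line_int_partial_deriv[OF test_smooth[OF \<psi>], of 0 1 i x] by simp
    finally show "(\<integral>t. h (x, t) \<partial>lborel) = \<psi> (x + ?e) - \<psi> x" .
  qed
  also have "(\<integral>x. \<psi> (x + ?e) - \<psi> x \<partial>lborel) = 0"
  proof -
    have "integrable lborel (\<lambda>x. \<psi> (x + ?e))"
    proof -
      have "distr lborel borel ((+) ?e) = (lborel :: (real^3) measure)" by (rule lborel_distr_plus)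
      then have "integrable (distr lborel borel ((+) ?e)) \<psi>" using integrable_test[OF \<psi>] by simp
      then have "integrable lborel (\<lambda>x. \<psi> (?e + x))"
        by (subst (asm) integrable_distr_eq) (use integrable_test[OF \<psi>] in auto)
      then show ?thesis by (simp add: add.commute)
    qed
    then show ?thesis using integrable_test[OF \<psi>] by (simp add: lborel_integral_translate)
  qed
  also have "(\<integral>t. (\<integral>x. h (x, t) \<partial>lborel) \<partial>lborel) = (\<integral>t. indicator {0..1::real} t * (\<integral>x. ?g x \<partial>lborel) \<partial>lborel)"
    unfolding h_eq by (simp add: lborel_integral_translate)
  also have "\<dots> = (\<integral>x. ?g x \<partial>lborel)" by simp
  finally show ?thesis .
qed

lemma integral_by_parts_test:
  assumes f: "smooth_function f" and \<psi>: "\<psi> \<in> test_functions"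
  shows "(\<integral>x. f x * partial_deriv i \<psi> x \<partial>lborel) = - (\<integral>x. partial_deriv i f x * \<psi> x \<partial>lborel)"
proof -
  have "0 = (\<integral>x. partial_deriv i (\<lambda>x. f x * \<psi> x) x \<partial>lborel)"
    by (simp add: integral_partial_deriv_test test_mult f \<psi>)
  also have "\<dots> = (\<integral>x. f x * partial_deriv i \<psi> x + partial_deriv i f x * \<psi> x \<partial>lborel)"
    using f test_smooth[OF \<psi>] by (subst partial_deriv_mult) (auto intro: smooth_differentiable)
  also have "\<dots> = (\<integral>x. f x * partial_deriv i \<psi> x \<partial>lborel) + (\<integral>x. partial_deriv i f x * \<psi> x \<partial>lborel)"
    using f \<psi> by (intro Bochner_Integration.integral_add integrable_test_mult smooth_continuous_on
        test_partial_deriv smooth_partial_deriv)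
  finally show ?thesis by simp
qed

section \<open>Bump functions\<close>

definition flat :: "real poly \<Rightarrow> real \<Rightarrow> real" where
  "flat p t = (if t > 0 then poly p (1 / t) * exp (- (1 / t)) else 0)"

lemma poly_exp_tendsto_0: "((\<lambda>s::real. poly p s * exp (- s)) \<longlongrightarrow> 0) at_top"
proof -
  have "((\<lambda>s. \<Sum>i\<le>degree p. coeff p i * (s ^ i / exp s)) \<longlongrightarrow> (\<Sum>i\<le>degree p. coeff p i * 0)) at_top"
    by (intro tendsto_sum tendsto_mult tendsto_const tendsto_power_div_exp_0)
  moreover have "poly p s * exp (- s) = (\<Sum>i\<le>degree p. coeff p i * (s ^ i / exp s))" for s
    by (simp add: poly_altdef exp_minus sum_distrib_right divide_inverse mult.assoc)
  ultimately show ?thesis by simp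
qed

text \<open>With s = 1/t, the t-derivative of p(s) exp(-s) is s^2 (p(s) - p'(s)) exp(-s), so the
  family stays closed under differentiation. At t = 0 the difference quotient is again a polynomial
  in s times exp(-s) and tends to 0.\<close>

lemma flat_has_field_derivative:
  "(flat p has_field_derivative flat ([:0, 0, 1:] * (p - pderiv p)) t) (at t)"
proof -
  consider "t > 0" | "t < 0" | "t = 0" by linarith
  then show ?thesis
  proof cases
    case 1
    have "((\<lambda>t. poly p (1 / t) * exp (- (1 / t))) has_field_derivative flat ([:0, 0, 1:] * (p - pderiv p)) t) (at t)"
      using 1 by (auto intro!: derivative_eq_intros simp: flat_def power2_eq_square field_simps)
    then show ?thesis
      by (rule has_field_derivative_transform_within_open[of _ _ _ "{0<..}"]) (use 1 in \<open>auto simp: flat_def\<close>)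
  next
    case 2
    have "((\<lambda>t. 0) has_field_derivative flat ([:0, 0, 1:] * (p - pderiv p)) t) (at t)"
      using 2 by (simp add: flat_def)
    then show ?thesis
      by (rule has_field_derivative_transform_within_open[of _ _ _ "{..<0}"]) (use 2 in \<open>auto simp: flat_def\<close>)
  next
    case 3
    have "((\<lambda>h. flat p h / h) \<longlongrightarrow> 0) (at_right 0)"
      unfolding filterlim_at_right_to_top
    proof (rule Lim_transform_eventually[OF poly_exp_tendsto_0[of "pCons 0 p"]])
      show "\<forall>\<^sub>F x in at_top. poly (pCons 0 p) x * exp (- x) = flat p (inverse x) / inverse x"
        using eventually_gt_at_top[of 0] by eventually_elim (simp add: flat_def field_simps)
    qed
    moreover have "((\<lambda>h. flat p h / h) \<longlongrightarrow> 0) (at_left 0)"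
      by (rule Lim_transform_eventually[OF tendsto_const])
        (auto simp: flat_def eventually_at_filter)
    ultimately have "((\<lambda>h. flat p h / h) \<longlongrightarrow> 0) (at 0)" by (simp add: filterlim_split_at)
    then show ?thesis using 3 by (simp add: has_field_derivative_iff flat_def[of _ 0])
  qed
qed

lemma smooth_flat: "smooth_function (\<lambda>x. flat p (c * x $ i + d))"
proof (rule smooth_coinduct[where S = "{\<lambda>x. a * flat p (c * x $ i + d) | a p. True}"])
  fix h :: "real ^ 3 \<Rightarrow> real" and x j
  assume "h \<in> {\<lambda>x. a * flat p (c * x $ i + d) | a p. True}"
  then obtain a p where h: "h = (\<lambda>x. a * flat p (c * x $ i + d))" by blast
  define q where "q = [:0, 0, 1:] * (p - pderiv p)"
  have D: "(h has_derivative (\<lambda>v. a * (c * v $ i * flat q (c * x $ i + d)))) (at x)" for x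
  proof -
    have lin: "((\<lambda>x :: real ^ 3. c * x $ i + d) has_derivative (\<lambda>v. c * v $ i)) (at x)"
      by (auto intro!: derivative_eq_intros bounded_linear_imp_has_derivative bounded_linear_vec_nth)
    from DERIV_compose_FDERIV[OF flat_has_field_derivative lin]
    show ?thesis unfolding h q_def by (intro has_derivative_mult_right)
  qed
  then show "h differentiable at x" using differentiable_def by blast
  have "partial_deriv j h = (\<lambda>x. (a * c * axis j 1 $ i) * flat q (c * x $ i + d))"
    by (rule ext, subst partial_deriv_eqI[OF D]) simp
  then show "partial_deriv j h \<in> {\<lambda>x. a * flat p (c * x $ i + d) | a p. True}" by blast
qed (rule CollectI, rule exI[of _ 1], auto)

definition bump :: "real \<Rightarrow> real \<Rightarrow> real \<Rightarrow> real" where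
  "bump a b t = flat 1 (t - a) * flat 1 (b - t)"

lemma bump_pos_iff: "bump a b t > 0 \<longleftrightarrow> a < t \<and> t < b"
  by (auto simp: bump_def flat_def zero_less_mult_iff)

lemma bump_nonneg: "bump a b t \<ge> 0"
  by (auto simp: bump_def flat_def)

lemma bump_eq_0: "t \<le> a \<or> t \<ge> b \<Longrightarrow> bump a b t = 0"
  by (auto simp: bump_def flat_def)

lemma smooth_bump: "smooth_function (\<lambda>x. bump a b (x $ i))"
  unfolding bump_def
  using smooth_flat[of 1 1 i "-a"] smooth_flat[of 1 "-1" i b] by (intro smooth_mult) (simp_all add: algebra_simps)

lemma continuous_on_bump: "continuous_on S (bump a b)"
proof -
  have c: "continuous_on T (flat p)" for T p
    by (meson DERIV_isCont continuous_at_imp_continuous_on flat_has_field_derivative)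
  show ?thesis unfolding bump_def
    by (intro continuous_on_mult continuous_on_compose2[OF c[of UNIV]] continuous_intros) auto
qed

definition box_bump :: "real ^ 3 \<Rightarrow> real \<Rightarrow> real ^ 3 \<Rightarrow> real" where
  "box_bump a e x = (bump (a $ 1 - e) (a $ 1 + e) (x $ 1) * bump (a $ 2 - e) (a $ 2 + e) (x $ 2))
     * bump (a $ 3 - e) (a $ 3 + e) (x $ 3)"

lemma box_bump_neq_0_iff: "box_bump a e x \<noteq> 0 \<longleftrightarrow> (\<forall>i. \<bar>x $ i - a $ i\<bar> < e)"
  using bump_pos_iff[of "a $ 1 - e" "a $ 1 + e" "x $ 1"] bump_pos_iff[of "a $ 2 - e" "a $ 2 + e" "x $ 2"]
    bump_pos_iff[of "a $ 3 - e" "a $ 3 + e" "x $ 3"]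
  by (auto simp: box_bump_def forall_3 less_le[of 0] bump_nonneg abs_less_iff)

lemma box_bump_nonneg: "box_bump a e x \<ge> 0"
  by (simp add: box_bump_def bump_nonneg)

lemma bounded_box_3: "bounded {x :: real ^ 3. \<forall>i. \<bar>x $ i\<bar> \<le> R}"
proof (rule boundedI)
  fix x :: "real ^ 3" assume "x \<in> {x. \<forall>i. \<bar>x $ i\<bar> \<le> R}"
  then have "(\<Sum>i\<in>UNIV. \<bar>x $ i\<bar>) \<le> (\<Sum>i\<in>(UNIV::3 set). R)" by (intro sum_mono) auto
  then show "norm x \<le> (\<Sum>i\<in>(UNIV::3 set). R)" using norm_le_l1_cart[of x] by simp
qed

lemma test_box_bump: "box_bump a e \<in> test_functions"
proof -
  have "smooth_function (box_bump a e)"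
    unfolding box_bump_def[abs_def] by (intro smooth_mult smooth_bump)
  moreover have "\<bar>x $ i\<bar> \<le> norm a + e" if "\<bar>x $ i - a $ i\<bar> < e" for x :: "real ^ 3" and i
    using that component_le_norm_cart[of a i] by linarith
  then have "bounded {x. box_bump a e x \<noteq> 0}"
    by (intro bounded_subset[OF bounded_box_3[of "norm a + e"]]) (auto simp: box_bump_neq_0_iff)
  ultimately show ?thesis by (simp add: test_function_iff)
qed

text \<open>The fundamental lemma of the calculus of variations: where h is nonzero it has constant
  sign on a small cube, and a bump supported there detects it.\<close>

lemma continuous_zero_if_test_integrals_zero:
  assumes h: "continuous_on UNIV h" and zero: "\<And>\<psi>. \<psi> \<in> test_functions \<Longrightarrow> (\<integral>x. h x * \<psi> x \<partial>lborel) = 0"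
  shows "h x = 0"
proof (rule ccontr)
  assume nz: "h x \<noteq> 0"
  define s where "s = sgn (h x)"
  have "open {y. 0 < s * h y}" by (intro open_Collect_less continuous_intros h)
  moreover have "s * h x > 0" using nz by (simp add: s_def sgn_if)
  ultimately obtain d where d: "d > 0" "\<And>y. dist y x < d \<Longrightarrow> s * h y > 0"
    unfolding open_dist by blast
  \<comment> \<open>The norm is at most the sum of the three coordinates, each at most e, and 3 d /
    4 < d.\<close>
  define e where "e = d / 4"
  define \<psi> where "\<psi> = box_bump x e"
  have \<psi>: "\<psi> \<in> test_functions" by (simp add: \<psi>_def test_box_bump)
  have pos: "s * h y > 0" if "\<psi> y \<noteq> 0" for y
  proof (rule d(2))
    have "\<bar>(y - x) $ i\<bar> \<le> e" for i using that by (simp add: \<psi>_def box_bump_neq_0_iff less_imp_le)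
    then have "(\<Sum>i\<in>UNIV. \<bar>(y - x) $ i\<bar>) \<le> (\<Sum>i\<in>(UNIV::3 set). e)" by (intro sum_mono) auto
    then show "dist y x < d" using norm_le_l1_cart[of "y - x"] d(1) by (simp add: dist_norm e_def)
  qed
  have int: "integrable lborel (\<lambda>y. (s * h y) * \<psi> y)"
    using h by (intro integrable_test_mult \<psi> continuous_intros)
  have nn: "(s * h y) * \<psi> y \<ge> 0" for y
    using pos[of y] box_bump_nonneg[of x e y] by (cases "\<psi> y = 0") (auto simp: \<psi>_def)
  have "(\<integral>y. (s * h y) * \<psi> y \<partial>lborel) = s * (\<integral>y. h y * \<psi> y \<partial>lborel)"
    by (simp add: mult.assoc)
  then have "(\<integral>y. (s * h y) * \<psi> y \<partial>lborel) = 0" using zero[OF \<psi>] by simp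
  then have "AE y in lborel. (s * h y) * \<psi> y = 0"
    using integral_nonneg_eq_0_iff_AE[OF int] nn by simp
  then have "AE y in lborel. y \<notin> {y. \<psi> y \<noteq> 0}"
    by eventually_elim (use pos in force)
  moreover have op: "open {y. \<psi> y \<noteq> 0}"
    using smooth_continuous_on[OF test_smooth[OF \<psi>], of UNIV]
    by (intro open_Collect_neq) (auto intro: continuous_on_const)
  ultimately have "emeasure lborel {y. \<psi> y \<noteq> 0} = 0"
    by (subst AE_iff_measurable[symmetric, of _ _ "\<lambda>y. y \<notin> {y. \<psi> y \<noteq> 0}"]) auto
  moreover have "x \<in> {y. \<psi> y \<noteq> 0}" using d(1) by (simp add: \<psi>_def box_bump_neq_0_iff e_def)
  moreover have "{y. \<psi> y \<noteq> 0} \<in> sets lborel" using op by simp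
  ultimately have "{y. \<psi> y \<noteq> 0} \<in> null_sets lebesgue" by (intro null_sets_completionI null_setsI)
  with op show False
    using open_not_negligible[of "{y. \<psi> y \<noteq> 0}"] \<open>x \<in> _\<close> by (auto simp: negligible_iff_null_sets)
qed

section \<open>Gluing of smooth functions and primitives of test functions\<close>

lemma partial_deriv_cong_open:
  assumes "open U" "x \<in> U" "\<And>y. y \<in> U \<Longrightarrow> f y = h y" "h differentiable at x"
  shows "f differentiable at x" "partial_deriv i f x = partial_deriv i h x"
proof -
  have D: "(h has_derivative frechet_derivative h (at x)) (at x)"
    using assms(4) by (simp add: frechet_derivative_works)
  have "(f has_derivative frechet_derivative h (at x)) (at x)"
    by (rule has_derivative_transform_within_open[OF D assms(1,2)]) (simp add: assms(3))
  then show "f differentiable at x" "partial_deriv i f x = partial_deriv i h x"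
    using differentiable_def partial_deriv_eqI by (blast, simp add: partial_deriv_eqI partial_deriv_def[of _ h])
qed

lemma smooth_local:
  assumes "\<And>x. \<exists>U h. open U \<and> x \<in> U \<and> smooth_function h \<and> (\<forall>y\<in>U. f y = h y)"
  shows "smooth_function f"
proof (rule smooth_coinduct[where S = "{f. \<forall>x. \<exists>U h. open U \<and> x \<in> U \<and> smooth_function h \<and> (\<forall>y\<in>U. f y = h y)}"])
  fix f :: "real ^ 3 \<Rightarrow> real" and x i assume "f \<in> {f. \<forall>x. \<exists>U h. open U \<and> x \<in> U \<and> smooth_function h \<and> (\<forall>y\<in>U. f y = h y)}"
  then have f: "\<exists>U h. open U \<and> x \<in> U \<and> smooth_function h \<and> (\<forall>y\<in>U. f y = h y)" for x by blast
  show "f differentiable at x"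
    using f[of x] partial_deriv_cong_open(1) smooth_differentiable by metis
  have "\<exists>U h. open U \<and> x \<in> U \<and> smooth_function h \<and> (\<forall>y\<in>U. partial_deriv i f y = h y)" for x
  proof -
    obtain U h where U: "open U" "x \<in> U" "smooth_function h" "\<forall>y\<in>U. f y = h y" using f by blast
    have "\<forall>y\<in>U. partial_deriv i f y = partial_deriv i h y"
      using U by (auto intro: partial_deriv_cong_open(2) smooth_differentiable)
    with U show ?thesis using smooth_partial_deriv by blast
  qed
  then show "partial_deriv i f \<in> {f. \<forall>x. \<exists>U h. open U \<and> x \<in> U \<and> smooth_function h \<and> (\<forall>y\<in>U. f y = h y)}" by blast
qed (use assms in blast)

definition unit_bump :: "real \<Rightarrow> real" where
  "unit_bump t = bump (-1) 1 t / integral {-1..1} (bump (-1) 1)"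

lemma unit_bump_eq_0: "\<bar>t\<bar> \<ge> 1 \<Longrightarrow> unit_bump t = 0"
  unfolding unit_bump_def by (subst bump_eq_0) auto

lemma continuous_on_unit_bump: "continuous_on S unit_bump"
  unfolding unit_bump_def[abs_def] divide_inverse by (intro continuous_intros continuous_on_bump)

lemma smooth_unit_bump: "smooth_function (\<lambda>x. unit_bump (x $ i))"
  unfolding unit_bump_def divide_inverse
  using smooth_cmult[OF smooth_bump, of "inverse (integral {-1..1} (bump (-1) 1))" "-1" 1 i] by (simp add: mult.commute)

lemma integral_unit_bump:
  assumes "R \<ge> 1" shows "integral {-R..R} unit_bump = 1"
proof -
  let ?I = "integral {-1..1} (bump (-1) 1)"
  have int: "bump (-1) 1 integrable_on {-1..1}"
    by (intro integrable_continuous_real continuous_on_bump)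
  have "?I \<noteq> 0"
  proof
    assume "?I = 0"
    then have "bump (-1) 1 0 = 0"
      using integral_eq_0_iff[of "-1" 1 "bump (-1) 1"] continuous_on_bump bump_nonneg by auto
    then show False using bump_pos_iff[of "-1" 1 0] by simp
  qed
  have "(unit_bump has_integral 1) {-1..1}"
    using has_integral_mult_left[OF integrable_integral[OF int], of "inverse ?I"] \<open>?I \<noteq> 0\<close>
    by (simp add: unit_bump_def[abs_def] divide_inverse)
  then have "(unit_bump has_integral 1) {-R..R}"
    by (rule has_integral_on_superset) (use assms in \<open>auto intro!: unit_bump_eq_0\<close>)
  then show ?thesis by (rule integral_unique)
qed

definition axis_proj :: "3 \<Rightarrow> real ^ 3 \<Rightarrow> real ^ 3" where
  "axis_proj i x = x - x $ i *\<^sub>R axis i 1"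

lemma linear_axis_proj: "linear (axis_proj i)"
  unfolding axis_proj_def[abs_def]
  by (rule linearI) (auto simp: algebra_simps)

lemma axis_proj_nth:
  "(axis_proj i x + t *\<^sub>R axis i 1) $ j = (if j = i then t else x $ j)"
  "axis_proj i x $ j + t * axis i 1 $ j = (if j = i then t else x $ j)"
  "axis_proj i x $ i = 0"
  by (simp_all add: axis_proj_def axis_def)

lemma axis_proj_eq_iff: "axis_proj i x = axis_proj i y \<longleftrightarrow> (\<forall>j. j \<noteq> i \<longrightarrow> x $ j = y $ j)"
  by (auto simp: axis_proj_def vec_eq_iff axis_def)

text \<open>For a function that vanishes where some coordinate exceeds R in absolute value, this is
  the integral over the whole line through x parallel to axis i, not divided by a length.\<close>

definition line_mean :: "real \<Rightarrow> 3 \<Rightarrow> (real ^ 3 \<Rightarrow> real) \<Rightarrow> real ^ 3 \<Rightarrow> real" where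
  "line_mean R i f x = line_int (-R) R i f (axis_proj i x)"

lemma smooth_line_mean: "smooth_function f \<Longrightarrow> smooth_function (line_mean R i f)"
  using smooth_compose_affine[OF smooth_line_int linear_axis_proj, of f "-R" R i 0 i] by (simp add: line_mean_def[abs_def])

text \<open>Subtracting the integrals along lines, spread out by a bump of integral 1, leaves a
  function with integral 0 along every line parallel to axis i. Its primitive along these lines is
  again compactly supported.\<close>

lemma test_primitive:
  assumes \<psi>: "smooth_function \<psi>" and supp0: "\<forall>x j. \<bar>x $ j\<bar> > R \<longrightarrow> \<psi> x = 0" and R: "R \<ge> 1"
  shows "\<exists>\<Phi>\<in>test_functions. partial_deriv i \<Phi> = (\<lambda>x. \<psi> x - unit_bump (x $ i) * line_mean R i \<psi> x)"
    and "\<bar>x $ j\<bar> > R \<Longrightarrow> unit_bump (x $ i) * line_mean R i \<psi> x = 0"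
proof -
  have supp: "\<psi> x = 0" if "\<bar>x $ j\<bar> > R" for x j using supp0 that by blast
  define \<phi> where "\<phi> x = \<psi> x - unit_bump (x $ i) * line_mean R i \<psi> x" for x
  let ?e = "axis i 1 :: real ^ 3"
  have lm0: "unit_bump (x $ i) * line_mean R i \<psi> x = 0" if "\<bar>x $ j\<bar> > R" for x j
  proof (cases "j = i")
    case True
    then show ?thesis using that R by (simp add: unit_bump_eq_0)
  next
    case False
    then have "\<psi> (axis_proj i x + t *\<^sub>R ?e) = 0" for t using that by (intro supp[of _ j]) (simp add: axis_proj_nth)
    then show ?thesis by (simp add: line_mean_def line_int_def)
  qed
  then show "\<bar>x $ j\<bar> > R \<Longrightarrow> unit_bump (x $ i) * line_mean R i \<psi> x = 0" .
  have sm: "smooth_function \<phi>"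
    unfolding \<phi>_def[abs_def] by (intro smooth_diff smooth_mult smooth_unit_bump smooth_line_mean \<psi>)
  have \<phi>0: "\<phi> x = 0" if "\<bar>x $ j\<bar> > R" for x j
    using lm0[OF that] supp[OF that] by (simp add: \<phi>_def)
  have c\<phi>: "continuous_on S (\<lambda>t. \<phi> (y + t *\<^sub>R ?e))" for S y
    by (intro continuous_on_line smooth_continuous_on sm)
  have zero: "integral {-R..R} (\<lambda>t. \<phi> (axis_proj i x + t *\<^sub>R ?e)) = 0" for x
  proof -
    have p: "axis_proj i (axis_proj i x + t *\<^sub>R ?e) = axis_proj i x" for t
      by (simp add: axis_proj_eq_iff axis_proj_nth)
    have "integral {-R..R} (\<lambda>t. \<phi> (axis_proj i x + t *\<^sub>R ?e)) =
        integral {-R..R} (\<lambda>t. \<psi> (axis_proj i x + t *\<^sub>R ?e) - unit_bump t * line_mean R i \<psi> x)"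
      by (simp add: \<phi>_def axis_proj_nth line_mean_def p)
    also have "\<dots> = line_mean R i \<psi> x - integral {-R..R} unit_bump * line_mean R i \<psi> x"
      unfolding line_mean_def line_int_def
      by (subst integral_diff) (auto intro!: integrable_continuous_real continuous_on_line smooth_continuous_on \<psi>
          continuous_intros continuous_on_unit_bump)
    also have "\<dots> = 0" by (simp add: integral_unit_bump R)
    finally show ?thesis .
  qed
  \<comment> \<open>The lower end 2R + 2 places the start of the segment below -R as long as x_i < R
    + 1, so J is there the primitive from minus infinity.\<close>
  define J where "J = line_int (-(2*R+2)) 0 i \<phi>"
  have J0: "J x = 0" if "R < x $ i" "x $ i \<le> R + 1" for x
  proof -
    let ?g = "\<lambda>t. \<phi> (axis_proj i x + t *\<^sub>R ?e)"
    have "(?g has_integral 0) {-R..R}"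
      unfolding has_integral_iff using zero[of x] integrable_continuous_real[OF c\<phi>] by simp
    then have "(?g has_integral 0) {- (2*R+2) + x $ i..0 + x $ i}"
      by (rule has_integral_on_superset) (use that in \<open>auto intro!: \<phi>0[of _ i] simp: axis_proj_nth\<close>)
    then have "integral {- (2*R+2) + x $ i..0 + x $ i} ?g = 0" by (rule integral_unique)
    moreover have "J x = integral {- (2*R+2)..0} (\<lambda>t. ?g (t + x $ i))"
      unfolding J_def line_int_def axis_proj_def by (simp add: algebra_simps)
    moreover have "\<dots> = integral {- (2*R+2) + x $ i..0 + x $ i} ?g"
      using integral_shift[of "- (2*R+2)" "x $ i" 0 ?g] c\<phi> by (simp add: o_def)
    ultimately show ?thesis by simp
  qed
  \<comment> \<open>Farther out the segment of J no longer covers the whole support, so J is cut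
    off. On the strip R < x_i \<le> R + 1 the segment covers the support and J is already 0, so the
    two pieces agree on an open overlap.\<close>
  define \<Phi> where "\<Phi> x = (if x $ i \<le> R + 1 then J x else 0)" for x
  have smJ: "smooth_function J" unfolding J_def by (rule smooth_line_int[OF sm])
  have U1: "open {x :: real ^ 3. x $ i < R + 1}" and U2: "open {x :: real ^ 3. R < x $ i}"
    by (auto intro!: open_Collect_less continuous_intros)
  have e1: "\<forall>y\<in>{x. x $ i < R + 1}. \<Phi> y = J y" by (simp add: \<Phi>_def)
  have e2: "\<forall>y\<in>{x. R < x $ i}. \<Phi> y = 0" using J0 by (simp add: \<Phi>_def)
  have "smooth_function \<Phi>"
  proof (rule smooth_local)
    fix x :: "real ^ 3"
    show "\<exists>U h. open U \<and> x \<in> U \<and> smooth_function h \<and> (\<forall>y\<in>U. \<Phi> y = h y)"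
    proof (cases "x $ i < R + 1")
      case True then show ?thesis using U1 e1 smJ by blast
    next
      case False
      then have "x \<in> {x. R < x $ i}" by simp
      then show ?thesis using U2 e2 smooth_const[of 0] by blast
    qed
  qed
  moreover have "\<Phi> x = 0" if "\<bar>x $ j\<bar> > R" for x j
  proof (cases "x $ i \<le> R")
    case True
    have "\<phi> (x + t *\<^sub>R ?e) = 0" if "t \<le> 0" for t
    proof (cases "j = i")
      case True
      then have "\<bar>(x + t *\<^sub>R ?e) $ i\<bar> > R" using \<open>\<bar>x $ j\<bar> > R\<close> \<open>x $ i \<le> R\<close> that by (simp add: axis_def)
      then show ?thesis by (rule \<phi>0)
    next
      case False
      then have "\<bar>(x + t *\<^sub>R ?e) $ j\<bar> > R" using \<open>\<bar>x $ j\<bar> > R\<close> by (simp add: axis_def)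
      then show ?thesis by (rule \<phi>0)
    qed
    then have "J x = integral {-(2*R+2)..0} (\<lambda>t. 0)"
      unfolding J_def line_int_def by (intro integral_cong) auto
    then show ?thesis by (simp add: \<Phi>_def)
  qed (use e2 in auto)
  then have "bounded {x. \<Phi> x \<noteq> 0}"
    by (intro bounded_subset[OF bounded_box_3[of R]]) (auto simp: not_less[symmetric])
  moreover have "partial_deriv i \<Phi> x = \<phi> x" for x
  proof (cases "x $ i < R + 1")
    case True
    have "partial_deriv i \<Phi> x = partial_deriv i J x"
      by (rule partial_deriv_cong_open(2)[OF U1]) (use True e1 smJ in \<open>auto intro: smooth_differentiable\<close>)
    also have "\<dots> = \<phi> x - \<phi> (x + (-(2*R+2)) *\<^sub>R ?e)"
      unfolding J_def partial_deriv_line_int[OF sm] using R by (subst line_int_partial_deriv[OF sm]) auto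
    also have "\<phi> (x + (-(2*R+2)) *\<^sub>R ?e) = 0"
      by (rule \<phi>0[of _ i]) (use True R in \<open>simp add: axis_def\<close>)
    finally show ?thesis by simp
  next
    case False
    have "partial_deriv i \<Phi> x = partial_deriv i (\<lambda>_. 0) x"
      by (rule partial_deriv_cong_open(2)[OF U2]) (use False e2 in auto)
    then show ?thesis using False R \<phi>0[of x i] by simp
  qed
  ultimately show "\<exists>\<Phi>\<in>test_functions. partial_deriv i \<Phi> = (\<lambda>x. \<psi> x - unit_bump (x $ i) * line_mean R i \<psi> x)"
    by (intro bexI[of _ \<Phi>]) (auto simp: test_function_iff \<phi>_def fun_eq_iff)
qed

section \<open>Functionals that vanish on derivatives\<close>

definition test_linear :: "((real ^ 3 \<Rightarrow> real) \<Rightarrow> real) \<Rightarrow> bool" where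
  "test_linear u \<longleftrightarrow> (\<forall>\<phi>\<in>test_functions. \<forall>\<psi>\<in>test_functions. \<forall>a b.
     u (\<lambda>x. a * \<phi> x + b * \<psi> x) = a * u \<phi> + b * u \<psi>)"

lemma test_linearD:
  assumes "test_linear u" "\<phi> \<in> test_functions" "\<psi> \<in> test_functions"
  shows "u (\<lambda>x. \<phi> x + \<psi> x) = u \<phi> + u \<psi>" "u (\<lambda>x. \<phi> x - \<psi> x) = u \<phi> - u \<psi>" "u (\<lambda>x. a * \<phi> x) = a * u \<phi>"
proof -
  have *: "u (\<lambda>x. a * \<phi> x + b * \<psi> x) = a * u \<phi> + b * u \<psi>" for a b
    using assms by (simp add: test_linear_def)
  show "u (\<lambda>x. \<phi> x + \<psi> x) = u \<phi> + u \<psi>" using *[of 1 1] by simp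
  show "u (\<lambda>x. \<phi> x - \<psi> x) = u \<phi> - u \<psi>" using *[of 1 "-1"] by simp
  show "u (\<lambda>x. a * \<phi> x) = a * u \<phi>" using *[of a 0] by simp
qed

lemma test_linear_integral:
  assumes "continuous_on UNIV f"
  shows "test_linear (\<lambda>\<psi>. \<integral>x. f x * \<psi> x \<partial>lborel)"
  unfolding test_linear_def
proof (intro ballI allI)
  fix \<phi> \<psi> :: "real ^ 3 \<Rightarrow> real" and a b :: real assume t: "\<phi> \<in> test_functions" "\<psi> \<in> test_functions"
  have "(\<integral>x. f x * (a * \<phi> x + b * \<psi> x) \<partial>lborel) = (\<integral>x. a * (f x * \<phi> x) + b * (f x * \<psi> x) \<partial>lborel)"
    by (simp add: algebra_simps)
  also have "\<dots> = a * (\<integral>x. f x * \<phi> x \<partial>lborel) + b * (\<integral>x. f x * \<psi> x \<partial>lborel)"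
    using integrable_test_mult[OF assms t(1)] integrable_test_mult[OF assms t(2)] by simp
  finally show "(\<integral>x. f x * (a * \<phi> x + b * \<psi> x) \<partial>lborel) = a * (\<integral>x. f x * \<phi> x \<partial>lborel) + b * (\<integral>x. f x * \<psi> x \<partial>lborel)" .
qed

text \<open>Integrating out the three variables one after the other, a test function is congruent to a
  multiple of a fixed product of bumps modulo derivatives of test functions.\<close>

lemma closed_test_functional_is_integral:
  assumes w: "test_linear w" and zero: "\<And>\<psi> i. \<psi> \<in> test_functions \<Longrightarrow> w (partial_deriv i \<psi>) = 0"
  shows "\<exists>c. \<forall>\<psi>\<in>test_functions. w \<psi> = c * (\<integral>x. \<psi> x \<partial>lborel)"
proof -
  define \<rho> :: "real ^ 3 \<Rightarrow> real" where "\<rho> x = unit_bump (x $ 3) * (unit_bump (x $ 2) * unit_bump (x $ 1))" for x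
  have "smooth_function \<rho>" unfolding \<rho>_def[abs_def] by (intro smooth_mult smooth_unit_bump)
  moreover have "\<bar>x $ i\<bar> \<le> 1" if "\<rho> x \<noteq> 0" for x i
  proof (rule ccontr)
    assume "\<not> \<bar>x $ i\<bar> \<le> 1"
    then have "unit_bump (x $ i) = 0" by (intro unit_bump_eq_0) simp
    with that show False using exhaust_3[of i] by (auto simp: \<rho>_def)
  qed
  then have "bounded {x. \<rho> x \<noteq> 0}" by (intro bounded_subset[OF bounded_box_3[of 1]]) auto
  ultimately have \<rho>: "\<rho> \<in> test_functions" by (simp add: test_function_iff)
  \<comment> \<open>The constant C depends on \<psi> alone and not on the functional. Applying it to
    w and to the Lebesgue integral and eliminating C identifies w as a multiple of the
    integral.\<close>
  have main: "\<exists>C. \<forall>w. test_linear w \<and> (\<forall>\<psi>\<in>test_functions. \<forall>i. w (partial_deriv i \<psi>) = 0) \<longrightarrow> w \<psi> = C * w \<rho>"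
    if \<psi>: "\<psi> \<in> test_functions" for \<psi>
  proof -
    obtain R0 where R0: "\<And>x. norm x > R0 \<Longrightarrow> \<psi> x = 0" using test_support[OF \<psi>] by blast
    define R where "R = max 1 R0"
    have R: "R \<ge> 1" by (simp add: R_def)
    have step: "\<psi>' \<in> test_functions" if "smooth_function \<psi>'" "\<forall>x j. \<bar>x $ j\<bar> > R \<longrightarrow> \<psi>' x = 0" for \<psi>'
      using that unfolding test_function_iff
      by (auto intro!: bounded_subset[OF bounded_box_3[of R]]) (meson not_less)
    have s0: "\<forall>x j. \<bar>x $ j\<bar> > R \<longrightarrow> \<psi> x = 0"
    proof (intro allI impI)
      fix x :: "real ^ 3" and j assume "\<bar>x $ j\<bar> > R"
      then show "\<psi> x = 0" using R0[of x] component_le_norm_cart[of x j] by (simp add: R_def)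
    qed
    have sm0: "smooth_function \<psi>" by (rule test_smooth[OF \<psi>])
    define g1 where "g1 = line_mean R 1 \<psi>"
    define g2 where "g2 = line_mean R 2 g1"
    define g3 where "g3 = line_mean R 3 g2"
    define \<psi>1 where "\<psi>1 x = unit_bump (x $ 1) * g1 x" for x
    define \<psi>2 where "\<psi>2 x = unit_bump (x $ 2) * (unit_bump (x $ 1) * g2 x)" for x
    define \<psi>3 where "\<psi>3 x = unit_bump (x $ 3) * (unit_bump (x $ 2) * (unit_bump (x $ 1) * g3 x))" for x
    have sg1: "smooth_function g1" and sg2: "smooth_function g2"
      unfolding g1_def g2_def by (intro smooth_line_mean sm0)+
    have sm1: "smooth_function \<psi>1" and sm2: "smooth_function \<psi>2"
      unfolding \<psi>1_def[abs_def] \<psi>2_def[abs_def] by (intro smooth_mult smooth_unit_bump sg1 sg2)+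
    have m2: "unit_bump (x $ 2) * line_mean R 2 \<psi>1 x = \<psi>2 x" for x
      unfolding \<psi>2_def g2_def \<psi>1_def[abs_def] line_mean_def line_int_def
      by (simp add: axis_proj_nth)
    have m3: "unit_bump (x $ 3) * line_mean R 3 \<psi>2 x = \<psi>3 x" for x
      unfolding \<psi>3_def g3_def \<psi>2_def[abs_def] line_mean_def line_int_def
      by (simp add: axis_proj_nth mult.assoc[symmetric])
    have s1: "\<forall>x j. \<bar>x $ j\<bar> > R \<longrightarrow> \<psi>1 x = 0"
      unfolding \<psi>1_def g1_def by (intro allI impI test_primitive(2)[OF sm0 s0 R])
    have s2: "\<forall>x j. \<bar>x $ j\<bar> > R \<longrightarrow> \<psi>2 x = 0"
      unfolding m2[symmetric] by (intro allI impI test_primitive(2)[OF sm1 s1 R])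
    obtain \<Phi>1 where \<Phi>1: "\<Phi>1 \<in> test_functions" "partial_deriv 1 \<Phi>1 = (\<lambda>x. \<psi> x - \<psi>1 x)"
      using test_primitive(1)[OF sm0 s0 R, where i = 1] by (auto simp: \<psi>1_def g1_def)
    obtain \<Phi>2 where \<Phi>2: "\<Phi>2 \<in> test_functions" "partial_deriv 2 \<Phi>2 = (\<lambda>x. \<psi>1 x - \<psi>2 x)"
      using test_primitive(1)[OF sm1 s1 R, where i = 2] by (auto simp: m2)
    obtain \<Phi>3 where \<Phi>3: "\<Phi>3 \<in> test_functions" "partial_deriv 3 \<Phi>3 = (\<lambda>x. \<psi>2 x - \<psi>3 x)"
      using test_primitive(1)[OF sm2 s2 R, where i = 3] by (auto simp: m3)
    have ax: "axis_proj i x = axis_proj i y" if "\<And>j. j \<noteq> i \<Longrightarrow> x $ j = y $ j" for i x y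
      using that by (simp add: axis_proj_eq_iff)
    have i1: "g1 x = g1 y" if "x $ 2 = y $ 2" "x $ 3 = y $ 3" for x y
      unfolding g1_def line_mean_def using that by (subst ax[of 1 x y]) (auto simp: exhaust_3, metis exhaust_3)
    have i2: "g2 x = g2 y" if "x $ 3 = y $ 3" for x y
      unfolding g2_def line_mean_def line_int_def
      by (intro integral_cong i1) (use that in \<open>auto simp: axis_proj_nth\<close>)
    have i3: "g3 x = g3 y" for x y
      unfolding g3_def line_mean_def line_int_def
      by (intro integral_cong i2) (auto simp: axis_proj_nth)
    have \<psi>3: "\<psi>3 = (\<lambda>x. g3 0 * \<rho> x)"
      using i3[of _ 0] by (auto simp: \<psi>3_def \<rho>_def fun_eq_iff)
    have t: "\<psi>1 \<in> test_functions" "\<psi>2 \<in> test_functions"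
      using step[OF sm1 s1] step[OF sm2 s2] by auto
    have "w \<psi> = g3 0 * w \<rho>" if w: "test_linear w" "\<forall>\<psi>\<in>test_functions. \<forall>i. w (partial_deriv i \<psi>) = 0" for w
    proof -
      have "w \<psi> - w \<psi>1 = 0" using w(2) \<Phi>1 test_linearD(2)[OF w(1) \<psi> t(1)] by metis
      moreover have "w \<psi>1 - w \<psi>2 = 0" using w(2) \<Phi>2 test_linearD(2)[OF w(1) t] by metis
      moreover have "w \<psi>2 - w \<psi>3 = 0" 
        using w(2) \<Phi>3 test_linearD(2)[OF w(1) t(2) test_cmult[OF \<rho>]] unfolding \<psi>3 by metis
      moreover have "w \<psi>3 = g3 0 * w \<rho>" unfolding \<psi>3 by (rule test_linearD(3)[OF w(1) \<rho> \<rho>])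
      ultimately show ?thesis by simp
    qed
    then show ?thesis by blast
  qed
  have I: "test_linear (\<lambda>\<psi>. \<integral>x. \<psi> x \<partial>lborel)"
    using test_linear_integral[of "\<lambda>_. 1"] by simp
  have I0: "\<forall>\<psi>\<in>test_functions. \<forall>i. (\<integral>x. partial_deriv i \<psi> x \<partial>lborel) = 0"
    by (simp add: integral_partial_deriv_test)
  \<comment> \<open>If \<rho> had integral 0, then by \<open>main\<close> every test function would,
    contradicting the fundamental lemma for the constant 1.\<close>
  have nz: "(\<integral>x. \<rho> x \<partial>lborel) \<noteq> 0"
  proof
    assume "(\<integral>x. \<rho> x \<partial>lborel) = 0"
    then have "(\<integral>x. \<psi> x \<partial>lborel) = 0" if "\<psi> \<in> test_functions" for \<psi>
      using main[OF that] I I0 by force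
    then have "(1::real) = 0"
      using continuous_zero_if_test_integrals_zero[of "\<lambda>_. 1"] by simp
    then show False by simp
  qed
  show ?thesis
  proof (intro exI ballI)
    fix \<psi> assume \<psi>: "\<psi> \<in> test_functions"
    obtain C where C: "\<And>w. test_linear w \<Longrightarrow> (\<forall>\<psi>\<in>test_functions. \<forall>i. w (partial_deriv i \<psi>) = 0) \<Longrightarrow> w \<psi> = C * w \<rho>"
      using main[OF \<psi>] by blast
    have "w \<psi> = C * w \<rho>" using C[OF w] zero by blast
    moreover have "(\<integral>x. \<psi> x \<partial>lborel) = C * (\<integral>x. \<rho> x \<partial>lborel)" using C[OF I I0] .
    ultimately show "w \<psi> = (w \<rho> / (\<integral>x. \<rho> x \<partial>lborel)) * (\<integral>x. \<psi> x \<partial>lborel)" using nz by simp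
  qed
qed

section \<open>Mixed derivatives and Taylor polynomials\<close>

lemma smooth_funpow: "smooth_function f \<Longrightarrow> smooth_function ((partial_deriv i ^^ n) f)"
  by (induction n) (auto intro: smooth_partial_deriv)

lemma funpow_partial_deriv_commute:
  "smooth_function f \<Longrightarrow> (partial_deriv i ^^ n) (partial_deriv j f) = partial_deriv j ((partial_deriv i ^^ n) f)"
  by (induction n) (auto simp: partial_deriv_commute smooth_funpow)

lemma funpow_funpow_commute:
  "smooth_function f \<Longrightarrow>
    (partial_deriv i ^^ n) ((partial_deriv j ^^ m) f) = (partial_deriv j ^^ m) ((partial_deriv i ^^ n) f)"
  by (induction m) (auto simp: funpow_partial_deriv_commute smooth_funpow)

definition mixed_deriv :: "nat \<Rightarrow> nat \<Rightarrow> nat \<Rightarrow> (real ^ 3 \<Rightarrow> real) \<Rightarrow> real ^ 3 \<Rightarrow> real" where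
  "mixed_deriv a b c f = (partial_deriv 1 ^^ a) ((partial_deriv 2 ^^ b) ((partial_deriv 3 ^^ c) f))"

lemma mixed_deriv_0 [simp]: "mixed_deriv 0 0 0 f = f"
  by (simp add: mixed_deriv_def)

lemma smooth_mixed_deriv: "smooth_function f \<Longrightarrow> smooth_function (mixed_deriv a b c f)"
  by (simp add: mixed_deriv_def smooth_funpow)

lemma partial_deriv_mixed_deriv:
  assumes "smooth_function f"
  shows "partial_deriv 1 (mixed_deriv a b c f) = mixed_deriv (Suc a) b c f"
    "partial_deriv 2 (mixed_deriv a b c f) = mixed_deriv a (Suc b) c f"
    "partial_deriv 3 (mixed_deriv a b c f) = mixed_deriv a b (Suc c) f"
  using assms by (simp_all add: mixed_deriv_def funpow_partial_deriv_commute[symmetric] smooth_funpow)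

lemma mixed_deriv_partial_deriv:
  assumes "smooth_function f"
  shows "mixed_deriv a b c (partial_deriv i f) = partial_deriv i (mixed_deriv a b c f)"
  using assms by (simp add: mixed_deriv_def funpow_partial_deriv_commute smooth_funpow)

lemma mixed_deriv_mixed_deriv:
  assumes "smooth_function f"
  shows "mixed_deriv a b c (mixed_deriv a' b' c' f) = mixed_deriv (a + a') (b + b') (c + c') f"
proof -
  have "mixed_deriv a b c (mixed_deriv a' b' c' f) =
    (partial_deriv 1 ^^ a) ((partial_deriv 2 ^^ b) ((partial_deriv 1 ^^ a') ((partial_deriv 3 ^^ c) ((partial_deriv 2 ^^ b') ((partial_deriv 3 ^^ c') f)))))"
    using assms by (simp add: mixed_deriv_def funpow_funpow_commute[where i = 3 and n = c and j = 1 and m = a'] smooth_funpow)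
  also have "\<dots> = (partial_deriv 1 ^^ a) ((partial_deriv 1 ^^ a') ((partial_deriv 2 ^^ b) ((partial_deriv 2 ^^ b') ((partial_deriv 3 ^^ c) ((partial_deriv 3 ^^ c') f)))))"
    using assms by (simp add: funpow_funpow_commute[where i = 2 and n = b and j = 1 and m = a'] funpow_funpow_commute[where i = 3 and n = c and j = 2 and m = b'] smooth_funpow)
  finally show ?thesis by (simp add: mixed_deriv_def funpow_add)
qed

lemma test_mixed_deriv: "\<psi> \<in> test_functions \<Longrightarrow> mixed_deriv a b c \<psi> \<in> test_functions"
proof -
  have *: "\<psi> \<in> test_functions \<Longrightarrow> (partial_deriv i ^^ n) \<psi> \<in> test_functions" for i n \<psi>
    by (induction n) (auto intro: test_partial_deriv)
  show "\<psi> \<in> test_functions \<Longrightarrow> mixed_deriv a b c \<psi> \<in> test_functions"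
    by (simp add: mixed_deriv_def *)
qed

lemma funpow_partial_deriv_linear:
  assumes "smooth_function f" "smooth_function g"
  shows "(partial_deriv i ^^ n) (\<lambda>x. p * f x + q * g x) = (\<lambda>x. p * (partial_deriv i ^^ n) f x + q * (partial_deriv i ^^ n) g x)"
  using assms by (induction n) (auto simp: partial_deriv_add partial_deriv_cmult smooth_cmult smooth_funpow)

lemma mixed_deriv_linear:
  assumes "smooth_function f" "smooth_function g"
  shows "mixed_deriv a b c (\<lambda>x. p * f x + q * g x) = (\<lambda>x. p * mixed_deriv a b c f x + q * mixed_deriv a b c g x)"
  using assms by (simp add: mixed_deriv_def funpow_partial_deriv_linear smooth_funpow)

lemma mixed_deriv_const_0 [simp]: "mixed_deriv a b c (\<lambda>x. 0) = (\<lambda>x. 0)"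
proof -
  have "(partial_deriv i ^^ n) (\<lambda>x. 0) = (\<lambda>x. 0)" for i n by (induction n) auto
  then show ?thesis by (simp add: mixed_deriv_def)
qed

lemma mixed_deriv_sum:
  assumes "\<And>j. j \<in> I \<Longrightarrow> smooth_function (f j)"
  shows "mixed_deriv a b c (\<lambda>x. \<Sum>j\<in>I. k j * f j x) = (\<lambda>x. \<Sum>j\<in>I. k j * mixed_deriv a b c (f j) x)"
  using assms
proof (induction I rule: infinite_finite_induct)
  case (insert j I)
  then have "mixed_deriv a b c (\<lambda>x. k j * f j x + 1 * (\<Sum>j\<in>I. k j * f j x))
      = (\<lambda>x. k j * mixed_deriv a b c (f j) x + 1 * mixed_deriv a b c (\<lambda>x. \<Sum>j\<in>I. k j * f j x) x)"
    by (intro mixed_deriv_linear smooth_sum smooth_cmult) auto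
  then show ?case using insert by simp
qed auto

lemma integral_mixed_deriv:
  assumes f: "smooth_function f" and \<psi>: "\<psi> \<in> test_functions"
  shows "(\<integral>x. f x * mixed_deriv a b c \<psi> x \<partial>lborel) = (-1) ^ (a + b + c) * (\<integral>x. mixed_deriv a b c f x * \<psi> x \<partial>lborel)"
proof -
  have t: "\<psi> \<in> test_functions \<Longrightarrow> (partial_deriv i ^^ n) \<psi> \<in> test_functions" for i n \<psi>
    by (induction n) (auto intro: test_partial_deriv)
  have *: "(\<integral>x. f x * (partial_deriv i ^^ n) \<psi> x \<partial>lborel) = (-1) ^ n * (\<integral>x. (partial_deriv i ^^ n) f x * \<psi> x \<partial>lborel)"
    if "smooth_function f" "\<psi> \<in> test_functions" for f \<psi> i n
    using that
  proof (induction n arbitrary: f)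
    case (Suc n)
    have "(\<integral>x. f x * (partial_deriv i ^^ Suc n) \<psi> x \<partial>lborel) = - (\<integral>x. partial_deriv i f x * (partial_deriv i ^^ n) \<psi> x \<partial>lborel)"
      using Suc.prems by (simp add: integral_by_parts_test t)
    also have "\<dots> = - ((-1) ^ n * (\<integral>x. (partial_deriv i ^^ n) (partial_deriv i f) x * \<psi> x \<partial>lborel))"
      using Suc.prems by (subst Suc.IH) (auto intro: smooth_partial_deriv)
    finally show ?case by (simp add: funpow_swap1)
  qed simp
  show ?thesis
    unfolding mixed_deriv_def using f \<psi>
    by (simp add: * t smooth_funpow funpow_funpow_commute[where i = 1 and n = a and j = 2 and m = b] funpow_funpow_commute[where i = 1 and n = a and j = 3 and m = c]
        funpow_funpow_commute[where i = 2 and n = b and j = 3 and m = c] power_add mult.assoc)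
qed

definition monomial3 :: "nat \<Rightarrow> nat \<Rightarrow> nat \<Rightarrow> real ^ 3 \<Rightarrow> real" where
  "monomial3 a b c y = y $ 1 ^ a * y $ 2 ^ b * y $ 3 ^ c"

lemma smooth_monomial3: "smooth_function (monomial3 a b c)"
  unfolding monomial3_def[abs_def] by (intro smooth_mult smooth_power smooth_coord)

text \<open>Divided powers, on which a partial derivative merely lowers an exponent.\<close>

definition taylor_monomial :: "nat \<Rightarrow> nat \<Rightarrow> nat \<Rightarrow> real ^ 3 \<Rightarrow> real" where
  "taylor_monomial a b c x = 1 / (fact a * fact b * fact c) * monomial3 a b c x"

lemma smooth_taylor_monomial: "smooth_function (taylor_monomial a b c)"
  unfolding taylor_monomial_def[abs_def] by (intro smooth_cmult smooth_monomial3)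

lemma has_derivative_monomial3:
  "(monomial3 a b c has_derivative
     (\<lambda>v. real a * v $ 1 * monomial3 (a - 1) b c x + real b * v $ 2 * monomial3 a (b - 1) c x
        + real c * v $ 3 * monomial3 a b (c - 1) x)) (at x)"
proof -
  have c: "((\<lambda>x::real^3. x $ i) has_derivative (\<lambda>v. v $ i)) (at x)" for i
    by (rule bounded_linear_imp_has_derivative) (rule bounded_linear_vec_nth)
  show ?thesis
    unfolding monomial3_def[abs_def]
    by (rule has_derivative_eq_rhs, (rule derivative_intros c)+) (auto simp: fun_eq_iff algebra_simps)
qed

lemma partial_deriv_taylor_monomial:
  "partial_deriv 1 (taylor_monomial (Suc a) b c) = taylor_monomial a b c"
  "partial_deriv 2 (taylor_monomial a (Suc b) c) = taylor_monomial a b c"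
  "partial_deriv 3 (taylor_monomial a b (Suc c)) = taylor_monomial a b c"
  "partial_deriv 1 (taylor_monomial 0 b c) = (\<lambda>x. 0)"
  "partial_deriv 2 (taylor_monomial a 0 c) = (\<lambda>x. 0)"
  "partial_deriv 3 (taylor_monomial a b 0) = (\<lambda>x. 0)"
  unfolding taylor_monomial_def[abs_def] partial_deriv_cmult[OF smooth_monomial3]
  by (auto simp: fun_eq_iff partial_deriv_eqI[OF has_derivative_monomial3] axis_def divide_simps)

lemma mixed_deriv_taylor_monomial:
  "mixed_deriv a b c (taylor_monomial a' b' c') =
    (if a \<le> a' \<and> b \<le> b' \<and> c \<le> c' then taylor_monomial (a' - a) (b' - b) (c' - c) else (\<lambda>x. 0))"
proof -
  have z: "(partial_deriv i ^^ n) (\<lambda>x. 0) = (\<lambda>x. 0)" for i n by (induction n) auto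
  have 1: "(partial_deriv 1 ^^ n) (taylor_monomial a b c) = (if n \<le> a then taylor_monomial (a - n) b c else (\<lambda>x. 0))" for n a b c
  proof (induction n)
    case (Suc n)
    consider "Suc n \<le> a" | "n = a" | "n > a" by linarith
    then show ?case
    proof cases
      case 1
      then have "a - n = Suc (a - Suc n)" by simp
      with Suc 1 show ?thesis by (simp add: partial_deriv_taylor_monomial)
    qed (use Suc in \<open>auto simp: partial_deriv_taylor_monomial\<close>)
  qed simp
  have 2: "(partial_deriv 2 ^^ n) (taylor_monomial a b c) = (if n \<le> b then taylor_monomial a (b - n) c else (\<lambda>x. 0))" for n a b c
  proof (induction n)
    case (Suc n)
    consider "Suc n \<le> b" | "n = b" | "n > b" by linarith
    then show ?case
    proof cases
      case 1
      then have "b - n = Suc (b - Suc n)" by simp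
      with Suc 1 show ?thesis by (simp add: partial_deriv_taylor_monomial)
    qed (use Suc in \<open>auto simp: partial_deriv_taylor_monomial\<close>)
  qed simp
  have 3: "(partial_deriv 3 ^^ n) (taylor_monomial a b c) = (if n \<le> c then taylor_monomial a b (c - n) else (\<lambda>x. 0))" for n a b c
  proof (induction n)
    case (Suc n)
    consider "Suc n \<le> c" | "n = c" | "n > c" by linarith
    then show ?case
    proof cases
      case 1
      then have "c - n = Suc (c - Suc n)" by simp
      with Suc 1 show ?thesis by (simp add: partial_deriv_taylor_monomial)
    qed (use Suc in \<open>auto simp: partial_deriv_taylor_monomial\<close>)
  qed simp
  show ?thesis by (simp add: mixed_deriv_def 1 2 3 z)
qed

definition exponents :: "nat \<Rightarrow> (nat \<times> nat \<times> nat) set" where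
  "exponents m = {(a, b, c). a + b + c = m}"

lemma finite_exponents [simp]: "finite (exponents m)"
proof (rule finite_subset)
  show "exponents m \<subseteq> {..m} \<times> {..m} \<times> {..m}" by (auto simp: exponents_def)
qed auto

text \<open>Composed with a derivative of the order just below the annihilated one, the functional
  kills all first derivatives and is therefore a multiple of the integral. Subtracting a homogeneous
  polynomial that accounts for these multiples lowers the order by one. The function obtained is
  thus a polynomial of degree less than n.\<close>

lemma annihilated_functional_is_smooth:
  assumes "test_linear u"
    and "\<And>\<psi> a b c. \<psi> \<in> test_functions \<Longrightarrow> a + b + c = n \<Longrightarrow> u (mixed_deriv a b c \<psi>) = 0"
  shows "\<exists>f. smooth_function f \<and> (\<forall>\<psi>\<in>test_functions. u \<psi> = (\<integral>x. f x * \<psi> x \<partial>lborel))"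
  using assms
proof (induction n arbitrary: u)
  case 0
  have "u \<psi> = 0" if "\<psi> \<in> test_functions" for \<psi> using 0(2)[OF that, of 0 0 0] by simp
  then show ?case by (intro exI[of _ "\<lambda>x. 0"]) auto
next
  case (Suc n)
  have "\<exists>k. \<forall>\<psi>\<in>test_functions. u (mixed_deriv a b c \<psi>) = k * (\<integral>x. \<psi> x \<partial>lborel)" if "a + b + c = n" for a b c
  proof (rule closed_test_functional_is_integral)
    show "test_linear (\<lambda>\<psi>. u (mixed_deriv a b c \<psi>))"
      using Suc.prems(1) by (auto simp: test_linear_def mixed_deriv_linear test_smooth test_mixed_deriv)
    fix \<psi> and i :: 3 assume \<psi>: "\<psi> \<in> test_functions"
    have "i = 1 \<or> i = 2 \<or> i = 3" by (rule exhaust_3)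
    then show "u (mixed_deriv a b c (partial_deriv i \<psi>)) = 0"
      using \<psi> that Suc.prems(2)[of \<psi>] by (auto simp: mixed_deriv_partial_deriv partial_deriv_mixed_deriv test_smooth)
  qed
  then obtain k where k: "\<And>a b c \<psi>. a + b + c = n \<Longrightarrow> \<psi> \<in> test_functions \<Longrightarrow>
      u (mixed_deriv a b c \<psi>) = k a b c * (\<integral>x. \<psi> x \<partial>lborel)"
    by metis
  \<comment> \<open>The derivatives of q of order n are the constants
    \<open>(-1) ^ n * k a b c\<close>; the sign compensates for the n integrations by parts.\<close>
  define q where "q x = (\<Sum>(a, b, c)\<in>exponents n. ((-1) ^ n * k a b c) * taylor_monomial a b c x)" for x
  have q: "smooth_function q"
    unfolding q_def[abs_def] by (intro smooth_sum) (auto intro!: smooth_cmult smooth_taylor_monomial)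
  have dq: "mixed_deriv a b c q = (\<lambda>x. (-1) ^ n * k a b c)" if abc: "a + b + c = n" for a b c
  proof -
    have "mixed_deriv a b c q = (\<lambda>x. \<Sum>e\<in>exponents n. (case e of (a', b', c') \<Rightarrow> (-1) ^ n * k a' b' c') *
        mixed_deriv a b c (case e of (a', b', c') \<Rightarrow> taylor_monomial a' b' c') x)"
      unfolding q_def[abs_def]
      by (subst mixed_deriv_sum[symmetric]) (auto simp: case_prod_beta smooth_taylor_monomial)
    also have "\<dots> = (\<lambda>x. \<Sum>e\<in>exponents n. if e = (a, b, c) then (-1) ^ n * k a b c else 0)"
    proof (intro ext sum.cong refl)
      fix x e assume "e \<in> exponents n"
      then obtain a' b' c' where e: "e = (a', b', c')" "a' + b' + c' = n" by (auto simp: exponents_def)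
      show "(case e of (a', b', c') \<Rightarrow> (-1) ^ n * k a' b' c') * mixed_deriv a b c (case e of (a', b', c') \<Rightarrow> taylor_monomial a' b' c') x
          = (if e = (a, b, c) then (-1) ^ n * k a b c else 0)"
        using e abc by (auto simp: mixed_deriv_taylor_monomial taylor_monomial_def monomial3_def)
    qed
    also have "\<dots> = (\<lambda>x. (-1) ^ n * k a b c)"
    proof -
      have "(a, b, c) \<in> exponents n" using abc by (simp add: exponents_def)
      then show ?thesis by (simp add: sum.delta)
    qed
    finally show ?thesis .
  qed
  define v where "v \<psi> = u \<psi> - (\<integral>x. q x * \<psi> x \<partial>lborel)" for \<psi>
  have "\<exists>f. smooth_function f \<and> (\<forall>\<psi>\<in>test_functions. v \<psi> = (\<integral>x. f x * \<psi> x \<partial>lborel))"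
  proof (rule Suc.IH)
    show "test_linear v"
      using Suc.prems(1) test_linear_integral[OF smooth_continuous_on[OF q]]
      unfolding test_linear_def v_def by (simp add: algebra_simps)
    fix \<psi> a b c assume \<psi>: "\<psi> \<in> test_functions" and abc: "a + b + (c::nat) = n"
    have "(\<integral>x. q x * mixed_deriv a b c \<psi> x \<partial>lborel) = k a b c * (\<integral>x. \<psi> x \<partial>lborel)"
      unfolding integral_mixed_deriv[OF q \<psi>] abc dq[OF abc] by (simp flip: power_mult_distrib mult.assoc)
    then show "v (mixed_deriv a b c \<psi>) = 0" using k[OF abc \<psi>] by (simp add: v_def)
  qed
  then obtain f where f: "smooth_function f" "\<And>\<psi>. \<psi> \<in> test_functions \<Longrightarrow> v \<psi> = (\<integral>x. f x * \<psi> x \<partial>lborel)" by blast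
  have "u \<psi> = (\<integral>x. (f x + q x) * \<psi> x \<partial>lborel)" if \<psi>: "\<psi> \<in> test_functions" for \<psi>
    using f(2)[OF \<psi>] integrable_test_mult[OF smooth_continuous_on[OF f(1)] \<psi>]
      integrable_test_mult[OF smooth_continuous_on[OF q] \<psi>]
    by (simp add: v_def algebra_simps)
  then show ?case using smooth_add[OF f(1) q] by blast
qed

section \<open>Multinomial theorem and Taylor's formula\<close>

definition multinom :: "nat \<Rightarrow> nat \<Rightarrow> nat \<Rightarrow> real" where
  "multinom a b c = fact (a + b + c) / (fact a * fact b * fact c)"

text \<open>Pascal's rule: the three shifted sums contribute each term with weights a/(m+1), b/(m+1)
  and c/(m+1), which add up to 1. F is arbitrary because the rule serves both the powers of a linear
  form and the iterated directional derivatives.\<close>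

lemma multinom_sum_Suc:
  fixes F :: "nat \<Rightarrow> nat \<Rightarrow> nat \<Rightarrow> real"
  shows "(\<Sum>(a, b, c)\<in>exponents m. multinom a b c * (F (Suc a) b c + F a (Suc b) c + F a b (Suc c)))
    = (\<Sum>(a, b, c)\<in>exponents (Suc m). multinom a b c * F a b c)"
proof -
  \<comment> \<open>The shift of a misses exactly the exponents with a = 0, whose weight is 0. The
    same happens for b and c.\<close>
  have A: "(\<Sum>(a, b, c)\<in>exponents m. multinom a b c * F (Suc a) b c)
    = (\<Sum>(a, b, c)\<in>exponents (Suc m). (real a / real (Suc m)) * (multinom a b c * F a b c))"
  proof (rule sum.reindex_bij_witness_not_neutral[where S' = "{}" and T' = "{(a, b, c)\<in>exponents (Suc m). a = 0}"
        and i = "\<lambda>(a, b, c). (a - 1, b, c)" and j = "\<lambda>(a, b, c). (Suc a, b, c)"])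
    show "finite {(a, b, c)\<in>exponents (Suc m). a = 0}" by (rule finite_subset[OF _ finite_exponents[of "Suc m"]]) auto
  qed (auto simp: exponents_def multinom_def fact_Suc simp del: of_nat_Suc)
  have B: "(\<Sum>(a, b, c)\<in>exponents m. multinom a b c * F a (Suc b) c)
    = (\<Sum>(a, b, c)\<in>exponents (Suc m). (real b / real (Suc m)) * (multinom a b c * F a b c))"
  proof (rule sum.reindex_bij_witness_not_neutral[where S' = "{}" and T' = "{(a, b, c)\<in>exponents (Suc m). b = 0}"
        and i = "\<lambda>(a, b, c). (a, b - 1, c)" and j = "\<lambda>(a, b, c). (a, Suc b, c)"])
    show "finite {(a, b, c)\<in>exponents (Suc m). b = 0}" by (rule finite_subset[OF _ finite_exponents[of "Suc m"]]) auto
  qed (auto simp: exponents_def multinom_def fact_Suc simp del: of_nat_Suc)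
  have C: "(\<Sum>(a, b, c)\<in>exponents m. multinom a b c * F a b (Suc c))
    = (\<Sum>(a, b, c)\<in>exponents (Suc m). (real c / real (Suc m)) * (multinom a b c * F a b c))"
  proof (rule sum.reindex_bij_witness_not_neutral[where S' = "{}" and T' = "{(a, b, c)\<in>exponents (Suc m). c = 0}"
        and i = "\<lambda>(a, b, c). (a, b, c - 1)" and j = "\<lambda>(a, b, c). (a, b, Suc c)"])
    show "finite {(a, b, c)\<in>exponents (Suc m). c = 0}" by (rule finite_subset[OF _ finite_exponents[of "Suc m"]]) auto
  qed (auto simp: exponents_def multinom_def fact_Suc simp del: of_nat_Suc)
  have "(\<Sum>(a, b, c)\<in>exponents m. multinom a b c * (F (Suc a) b c + F a (Suc b) c + F a b (Suc c)))
    = (\<Sum>(a, b, c)\<in>exponents m. multinom a b c * F (Suc a) b c) + (\<Sum>(a, b, c)\<in>exponents m. multinom a b c * F a (Suc b) c)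
      + (\<Sum>(a, b, c)\<in>exponents m. multinom a b c * F a b (Suc c))"
    by (simp add: case_prod_beta ring_distribs sum.distrib)
  also have "\<dots> = (\<Sum>(a, b, c)\<in>exponents (Suc m). (real a / real (Suc m)) * (multinom a b c * F a b c)
      + (real b / real (Suc m)) * (multinom a b c * F a b c) + (real c / real (Suc m)) * (multinom a b c * F a b c))"
    unfolding A B C by (simp add: case_prod_beta sum.distrib)
  also have "\<dots> = (\<Sum>(a, b, c)\<in>exponents (Suc m). multinom a b c * F a b c)"
  proof (intro sum.cong refl, clarify)
    fix a b c assume "(a, b, c) \<in> exponents (Suc m)"
    then have "real a + real b + real c = real (Suc m)" by (simp add: exponents_def flip: of_nat_add)
    then have "real a / real (Suc m) + real b / real (Suc m) + real c / real (Suc m) = 1"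
      by (simp add: add_divide_distrib[symmetric] del: of_nat_Suc)
    then show "(real a / real (Suc m)) * (multinom a b c * F a b c) + (real b / real (Suc m)) * (multinom a b c * F a b c)
        + (real c / real (Suc m)) * (multinom a b c * F a b c) = multinom a b c * F a b c"
      by (metis distrib_right mult_1)
  qed
  finally show ?thesis .
qed

lemma multinomial_theorem:
  "(y $ 1 * z $ 1 + y $ 2 * z $ 2 + y $ 3 * z $ 3 :: real) ^ m
    = (\<Sum>(a, b, c)\<in>exponents m. multinom a b c * (monomial3 a b c y * monomial3 a b c z))"
proof (induction m)
  case 0
  have "exponents 0 = {(0, 0, 0)}" by (auto simp: exponents_def)
  then show ?case by (simp add: multinom_def monomial3_def)
next
  case (Suc m)
  have "(y $ 1 * z $ 1 + y $ 2 * z $ 2 + y $ 3 * z $ 3) ^ Suc m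
      = (\<Sum>(a, b, c)\<in>exponents m. multinom a b c * ((y $ 1 * z $ 1 + y $ 2 * z $ 2 + y $ 3 * z $ 3) * (monomial3 a b c y * monomial3 a b c z)))"
    unfolding power_Suc Suc sum_distrib_left by (intro sum.cong) auto
  also have "\<dots> = (\<Sum>(a, b, c)\<in>exponents m. multinom a b c * (monomial3 (Suc a) b c y * monomial3 (Suc a) b c z
      + monomial3 a (Suc b) c y * monomial3 a (Suc b) c z + monomial3 a b (Suc c) y * monomial3 a b (Suc c) z))"
    by (intro sum.cong) (auto simp: monomial3_def algebra_simps)
  also have "\<dots> = (\<Sum>(a, b, c)\<in>exponents (Suc m). multinom a b c * (monomial3 a b c y * monomial3 a b c z))"
    by (rule multinom_sum_Suc)
  finally show ?case .
qed

text \<open>The m-th derivative of f(x + t y) with respect to t at t = 0, expanded by the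
  multinomial theorem so that the dependence on y is an explicit homogeneous polynomial that can be
  integrated.\<close>

definition dir_deriv :: "nat \<Rightarrow> real ^ 3 \<Rightarrow> (real ^ 3 \<Rightarrow> real) \<Rightarrow> real ^ 3 \<Rightarrow> real" where
  "dir_deriv m y f x = (\<Sum>(a, b, c)\<in>exponents m. multinom a b c * monomial3 a b c y * mixed_deriv a b c f x)"

lemma dir_deriv_0 [simp]: "dir_deriv 0 y f x = f x"
proof -
  have "exponents 0 = {(0, 0, 0)}" by (auto simp: exponents_def)
  then show ?thesis by (simp add: dir_deriv_def multinom_def monomial3_def)
qed

lemma smooth_dir_deriv: "smooth_function f \<Longrightarrow> smooth_function (dir_deriv m y f)"
  unfolding dir_deriv_def[abs_def] by (intro smooth_sum) (auto intro!: smooth_cmult smooth_mixed_deriv)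

lemma dir_deriv_Suc:
  assumes f: "smooth_function f"
  shows "(\<Sum>i\<in>UNIV. y $ i * partial_deriv i (dir_deriv m y f) x) = dir_deriv (Suc m) y f x"
proof -
  have p: "partial_deriv i (dir_deriv m y f) x =
      (\<Sum>(a, b, c)\<in>exponents m. multinom a b c * monomial3 a b c y * partial_deriv i (mixed_deriv a b c f) x)" for i
    unfolding dir_deriv_def[abs_def] using f
    by (subst partial_deriv_sum) (auto simp: case_prod_beta partial_deriv_cmult smooth_mixed_deriv smooth_cmult)
  have "(\<Sum>i\<in>UNIV. y $ i * partial_deriv i (dir_deriv m y f) x) =
     (\<Sum>(a, b, c)\<in>exponents m. multinom a b c * (monomial3 (Suc a) b c y * mixed_deriv (Suc a) b c f x
       + monomial3 a (Suc b) c y * mixed_deriv a (Suc b) c f x + monomial3 a b (Suc c) y * mixed_deriv a b (Suc c) f x))"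
    unfolding sum_3 p sum_distrib_left sum.distrib[symmetric]
    by (intro sum.cong) (auto simp: partial_deriv_mixed_deriv[OF f] monomial3_def algebra_simps)
  also have "\<dots> = (\<Sum>(a, b, c)\<in>exponents (Suc m). multinom a b c * (monomial3 a b c y * mixed_deriv a b c f x))"
    by (rule multinom_sum_Suc)
  finally show ?thesis by (simp add: dir_deriv_def mult.assoc)
qed

lemma taylor_dir:
  assumes f: "smooth_function f" and "s > 0" "n > 0"
  shows "\<exists>t. f (x + s *\<^sub>R y) = (\<Sum>m<n. dir_deriv m y f x / fact m * s ^ m) + dir_deriv n y f (x + t *\<^sub>R y) / fact n * s ^ n"
proof -
  have "\<exists>t>0. t < s \<and> (\<lambda>t. f (x + t *\<^sub>R y)) s = (\<Sum>m<n. (\<lambda>m t. dir_deriv m y f (x + t *\<^sub>R y)) m 0 / fact m * s ^ m)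
      + (\<lambda>m t. dir_deriv m y f (x + t *\<^sub>R y)) n t / fact n * s ^ n"
  proof (rule Maclaurin)
    show "\<forall>m t. m < n \<and> 0 \<le> t \<and> t \<le> s \<longrightarrow>
      ((\<lambda>t. dir_deriv m y f (x + t *\<^sub>R y)) has_real_derivative dir_deriv (Suc m) y f (x + t *\<^sub>R y)) (at t)"
    proof (intro allI impI)
      fix m t
      show "((\<lambda>t. dir_deriv m y f (x + t *\<^sub>R y)) has_real_derivative dir_deriv (Suc m) y f (x + t *\<^sub>R y)) (at t)"
        using has_field_derivative_line[OF smooth_dir_deriv[OF f, of m y], of x y t UNIV] by (simp only: dir_deriv_Suc[OF f])
    qed
  qed (use assms in auto)
  then show ?thesis by auto
qed

section \<open>Mean values and moments\<close>

text \<open>Once the lower coefficients are known to vanish, division by s^m leaves a polynomial q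
  with constant term c m that is O(s^(n - m)) at 0.\<close>

lemma small_polynomial_coeffs_zero:
  fixes c :: "nat \<Rightarrow> real"
  assumes small: "\<And>s. 0 < s \<Longrightarrow> s \<le> 1 \<Longrightarrow> \<bar>\<Sum>m<n. c m * s ^ m\<bar> \<le> C * s ^ n"
  shows "m < n \<Longrightarrow> c m = 0"
proof (induction m rule: less_induct)
  case (less m)
  define q where "q s = (\<Sum>j<n. if j < m then 0 else c j * s ^ (j - m))" for s :: real
  have "(q \<longlongrightarrow> q 0) (at_right 0)"
    unfolding q_def by (intro tendsto_sum) (auto intro!: tendsto_intros tendsto_eq_intros)
  moreover have "q 0 = (\<Sum>j<n. if j = m then c m else 0)"
    unfolding q_def by (intro sum.cong) (auto simp: power_0_left)
  then have "q 0 = c m" using less.prems by simp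
  moreover have "(q \<longlongrightarrow> 0) (at_right 0)"
  proof (rule Lim_null_comparison)
    have "((\<lambda>s. C * s ^ (n - m)) \<longlongrightarrow> C * 0 ^ (n - m)) (at_right 0)"
      by (intro tendsto_intros)
    then show "((\<lambda>s. C * s ^ (n - m)) \<longlongrightarrow> 0) (at_right 0)" using less.prems by (simp add: power_0_left)
    have "norm (q s) \<le> C * s ^ (n - m)" if s: "0 < s" "s \<le> 1" for s
    proof -
      have "(\<Sum>j<n. c j * s ^ j) = s ^ m * q s"
        unfolding q_def sum_distrib_left using less by (intro sum.cong) (auto simp: power_add[symmetric])
      then have "s ^ m * \<bar>q s\<bar> \<le> C * s ^ n" using small[OF s] s by (simp add: abs_mult)
      also have "\<dots> = s ^ m * (C * s ^ (n - m))" using less.prems by (simp add: power_add[symmetric])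
      finally show ?thesis using s by simp
    qed
    then show "\<forall>\<^sub>F s in at_right 0. norm (q s) \<le> C * s ^ (n - m)"
      unfolding eventually_at_right_field by (intro exI[of _ 1]) auto
  qed
  ultimately show ?case using tendsto_unique trivial_limit_at_right_real by metis
qed

lemma continuous_on_monomial3: "continuous_on S (monomial3 a b c)"
  by (rule smooth_continuous_on[OF smooth_monomial3])

lemma monomial3_uminus: "monomial3 a b c (- y) = (-1) ^ (a + b + c) * monomial3 a b c y"
  by (simp add: monomial3_def power_minus[of "y $ 1"] power_minus[of "y $ 2"] power_minus[of "y $ 3"] power_add)

lemma dir_deriv_uminus: "dir_deriv m (- y) f x = (-1) ^ m * dir_deriv m y f x"
  unfolding dir_deriv_def sum_distrib_left
  by (intro sum.cong) (auto simp: monomial3_uminus exponents_def)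

lemma continuous_on_compact_bounded:
  fixes f :: "'a::topological_space \<Rightarrow> real"
  assumes "continuous_on K f" "compact K"
  obtains M where "M \<ge> 0" "\<And>x. x \<in> K \<Longrightarrow> \<bar>f x\<bar> \<le> M"
proof -
  have "bounded (f ` K)" using assms compact_continuous_image compact_imp_bounded by blast
  then obtain M where "\<And>x. x \<in> K \<Longrightarrow> \<bar>f x\<bar> \<le> M" unfolding bounded_iff by auto
  then show ?thesis by (intro that[of "max M 0"]) (auto simp: le_max_iff_disj)
qed

lemma continuous_bounded_cball:
  fixes f :: "'a::euclidean_space \<Rightarrow> real"
  assumes "continuous_on UNIV f"
  shows "\<exists>M\<ge>0. \<forall>x. norm x \<le> r \<longrightarrow> \<bar>f x\<bar> \<le> M"
proof -
  have "continuous_on (cball 0 r) f" using assms continuous_on_subset by blast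
  then obtain M where "M \<ge> 0" "\<And>x. x \<in> cball 0 r \<Longrightarrow> \<bar>f x\<bar> \<le> M"
    using continuous_on_compact_bounded[OF _ compact_cball] by blast
  then show ?thesis by auto
qed

lemma mixed_deriv_zero_outside:
  assumes "\<And>z. norm z > R \<Longrightarrow> g z = 0" "norm z > R"
  shows "mixed_deriv a b c g z = 0"
proof -
  have *: "(partial_deriv i ^^ k) g z = 0" if g: "\<And>z. norm z > R \<Longrightarrow> g z = 0" and z: "norm z > R" for i k g z
    using z
  proof (induction k arbitrary: z)
    case 0
    then show ?case using g by simp
  next
    case (Suc k)
    have "norm w \<le> R" if "(partial_deriv i ^^ k) g w \<noteq> 0" for w
      using Suc.IH[of w] that by (cases "norm w > R") auto
    then have "{w. (partial_deriv i ^^ k) g w \<noteq> 0} \<subseteq> cball 0 R" by auto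
    then have "closure {w. (partial_deriv i ^^ k) g w \<noteq> 0} \<subseteq> cball 0 R" by (rule closure_minimal) simp
    then have "z \<notin> closure {w. (partial_deriv i ^^ k) g w \<noteq> 0}" using Suc.prems by auto
    from partial_deriv_zero_outside[OF this, of i] show ?case by simp
  qed
  show ?thesis unfolding mixed_deriv_def by (intro * assms)
qed

section \<open>Moments of a compactly supported probability measure\<close>

locale compact_probability =
  fixes P :: "(real ^ 3) measure" and B :: real
  assumes fin: "finite_measure P" and sets_P [measurable_cong, simp]: "sets P = sets borel"
    and total: "measure P UNIV = 1" and B: "B > 0" and supp: "AE y in P. norm y \<le> B"
begin

lemma space_P [simp]: "space P = UNIV"
  using sets_eq_imp_space_eq[OF sets_P] by simp

lemma integrable_continuous:
  fixes g :: "real ^ 3 \<Rightarrow> real"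
  assumes "continuous_on UNIV g" shows "integrable P g"
proof -
  interpret finite_measure P by (rule fin)
  obtain M where M: "\<And>x. norm x \<le> B \<Longrightarrow> \<bar>g x\<bar> \<le> M"
    using continuous_bounded_cball[OF assms] by blast
  have "AE y in P. norm (g y) \<le> M" using supp by eventually_elim (use M in auto)
  then show ?thesis
    using borel_measurable_continuous_onI[OF assms] by (intro integrable_const_bound[where B = M]) auto
qed

definition moment :: "nat \<Rightarrow> nat \<Rightarrow> nat \<Rightarrow> real" where
  "moment a b c = (\<integral>y. monomial3 a b c y \<partial>P)"

definition mean_value :: "(real ^ 3 \<Rightarrow> real) \<Rightarrow> bool" where
  "mean_value f \<longleftrightarrow> continuous_on UNIV f \<and> (\<forall>x. \<forall>s>0. f x = (\<integral>y. f (x + s *\<^sub>R y) \<partial>P))"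

lemma integral_dir_deriv:
  "(\<integral>y. dir_deriv m y f x \<partial>P) = (\<Sum>(a, b, c)\<in>exponents m. multinom a b c * moment a b c * mixed_deriv a b c f x)"
proof -
  have "(\<integral>y. dir_deriv m y f x \<partial>P) = (\<Sum>e\<in>exponents m. \<integral>y. (case e of (a, b, c) \<Rightarrow> multinom a b c * monomial3 a b c y * mixed_deriv a b c f x) \<partial>P)"
    unfolding dir_deriv_def
    by (intro Bochner_Integration.integral_sum)
       (auto intro!: integrable_continuous continuous_intros continuous_on_monomial3)
  also have "\<dots> = (\<Sum>(a, b, c)\<in>exponents m. multinom a b c * moment a b c * mixed_deriv a b c f x)"
    by (intro sum.cong) (auto simp: moment_def)
  finally show ?thesis .
qed

lemma integral_linear_power:
  "(\<integral>y. (y $ 1 * z $ 1 + y $ 2 * z $ 2 + y $ 3 * z $ 3) ^ m \<partial>P)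
    = (\<Sum>(a, b, c)\<in>exponents m. multinom a b c * moment a b c * monomial3 a b c z)"
proof -
  have "(\<integral>y. (y $ 1 * z $ 1 + y $ 2 * z $ 2 + y $ 3 * z $ 3) ^ m \<partial>P)
      = (\<Sum>e\<in>exponents m. \<integral>y. (case e of (a, b, c) \<Rightarrow> multinom a b c * (monomial3 a b c y * monomial3 a b c z)) \<partial>P)"
    unfolding multinomial_theorem
    by (intro Bochner_Integration.integral_sum)
       (auto intro!: integrable_continuous continuous_intros continuous_on_monomial3)
  also have "\<dots> = (\<Sum>(a, b, c)\<in>exponents m. multinom a b c * moment a b c * monomial3 a b c z)"
    by (intro sum.cong) (auto simp: moment_def)
  finally show ?thesis .
qed

text \<open>If the moment equations hold for a function whose derivatives of order \<open>n\<close> vanish, the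
  mean value property follows from its exact Taylor expansion.\<close>

lemma mean_value_if_moment_equations:
  assumes f: "smooth_function f" and n: "n > 0"
    and top: "\<And>a b c. a + b + c = n \<Longrightarrow> mixed_deriv a b c f = (\<lambda>x. 0)"
    and eqs: "\<And>m x. m > 0 \<Longrightarrow> m < n \<Longrightarrow>
      (\<Sum>(a, b, c)\<in>exponents m. multinom a b c * moment a b c * mixed_deriv a b c f x) = 0"
  shows "mean_value f"
  unfolding mean_value_def
proof (intro conjI allI impI)
  interpret finite_measure P by (rule fin)
  show "continuous_on UNIV f" by (rule smooth_continuous_on[OF f])
  fix x and s :: real assume s: "s > 0"
  have "dir_deriv n y f z = 0" for y z
    unfolding dir_deriv_def by (intro sum.neutral) (auto simp: exponents_def top)
  then have T: "f (x + s *\<^sub>R y) = (\<Sum>m<n. dir_deriv m y f x * (s ^ m / fact m))" for y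
    using taylor_dir[OF f s n, of x y] by simp
  have int: "integrable P (\<lambda>y. dir_deriv m y f x)" for m
    unfolding dir_deriv_def
    by (intro integrable_continuous continuous_on_sum) (auto intro!: continuous_intros continuous_on_monomial3)
  have "(\<integral>y. f (x + s *\<^sub>R y) \<partial>P) = (\<Sum>m<n. (\<integral>y. dir_deriv m y f x \<partial>P) * (s ^ m / fact m))"
    unfolding T using int by (subst Bochner_Integration.integral_sum) auto
  also have "\<dots> = (\<Sum>m<n. if m = 0 then f x else 0)"
    using eqs total by (intro sum.cong) (auto simp: integral_dir_deriv[symmetric])
  also have "\<dots> = f x" using n by simp
  finally show "f x = (\<integral>y. f (x + s *\<^sub>R y) \<partial>P)" by simp
qed

text \<open>Mollification in dual form: all translations are moved to \<psi>, so that Taylor's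
  formula is applied to a smooth function while f stays merely continuous. By the mean value
  property the average over y of the pairing of f with \<psi>(x - s y) is independent of s, hence
  every positive power of s has coefficient 0.\<close>

lemma moment_equations_if_mean_value:
  assumes mv: "mean_value f" and \<psi>: "\<psi> \<in> test_functions" and m: "m > 0"
  shows "(\<Sum>(a, b, c)\<in>exponents m. multinom a b c * moment a b c * (\<integral>x. f x * mixed_deriv a b c \<psi> x \<partial>lborel)) = 0"
proof -
  interpret finite_measure P by (rule fin)
  interpret L: pair_sigma_finite P "lborel :: (real ^ 3) measure" ..
  have f: "continuous_on UNIV f" and mvp: "\<And>x s. s > 0 \<Longrightarrow> f x = (\<integral>y. f (x + s *\<^sub>R y) \<partial>P)"
    using mv unfolding mean_value_def by blast+
  define T where "T a b c = (\<integral>x. f x * mixed_deriv a b c \<psi> x \<partial>lborel)" for a b c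
  define G where "G j = (\<Sum>(a, b, c)\<in>exponents j. multinom a b c * moment a b c * T a b c)" for j
  define Q where "Q j y = (\<Sum>(a, b, c)\<in>exponents j. multinom a b c * monomial3 a b c y * T a b c)" for j y
  \<comment> \<open>One order more than m, so that the coefficient of s^m lies below the order of
    the remainder.\<close>
  define n where "n = Suc m"
  have n: "n > 0" by (simp add: n_def)
  have sm: "smooth_function \<psi>" by (rule test_smooth[OF \<psi>])
  have smc: "continuous_on UNIV \<psi>" by (rule smooth_continuous_on[OF sm])
  obtain R where R: "R > 0" "\<And>x. norm x > R \<Longrightarrow> \<psi> x = 0" using test_support[OF \<psi>] by blast
  have dd_test: "dir_deriv j y \<psi> \<in> test_functions" for j y
    unfolding dir_deriv_def[abs_def] by (intro test_sum) (auto intro!: test_cmult test_mixed_deriv \<psi>)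
  have Qint: "(\<integral>x. f x * dir_deriv j y \<psi> x \<partial>lborel) = Q j y" for j y
  proof -
    have "(\<integral>x. f x * dir_deriv j y \<psi> x \<partial>lborel) =
      (\<integral>x. (\<Sum>e\<in>exponents j. case e of (a, b, c) \<Rightarrow> (multinom a b c * monomial3 a b c y) * (f x * mixed_deriv a b c \<psi> x)) \<partial>lborel)"
      unfolding dir_deriv_def sum_distrib_left by (intro Bochner_Integration.integral_cong refl sum.cong) auto
    also have "\<dots> = (\<Sum>e\<in>exponents j. \<integral>x. (case e of (a, b, c) \<Rightarrow> (multinom a b c * monomial3 a b c y) * (f x * mixed_deriv a b c \<psi> x)) \<partial>lborel)"
      by (intro Bochner_Integration.integral_sum)
         (auto intro!: integrable_mult_right integrable_test_mult f test_mixed_deriv \<psi>)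
    also have "\<dots> = Q j y" unfolding Q_def by (intro sum.cong) (auto simp: T_def)
    finally show ?thesis .
  qed
  have Qc: "continuous_on S (Q j)" for S j
    unfolding Q_def[abs_def] by (intro continuous_on_sum) (auto intro!: continuous_intros continuous_on_monomial3)
  have QG: "(\<integral>y. Q j y \<partial>P) = G j" for j
  proof -
    have "(\<integral>y. Q j y \<partial>P) = (\<Sum>e\<in>exponents j. \<integral>y. (case e of (a, b, c) \<Rightarrow> multinom a b c * monomial3 a b c y * T a b c) \<partial>P)"
      unfolding Q_def by (intro Bochner_Integration.integral_sum)
        (auto intro!: integrable_continuous continuous_intros continuous_on_monomial3)
    also have "\<dots> = G j" unfolding G_def by (intro sum.cong) (auto simp: moment_def)
    finally show ?thesis .
  qed
  obtain Mf where Mf: "Mf \<ge> 0" "\<And>x. norm x \<le> R + B \<Longrightarrow> \<bar>f x\<bar> \<le> Mf"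
    using continuous_bounded_cball[OF f] by blast
  have "\<exists>M\<ge>0. \<forall>x y. norm y \<le> B \<longrightarrow> \<bar>dir_deriv n y \<psi> x\<bar> \<le> M"
  proof -
    have "continuous_on (cball 0 (R + 1) \<times> cball 0 B) (\<lambda>(x, y). dir_deriv n y \<psi> x)"
      unfolding dir_deriv_def case_prod_beta
      by (intro continuous_intros continuous_on_compose2[OF continuous_on_monomial3[of UNIV]]
          continuous_on_compose2[OF smooth_continuous_on[OF smooth_mixed_deriv[OF sm], of UNIV]]) auto
    then obtain M where M: "M \<ge> 0" "\<And>z. z \<in> cball 0 (R + 1) \<times> cball 0 B \<Longrightarrow> \<bar>case z of (x, y) \<Rightarrow> dir_deriv n y \<psi> x\<bar> \<le> M"
      using continuous_on_compact_bounded[OF _ compact_Times[OF compact_cball compact_cball]] by blast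
    have "\<bar>dir_deriv n y \<psi> x\<bar> \<le> M" if "norm y \<le> B" for x y
    proof (cases "norm x > R")
      case True
      then have "mixed_deriv a b c \<psi> x = 0" for a b c
        using mixed_deriv_zero_outside[of R \<psi> x a b c] R(2) by blast
      then show ?thesis using M(1) by (simp add: dir_deriv_def case_prod_beta)
    qed (use M(2)[of "(x, y)"] that in auto)
    then show ?thesis using M(1) by blast
  qed
  then obtain Mn where Mn: "Mn \<ge> 0" "\<And>x y. norm y \<le> B \<Longrightarrow> \<bar>dir_deriv n y \<psi> x\<bar> \<le> Mn" by blast
  define V where "V = measure lborel (cball (0::real^3) (R + B))"
  define C where "C = Mf * Mn * V"
  define U where "U s y = (\<integral>x. f x * \<psi> (x - s *\<^sub>R y) \<partial>lborel)" for s y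
  \<comment> \<open>The bound is uniform over the support of P. Restricting to s \<le> 1 keeps all
    translates of the support of \<psi> in the fixed ball of radius R + B.\<close>
  have U_bound: "\<bar>U s y - (\<Sum>j<n. (-1) ^ j * Q j y / fact j * s ^ j)\<bar> \<le> C * s ^ n"
    if s: "0 < s" "s \<le> 1" and y: "norm y \<le> B" for s y
  proof -
    define r where "r x = \<psi> (x - s *\<^sub>R y) - (\<Sum>j<n. (-1) ^ j * dir_deriv j y \<psi> x / fact j * s ^ j)" for x
    have rr: "\<exists>t. r x = (-1) ^ n * dir_deriv n y \<psi> (x - t *\<^sub>R y) / fact n * s ^ n" for x
      using taylor_dir[OF sm s(1) n, of x "- y"] by (auto simp: r_def dir_deriv_uminus)
    have rb: "\<bar>r x\<bar> \<le> Mn * s ^ n" for x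
    proof -
      obtain t where t: "r x = (-1) ^ n * dir_deriv n y \<psi> (x - t *\<^sub>R y) / fact n * s ^ n" using rr by blast
      have "\<bar>r x\<bar> = \<bar>dir_deriv n y \<psi> (x - t *\<^sub>R y)\<bar> / fact n * s ^ n"
        using s by (simp add: t abs_mult power_abs)
      also have "\<dots> \<le> Mn / 1 * s ^ n"
        using s Mn y by (intro mult_right_mono frac_le) (auto simp: fact_ge_1)
      finally show ?thesis by simp
    qed
    have tr: "(\<lambda>x. \<psi> (x - s *\<^sub>R y)) \<in> test_functions"
    proof -
      have "norm x \<le> R + B" if "\<psi> (x - s *\<^sub>R y) \<noteq> 0" for x
      proof -
        have "norm (x - s *\<^sub>R y) \<le> R" using that R(2) not_less by blast
        moreover have "norm (s *\<^sub>R y) \<le> B" using s y mult_mono[of s 1 "norm y" B] by simp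
        ultimately show ?thesis using norm_triangle_ineq[of "x - s *\<^sub>R y" "s *\<^sub>R y"] by simp
      qed
      then have "bounded {x. \<psi> (x - s *\<^sub>R y) \<noteq> 0}" unfolding bounded_iff by blast
      then show ?thesis using smooth_translate[OF sm, of "- (s *\<^sub>R y)"] by (simp add: test_function_iff)
    qed
    have r_test: "r \<in> test_functions"
    proof -
      have "(\<lambda>x. \<psi> (x - s *\<^sub>R y) + (\<Sum>j<n. (- ((-1) ^ j / fact j * s ^ j)) * dir_deriv j y \<psi> x)) \<in> test_functions"
        by (intro test_add tr test_sum test_cmult dd_test)
      also have "(\<lambda>x. \<psi> (x - s *\<^sub>R y) + (\<Sum>j<n. (- ((-1) ^ j / fact j * s ^ j)) * dir_deriv j y \<psi> x)) = r"
        by (simp add: r_def fun_eq_iff sum_negf mult_ac)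
      finally show ?thesis .
    qed
    have r0: "r x = 0" if "norm x > R + B" for x
    proof -
      have 1: "\<psi> (x - s *\<^sub>R y) = 0"
      proof (rule R(2))
        have "norm (s *\<^sub>R y) \<le> B" using s y mult_mono[of s 1 "norm y" B] by simp
        then show "norm (x - s *\<^sub>R y) > R" using that norm_triangle_ineq2[of x "s *\<^sub>R y"] by simp
      qed
      have "mixed_deriv a b c \<psi> x = 0" for a b c
        using mixed_deriv_zero_outside[of R \<psi> x a b c] R(2) that B by simp
      then have "dir_deriv j y \<psi> x = 0" for j by (simp add: dir_deriv_def case_prod_beta)
      with 1 show ?thesis by (simp add: r_def)
    qed
    have "U s y - (\<Sum>j<n. (-1) ^ j * Q j y / fact j * s ^ j) = (\<integral>x. f x * r x \<partial>lborel)"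
    proof -
      have "(\<integral>x. f x * r x \<partial>lborel) = (\<integral>x. f x * \<psi> (x - s *\<^sub>R y) - (\<Sum>j<n. ((-1) ^ j / fact j * s ^ j) * (f x * dir_deriv j y \<psi> x)) \<partial>lborel)"
        unfolding r_def by (intro Bochner_Integration.integral_cong refl) (simp add: right_diff_distrib sum_distrib_left mult_ac)
      also have "\<dots> = U s y - (\<integral>x. (\<Sum>j<n. ((-1) ^ j / fact j * s ^ j) * (f x * dir_deriv j y \<psi> x)) \<partial>lborel)"
        unfolding U_def
        by (intro Bochner_Integration.integral_diff integrable_test_mult f tr Bochner_Integration.integrable_sum integrable_mult_right dd_test)
      also have "(\<integral>x. (\<Sum>j<n. ((-1) ^ j / fact j * s ^ j) * (f x * dir_deriv j y \<psi> x)) \<partial>lborel)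
          = (\<Sum>j<n. \<integral>x. ((-1) ^ j / fact j * s ^ j) * (f x * dir_deriv j y \<psi> x) \<partial>lborel)"
        by (intro Bochner_Integration.integral_sum integrable_mult_right integrable_test_mult f dd_test)
      also have "\<dots> = (\<Sum>j<n. (-1) ^ j * Q j y / fact j * s ^ j)"
        by (intro sum.cong) (auto simp: Qint)
      finally show ?thesis by simp
    qed
    also have "\<bar>\<integral>x. f x * r x \<partial>lborel\<bar> \<le> (\<integral>x. \<bar>f x * r x\<bar> \<partial>lborel)"
      using integral_norm_bound[of lborel "\<lambda>x. f x * r x"] by simp
    also have "\<dots> \<le> (\<integral>x. (Mf * (Mn * s ^ n)) * indicator (cball (0::real^3) (R + B)) x \<partial>lborel)"
    proof (rule Bochner_Integration.integral_mono)
      show "integrable lborel (\<lambda>x. \<bar>f x * r x\<bar>)" using integrable_test_mult[OF f r_test] by auto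
      show "integrable lborel (\<lambda>x::real^3. (Mf * (Mn * s ^ n)) * indicator (cball 0 (R + B)) x)"
        using emeasure_bounded_finite[OF bounded_cball[of "0::real^3" "R + B"]]
        by (intro integrable_mult_right integrable_real_indicator) auto
      fix x :: "real ^ 3"
      show "\<bar>f x * r x\<bar> \<le> (Mf * (Mn * s ^ n)) * indicator (cball 0 (R + B)) x"
      proof (cases "norm x > R + B")
        case False
        then have "\<bar>f x\<bar> * \<bar>r x\<bar> \<le> Mf * (Mn * s ^ n)" using Mf rb by (intro mult_mono) auto
        with False show ?thesis by (simp add: abs_mult)
      qed (simp add: r0)
    qed
    also have "\<dots> = C * s ^ n" by (simp add: C_def V_def mult_ac)
    finally show ?thesis .
  qed
  have main: "\<bar>(\<integral>x. f x * \<psi> x \<partial>lborel) - (\<Sum>j<n. (-1) ^ j * G j / fact j * s ^ j)\<bar> \<le> C * s ^ n"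
    if s: "0 < s" "s \<le> 1" for s
  proof -
    \<comment> \<open>The indicator changes K only on a P-null set of y, but it makes K bounded on
      the product for x in the ball of radius R, outside of which K vanishes; this is what Fubini's
      theorem asks for.\<close>
    define K where "K y x = indicator (cball 0 B) y * (f (x + s *\<^sub>R y) * \<psi> x)" for y x :: "real ^ 3"
    have Km: "(\<lambda>(y, x). K y x) \<in> borel_measurable (P \<Otimes>\<^sub>M lborel)"
    proof -
      have m1: "(\<lambda>z. f (snd z + s *\<^sub>R fst z) * \<psi> (snd z)) \<in> borel_measurable borel"
        by (intro borel_measurable_continuous_onI continuous_on_mult continuous_on_compose2[OF f]
            continuous_on_compose2[OF smc] continuous_intros) auto
      have "(\<lambda>z. indicator (cball 0 B \<times> UNIV) z * (f (snd z + s *\<^sub>R fst z) * \<psi> (snd z))) \<in> borel_measurable borel"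
        by (intro borel_measurable_times[OF borel_measurable_indicator m1] borel_closed closed_Times) auto
      moreover have "(\<lambda>(y, x). K y x) = (\<lambda>z. indicator (cball 0 B \<times> UNIV) z * (f (snd z + s *\<^sub>R fst z) * \<psi> (snd z)))"
        by (auto simp: K_def fun_eq_iff indicator_def)
      moreover have "sets (P \<Otimes>\<^sub>M lborel) = sets (borel :: ((real^3) \<times> (real^3)) measure)"
        by (simp add: borel_prod[symmetric] cong: sets_pair_measure_cong)
      ultimately show ?thesis by (simp cong: measurable_cong_sets)
    qed
    obtain M where M: "M \<ge> 0" "\<And>z. norm z \<le> R + B \<Longrightarrow> \<bar>f z\<bar> \<le> M"
      using continuous_bounded_cball[OF f] by blast
    obtain M' where M': "M' \<ge> 0" "\<And>z. norm z \<le> R \<Longrightarrow> \<bar>\<psi> z\<bar> \<le> M'"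
      using continuous_bounded_cball[OF smc] by blast
    have Kint: "integrable (P \<Otimes>\<^sub>M lborel) (\<lambda>(y, x). K y x)"
    proof (rule integrableI_bounded_set[where A = "UNIV \<times> cball 0 R" and B = "M * M'"])
      show "UNIV \<times> cball 0 R \<in> sets (P \<Otimes>\<^sub>M (lborel :: (real^3) measure))" by (intro pair_measureI) auto
      have "emeasure (P \<Otimes>\<^sub>M lborel) (UNIV \<times> cball (0::real^3) R) = emeasure P UNIV * emeasure lborel (cball (0::real^3) R)"
        by (intro lborel.emeasure_pair_measure_Times) auto
      also have "\<dots> < \<infinity>"
      proof -
        have "emeasure P UNIV < top" using less_top emeasure_finite by blast
        then show ?thesis using emeasure_bounded_finite[OF bounded_cball[of "0::real^3" R]]
          by (simp add: ennreal_mult_less_top)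
      qed
      finally show "emeasure (P \<Otimes>\<^sub>M lborel) (UNIV \<times> cball (0::real^3) R) < \<infinity>" .
      show "AE z in P \<Otimes>\<^sub>M lborel. z \<in> UNIV \<times> cball 0 R \<longrightarrow> norm (case z of (y, x) \<Rightarrow> K y x) \<le> M * M'"
      proof (rule AE_I2, clarify)
        fix y x :: "real ^ 3" assume x: "x \<in> cball 0 R"
        show "norm (K y x) \<le> M * M'"
        proof (cases "y \<in> cball 0 B")
          case True
          have "norm (s *\<^sub>R y) \<le> B" using s True mult_mono[of s 1 "norm y" B] by simp
          then have "norm (x + s *\<^sub>R y) \<le> R + B" using x norm_triangle_ineq[of x "s *\<^sub>R y"] by simp
          then have "\<bar>f (x + s *\<^sub>R y)\<bar> * \<bar>\<psi> x\<bar> \<le> M * M'"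
            using M M' x by (intro mult_mono) auto
          then show ?thesis using True by (simp add: K_def abs_mult)
        next
          case False
          then show ?thesis using M M' by (simp add: K_def)
        qed
      qed
      show "AE z in P \<Otimes>\<^sub>M lborel. z \<notin> UNIV \<times> cball 0 R \<longrightarrow> (case z of (y, x) \<Rightarrow> K y x) = 0"
      proof (rule AE_I2)
        have "\<psi> b \<noteq> 0 \<Longrightarrow> norm b \<le> R" for b using R(2) not_less by blast
        then show "z \<notin> UNIV \<times> cball 0 R \<longrightarrow> (case z of (y, x) \<Rightarrow> K y x) = 0" for z
          by (cases z) (auto simp: K_def)
      qed
    qed (rule Km)
    have "(\<integral>x. f x * \<psi> x \<partial>lborel) = (\<integral>x. (\<integral>y. K y x \<partial>P) \<partial>lborel)"
    proof (intro Bochner_Integration.integral_cong refl)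
      fix x
      have "f x * \<psi> x = (\<integral>y. f (x + s *\<^sub>R y) * \<psi> x \<partial>P)" using mvp[OF s(1), of x] by simp
      also have "\<dots> = (\<integral>y. K y x \<partial>P)"
      proof (rule integral_cong_AE)
        have c: "continuous_on UNIV (\<lambda>y. f (x + s *\<^sub>R y))"
          by (intro continuous_on_compose2[OF f] continuous_intros) auto
        have m1: "(\<lambda>y. f (x + s *\<^sub>R y) * \<psi> x) \<in> borel_measurable P"
          by (intro borel_measurable_integrable integrable_continuous continuous_on_mult c continuous_on_const)
        then show "(\<lambda>y. f (x + s *\<^sub>R y) * \<psi> x) \<in> borel_measurable P" .
        show "(\<lambda>y. K y x) \<in> borel_measurable P"
          unfolding K_def by (rule borel_measurable_times[OF borel_measurable_indicator m1]) simp
        show "AE y in P. f (x + s *\<^sub>R y) * \<psi> x = K y x"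
          using supp by eventually_elim (simp add: K_def)
      qed
      finally show "f x * \<psi> x = (\<integral>y. K y x \<partial>P)" .
    qed
    also have "\<dots> = (\<integral>y. (\<integral>x. K y x \<partial>lborel) \<partial>P)" by (rule L.Fubini_integral[OF Kint])
    also have KU: "(\<lambda>y. \<integral>x. K y x \<partial>lborel) = (\<lambda>y. indicator (cball 0 B) y * U s y)"
    proof
      fix y
      have "(\<integral>x. f (x + s *\<^sub>R y) * \<psi> x \<partial>lborel) = U s y"
        unfolding U_def using lborel_integral_translate[of "\<lambda>x. f x * \<psi> (x - s *\<^sub>R y)" "s *\<^sub>R y"] by simp
      then show "(\<integral>x. K y x \<partial>lborel) = indicator (cball 0 B) y * U s y" by (simp add: K_def)
    qed
    finally have 1: "(\<integral>x. f x * \<psi> x \<partial>lborel) = (\<integral>y. indicator (cball 0 B) y * U s y \<partial>P)" .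
    have Uint: "integrable P (\<lambda>y. indicator (cball 0 B) y * U s y)"
      using L.integrable_fst'[OF Kint] by (simp add: KU)
    have Sint: "integrable P (\<lambda>y. \<Sum>j<n. (-1) ^ j * Q j y / fact j * s ^ j)"
      by (intro integrable_continuous continuous_intros Qc) auto
    have 2: "(\<integral>y. (\<Sum>j<n. (-1) ^ j * Q j y / fact j * s ^ j) \<partial>P) = (\<Sum>j<n. (-1) ^ j * G j / fact j * s ^ j)"
    proof -
      have "(\<integral>y. (\<Sum>j<n. (-1) ^ j * Q j y / fact j * s ^ j) \<partial>P) = (\<Sum>j<n. \<integral>y. (-1) ^ j * Q j y / fact j * s ^ j \<partial>P)"
        by (intro Bochner_Integration.integral_sum integrable_continuous continuous_intros Qc) auto
      then show ?thesis by (simp add: QG)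
    qed
    have "(\<integral>x. f x * \<psi> x \<partial>lborel) - (\<Sum>j<n. (-1) ^ j * G j / fact j * s ^ j)
        = (\<integral>y. indicator (cball 0 B) y * U s y - (\<Sum>j<n. (-1) ^ j * Q j y / fact j * s ^ j) \<partial>P)"
      unfolding 1 2[symmetric] by (rule Bochner_Integration.integral_diff[symmetric, OF Uint Sint])
    also have "\<bar>\<dots>\<bar> \<le> (\<integral>y. \<bar>indicator (cball 0 B) y * U s y - (\<Sum>j<n. (-1) ^ j * Q j y / fact j * s ^ j)\<bar> \<partial>P)"
      using integral_norm_bound[of P "\<lambda>y. indicator (cball 0 B) y * U s y - (\<Sum>j<n. (-1) ^ j * Q j y / fact j * s ^ j)"] by simp
    also have "\<dots> \<le> (\<integral>y. C * s ^ n \<partial>P)"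
    proof (rule integral_mono_AE)
      show "integrable P (\<lambda>y. \<bar>indicator (cball 0 B) y * U s y - (\<Sum>j<n. (-1) ^ j * Q j y / fact j * s ^ j)\<bar>)"
        using Uint Sint by auto
      show "AE y in P. \<bar>indicator (cball 0 B) y * U s y - (\<Sum>j<n. (-1) ^ j * Q j y / fact j * s ^ j)\<bar> \<le> C * s ^ n"
        using supp by eventually_elim (use U_bound[OF s] in auto)
    qed auto
    also have "\<dots> = C * s ^ n" using total by simp
    finally show ?thesis .
  qed
  \<comment> \<open>The coefficient of s^0 is set to 0: \<open>G 0\<close> is the pairing of f with
    \<psi> and cancels against the left side of \<open>main\<close>.\<close>
  define c where "c j = (if j = 0 then 0 else (-1) ^ j * G j / fact j)" for j
  have "exponents 0 = {(0, 0, 0)}" by (auto simp: exponents_def)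
  then have G0: "G 0 = (\<integral>x. f x * \<psi> x \<partial>lborel)"
    using total by (simp add: G_def T_def multinom_def moment_def monomial3_def)
  have "\<bar>\<Sum>j<n. c j * s ^ j\<bar> \<le> C * s ^ n" if "0 < s" "s \<le> 1" for s
  proof -
    have "(\<Sum>j<n. (-1) ^ j * G j / fact j * s ^ j) = G 0 + (\<Sum>j<n. c j * s ^ j)"
      unfolding n_def sum.lessThan_Suc_shift by (simp add: c_def)
    then show ?thesis using main[OF that] G0 by simp
  qed
  then have "c m = 0" by (rule small_polynomial_coeffs_zero) (auto simp: n_def)
  then have "G m = 0" using m by (simp add: c_def)
  then show ?thesis by (simp add: G_def T_def)
qed

end

section \<open>Ideals of invariants\<close>

text \<open>The arrays \<open>T a b c\<close> below stand for the values of a functional on the mixed derivatives of a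
  fixed test function, so that membership of a polynomial in an ideal becomes linear arithmetic:
  \<open>rec_B\<close> says that the ideal generated by \<open>x\<^sup>2 + y\<^sup>2 + z\<^sup>2\<close>, \<open>x\<^sup>4 + y\<^sup>4 + z\<^sup>4\<close> and
  \<open>x\<^sup>2 y\<^sup>2 z\<^sup>2\<close> is annihilated, and \<open>rec_A\<close> has \<open>x y z\<close> in place of the last generator.\<close>

definition rec_24 :: "(nat \<Rightarrow> nat \<Rightarrow> nat \<Rightarrow> real) \<Rightarrow> bool" where
  "rec_24 T \<longleftrightarrow> (\<forall>a b c. T (a + 2) b c + T a (b + 2) c + T a b (c + 2) = 0) \<and>
    (\<forall>a b c. T (a + 4) b c + T a (b + 4) c + T a b (c + 4) = 0)"

definition rec_B :: "(nat \<Rightarrow> nat \<Rightarrow> nat \<Rightarrow> real) \<Rightarrow> bool" where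
  "rec_B T \<longleftrightarrow> rec_24 T \<and> (\<forall>a b c. T (a + 2) (b + 2) (c + 2) = 0)"

definition rec_A :: "(nat \<Rightarrow> nat \<Rightarrow> nat \<Rightarrow> real) \<Rightarrow> bool" where
  "rec_A T \<longleftrightarrow> rec_24 T \<and> (\<forall>a b c. T (a + 1) (b + 1) (c + 1) = 0)"

lemma rec_A_imp_B: "rec_A T \<Longrightarrow> rec_B T"
  unfolding rec_A_def rec_B_def
proof (elim conjE, intro conjI allI)
  fix a b c assume *: "\<forall>a b c. T (a + 1) (b + 1) (c + 1) = 0"
  have "T (a + 2) (b + 2) (c + 2) = T ((a + 1) + 1) ((b + 1) + 1) ((c + 1) + 1)" by simp
  then show "T (a + 2) (b + 2) (c + 2) = 0" using * by metis
qed

text \<open>Each squared variable is a root of t^3 - e_1 t^2 + e_2 t - e_3, where the e_j are the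
  elementary symmetric polynomials of the squares. All three lie in the ideal, since e_2 = (p_2^2 -
  p_4) / 2, and therefore so do the sixth powers of the variables.\<close>

lemma rec_B_high:
  assumes "rec_B T" "a \<ge> 6 \<or> b \<ge> 6 \<or> c \<ge> 6"
  shows "T a b c = 0"
proof -
  have R1: "T (a + 2) b c + T a (b + 2) c + T a b (c + 2) = 0"
    and R2: "T (a + 4) b c + T a (b + 4) c + T a b (c + 4) = 0"
    and R3: "T (a + 2) (b + 2) (c + 2) = 0" for a b c
    using assms(1) by (auto simp: rec_B_def rec_24_def)
  have 1: "T (a + 6) b c = 0" for a b c
    using R1[of "a + 4" b c] R2[of "a + 2" b c] R1[of "a + 2" "b + 2" c] R1[of "a + 2" b "c + 2"] R3[of a b c]
    by (simp add: eval_nat_numeral)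
  have 2: "T a (b + 6) c = 0" for a b c
    using R1[of a "b + 4" c] R2[of a "b + 2" c] R1[of "a + 2" "b + 2" c] R1[of a "b + 2" "c + 2"] R3[of a b c]
    by (simp add: eval_nat_numeral)
  have 3: "T a b (c + 6) = 0" for a b c
    using R1[of a b "c + 4"] R2[of a b "c + 2"] R1[of "a + 2" b "c + 2"] R1[of a "b + 2" "c + 2"] R3[of a b c]
    by (simp add: eval_nat_numeral)
  show ?thesis using assms(2) 1[of "a - 6" b c] 2[of a "b - 6" c] 3[of a b "c - 6"] by auto
qed

text \<open>All six arrangements are counted even when exponents coincide, so that symmetrization
  multiplies every symmetric sum by the same factor 6.\<close>

definition sym_sum :: "(nat \<Rightarrow> nat \<Rightarrow> nat \<Rightarrow> real) \<Rightarrow> nat \<Rightarrow> nat \<Rightarrow> nat \<Rightarrow> real" where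
  "sym_sum T a b c = T a b c + T a c b + T b a c + T b c a + T c a b + T c b a"

text \<open>Monomials with an exponent at least 6, or with all exponents at least 2, are in the
  ideal already. Up to order the remaining even exponents are (2,0,0), (4,0,0), (2,2,0), (4,2,0) and
  (4,4,0), and each of these symmetric sums is reduced by hand.\<close>

lemma sym_sum_even_zero:
  assumes T: "rec_B T" and "even a" "even b" "even c" "a + b + c > 0"
  shows "sym_sum T a b c = 0"
proof -
  have R1: "T (a + 2) b c + T a (b + 2) c + T a b (c + 2) = 0"
    and R2: "T (a + 4) b c + T a (b + 4) c + T a b (c + 4) = 0"
    and R3: "T (a + 2) (b + 2) (c + 2) = 0" for a b c
    using T by (auto simp: rec_B_def rec_24_def)
  have z: "T p q s = 0" if "p \<ge> 2" "q \<ge> 2" "s \<ge> 2" for p q s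
    using R3[of "p - 2" "q - 2" "s - 2"] that by (simp del: add_2_eq_Suc')
  show ?thesis
  proof (cases "a \<ge> 6 \<or> b \<ge> 6 \<or> c \<ge> 6 \<or> (a \<ge> 2 \<and> b \<ge> 2 \<and> c \<ge> 2)")
    case True
    then show ?thesis unfolding sym_sum_def by (auto simp: rec_B_high[OF T] z)
  next
    case False
    have ev: "n = 0 \<or> n = 2 \<or> n = 4" if "even n" "\<not> n \<ge> 6" for n :: nat
      using that by presburger
    have s20: "T 2 0 0 + T 0 2 0 + T 0 0 2 = 0" using R1[of 0 0 0] by (simp add: eval_nat_numeral)
    have s40: "T 4 0 0 + T 0 4 0 + T 0 0 4 = 0" using R2[of 0 0 0] by (simp add: eval_nat_numeral)
    have s22: "T 2 2 0 + T 2 0 2 + T 0 2 2 = 0"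
      using R1[of 2 0 0] R1[of 0 2 0] R1[of 0 0 2] s40 by (simp add: eval_nat_numeral)
    have s42: "T 4 2 0 + T 2 4 0 + T 4 0 2 + T 2 0 4 + T 0 4 2 + T 0 2 4 = 0"
      using R1[of 2 2 0] R1[of 2 0 2] R1[of 0 2 2] R3[of 0 0 0] by (simp add: eval_nat_numeral)
    have s44: "T 4 4 0 + T 4 0 4 + T 0 4 4 = 0"
      using R2[of 4 0 0] R2[of 0 4 0] R2[of 0 0 4] rec_B_high[OF T, of 8 0 0] rec_B_high[OF T, of 0 8 0]
        rec_B_high[OF T, of 0 0 8] by (simp add: eval_nat_numeral)
    have a: "a = 0 \<or> a = 2 \<or> a = 4" and b: "b = 0 \<or> b = 2 \<or> b = 4" and c: "c = 0 \<or> c = 2 \<or> c = 4"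
      using False assms ev by auto
    have "a = 0 \<or> b = 0 \<or> c = 0" using False a b c by auto
    with a b c assms(5) show ?thesis
      unfolding sym_sum_def using s20 s40 s22 s42 s44 by (elim disjE) simp_all
  qed
qed

lemma sum_sym_sum:
  fixes k T :: "nat \<Rightarrow> nat \<Rightarrow> nat \<Rightarrow> real"
  assumes fin: "finite S"
    and S1: "\<And>a b c. (a, b, c) \<in> S \<Longrightarrow> (b, a, c) \<in> S" and S2: "\<And>a b c. (a, b, c) \<in> S \<Longrightarrow> (a, c, b) \<in> S"
    and k1: "\<And>a b c. k b a c = k a b c" and k2: "\<And>a b c. k a c b = k a b c"
  shows "6 * (\<Sum>(a, b, c)\<in>S. k a b c * T a b c) = (\<Sum>(a, b, c)\<in>S. k a b c * sym_sum T a b c)"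
proof -
  have s1: "(\<Sum>(a, b, c)\<in>S. k a b c * U b a c) = (\<Sum>(a, b, c)\<in>S. k a b c * U a b c)" for U :: "nat \<Rightarrow> nat \<Rightarrow> nat \<Rightarrow> real"
    by (rule sum.reindex_bij_witness[of _ "\<lambda>(a, b, c). (b, a, c)" "\<lambda>(a, b, c). (b, a, c)"])
       (auto simp: S1 k1)
  have s2: "(\<Sum>(a, b, c)\<in>S. k a b c * U a c b) = (\<Sum>(a, b, c)\<in>S. k a b c * U a b c)" for U :: "nat \<Rightarrow> nat \<Rightarrow> nat \<Rightarrow> real"
    by (rule sum.reindex_bij_witness[of _ "\<lambda>(a, b, c). (a, c, b)" "\<lambda>(a, b, c). (a, c, b)"])
       (auto simp: S2 k2)
  let ?s = "\<Sum>(a, b, c)\<in>S. k a b c * T a b c"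
  have e1: "(\<Sum>(a, b, c)\<in>S. k a b c * T a c b) = ?s" by (rule s2)
  have e2: "(\<Sum>(a, b, c)\<in>S. k a b c * T b a c) = ?s" by (rule s1)
  have e3: "(\<Sum>(a, b, c)\<in>S. k a b c * T c a b) = ?s" using s2[of "\<lambda>a b c. T b a c"] e2 by simp
  have e4: "(\<Sum>(a, b, c)\<in>S. k a b c * T b c a) = ?s" using s1[of "\<lambda>a b c. T a c b"] e1 by simp
  have e5: "(\<Sum>(a, b, c)\<in>S. k a b c * T c b a) = ?s" using s2[of "\<lambda>a b c. T b c a"] e4 by simp
  have "(\<Sum>(a, b, c)\<in>S. k a b c * sym_sum T a b c)
      = ?s + (\<Sum>(a, b, c)\<in>S. k a b c * T a c b) + (\<Sum>(a, b, c)\<in>S. k a b c * T b a c) + (\<Sum>(a, b, c)\<in>S. k a b c * T b c a)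
        + (\<Sum>(a, b, c)\<in>S. k a b c * T c a b) + (\<Sum>(a, b, c)\<in>S. k a b c * T c b a)"
    by (simp add: sym_sum_def case_prod_beta ring_distribs sum.distrib)
  then show ?thesis unfolding e1 e2 e3 e4 e5 by simp
qed

text \<open>The coefficients k are those of a polynomial invariant under permutations and even sign
  changes, so its exponents are all even or all odd. The even part is in the ideal of W(B_3). The
  odd part is x y z times an even symmetric polynomial and lies in that ideal too, up to a multiple
  of x y z itself. The lemma is applied to invariant polynomials of a group as well as to the
  polynomials M_m.\<close>

lemma invariant_sum_zero:
  fixes k T :: "nat \<Rightarrow> nat \<Rightarrow> nat \<Rightarrow> real"
  assumes fin: "finite S"
    and S1: "\<And>a b c. (a, b, c) \<in> S \<Longrightarrow> (b, a, c) \<in> S" and S2: "\<And>a b c. (a, b, c) \<in> S \<Longrightarrow> (a, c, b) \<in> S"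
    and k1: "\<And>a b c. k b a c = k a b c" and k2: "\<And>a b c. k a c b = k a b c"
    and parity: "\<And>a b c. odd (a + b) \<Longrightarrow> k a b c = 0"
    and zero: "(0, 0, 0) \<notin> S \<or> k 0 0 0 = 0"
    and T: "rec_A T \<or> (rec_B T \<and> ((1, 1, 1) \<notin> S \<or> k 1 1 1 = 0))"
  shows "(\<Sum>(a, b, c)\<in>S. k a b c * T a b c) = 0"
proof -
  have B: "rec_B T" using T rec_A_imp_B by blast
  have "k a b c * sym_sum T a b c = 0" if abc: "(a, b, c) \<in> S" for a b c
  proof (cases "k a b c = 0")
    case False
    have "even (a + b)" using parity[of a b c] False by blast
    moreover have "even (a + c)" using parity[of a c b] k2[of a b c] False by auto
    ultimately consider "even a" "even b" "even c" | "odd a" "odd b" "odd c" by auto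
    then have "sym_sum T a b c = 0"
    proof cases
      case 1
      then show ?thesis using zero abc False by (intro sym_sum_even_zero[OF B]) (auto intro: gr0I)
    next
      case 2
      from T show ?thesis
      proof
        assume A: "rec_A T"
        have *: "T p q s = 0" if "odd p" "odd q" "odd s" for p q s
        proof -
          have "T (p - 1 + 1) (q - 1 + 1) (s - 1 + 1) = 0" using A unfolding rec_A_def by blast
          then show ?thesis using that by (simp add: odd_pos)
        qed
        show ?thesis using 2 by (simp add: sym_sum_def *)
      next
        assume R: "rec_B T \<and> ((1, 1, 1) \<notin> S \<or> k 1 1 1 = 0)"
        \<comment> \<open>Division by x y z: the array shifted by (1, 1, 1) satisfies the same
          relations, so the even case applies to it, provided the quotient is not constant.\<close>
        obtain i j l where ijl: "a = 2 * i + 1" "b = 2 * j + 1" "c = 2 * l + 1" using 2 by (auto elim!: oddE)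
        have "rec_B (\<lambda>a b c. T (Suc a) (Suc b) (Suc c))"
        proof -
          have "T (Suc a + 2) (Suc b) (Suc c) + T (Suc a) (Suc b + 2) (Suc c) + T (Suc a) (Suc b) (Suc c + 2) = 0"
            "T (Suc a + 4) (Suc b) (Suc c) + T (Suc a) (Suc b + 4) (Suc c) + T (Suc a) (Suc b) (Suc c + 4) = 0"
            "T (Suc a + 2) (Suc b + 2) (Suc c + 2) = 0" for a b c
            using B unfolding rec_B_def rec_24_def by blast+
          then show ?thesis unfolding rec_B_def rec_24_def by simp
        qed
        moreover have "2 * i + 2 * j + 2 * l > 0" using R abc False ijl by (auto intro: gr0I)
        ultimately have "sym_sum (\<lambda>a b c. T (Suc a) (Suc b) (Suc c)) (2 * i) (2 * j) (2 * l) = 0"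
          by (intro sym_sum_even_zero) auto
        then show ?thesis by (simp add: sym_sum_def ijl)
      qed
    qed
    then show ?thesis by simp
  qed simp
  then have "(\<Sum>(a, b, c)\<in>S. k a b c * sym_sum T a b c) = 0" by (intro sum.neutral) auto
  then show ?thesis using sum_sym_sum[of S k T, OF fin S1 S2 k1 k2] by simp
qed

section \<open>Coefficients of polynomials in three variables\<close>

lemma poly3_coeffs_zero:
  fixes k :: "nat \<Rightarrow> nat \<Rightarrow> nat \<Rightarrow> real"
  assumes "\<And>x y z. (\<Sum>a\<le>N. \<Sum>b\<le>N. \<Sum>c\<le>N. k a b c * (x ^ a * y ^ b * z ^ c)) = 0" "a \<le> N" "b \<le> N" "c \<le> N"
  shows "k a b c = 0"
proof -
  have "(\<Sum>b\<le>N. \<Sum>c\<le>N. k a b c * (y ^ b * z ^ c)) = 0" for y z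
  proof -
    have "(\<Sum>a\<le>N. (\<Sum>b\<le>N. \<Sum>c\<le>N. k a b c * (y ^ b * z ^ c)) * x ^ a) = 0" for x
      using assms(1)[of x y z] by (simp add: sum_distrib_left sum_distrib_right mult_ac)
    then show ?thesis using polyfun_eq_0[of "\<lambda>a. \<Sum>b\<le>N. \<Sum>c\<le>N. k a b c * (y ^ b * z ^ c)" N] assms(2) by blast
  qed
  then have "(\<Sum>b\<le>N. (\<Sum>c\<le>N. k a b c * z ^ c) * y ^ b) = 0" for y z
    by (simp add: sum_distrib_left sum_distrib_right mult_ac)
  then have "(\<Sum>c\<le>N. k a b c * z ^ c) = 0" for z
    using polyfun_eq_0[of "\<lambda>b. \<Sum>c\<le>N. k a b c * z ^ c" N] assms(3) by blast
  then show ?thesis using polyfun_eq_0[of "\<lambda>c. k a b c" N] assms(4) by blast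
qed

definition exponent3 :: "nat \<Rightarrow> nat \<Rightarrow> nat \<Rightarrow> (3 \<Rightarrow>\<^sub>0 nat)" where
  "exponent3 a b c = Abs_poly_mapping (\<lambda>i. if i = 1 then a else if i = 2 then b else c)"

lemma lookup_exponent3:
  "Poly_Mapping.lookup (exponent3 a b c) 1 = a" "Poly_Mapping.lookup (exponent3 a b c) 2 = b"
  "Poly_Mapping.lookup (exponent3 a b c) 3 = c"
  by (simp_all add: exponent3_def)

lemma exponent3_lookup:
  "exponent3 (Poly_Mapping.lookup m 1) (Poly_Mapping.lookup m 2) (Poly_Mapping.lookup m 3) = m"
proof (rule poly_mapping_eqI)
  fix i :: 3
  have "i = 1 \<or> i = 2 \<or> i = 3" by (rule exhaust_3)
  then show "Poly_Mapping.lookup (exponent3 (Poly_Mapping.lookup m 1) (Poly_Mapping.lookup m 2) (Poly_Mapping.lookup m 3)) i = Poly_Mapping.lookup m i"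
    by (auto simp: lookup_exponent3)
qed

definition coeff3 :: "poly3 \<Rightarrow> nat \<Rightarrow> nat \<Rightarrow> nat \<Rightarrow> real" where
  "coeff3 p a b c = Poly_Mapping.lookup p (exponent3 a b c)"

definition cube_exponents :: "nat \<Rightarrow> (nat \<times> nat \<times> nat) set" where
  "cube_exponents N = {..N} \<times> {..N} \<times> {..N}"

text \<open>A cube of exponents is stable under permutations of the variables for every p, which
  allows sums to be reindexed before any symmetry of the coefficients is known. The same N serves
  for all F.\<close>

lemma sum_keys_coeff3:
  "\<exists>N. (\<forall>F :: nat \<Rightarrow> nat \<Rightarrow> nat \<Rightarrow> real.
    (\<Sum>m\<in>Poly_Mapping.keys p. Poly_Mapping.lookup p m * F (Poly_Mapping.lookup m 1) (Poly_Mapping.lookup m 2) (Poly_Mapping.lookup m 3))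
      = (\<Sum>(a, b, c)\<in>cube_exponents N. coeff3 p a b c * F a b c)) \<and>
    (\<forall>a b c. (a, b, c) \<notin> cube_exponents N \<longrightarrow> coeff3 p a b c = 0)"
proof -
  define N where "N = Max (insert 0 ((\<lambda>m. Poly_Mapping.lookup m 1 + Poly_Mapping.lookup m 2 + Poly_Mapping.lookup m 3) ` Poly_Mapping.keys p))"
  have N: "Poly_Mapping.lookup m 1 + Poly_Mapping.lookup m 2 + Poly_Mapping.lookup m 3 \<le> N" if "m \<in> Poly_Mapping.keys p" for m
    unfolding N_def using that by (intro Max_ge) auto
  have out: "coeff3 p a b c = 0" if "(a, b, c) \<notin> cube_exponents N" for a b c
  proof (rule ccontr)
    assume "coeff3 p a b c \<noteq> 0"
    then have "exponent3 a b c \<in> Poly_Mapping.keys p" by (simp add: coeff3_def in_keys_iff)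
    from N[OF this] that show False by (auto simp: lookup_exponent3 cube_exponents_def)
  qed
  have "(\<Sum>m\<in>Poly_Mapping.keys p. Poly_Mapping.lookup p m * F (Poly_Mapping.lookup m 1) (Poly_Mapping.lookup m 2) (Poly_Mapping.lookup m 3))
      = (\<Sum>(a, b, c)\<in>cube_exponents N. coeff3 p a b c * F a b c)" for F :: "nat \<Rightarrow> nat \<Rightarrow> nat \<Rightarrow> real"
  proof (rule sum.reindex_bij_witness_not_neutral[where S' = "{}" and T' = "{(a, b, c)\<in>cube_exponents N. coeff3 p a b c = 0}"
        and i = "\<lambda>(a, b, c). exponent3 a b c"
        and j = "\<lambda>m. (Poly_Mapping.lookup m 1, Poly_Mapping.lookup m 2, Poly_Mapping.lookup m 3)"])
    show "finite {(a, b, c)\<in>cube_exponents N. coeff3 p a b c = 0}"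
      by (rule finite_subset[of _ "cube_exponents N"]) (auto simp: cube_exponents_def)
    fix m assume m: "m \<in> Poly_Mapping.keys p - {}"
    have "Poly_Mapping.lookup m 1 \<le> N" "Poly_Mapping.lookup m 2 \<le> N" "Poly_Mapping.lookup m 3 \<le> N"
      using N[of m] m by auto
    then show "(Poly_Mapping.lookup m 1, Poly_Mapping.lookup m 2, Poly_Mapping.lookup m 3) \<in> cube_exponents N - {(a, b, c)\<in>cube_exponents N. coeff3 p a b c = 0}"
      using m by (auto simp: cube_exponents_def coeff3_def exponent3_lookup in_keys_iff)
  qed (auto simp: exponent3_lookup lookup_exponent3 coeff3_def in_keys_iff split: prod.splits)
  with out show ?thesis by blast
qed

section \<open>Solution spaces of the two ideals\<close>

definition harmonic_A :: "((real ^ 3 \<Rightarrow> real) \<Rightarrow> real) set" where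
  "harmonic_A = {u \<in> distributions. \<forall>\<psi>\<in>test_functions. rec_A (\<lambda>a b c. u (mixed_deriv a b c \<psi>))}"

definition harmonic_B :: "((real ^ 3 \<Rightarrow> real) \<Rightarrow> real) set" where
  "harmonic_B = {u \<in> distributions. \<forall>\<psi>\<in>test_functions. rec_B (\<lambda>a b c. u (mixed_deriv a b c \<psi>))}"

lemma funpow_distribution_deriv:
  "\<psi> \<in> test_functions \<Longrightarrow> (distribution_deriv i ^^ n) u \<psi> = (-1) ^ n * u ((partial_deriv i ^^ n) \<psi>)"
proof (induction n arbitrary: \<psi>)
  case (Suc n)
  then show ?case
    by (simp add: distribution_deriv_def test_partial_deriv funpow_swap1[of "partial_deriv i"])
qed simp

lemma distribution_monom_deriv_eq:
  assumes \<psi>: "\<psi> \<in> test_functions"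
  shows "distribution_monom_deriv m u \<psi> =
    (-1) ^ (Poly_Mapping.lookup m 1 + Poly_Mapping.lookup m 2 + Poly_Mapping.lookup m 3)
      * u (mixed_deriv (Poly_Mapping.lookup m 1) (Poly_Mapping.lookup m 2) (Poly_Mapping.lookup m 3) \<psi>)"
proof -
  have t: "\<psi> \<in> test_functions \<Longrightarrow> (partial_deriv i ^^ n) \<psi> \<in> test_functions" for i n \<psi>
    by (induction n) (auto intro: test_partial_deriv)
  have c: "(partial_deriv 3 ^^ c) ((partial_deriv 2 ^^ b) ((partial_deriv 1 ^^ a) \<psi>)) = mixed_deriv a b c \<psi>" for a b c
    using test_smooth[OF \<psi>]
    by (simp add: mixed_deriv_def smooth_funpow funpow_funpow_commute[where i = 2 and n = b and j = 1 and m = a]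
        funpow_funpow_commute[where i = 3 and n = c and j = 1 and m = a]
        funpow_funpow_commute[where i = 3 and n = c and j = 2 and m = b])
  show ?thesis
    unfolding distribution_monom_deriv_def using \<psi>
    by (simp add: funpow_distribution_deriv t c power_add mult.assoc)
qed

definition poly_sum :: "((3 \<Rightarrow>\<^sub>0 nat) \<Rightarrow> real) \<Rightarrow> poly3 \<Rightarrow> real" where
  "poly_sum F p = (\<Sum>m\<in>Poly_Mapping.keys p. Poly_Mapping.lookup p m * F m)"

lemma poly_sum_superset:
  assumes "finite S" "Poly_Mapping.keys p \<subseteq> S"
  shows "poly_sum F p = (\<Sum>m\<in>S. Poly_Mapping.lookup p m * F m)"
  unfolding poly_sum_def using assms by (intro sum.mono_neutral_left) (auto simp: in_keys_iff)

lemma poly_sum_add [simp]: "poly_sum F (p + q) = poly_sum F p + poly_sum F q"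
proof -
  let ?S = "Poly_Mapping.keys p \<union> Poly_Mapping.keys q"
  have "poly_sum F (p + q) = (\<Sum>m\<in>?S. Poly_Mapping.lookup (p + q) m * F m)"
    by (intro poly_sum_superset keys_add) auto
  also have "\<dots> = (\<Sum>m\<in>?S. Poly_Mapping.lookup p m * F m) + (\<Sum>m\<in>?S. Poly_Mapping.lookup q m * F m)"
    by (simp add: lookup_add distrib_right sum.distrib)
  also have "\<dots> = poly_sum F p + poly_sum F q"
    by (subst (1 2) poly_sum_superset[of ?S]) auto
  finally show ?thesis .
qed

lemma poly_sum_single [simp]: "poly_sum F (Poly_Mapping.single m c) = c * F m"
  by (cases "c = 0") (auto simp: poly_sum_def)

lemma prod_UNIV_3: "(\<Prod>i\<in>(UNIV :: 3 set). g i) = g 1 * g 2 * (g 3 :: real)"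
  unfolding UNIV_3 by (simp add: mult.assoc)

lemma poly3_eval_eq:
  "poly3_eval p x = poly_sum (\<lambda>m. monomial3 (Poly_Mapping.lookup m 1) (Poly_Mapping.lookup m 2) (Poly_Mapping.lookup m 3) x) p"
  by (simp add: poly3_eval_def poly_sum_def monomial3_def prod_UNIV_3)

lemma poly3_deriv_eq_0_iff:
  "poly3_deriv p u = (\<lambda>\<psi>\<in>test_functions. 0) \<longleftrightarrow> (\<forall>\<psi>\<in>test_functions.
     poly_sum (\<lambda>m. (-1) ^ (Poly_Mapping.lookup m 1 + Poly_Mapping.lookup m 2 + Poly_Mapping.lookup m 3)
      * u (mixed_deriv (Poly_Mapping.lookup m 1) (Poly_Mapping.lookup m 2) (Poly_Mapping.lookup m 3) \<psi>)) p = 0)"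
  unfolding poly3_deriv_def poly_sum_def
  by (auto simp: fun_eq_iff restrict_def distribution_monom_deriv_eq)

definition power_poly :: "nat \<Rightarrow> poly3" where
  "power_poly n = Poly_Mapping.single (exponent3 n 0 0) 1 + Poly_Mapping.single (exponent3 0 n 0) 1
     + Poly_Mapping.single (exponent3 0 0 n) 1"

definition product_poly :: "nat \<Rightarrow> poly3" where
  "product_poly n = Poly_Mapping.single (exponent3 n n n) 1"

lemma poly3_eval_power_poly: "poly3_eval (power_poly n) x = x $ 1 ^ n + x $ 2 ^ n + x $ 3 ^ n"
  by (simp add: poly3_eval_eq power_poly_def lookup_exponent3 monomial3_def)

lemma poly3_eval_product_poly: "poly3_eval (product_poly n) x = (x $ 1 * x $ 2 * x $ 3) ^ n"
  by (simp add: poly3_eval_eq product_poly_def lookup_exponent3 monomial3_def power_mult_distrib)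

lemma harmonic_power_poly:
  assumes "u \<in> group_harmonic G" "\<And>g x. g \<in> G \<Longrightarrow> g x $ 1 ^ n + g x $ 2 ^ n + g x $ 3 ^ n = x $ 1 ^ n + x $ 2 ^ n + x $ 3 ^ n"
    "n > 0" "\<psi> \<in> test_functions"
  shows "u (mixed_deriv (a + n) b c \<psi>) + u (mixed_deriv a (b + n) c \<psi>) + u (mixed_deriv a b (c + n) \<psi>) = 0"
proof -
  have "invariant_poly G (power_poly n) \<and> poly3_eval (power_poly n) 0 = 0"
    using assms(2,3) by (simp add: invariant_poly_def poly3_eval_power_poly)
  then have "poly3_deriv (power_poly n) u = (\<lambda>\<psi>\<in>test_functions. 0)" using assms(1) by (auto simp: group_harmonic_def)
  \<comment> \<open>Testing with a derivative of \<psi> yields not only the generator but all its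
    multiples by monomials.\<close>
  then have "(-1) ^ n * (u (mixed_deriv n 0 0 (mixed_deriv a b c \<psi>)) + u (mixed_deriv 0 n 0 (mixed_deriv a b c \<psi>)) + u (mixed_deriv 0 0 n (mixed_deriv a b c \<psi>))) = 0"
    unfolding poly3_deriv_eq_0_iff using test_mixed_deriv[OF assms(4), of a b c]
    by (simp add: power_poly_def lookup_exponent3 distrib_left)
  then show ?thesis
    using test_smooth[OF assms(4)] by (simp add: mixed_deriv_mixed_deriv add.commute)
qed

lemma harmonic_product_poly:
  assumes "u \<in> group_harmonic G" "\<And>g x. g \<in> G \<Longrightarrow> (g x $ 1 * g x $ 2 * g x $ 3) ^ n = (x $ 1 * x $ 2 * x $ 3) ^ n"
    "n > 0" "\<psi> \<in> test_functions"
  shows "u (mixed_deriv (a + n) (b + n) (c + n) \<psi>) = 0"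
proof -
  have "invariant_poly G (product_poly n) \<and> poly3_eval (product_poly n) 0 = 0"
    using assms(2,3) by (simp add: invariant_poly_def poly3_eval_product_poly)
  then have "poly3_deriv (product_poly n) u = (\<lambda>\<psi>\<in>test_functions. 0)" using assms(1) by (auto simp: group_harmonic_def)
  then have "u (mixed_deriv n n n (mixed_deriv a b c \<psi>)) = 0"
    unfolding poly3_deriv_eq_0_iff using test_mixed_deriv[OF assms(4), of a b c]
    by (simp add: product_poly_def lookup_exponent3)
  then show ?thesis
    using test_smooth[OF assms(4)] by (simp add: mixed_deriv_mixed_deriv add.commute)
qed

lemma group_harmonic_subset_A:
  assumes "\<And>g x n. g \<in> G \<Longrightarrow> n = 2 \<or> n = 4 \<Longrightarrow> g x $ 1 ^ n + g x $ 2 ^ n + g x $ 3 ^ n = x $ 1 ^ n + x $ 2 ^ n + x $ 3 ^ n"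
    and "\<And>g x. g \<in> G \<Longrightarrow> g x $ 1 * g x $ 2 * g x $ 3 = x $ 1 * x $ 2 * x $ 3"
  shows "group_harmonic G \<subseteq> harmonic_A"
proof
  fix u assume u: "u \<in> group_harmonic G"
  have "rec_A (\<lambda>a b c. u (mixed_deriv a b c \<psi>))" if \<psi>: "\<psi> \<in> test_functions" for \<psi>
    unfolding rec_A_def rec_24_def
  proof (intro conjI allI)
    fix a b c
    show "u (mixed_deriv (a + 2) b c \<psi>) + u (mixed_deriv a (b + 2) c \<psi>) + u (mixed_deriv a b (c + 2) \<psi>) = 0"
      by (rule harmonic_power_poly[OF u _ _ \<psi>], rule assms(1)) simp_all
    show "u (mixed_deriv (a + 4) b c \<psi>) + u (mixed_deriv a (b + 4) c \<psi>) + u (mixed_deriv a b (c + 4) \<psi>) = 0"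
      by (rule harmonic_power_poly[OF u _ _ \<psi>], rule assms(1)) simp_all
    show "u (mixed_deriv (a + 1) (b + 1) (c + 1) \<psi>) = 0"
      by (rule harmonic_product_poly[OF u _ _ \<psi>]) (simp_all add: assms(2))
  qed
  then show "u \<in> harmonic_A" using u by (auto simp: harmonic_A_def group_harmonic_def)
qed

lemma group_harmonic_subset_B:
  assumes "\<And>g x n. g \<in> G \<Longrightarrow> n = 2 \<or> n = 4 \<Longrightarrow> g x $ 1 ^ n + g x $ 2 ^ n + g x $ 3 ^ n = x $ 1 ^ n + x $ 2 ^ n + x $ 3 ^ n"
    and "\<And>g x. g \<in> G \<Longrightarrow> (g x $ 1 * g x $ 2 * g x $ 3)\<^sup>2 = (x $ 1 * x $ 2 * x $ 3)\<^sup>2"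
  shows "group_harmonic G \<subseteq> harmonic_B"
proof
  fix u assume u: "u \<in> group_harmonic G"
  have "rec_B (\<lambda>a b c. u (mixed_deriv a b c \<psi>))" if \<psi>: "\<psi> \<in> test_functions" for \<psi>
    unfolding rec_B_def rec_24_def
  proof (intro conjI allI)
    fix a b c
    show "u (mixed_deriv (a + 2) b c \<psi>) + u (mixed_deriv a (b + 2) c \<psi>) + u (mixed_deriv a b (c + 2) \<psi>) = 0"
      by (rule harmonic_power_poly[OF u _ _ \<psi>], rule assms(1)) simp_all
    show "u (mixed_deriv (a + 4) b c \<psi>) + u (mixed_deriv a (b + 4) c \<psi>) + u (mixed_deriv a b (c + 4) \<psi>) = 0"
      by (rule harmonic_power_poly[OF u _ _ \<psi>], rule assms(1)) simp_all
    show "u (mixed_deriv (a + 2) (b + 2) (c + 2) \<psi>) = 0"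
      by (rule harmonic_product_poly[OF u _ _ \<psi>], rule assms(2)) simp_all
  qed
  then show "u \<in> harmonic_B" using u by (auto simp: harmonic_B_def group_harmonic_def)
qed

text \<open>These three involutions generate W(A_3), the coordinate permutations combined with even
  sign changes; together with -1 they generate W(B_3).\<close>

definition swap12 :: "real ^ 3 \<Rightarrow> real ^ 3" where "swap12 x = vector [x $ 2, x $ 1, x $ 3]"
definition swap23 :: "real ^ 3 \<Rightarrow> real ^ 3" where "swap23 x = vector [x $ 1, x $ 3, x $ 2]"
definition neg12 :: "real ^ 3 \<Rightarrow> real ^ 3" where "neg12 x = vector [- x $ 1, - x $ 2, x $ 3]"

lemma monomial3_generators:
  "monomial3 a b c (swap12 x) = monomial3 b a c x"
  "monomial3 a b c (swap23 x) = monomial3 a c b x"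
  "monomial3 a b c (neg12 x) = (-1) ^ (a + b) * monomial3 a b c x"
  by (simp_all add: monomial3_def swap12_def swap23_def neg12_def power_minus[of "x $ 1"] power_minus[of "x $ 2"] power_add)

lemma invariant_poly_coeffs:
  assumes inv: "invariant_poly G p" and gens: "swap12 \<in> G" "swap23 \<in> G" "neg12 \<in> G"
  shows "coeff3 p b a c = coeff3 p a b c" "coeff3 p a c b = coeff3 p a b c"
    "odd (a + b) \<Longrightarrow> coeff3 p a b c = 0"
    "uminus \<in> G \<Longrightarrow> odd (a + b + c) \<Longrightarrow> coeff3 p a b c = 0"
proof -
  obtain N where N': "\<forall>F :: nat \<Rightarrow> nat \<Rightarrow> nat \<Rightarrow> real.
     (\<Sum>m\<in>Poly_Mapping.keys p. Poly_Mapping.lookup p m * F (Poly_Mapping.lookup m 1) (Poly_Mapping.lookup m 2) (Poly_Mapping.lookup m 3))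
      = (\<Sum>(a, b, c)\<in>cube_exponents N. coeff3 p a b c * F a b c)"
    and out': "\<forall>a b c. (a, b, c) \<notin> cube_exponents N \<longrightarrow> coeff3 p a b c = 0"
    using sum_keys_coeff3[of p] by (elim exE conjE)
  note N = N'[rule_format] and out = out'[rule_format]
  have eval: "poly3_eval p x = (\<Sum>(a, b, c)\<in>cube_exponents N. coeff3 p a b c * monomial3 a b c x)" for x
    unfolding poly3_eval_eq poly_sum_def by (rule N)
  \<comment> \<open>Coefficients are determined by the polynomial function, so each generator of the
    group turns into one identity between coefficients.\<close>
  have uniq: "k a b c = l a b c" if kl: "\<And>x. (\<Sum>(a, b, c)\<in>cube_exponents N. k a b c * monomial3 a b c x) = (\<Sum>(a, b, c)\<in>cube_exponents N. l a b c * monomial3 a b c x)"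
    and kl': "\<And>a b c. (a, b, c) \<notin> cube_exponents N \<Longrightarrow> k a b c = l a b c" for k l :: "nat \<Rightarrow> nat \<Rightarrow> nat \<Rightarrow> real" and a b c
  proof (cases "(a, b, c) \<in> cube_exponents N")
    case True
    have "k a b c - l a b c = 0"
    proof (rule poly3_coeffs_zero[where N = N and k = "\<lambda>a b c. k a b c - l a b c"])
      fix x y z :: real
      have "(\<Sum>(a, b, c)\<in>cube_exponents N. (k a b c - l a b c) * monomial3 a b c (vector [x, y, z])) = 0"
        using kl[of "vector [x, y, z]"] by (simp add: case_prod_beta left_diff_distrib sum_subtractf)
      then show "(\<Sum>a\<le>N. \<Sum>b\<le>N. \<Sum>c\<le>N. (k a b c - l a b c) * (x ^ a * y ^ b * z ^ c)) = 0"
        by (simp add: cube_exponents_def monomial3_def sum.cartesian_product[symmetric])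
    qed (use True in \<open>auto simp: cube_exponents_def\<close>)
    then show ?thesis by simp
  qed (rule kl')
  have i: "poly3_eval p (g x) = poly3_eval p x" if "g \<in> G" for g x using inv that by (simp add: invariant_poly_def)
  show "coeff3 p b a c = coeff3 p a b c"
  proof (rule uniq[of "\<lambda>a b c. coeff3 p b a c" "coeff3 p"])
    fix x
    have "(\<Sum>(a, b, c)\<in>cube_exponents N. coeff3 p b a c * monomial3 a b c x) = (\<Sum>(a, b, c)\<in>cube_exponents N. coeff3 p a b c * monomial3 b a c x)"
      by (rule sum.reindex_bij_witness[of _ "\<lambda>(a, b, c). (b, a, c)" "\<lambda>(a, b, c). (b, a, c)"]) (auto simp: cube_exponents_def)
    also have "\<dots> = poly3_eval p (swap12 x)" by (simp add: eval monomial3_generators)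
    finally show "(\<Sum>(a, b, c)\<in>cube_exponents N. coeff3 p b a c * monomial3 a b c x) = (\<Sum>(a, b, c)\<in>cube_exponents N. coeff3 p a b c * monomial3 a b c x)"
      unfolding eval[symmetric] i[OF gens(1)] .
  qed (auto simp: cube_exponents_def intro!: trans[OF out out[symmetric]])
  show "coeff3 p a c b = coeff3 p a b c"
  proof (rule uniq[of "\<lambda>a b c. coeff3 p a c b" "coeff3 p"])
    fix x
    have "(\<Sum>(a, b, c)\<in>cube_exponents N. coeff3 p a c b * monomial3 a b c x) = (\<Sum>(a, b, c)\<in>cube_exponents N. coeff3 p a b c * monomial3 a c b x)"
      by (rule sum.reindex_bij_witness[of _ "\<lambda>(a, b, c). (a, c, b)" "\<lambda>(a, b, c). (a, c, b)"]) (auto simp: cube_exponents_def)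
    also have "\<dots> = poly3_eval p (swap23 x)" by (simp add: eval monomial3_generators)
    finally show "(\<Sum>(a, b, c)\<in>cube_exponents N. coeff3 p a c b * monomial3 a b c x) = (\<Sum>(a, b, c)\<in>cube_exponents N. coeff3 p a b c * monomial3 a b c x)"
      unfolding eval[symmetric] i[OF gens(2)] .
  qed (auto simp: cube_exponents_def intro!: trans[OF out out[symmetric]])
  have "(-1) ^ (a + b) * coeff3 p a b c = coeff3 p a b c"
  proof (rule uniq[of "\<lambda>a b c. (-1) ^ (a + b) * coeff3 p a b c" "coeff3 p"])
    fix x
    have "(\<Sum>(a, b, c)\<in>cube_exponents N. (-1) ^ (a + b) * coeff3 p a b c * monomial3 a b c x) = poly3_eval p (neg12 x)"
      by (simp add: eval monomial3_generators mult_ac)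
    then show "(\<Sum>(a, b, c)\<in>cube_exponents N. (-1) ^ (a + b) * coeff3 p a b c * monomial3 a b c x) = (\<Sum>(a, b, c)\<in>cube_exponents N. coeff3 p a b c * monomial3 a b c x)"
      unfolding eval[symmetric] i[OF gens(3)] .
  qed (auto simp: out)
  then show "odd (a + b) \<Longrightarrow> coeff3 p a b c = 0" by simp
  assume u: "uminus \<in> G" and odd: "odd (a + b + c)"
  have "(-1) ^ (a + b + c) * coeff3 p a b c = coeff3 p a b c"
  proof (rule uniq[of "\<lambda>a b c. (-1) ^ (a + b + c) * coeff3 p a b c" "coeff3 p"])
    fix x
    have "(\<Sum>(a, b, c)\<in>cube_exponents N. (-1) ^ (a + b + c) * coeff3 p a b c * monomial3 a b c x) = poly3_eval p (- x)"
      by (simp add: eval monomial3_uminus mult_ac)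
    then show "(\<Sum>(a, b, c)\<in>cube_exponents N. (-1) ^ (a + b + c) * coeff3 p a b c * monomial3 a b c x) = (\<Sum>(a, b, c)\<in>cube_exponents N. coeff3 p a b c * monomial3 a b c x)"
      unfolding eval[symmetric] i[OF u] .
  qed (auto simp: out)
  then show "coeff3 p a b c = 0" using odd by simp
qed

text \<open>A larger group has fewer invariants and hence more harmonic distributions. Assuming only
  that G contains the generators makes this applicable to W(A_3), W(B_3) and the symmetry groups of
  all skeletons.\<close>

lemma harmonic_subset_group_harmonic:
  assumes gens: "swap12 \<in> G" "swap23 \<in> G" "neg12 \<in> G"
    and u: "u \<in> harmonic_A \<or> (uminus \<in> G \<and> u \<in> harmonic_B)"
  shows "u \<in> group_harmonic G"
proof -
  have "poly3_deriv p u = (\<lambda>\<psi>\<in>test_functions. 0)" if p: "invariant_poly G p" "poly3_eval p 0 = 0" for p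
    unfolding poly3_deriv_eq_0_iff
  proof
    fix \<psi> assume \<psi>: "\<psi> \<in> test_functions"
    note co = invariant_poly_coeffs[OF p(1) gens]
    obtain N where N': "\<forall>F :: nat \<Rightarrow> nat \<Rightarrow> nat \<Rightarrow> real.
     (\<Sum>m\<in>Poly_Mapping.keys p. Poly_Mapping.lookup p m * F (Poly_Mapping.lookup m 1) (Poly_Mapping.lookup m 2) (Poly_Mapping.lookup m 3))
      = (\<Sum>(a, b, c)\<in>cube_exponents N. coeff3 p a b c * F a b c)"
    and out': "\<forall>a b c. (a, b, c) \<notin> cube_exponents N \<longrightarrow> coeff3 p a b c = 0"
    using sum_keys_coeff3[of p] by (elim exE conjE)
  note N = N'[rule_format] and out = out'[rule_format]
    have "poly3_eval p 0 = (\<Sum>(a, b, c)\<in>cube_exponents N. coeff3 p a b c * monomial3 a b c 0)"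
      unfolding poly3_eval_eq poly_sum_def by (rule N)
    also have "\<dots> = (\<Sum>e\<in>cube_exponents N. if e = (0, 0, 0) then coeff3 p 0 0 0 else 0)"
      by (intro sum.cong) (auto simp: monomial3_def power_0_left split: if_splits)
    also have "\<dots> = coeff3 p 0 0 0" by (simp add: cube_exponents_def)
    finally have c0: "coeff3 p 0 0 0 = 0" using p(2) by simp
    let ?T = "\<lambda>a b c. u (mixed_deriv a b c \<psi>)"
    have T: "rec_A ?T \<or> (rec_B ?T \<and> (((1::nat), (1::nat), (1::nat)) \<notin> cube_exponents N \<or> coeff3 p 1 1 1 * (-1) ^ (1 + 1 + 1) = 0))"
      using u \<psi> co(4)[of 1 1 1] by (auto simp: harmonic_A_def harmonic_B_def)
    have "(\<Sum>(a, b, c)\<in>cube_exponents N. (coeff3 p a b c * (-1) ^ (a + b + c)) * ?T a b c) = 0"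
    proof (rule invariant_sum_zero[where k = "\<lambda>a b c. coeff3 p a b c * (-1) ^ (a + b + c)"])
      show "rec_A ?T \<or> (rec_B ?T \<and> ((1, 1, 1) \<notin> cube_exponents N \<or> coeff3 p 1 1 1 * (-1) ^ (1 + 1 + 1) = 0))" by (rule T)
      show "\<And>a b c. coeff3 p b a c * (- 1) ^ (b + a + c) = coeff3 p a b c * (- 1) ^ (a + b + c)"
        using co(1) by (simp add: add.commute)
      show "\<And>a b c. coeff3 p a c b * (- 1) ^ (a + c + b) = coeff3 p a b c * (- 1) ^ (a + b + c)"
        using co(2) by (simp add: add_ac)
    qed (use co(3) c0 in \<open>auto simp: cube_exponents_def\<close>)
    then show "poly_sum (\<lambda>m. (-1) ^ (Poly_Mapping.lookup m 1 + Poly_Mapping.lookup m 2 + Poly_Mapping.lookup m 3)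
      * u (mixed_deriv (Poly_Mapping.lookup m 1) (Poly_Mapping.lookup m 2) (Poly_Mapping.lookup m 3) \<psi>)) p = 0"
      unfolding poly_sum_def N[of "\<lambda>a b c. (-1) ^ (a + b + c) * u (mixed_deriv a b c \<psi>)"] by (simp add: mult.assoc)
  qed
  moreover have "u \<in> distributions" using u by (auto simp: harmonic_A_def harmonic_B_def)
  ultimately show ?thesis by (auto simp: group_harmonic_def)
qed

section \<open>Distributions given by functions\<close>

lemma distribution_of_test: "\<psi> \<in> test_functions \<Longrightarrow> distribution_of f \<psi> = (\<integral>x. f x * \<psi> x \<partial>lborel)"
  by (simp add: distribution_of_def)

lemma distribution_of_in_distributions:
  assumes f: "continuous_on UNIV f"
  shows "distribution_of f \<in> distributions"
proof -
  have lin: "distribution_of f (\<lambda>x. a * \<phi> x + b * \<psi> x) = a * distribution_of f \<phi> + b * distribution_of f \<psi>"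
    if "\<phi> \<in> test_functions" "\<psi> \<in> test_functions" for \<phi> \<psi> a b
    using test_linear_integral[OF f] that test_add[OF test_cmult[OF that(1), of a] test_cmult[OF that(2), of b]]
    by (simp add: distribution_of_test test_linear_def)
  have bound: "\<exists>C N. \<forall>\<psi>\<in>test_functions. supp \<psi> \<subseteq> K \<longrightarrow>
      \<bar>distribution_of f \<psi>\<bar> \<le> C * (\<Sum>is | length is \<le> N. SUP x. \<bar>partial_derivs is \<psi> x\<bar>)"
    if K: "compact K" for K
  proof -
    obtain r where r: "\<And>x. x \<in> K \<Longrightarrow> norm x \<le> r" using compact_imp_bounded[OF K] unfolding bounded_iff by blast
    obtain M where M: "M \<ge> 0" "\<And>x. norm x \<le> r \<Longrightarrow> \<bar>f x\<bar> \<le> M" using continuous_bounded_cball[OF f] by blast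
    define V where "V = measure lborel (cball (0::real^3) r)"
    have "\<bar>distribution_of f \<psi>\<bar> \<le> (M * V) * (\<Sum>is | length is \<le> 0. SUP x. \<bar>partial_derivs is \<psi> x\<bar>)"
      if \<psi>: "\<psi> \<in> test_functions" "supp \<psi> \<subseteq> K" for \<psi>
    proof -
      have z: "\<psi> x = 0" if "norm x > r" for x
        using that r[of x] \<psi>(2) closure_subset[of "{x. \<psi> x \<noteq> 0}"] by (auto simp: supp_def)
      obtain M' where M': "\<And>x. norm x \<le> r \<Longrightarrow> \<bar>\<psi> x\<bar> \<le> M'" "M' \<ge> 0"
        using continuous_bounded_cball[OF smooth_continuous_on[OF test_smooth[OF \<psi>(1)]]] by blast
      \<comment> \<open>Over the reals a supremum is an upper bound only when the set of values is
        bounded.\<close>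
      have bd: "bdd_above (range (\<lambda>x. \<bar>\<psi> x\<bar>))"
      proof (rule bdd_aboveI2)
        fix x show "\<bar>\<psi> x\<bar> \<le> M'" using z[of x] M' by (cases "norm x > r") auto
      qed
      define m where "m = (SUP x. \<bar>\<psi> x\<bar>)"
      have m: "\<bar>\<psi> x\<bar> \<le> m" for x unfolding m_def by (rule cSUP_upper[OF UNIV_I bd])
      have "\<bar>distribution_of f \<psi>\<bar> \<le> (\<integral>x. \<bar>f x * \<psi> x\<bar> \<partial>lborel)"
        using integral_norm_bound[of lborel "\<lambda>x. f x * \<psi> x"] \<psi>(1) by (simp add: distribution_of_test)
      also have "\<dots> \<le> (\<integral>x. (M * m) * indicator (cball (0::real^3) r) x \<partial>lborel)"
      proof (rule Bochner_Integration.integral_mono)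
        show "integrable lborel (\<lambda>x. \<bar>f x * \<psi> x\<bar>)" using integrable_test_mult[OF f \<psi>(1)] by auto
        show "integrable lborel (\<lambda>x. (M * m) * indicator (cball (0::real^3) r) x)"
          using emeasure_bounded_finite[OF bounded_cball[of "0::real^3" r]]
          by (intro integrable_mult_right integrable_real_indicator) auto
        fix x :: "real ^ 3"
        show "\<bar>f x * \<psi> x\<bar> \<le> (M * m) * indicator (cball 0 r) x"
        proof (cases "norm x > r")
          case False
          then have "\<bar>f x\<bar> * \<bar>\<psi> x\<bar> \<le> M * m" using M m by (intro mult_mono) auto
          then show ?thesis using False by (simp add: abs_mult)
        qed (simp add: z)
      qed
      also have "\<dots> = (M * V) * m" by (simp add: V_def)
      finally show ?thesis by (simp add: m_def)
    qed
    then show ?thesis by blast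
  qed
  have "distribution_of f \<in> extensional test_functions" by (simp add: distribution_of_def)
  then show ?thesis using lin bound unfolding distributions_def by blast
qed

lemma distributions_test_linear: "u \<in> distributions \<Longrightarrow> test_linear u"
  by (auto simp: distributions_def test_linear_def)

text \<open>16 = 3 * 5 + 1: in that degree one of the three exponents is at least 6, so by
  \<open>rec_B_high\<close> all derivatives of order 16 of the distribution vanish.\<close>

lemma harmonic_B_smooth:
  assumes "u \<in> harmonic_B"
  obtains f where "smooth_function f" "u = distribution_of f" "\<And>a b c. a + b + c = 16 \<Longrightarrow> mixed_deriv a b c f = (\<lambda>x. 0)"
proof -
  have u: "u \<in> distributions" and rec: "\<And>\<psi>. \<psi> \<in> test_functions \<Longrightarrow> rec_B (\<lambda>a b c. u (mixed_deriv a b c \<psi>))"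
    using assms by (auto simp: harmonic_B_def)
  have zero: "u (mixed_deriv a b c \<psi>) = 0" if "\<psi> \<in> test_functions" "a + b + c = 16" for \<psi> a b c
    by (rule rec_B_high[OF rec[OF that(1)]]) (use that(2) in linarith)
  obtain f where f: "smooth_function f" "\<And>\<psi>. \<psi> \<in> test_functions \<Longrightarrow> u \<psi> = (\<integral>x. f x * \<psi> x \<partial>lborel)"
    using annihilated_functional_is_smooth[OF distributions_test_linear[OF u] zero] by blast
  have "u = distribution_of f"
  proof
    fix \<psi> show "u \<psi> = distribution_of f \<psi>"
      using f(2)[of \<psi>] u by (cases "\<psi> \<in> test_functions") (auto simp: distribution_of_def distributions_def extensional_def)
  qed
  moreover have "mixed_deriv a b c f = (\<lambda>x. 0)" if abc: "a + b + c = 16" for a b c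
  proof
    fix x show "mixed_deriv a b c f x = 0"
    proof (rule continuous_zero_if_test_integrals_zero)
      show "continuous_on UNIV (mixed_deriv a b c f)" by (intro smooth_continuous_on smooth_mixed_deriv f)
      fix \<psi> assume \<psi>: "\<psi> \<in> test_functions"
      show "(\<integral>x. mixed_deriv a b c f x * \<psi> x \<partial>lborel) = 0"
        using zero[OF \<psi> abc] f(2)[OF test_mixed_deriv[OF \<psi>]] integral_mixed_deriv[OF f(1) \<psi>, of a b c] by simp
    qed
  qed
  ultimately show ?thesis using that f(1) by blast
qed

section \<open>Measures with tetrahedral symmetry\<close>

lemma sum_exponents:
  fixes F :: "nat \<Rightarrow> nat \<Rightarrow> nat \<Rightarrow> real"
  shows "(\<Sum>(a, b, c)\<in>exponents m. F a b c) = (\<Sum>a\<le>m. \<Sum>b\<le>m - a. F a b (m - a - b))"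
proof -
  have "(\<Sum>a\<le>m. \<Sum>b\<le>m - a. F a b (m - a - b)) = (\<Sum>(a, b)\<in>(SIGMA a:{..m}. {..m - a}). F a b (m - a - b))"
    by (rule sum.Sigma) auto
  also have "\<dots> = (\<Sum>(a, b, c)\<in>exponents m. F a b c)"
    by (rule sum.reindex_bij_witness[of _ "\<lambda>(a, b, c). (a, b)" "\<lambda>(a, b). (a, b, m - a - b)"]) (auto simp: exponents_def)
  finally show ?thesis by simp
qed

locale symmetric_probability = compact_probability +
  assumes moment_swap12: "moment b a c = moment a b c" and moment_swap23: "moment a c b = moment a b c"
    and moment_odd: "odd (a + b) \<Longrightarrow> moment a b c = 0"
begin

lemma moment_odd': "odd (a + b) \<or> odd (a + c) \<or> odd (b + c) \<Longrightarrow> moment a b c = 0"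
  using moment_odd[of a b c] moment_odd[of a c b] moment_odd[of b c a] moment_swap12 moment_swap23 by metis

lemma moment_perms:
  "moment 0 n 0 = moment n 0 0" "moment 0 0 n = moment n 0 0"
  "moment 0 n n = moment n n 0" "moment n 0 n = moment n n 0"
  "moment 2 4 0 = moment 4 2 0" "moment 4 0 2 = moment 4 2 0" "moment 2 0 4 = moment 4 2 0"
  "moment 0 4 2 = moment 4 2 0" "moment 0 2 4 = moment 4 2 0"
  "moment 1 3 1 = moment 3 1 1" "moment 1 1 3 = moment 3 1 1"
proof -
  have r: "moment c a b = moment a b c" for a b c
    using moment_swap12[of c a b] moment_swap23[of a c b] by simp
  have l: "moment b c a = moment a b c" for a b c
    by (rule r[symmetric])
  show "moment 0 n 0 = moment n 0 0" by (rule moment_swap12)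
  show "moment 0 0 n = moment n 0 0" by (rule l)
  show "moment 0 n n = moment n n 0" by (rule r)
  show "moment n 0 n = moment n n 0" by (rule moment_swap23)
  show "moment 2 4 0 = moment 4 2 0" by (rule moment_swap12)
  show "moment 4 0 2 = moment 4 2 0" by (rule moment_swap23)
  show "moment 2 0 4 = moment 4 2 0" by (rule l)
  show "moment 0 4 2 = moment 4 2 0" by (rule r)
  show "moment 0 2 4 = moment 4 2 0" using moment_swap12[of 0 2 4] l[of 2 0 4] l[of 4 2 0] by simp
  show "moment 1 3 1 = moment 3 1 1" by (rule moment_swap12)
  show "moment 1 1 3 = moment 3 1 1" by (rule l)
qed

text \<open>The polynomials M_2 to M_6 after removal of the moments that vanish by symmetry. X is
  arbitrary because it stands for the values of a functional on derivatives in one place and for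
  monomials at a point in another.\<close>

lemma moment_sum:
  fixes X :: "nat \<Rightarrow> nat \<Rightarrow> nat \<Rightarrow> real"
  shows "(\<Sum>(a, b, c)\<in>exponents 2. multinom a b c * moment a b c * X a b c) = moment 2 0 0 * (X 2 0 0 + X 0 2 0 + X 0 0 2)"
    "(\<Sum>(a, b, c)\<in>exponents 3. multinom a b c * moment a b c * X a b c) = 6 * moment 1 1 1 * X 1 1 1"
    "(\<Sum>(a, b, c)\<in>exponents 4. multinom a b c * moment a b c * X a b c) =
      moment 4 0 0 * (X 4 0 0 + X 0 4 0 + X 0 0 4) + 6 * moment 2 2 0 * (X 2 2 0 + X 2 0 2 + X 0 2 2)"
    "(\<Sum>(a, b, c)\<in>exponents 5. multinom a b c * moment a b c * X a b c) =
      20 * moment 3 1 1 * (X 3 1 1 + X 1 3 1 + X 1 1 3)"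
    "(\<Sum>(a, b, c)\<in>exponents 6. multinom a b c * moment a b c * X a b c) =
      moment 6 0 0 * (X 6 0 0 + X 0 6 0 + X 0 0 6)
      + 15 * moment 4 2 0 * (X 4 2 0 + X 2 4 0 + X 4 0 2 + X 2 0 4 + X 0 4 2 + X 0 2 4) + 90 * moment 2 2 2 * X 2 2 2"
proof -
  \<comment> \<open>In unary form the index ranges of \<open>sum_exponents\<close> unfold by
    simplification, and \<open>moment_perms\<close> has to be brought to the same form.\<close>
  have e: "(6::nat) = Suc (Suc (Suc (Suc (Suc (Suc 0)))))" "(5::nat) = Suc (Suc (Suc (Suc (Suc 0))))"
    "(4::nat) = Suc (Suc (Suc (Suc 0)))" "(3::nat) = Suc (Suc (Suc 0))" "(2::nat) = Suc (Suc 0)" "(1::nat) = Suc 0"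
    by simp_all
  note p = moment_perms[unfolded e]
  show "(\<Sum>(a, b, c)\<in>exponents 2. multinom a b c * moment a b c * X a b c) = moment 2 0 0 * (X 2 0 0 + X 0 2 0 + X 0 0 2)"
    unfolding sum_exponents e by (simp add: multinom_def ring_distribs) (simp add: moment_odd' p fact_numeral)
  show "(\<Sum>(a, b, c)\<in>exponents 3. multinom a b c * moment a b c * X a b c) = 6 * moment 1 1 1 * X 1 1 1"
    unfolding sum_exponents e by (simp add: multinom_def ring_distribs) (simp add: moment_odd' p fact_numeral)
  show "(\<Sum>(a, b, c)\<in>exponents 4. multinom a b c * moment a b c * X a b c) =
      moment 4 0 0 * (X 4 0 0 + X 0 4 0 + X 0 0 4) + 6 * moment 2 2 0 * (X 2 2 0 + X 2 0 2 + X 0 2 2)"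
    unfolding sum_exponents e by (simp add: multinom_def ring_distribs) (simp add: moment_odd' p fact_numeral)
  show "(\<Sum>(a, b, c)\<in>exponents 5. multinom a b c * moment a b c * X a b c) =
      20 * moment 3 1 1 * (X 3 1 1 + X 1 3 1 + X 1 1 3)"
    unfolding sum_exponents e by (simp add: multinom_def ring_distribs) (simp add: moment_odd' p fact_numeral)
  show "(\<Sum>(a, b, c)\<in>exponents 6. multinom a b c * moment a b c * X a b c) =
      moment 6 0 0 * (X 6 0 0 + X 0 6 0 + X 0 0 6)
      + 15 * moment 4 2 0 * (X 4 2 0 + X 2 4 0 + X 4 0 2 + X 2 0 4 + X 0 4 2 + X 0 2 4) + 90 * moment 2 2 2 * X 2 2 2"
    unfolding sum_exponents e by (simp add: multinom_def ring_distribs) (simp add: moment_odd' p fact_numeral)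
qed

text \<open>Write m_abc for the moments. Modulo p_2 the sum of the products x^2 y^2 is -p_4 / 2,
  which turns M_4 into (m_400 - 3 m_220) p_4. In degree 6, again modulo p_2, the sum of the sixth
  powers is 3 (x y z)^2 and the sum of the products x^4 y^2 is -3 (x y z)^2; this turns M_6 into (3
  m_600 - 45 m_420 + 90 m_222) (x y z)^2.\<close>

lemma mean_value_functions_subset:
  assumes f: "mean_value f" and m2: "moment 2 0 0 \<noteq> 0" and m4: "moment 4 0 0 \<noteq> 3 * moment 2 2 0"
  shows "moment 1 1 1 \<noteq> 0 \<Longrightarrow> distribution_of f \<in> harmonic_A"
    and "3 * moment 6 0 0 - 45 * moment 4 2 0 + 90 * moment 2 2 2 \<noteq> 0 \<Longrightarrow> distribution_of f \<in> harmonic_B"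
proof -
  have c: "continuous_on UNIV f" using f unfolding mean_value_def by blast
  define T where "T \<psi> a b c = distribution_of f (mixed_deriv a b c \<psi>)" for \<psi> a b c
  have eqs: "(\<Sum>(a', b', c')\<in>exponents m. multinom a' b' c' * moment a' b' c' * T \<psi> (a + a') (b + b') (c + c')) = 0"
    if \<psi>: "\<psi> \<in> test_functions" and m: "m > 0" for \<psi> m a b c
  proof -
    have "T \<psi> (a + a') (b + b') (c + c') = (\<integral>x. f x * mixed_deriv a' b' c' (mixed_deriv a b c \<psi>) x \<partial>lborel)" for a' b' c'
      unfolding T_def mixed_deriv_mixed_deriv[OF test_smooth[OF \<psi>]]
      by (simp add: distribution_of_test test_mixed_deriv[OF \<psi>] add.commute)
    then show ?thesis using moment_equations_if_mean_value[OF f test_mixed_deriv[OF \<psi>] m] by simp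
  qed
  have R1: "T \<psi> (a + 2) b c + T \<psi> a (b + 2) c + T \<psi> a b (c + 2) = 0" if \<psi>: "\<psi> \<in> test_functions" for \<psi> a b c
    using eqs[OF \<psi>, of 2 a b c] m2 by (simp add: moment_sum(1)[of "\<lambda>a' b' c'. T \<psi> (a + a') (b + b') (c + c')"])
  have R2: "T \<psi> (a + 4) b c + T \<psi> a (b + 4) c + T \<psi> a b (c + 4) = 0" if \<psi>: "\<psi> \<in> test_functions" for \<psi> a b c
  proof -
    let ?p = "T \<psi> (a + 4) b c + T \<psi> a (b + 4) c + T \<psi> a b (c + 4)"
    let ?e = "T \<psi> (a + 2) (b + 2) c + T \<psi> (a + 2) b (c + 2) + T \<psi> a (b + 2) (c + 2)"
    have "moment 4 0 0 * ?p + 6 * moment 2 2 0 * ?e = 0"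
      using eqs[OF \<psi>, of 4 a b c] by (simp add: moment_sum(3)[of "\<lambda>a' b' c'. T \<psi> (a + a') (b + b') (c + c')"])
    moreover have "?p + 2 * ?e = 0"
      using R1[OF \<psi>, of "a + 2" b c] R1[OF \<psi>, of a "b + 2" c] R1[OF \<psi>, of a b "c + 2"] by (simp add: eval_nat_numeral)
    then have "?e = - ?p / 2" by simp
    moreover have "P = 0" if "m * P + 6 * n * E = 0" "E = - P / 2" "m \<noteq> 3 * n" for m n P E :: real
    proof -
      have "(m - 3 * n) * P = 0" using that(1) unfolding that(2) by (simp add: algebra_simps)
      then show ?thesis using that(3) by simp
    qed
    ultimately show ?thesis using m4 by blast
  qed
  have u: "distribution_of f \<in> distributions" by (rule distribution_of_in_distributions[OF c])
  have R24: "rec_24 (\<lambda>a b c. distribution_of f (mixed_deriv a b c \<psi>))" if "\<psi> \<in> test_functions" for \<psi>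
    using R1[OF that] R2[OF that] by (simp add: rec_24_def T_def)
  {
    assume m3: "moment 1 1 1 \<noteq> 0"
    have "T \<psi> (a + 1) (b + 1) (c + 1) = 0" if \<psi>: "\<psi> \<in> test_functions" for \<psi> a b c
      using eqs[OF \<psi>, of 3 a b c] m3 by (simp add: moment_sum(2)[of "\<lambda>a' b' c'. T \<psi> (a + a') (b + b') (c + c')"])
    then show "distribution_of f \<in> harmonic_A" using u R24 by (simp add: harmonic_A_def rec_A_def T_def)
  next
    assume m6: "3 * moment 6 0 0 - 45 * moment 4 2 0 + 90 * moment 2 2 2 \<noteq> 0"
    have "T \<psi> (a + 2) (b + 2) (c + 2) = 0" if \<psi>: "\<psi> \<in> test_functions" for \<psi> a b c
    proof -
      let ?p = "T \<psi> (a + 6) b c + T \<psi> a (b + 6) c + T \<psi> a b (c + 6)"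
      let ?q = "T \<psi> (a + 4) (b + 2) c + T \<psi> (a + 2) (b + 4) c + T \<psi> (a + 4) b (c + 2) + T \<psi> (a + 2) b (c + 4)
        + T \<psi> a (b + 4) (c + 2) + T \<psi> a (b + 2) (c + 4)"
      let ?t = "T \<psi> (a + 2) (b + 2) (c + 2)"
      have "moment 6 0 0 * ?p + 15 * moment 4 2 0 * ?q + 90 * moment 2 2 2 * ?t = 0"
        using eqs[OF \<psi>, of 6 a b c] by (simp add: moment_sum(5)[of "\<lambda>a' b' c'. T \<psi> (a + a') (b + b') (c + c')"])
      moreover have "?q = - 3 * ?t"
        using R1[OF \<psi>, of "a + 2" "b + 2" c] R1[OF \<psi>, of "a + 2" b "c + 2"] R1[OF \<psi>, of a "b + 2" "c + 2"] by (simp add: eval_nat_numeral)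
      moreover have "?p + ?q = 0"
        using R1[OF \<psi>, of "a + 4" b c] R1[OF \<psi>, of a "b + 4" c] R1[OF \<psi>, of a b "c + 4"] by (simp add: eval_nat_numeral)
      then have "?p = 3 * ?t" using \<open>?q = - 3 * ?t\<close> by linarith
      moreover have "t = 0" if "m * P + 15 * n * Q + 90 * l * t = 0" "Q = - 3 * t" "P = 3 * t" "3 * m - 45 * n + 90 * l \<noteq> 0"
        for m n l P Q t :: real
      proof -
        have "(3 * m - 45 * n + 90 * l) * t = 0" using that(1) unfolding that(2,3) by (simp add: algebra_simps)
        then show ?thesis using that(4) by simp
      qed
      ultimately show ?thesis using m6 by blast
    qed
    then show "distribution_of f \<in> harmonic_B" using u R24 by (simp add: harmonic_B_def rec_B_def T_def)
  }
qed

text \<open>Such a distribution is a smooth function whose derivatives of order 16 vanish, so the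
  moment equations are enough. They hold because M_m is an invariant polynomial; its possible term x
  y z, in degree 3, is annihilated in the first case and absent in the second.\<close>

lemma harmonic_is_mean_value:
  assumes u: "u \<in> harmonic_A \<or> (u \<in> harmonic_B \<and> moment 1 1 1 = 0)"
  shows "\<exists>f. mean_value f \<and> u = distribution_of f"
proof -
  have B: "u \<in> harmonic_B" using u rec_A_imp_B by (auto simp: harmonic_A_def harmonic_B_def)
  obtain f where f: "smooth_function f" "u = distribution_of f" "\<And>a b c. a + b + c = 16 \<Longrightarrow> mixed_deriv a b c f = (\<lambda>x. 0)"
    using harmonic_B_smooth[OF B] by blast
  have "mean_value f"
  proof (rule mean_value_if_moment_equations[where n = 16, OF f(1) _ f(3)])
    fix m x assume m: "m > (0::nat)"
    let ?h = "\<lambda>x. \<Sum>(a, b, c)\<in>exponents m. multinom a b c * moment a b c * mixed_deriv a b c f x"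
    show "?h x = 0"
    proof (rule continuous_zero_if_test_integrals_zero)
      show "continuous_on UNIV ?h"
        by (intro continuous_on_sum)
          (auto intro!: continuous_on_mult continuous_on_const smooth_continuous_on[OF smooth_mixed_deriv[OF f(1)]])
      fix \<psi> assume \<psi>: "\<psi> \<in> test_functions"
      let ?T = "\<lambda>a b c. u (mixed_deriv a b c \<psi>)"
      have "(\<integral>x. ?h x * \<psi> x \<partial>lborel) = (\<integral>x. (\<Sum>e\<in>exponents m. case e of (a, b, c) \<Rightarrow> (multinom a b c * moment a b c) * (mixed_deriv a b c f x * \<psi> x)) \<partial>lborel)"
        unfolding sum_distrib_right by (intro Bochner_Integration.integral_cong refl sum.cong) (auto simp: mult.assoc)
      also have "\<dots> = (\<Sum>e\<in>exponents m. \<integral>x. (case e of (a, b, c) \<Rightarrow> (multinom a b c * moment a b c) * (mixed_deriv a b c f x * \<psi> x)) \<partial>lborel)"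
        by (intro Bochner_Integration.integral_sum)
          (auto intro!: integrable_mult_right integrable_test_mult[OF smooth_continuous_on[OF smooth_mixed_deriv[OF f(1)]] \<psi>])
      also have "\<dots> = (\<Sum>(a, b, c)\<in>exponents m. (-1) ^ m * (multinom a b c * moment a b c * ?T a b c))"
      proof (intro sum.cong refl, clarify)
        fix a b c assume "(a, b, c) \<in> exponents m"
        then have "a + b + c = m" by (simp add: exponents_def)
        moreover have "?T a b c = (-1) ^ (a + b + c) * (\<integral>x. mixed_deriv a b c f x * \<psi> x \<partial>lborel)"
          unfolding f(2) using integral_mixed_deriv[OF f(1) \<psi>] by (simp add: distribution_of_test test_mixed_deriv \<psi>)
        ultimately show "(\<integral>x. (multinom a b c * moment a b c) * (mixed_deriv a b c f x * \<psi> x) \<partial>lborel)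
            = (-1) ^ m * (multinom a b c * moment a b c * ?T a b c)" by (cases "even m") auto
      qed
      also have "\<dots> = (-1) ^ m * (\<Sum>(a, b, c)\<in>exponents m. (multinom a b c * moment a b c) * ?T a b c)"
        unfolding sum_distrib_left by (intro sum.cong) auto
      also have "(\<Sum>(a, b, c)\<in>exponents m. (multinom a b c * moment a b c) * ?T a b c) = 0"
      proof (rule invariant_sum_zero[OF finite_exponents])
        show "rec_A ?T \<or> (rec_B ?T \<and> ((1, 1, 1) \<notin> exponents m \<or> multinom 1 1 1 * moment 1 1 1 = 0))"
          using u \<psi> by (auto simp: harmonic_A_def harmonic_B_def)
        show "multinom b a c * moment b a c = multinom a b c * moment a b c" for a b c
          using moment_swap12[of b a c] by (simp add: multinom_def add_ac mult_ac)
        show "multinom a c b * moment a c b = multinom a b c * moment a b c" for a b c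
          using moment_swap23[of a c b] by (simp add: multinom_def add_ac mult_ac)
      qed (use m moment_odd in \<open>auto simp: exponents_def\<close>)
      finally show "(\<integral>x. ?h x * \<psi> x \<partial>lborel) = 0" by simp
    qed
  qed simp
  then show ?thesis using f(2) by blast
qed

lemma mean_value_distributions_A:
  assumes "moment 2 0 0 \<noteq> 0" "moment 4 0 0 \<noteq> 3 * moment 2 2 0" "moment 1 1 1 \<noteq> 0"
  shows "distribution_of ` {f. mean_value f} = harmonic_A"
  using mean_value_functions_subset(1)[OF _ assms(1,2)] harmonic_is_mean_value assms(3) by blast

lemma mean_value_distributions_B:
  assumes "moment 2 0 0 \<noteq> 0" "moment 4 0 0 \<noteq> 3 * moment 2 2 0" "moment 1 1 1 = 0"
    "3 * moment 6 0 0 - 45 * moment 4 2 0 + 90 * moment 2 2 2 \<noteq> 0"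
  shows "distribution_of ` {f. mean_value f} = harmonic_B"
  using mean_value_functions_subset(2)[OF _ assms(1,2,4)] harmonic_is_mean_value assms(3) by blast

end

text \<open>A derivative that differentiates twice in one variable kills x y z, and every term of
  the generators of the ideal of W(B_3) does so. The derivative once in each variable is 1, however,
  so the generator x y z of the ideal of W(A_3) does not annihilate it.\<close>

lemma xyz_harmonic_B: "distribution_of (monomial3 1 1 1) \<in> harmonic_B - harmonic_A"
proof -
  have tm: "monomial3 1 1 1 = taylor_monomial 1 1 1" by (simp add: taylor_monomial_def fun_eq_iff)
  have c: "continuous_on UNIV (monomial3 1 1 1)" by (rule continuous_on_monomial3)
  have u: "distribution_of (monomial3 1 1 1) \<in> distributions" by (rule distribution_of_in_distributions[OF c])
  have T: "distribution_of (monomial3 1 1 1) (mixed_deriv a b c \<psi>) = (-1) ^ (a + b + c) * (\<integral>x. mixed_deriv a b c (taylor_monomial 1 1 1) x * \<psi> x \<partial>lborel)"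
    if "\<psi> \<in> test_functions" for a b c \<psi>
    using integral_mixed_deriv[OF smooth_taylor_monomial that] by (simp add: distribution_of_test test_mixed_deriv that tm del: One_nat_def)
  have z: "distribution_of (monomial3 1 1 1) (mixed_deriv a b c \<psi>) = 0"
    if "\<psi> \<in> test_functions" "a > 1 \<or> b > 1 \<or> c > 1" for a b c \<psi>
    unfolding T[OF that(1)] using that(2) by (auto simp: mixed_deriv_taylor_monomial)
  then have "distribution_of (monomial3 1 1 1) \<in> harmonic_B"
    using u by (simp add: harmonic_B_def rec_B_def rec_24_def)
  moreover have "distribution_of (monomial3 1 1 1) \<notin> harmonic_A"
  proof
    assume A: "distribution_of (monomial3 1 1 1) \<in> harmonic_A"
    have "(\<integral>x. (\<lambda>x. 1) x * \<psi> x \<partial>lborel) = 0" if \<psi>: "\<psi> \<in> test_functions" for \<psi>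
    proof -
      have "distribution_of (monomial3 1 1 1) (mixed_deriv (0 + 1) (0 + 1) (0 + 1) \<psi>) = 0"
        using A \<psi> unfolding harmonic_A_def rec_A_def by blast
      then show ?thesis using T[OF \<psi>, of 1 1 1] by (simp add: mixed_deriv_taylor_monomial taylor_monomial_def monomial3_def)
    qed
    then have "(1::real) = 0" using continuous_zero_if_test_integrals_zero[of "\<lambda>x. 1"] by simp
    then show False by simp
  qed
  ultimately show ?thesis by blast
qed

section \<open>Symmetry groups\<close>

lemma less_4_cases: "i < 4 \<longleftrightarrow> i = 0 \<or> i = 1 \<or> i = 2 \<or> i = (3::nat)"
  by auto

lemma lessThan_4: "{..<4} = {0, 1, 2, 3 :: nat}"
  by auto

lemma tet_vertex_simps:
  "tet_vertex 0 = vector [1, -1, -1]" "tet_vertex 1 = vector [-1, 1, -1]" "tet_vertex (Suc 0) = vector [-1, 1, -1]"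
  "tet_vertex 2 = vector [-1, -1, 1]" "tet_vertex 3 = vector [1, 1, 1]"
  by (simp_all add: tet_vertex_def)

lemma inner_vec_3: "(x :: real ^ 3) \<bullet> y = x $ 1 * y $ 1 + x $ 2 * y $ 2 + x $ 3 * y $ 3"
  by (simp add: inner_vec_def sum_3)

lemma inner_tet_vertex:
  "tet_vertex 0 \<bullet> x = x $ 1 - x $ 2 - x $ 3" "tet_vertex 1 \<bullet> x = - x $ 1 + x $ 2 - x $ 3"
  "tet_vertex (Suc 0) \<bullet> x = - x $ 1 + x $ 2 - x $ 3"
  "tet_vertex 2 \<bullet> x = - x $ 1 - x $ 2 + x $ 3" "tet_vertex 3 \<bullet> x = x $ 1 + x $ 2 + x $ 3"
  by (simp_all add: tet_vertex_simps inner_vec_3)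

lemma inner_tet_vertex_tet_vertex:
  "i < 4 \<Longrightarrow> j < 4 \<Longrightarrow> tet_vertex i \<bullet> tet_vertex j = (if i = j then 3 else -1)"
  unfolding less_4_cases by (elim disjE) (simp_all add: tet_vertex_simps inner_vec_3)

lemma tet_apex_eq: "i < 4 \<Longrightarrow> tet_apex r i = (- r / 3) *\<^sub>R tet_vertex i"
proof -
  assume i: "i < 4"
  have "(\<Sum>j\<in>{..<4}. tet_vertex j) = 0"
    by (simp add: lessThan_4 tet_vertex_simps vec_eq_iff forall_3)
  then have "(\<Sum>j\<in>{..<4} - {i}. tet_vertex j) = - tet_vertex i"
    using i by (subst sum_diff1) auto
  then show ?thesis by (simp add: tet_apex_def)
qed

text \<open>The four vertices v_p satisfy \<Sum> (v_p . x) v_p = 4 x and \<Sum> v_p = 0. Subtracting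
  the value at l eliminates v_l; all three displayed coefficients are nonnegative when k has the
  smallest and l the second smallest value of v_p . x.\<close>

lemma tet_decomposition:
  assumes d: "distinct [i, j, k, l]" and lt: "i < 4" "j < 4" "k < 4" "l < 4"
  shows "x = ((tet_vertex i \<bullet> x - tet_vertex l \<bullet> x) / 4) *\<^sub>R tet_vertex i
    + ((tet_vertex j \<bullet> x - tet_vertex l \<bullet> x) / 4) *\<^sub>R tet_vertex j
    - ((tet_vertex l \<bullet> x - tet_vertex k \<bullet> x) / 4) *\<^sub>R tet_vertex k"
proof -
  have I: "{..<4} = {i, j, k, l}"
    using d lt by (intro card_subset_eq[symmetric]) auto
  have s: "(\<Sum>p\<in>{..<4}. (tet_vertex p \<bullet> x) *\<^sub>R tet_vertex p) = 4 *\<^sub>R x"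
    by (simp add: lessThan_4 inner_vec_3 tet_vertex_simps vec_eq_iff forall_3)
  have z: "(\<Sum>p\<in>{..<4}. tet_vertex p) = 0"
    by (simp add: lessThan_4 tet_vertex_simps vec_eq_iff forall_3)
  have s': "(tet_vertex i \<bullet> x) *\<^sub>R tet_vertex i + (tet_vertex j \<bullet> x) *\<^sub>R tet_vertex j
      + (tet_vertex k \<bullet> x) *\<^sub>R tet_vertex k + (tet_vertex l \<bullet> x) *\<^sub>R tet_vertex l = 4 *\<^sub>R x"
    using s d unfolding I by (simp add: add.assoc)
  have z': "tet_vertex l = - tet_vertex i - tet_vertex j - tet_vertex k"
  proof -
    have "tet_vertex i + (tet_vertex j + (tet_vertex k + tet_vertex l)) = 0"
      using z d unfolding I by simp
    then show ?thesis by (simp add: algebra_simps eq_neg_iff_add_eq_0)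
  qed
  have "4 *\<^sub>R x = (tet_vertex i \<bullet> x - tet_vertex l \<bullet> x) *\<^sub>R tet_vertex i
      + (tet_vertex j \<bullet> x - tet_vertex l \<bullet> x) *\<^sub>R tet_vertex j
      - (tet_vertex l \<bullet> x - tet_vertex k \<bullet> x) *\<^sub>R tet_vertex k" (is "_ = ?R")
  proof -
    have "c *\<^sub>R tet_vertex l = - (c *\<^sub>R tet_vertex i) - c *\<^sub>R tet_vertex j - c *\<^sub>R tet_vertex k" for c :: real
      by (subst z') (simp add: algebra_simps)
    then show ?thesis unfolding s'[symmetric] by (simp add: algebra_simps)
  qed
  then have "(1/4) *\<^sub>R (4 *\<^sub>R x) = (1/4) *\<^sub>R ?R" by (rule arg_cong)
  then show ?thesis by (simp add: scaleR_add_right scaleR_diff_right)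
qed

section \<open>Symmetries of the tetrahedron\<close>

lemma tetrahedron_halfspaces:
  assumes "x \<in> tetrahedron" "p < 4"
  shows "tet_vertex p \<bullet> x \<ge> -1"
proof -
  have "tet_vertex ` {..<4} \<subseteq> {x. tet_vertex p \<bullet> x \<ge> -1}"
    using assms(2) by (auto simp: inner_tet_vertex_tet_vertex)
  then have "tetrahedron \<subseteq> {x. tet_vertex p \<bullet> x \<ge> -1}"
    unfolding tetrahedron_def by (rule hull_minimal) (rule convex_halfspace_ge)
  then show ?thesis using assms(1) by auto
qed

text \<open>The b p are four times the barycentric coordinates of x. They are nonnegative with sum
  4, and |x|^2 = 3 makes their squares add up to 16, so all products of two of them vanish. Vertices
  are thus recognized by their norm, which orthogonal maps preserve.\<close>

lemma tetrahedron_norm_vertex: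
  assumes x: "x \<in> tetrahedron" and n: "x \<bullet> x = 3"
  shows "x \<in> tet_vertex ` {..<4}"
proof -
  define b where "b p = tet_vertex p \<bullet> x + 1" for p
  have nn: "b 0 \<ge> 0" "b 1 \<ge> 0" "b 2 \<ge> 0" "b 3 \<ge> 0"
    using tetrahedron_halfspaces[OF x, of 0] tetrahedron_halfspaces[OF x, of 1]
      tetrahedron_halfspaces[OF x, of 2] tetrahedron_halfspaces[OF x, of 3] by (simp_all add: b_def)
  have s: "b 0 + b 1 + b 2 + b 3 = 4" by (simp add: b_def inner_tet_vertex)
  have "b 0 * b 0 + b 1 * b 1 + b 2 * b 2 + b 3 * b 3 = 4 * (x \<bullet> x) + 4"
    unfolding b_def inner_tet_vertex by (simp add: inner_vec_3 algebra_simps)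
  then have sq: "b 0 * b 0 + b 1 * b 1 + b 2 * b 2 + b 3 * b 3 = 16" using n by simp
  have "(b 0 + b 1 + b 2 + b 3) * (b 0 + b 1 + b 2 + b 3) = 16" using s by simp
  then have "b 0 * b 1 + b 0 * b 2 + b 0 * b 3 + b 1 * b 2 + b 1 * b 3 + b 2 * b 3 = 0"
    using sq by (simp add: algebra_simps)
  moreover have "b 0 * b 1 \<ge> 0" "b 0 * b 2 \<ge> 0" "b 0 * b 3 \<ge> 0" "b 1 * b 2 \<ge> 0" "b 1 * b 3 \<ge> 0" "b 2 * b 3 \<ge> 0"
    using nn by (simp_all add: mult_nonneg_nonneg)
  ultimately have c: "b 0 * b 1 = 0" "b 0 * b 2 = 0" "b 0 * b 3 = 0" "b 1 * b 2 = 0" "b 1 * b 3 = 0" "b 2 * b 3 = 0"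
    by linarith+
  have x1: "4 * x $ 1 = b 0 - b 1 - b 2 + b 3" and x2: "4 * x $ 2 = - b 0 + b 1 - b 2 + b 3"
    and x3: "4 * x $ 3 = - b 0 - b 1 + b 2 + b 3" by (simp_all add: b_def inner_tet_vertex)
  have "\<not> (b 0 = 0 \<and> b 1 = 0 \<and> b 2 = 0 \<and> b 3 = 0)" using s by auto
  then consider "b 0 \<noteq> 0" | "b 1 \<noteq> 0" | "b 2 \<noteq> 0" | "b 3 \<noteq> 0" by blast
  then show ?thesis
  proof cases
    case 1
    then have "b 1 = 0" "b 2 = 0" "b 3 = 0" using c by auto
    then have "x = tet_vertex 0" using s x1 x2 x3 by (simp add: tet_vertex_simps vec_eq_iff forall_3)
    then show ?thesis by auto
  next
    case 2
    then have "b 0 = 0" "b 2 = 0" "b 3 = 0" using c by auto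
    then have "x = tet_vertex 1" using s x1 x2 x3 by (simp add: tet_vertex_simps vec_eq_iff forall_3)
    then show ?thesis by auto
  next
    case 3
    then have "b 0 = 0" "b 1 = 0" "b 3 = 0" using c by auto
    then have "x = tet_vertex 2" using s x1 x2 x3 by (simp add: tet_vertex_simps vec_eq_iff forall_3)
    then show ?thesis by auto
  next
    case 4
    then have "b 0 = 0" "b 1 = 0" "b 2 = 0" using c by auto
    then have "x = tet_vertex 3" using s x1 x2 x3 by (simp add: tet_vertex_simps vec_eq_iff forall_3)
    then show ?thesis by auto
  qed
qed

lemma inj_on_tet_vertex: "inj_on tet_vertex {..<4}"
  unfolding lessThan_4 by (auto simp: inj_on_def tet_vertex_simps vec_eq_iff forall_3)

text \<open>An orthogonal map permuting V permutes the linear forms given by V, so their power sums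
  are invariant. This yields the basic invariants without a list of the group elements.\<close>

lemma power_sum_invariant:
  fixes g :: "real ^ 3 \<Rightarrow> real ^ 3"
  assumes g: "orthogonal_transformation g" and V: "finite V" "g ` V \<subseteq> V"
  shows "(\<Sum>v\<in>V. (v \<bullet> g x) ^ m) = (\<Sum>v\<in>V. (v \<bullet> x) ^ m)"
proof -
  have inj: "inj_on g V" using orthogonal_transformation_inj[OF g] by (rule inj_on_subset) auto
  then have "g ` V = V" using V by (simp add: card_image card_subset_eq)
  then have "(\<Sum>v\<in>V. (v \<bullet> g x) ^ m) = (\<Sum>v\<in>g ` V. (v \<bullet> g x) ^ m)" by simp
  also have "\<dots> = (\<Sum>v\<in>V. (g v \<bullet> g x) ^ m)" using inj by (simp add: sum.reindex)
  also have "\<dots> = (\<Sum>v\<in>V. (v \<bullet> x) ^ m)" using g by (simp add: orthogonal_transformation_def)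
  finally show ?thesis .
qed

lemma tet_power_sum: "(\<Sum>v\<in>tet_vertex ` {..<4}. (v \<bullet> x) ^ m) =
  (x $ 1 - x $ 2 - x $ 3) ^ m + (- x $ 1 + x $ 2 - x $ 3) ^ m + (- x $ 1 - x $ 2 + x $ 3) ^ m + (x $ 1 + x $ 2 + x $ 3) ^ m"
  unfolding sum.reindex[OF inj_on_tet_vertex] by (simp add: lessThan_4 inner_tet_vertex)

lemma orthogonal_sum_squares:
  fixes g :: "real ^ 3 \<Rightarrow> real ^ 3"
  assumes "orthogonal_transformation g"
  shows "g x $ 1 ^ 2 + g x $ 2 ^ 2 + g x $ 3 ^ 2 = (x::real^3) $ 1 ^ 2 + x $ 2 ^ 2 + x $ 3 ^ 2"
proof -
  have "g x \<bullet> g x = x \<bullet> x" using assms by (simp add: orthogonal_transformation_def)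
  then show ?thesis by (simp add: inner_vec_3 power2_eq_square)
qed

lemma W_A3_vertices:
  assumes "g \<in> W_A3"
  shows "orthogonal_transformation g" "g ` tet_vertex ` {..<4} \<subseteq> tet_vertex ` {..<4}"
proof -
  show g: "orthogonal_transformation g" using assms by (simp add: W_A3_def symmetry_group_def)
  show "g ` tet_vertex ` {..<4} \<subseteq> tet_vertex ` {..<4}"
  proof
    fix y assume "y \<in> g ` tet_vertex ` {..<4}"
    then obtain i where i: "i < 4" "y = g (tet_vertex i)" by auto
    have "tet_vertex i \<in> tetrahedron" using i by (auto simp: tetrahedron_def intro: hull_inc)
    then have "y \<in> tetrahedron" using assms i by (auto simp: W_A3_def symmetry_group_def)
    moreover have "y \<bullet> y = 3" using i g by (simp add: orthogonal_transformation_def inner_tet_vertex_tet_vertex)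
    ultimately show "y \<in> tet_vertex ` {..<4}" by (rule tetrahedron_norm_vertex)
  qed
qed

lemma cubic_power_sum: "(x - y - z) ^ 3 + (- x + y - z) ^ 3 + (- x - y + z) ^ 3 + (x + y + z) ^ 3 = 24 * (x * y * z)" for x y z :: real
  by (simp add: power3_eq_cube algebra_simps)

lemma quartic_power_sum: "(x - y - z) ^ 4 + (- x + y - z) ^ 4 + (- x - y + z) ^ 4 + (x + y + z) ^ 4
    = 12 * (x\<^sup>2 + y\<^sup>2 + z\<^sup>2)\<^sup>2 - 8 * (x ^ 4 + y ^ 4 + z ^ 4)" for x y z :: real
  by algebra

text \<open>Solved for (x y z)^2, this identity expresses an invariant of the cube through p_2, p_4
  and a power sum over vertices.\<close>

lemma sextic_power_sum: "(x - y - z) ^ 6 + (- x + y - z) ^ 6 + (- x - y + z) ^ 6 + (x + y + z) ^ 6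
    = 192 * (x * y * z)\<^sup>2 - 24 * (x\<^sup>2 + y\<^sup>2 + z\<^sup>2) * (x ^ 4 + y ^ 4 + z ^ 4) + 28 * (x\<^sup>2 + y\<^sup>2 + z\<^sup>2) ^ 3" for x y z :: real
  by algebra

lemma W_A3_harmonic_subset: "group_harmonic W_A3 \<subseteq> harmonic_A"
proof (rule group_harmonic_subset_A)
  fix g x assume g: "g \<in> W_A3"
  note inv = power_sum_invariant[OF W_A3_vertices(1)[OF g] finite_imageI[OF finite_lessThan] W_A3_vertices(2)[OF g],
      of x, unfolded tet_power_sum]
  have sq: "g x $ 1 ^ 2 + g x $ 2 ^ 2 + g x $ 3 ^ 2 = x $ 1 ^ 2 + x $ 2 ^ 2 + x $ 3 ^ 2"
    by (rule orthogonal_sum_squares[OF W_A3_vertices(1)[OF g]])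
  show "g x $ 1 * g x $ 2 * g x $ 3 = x $ 1 * x $ 2 * x $ 3"
    using inv[of 3] unfolding cubic_power_sum by simp
  fix n :: nat assume "n = 2 \<or> n = 4"
  then show "g x $ 1 ^ n + g x $ 2 ^ n + g x $ 3 ^ n = x $ 1 ^ n + x $ 2 ^ n + x $ 3 ^ n"
  proof
    assume "n = 4"
    then show ?thesis using inv[of 4] unfolding quartic_power_sum sq by simp
  qed (simp add: sq)
qed

section \<open>Symmetries of the cube\<close>

definition cube_vertices :: "(real ^ 3) set" where
  "cube_vertices = {x. \<forall>i. x $ i = 1 \<or> x $ i = -1}"

lemma cube_vertices_eq: "cube_vertices = tet_vertex ` {..<4} \<union> uminus ` tet_vertex ` {..<4}"
proof -
  have "x \<in> cube_vertices \<longleftrightarrow> x \<in> tet_vertex ` {..<4} \<union> uminus ` tet_vertex ` {..<4}" for x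
    unfolding lessThan_4 by (auto simp: cube_vertices_def tet_vertex_simps vec_eq_iff forall_3)
  then show ?thesis by blast
qed

lemma cube_power_sum:
  assumes "even m"
  shows "(\<Sum>v\<in>cube_vertices. (v \<bullet> x) ^ m) = 2 * (\<Sum>v\<in>tet_vertex ` {..<4}. (v \<bullet> x) ^ m)"
proof -
  have d: "tet_vertex ` {..<4} \<inter> uminus ` tet_vertex ` {..<4} = {}"
    unfolding lessThan_4 by (auto simp: tet_vertex_simps vec_eq_iff forall_3)
  have "(\<Sum>v\<in>cube_vertices. (v \<bullet> x) ^ m) = (\<Sum>v\<in>tet_vertex ` {..<4}. (v \<bullet> x) ^ m) + (\<Sum>v\<in>uminus ` tet_vertex ` {..<4}. (v \<bullet> x) ^ m)"
    unfolding cube_vertices_eq by (rule sum.union_disjoint) (use d in auto)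
  also have "(\<Sum>v\<in>uminus ` tet_vertex ` {..<4}. (v \<bullet> x) ^ m) = (\<Sum>v\<in>tet_vertex ` {..<4}. (v \<bullet> x) ^ m)"
    using assms by (subst sum.reindex) (auto simp: inj_on_def)
  finally show ?thesis by simp
qed

lemma cube_hull_bound: "x \<in> convex hull cube_vertices \<Longrightarrow> \<bar>x $ i\<bar> \<le> 1"
proof -
  have 1: "convex {x :: real ^ 3. \<bar>x $ i\<bar> \<le> 1}"
  proof -
    have "{x :: real ^ 3. \<bar>x $ i\<bar> \<le> 1} = {x. axis i 1 \<bullet> x \<le> 1} \<inter> {x. axis i 1 \<bullet> x \<ge> -1}"
      by (auto simp: inner_axis')
    then show ?thesis by (simp add: convex_Int convex_halfspace_le convex_halfspace_ge)
  qed
  have "cube_vertices \<subseteq> {x :: real ^ 3. \<bar>x $ i\<bar> \<le> 1}"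
  proof
    fix x :: "real ^ 3" assume "x \<in> cube_vertices"
    then have "x $ i = 1 \<or> x $ i = -1" by (simp add: cube_vertices_def)
    then show "x \<in> {x. \<bar>x $ i\<bar> \<le> 1}" by auto
  qed
  then have "convex hull cube_vertices \<subseteq> {x :: real ^ 3. \<bar>x $ i\<bar> \<le> 1}" using 1 by (rule hull_minimal)
  then show "x \<in> convex hull cube_vertices \<Longrightarrow> \<bar>x $ i\<bar> \<le> 1" by auto
qed

lemma W_B3_vertices:
  assumes "g \<in> W_B3"
  shows "orthogonal_transformation g" "g ` cube_vertices \<subseteq> cube_vertices"
proof -
  have W: "orthogonal_transformation g" "g ` (convex hull cube_vertices) = convex hull cube_vertices"
    using assms by (auto simp: W_B3_def symmetry_group_def cube_vertices_def)
  show "orthogonal_transformation g" by (rule W)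
  show "g ` cube_vertices \<subseteq> cube_vertices"
  proof
    fix y assume "y \<in> g ` cube_vertices"
    then obtain v where v: "v \<in> cube_vertices" "y = g v" by auto
    have "y \<in> convex hull cube_vertices" using W(2) v hull_inc[of v cube_vertices] by blast
    then have b: "\<bar>y $ i\<bar> \<le> 1" for i by (rule cube_hull_bound)
    have "v \<bullet> v = 3" using v(1) by (auto simp: inner_vec_3 cube_vertices_def forall_3)
    then have "y \<bullet> y = 3" using v W(1) by (simp add: orthogonal_transformation_def)
    then have s: "(y $ 1)\<^sup>2 + (y $ 2)\<^sup>2 + (y $ 3)\<^sup>2 = 3" by (simp add: inner_vec_3 power2_eq_square)
    \<comment> \<open>Three squares that are at most 1 and add up to 3 all equal 1.\<close>
    have "(y $ i)\<^sup>2 \<le> 1" for i using b[of i] by (simp add: abs_square_le_1)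
    from this[of 1] this[of 2] this[of 3] s have "(y $ 1)\<^sup>2 = 1" "(y $ 2)\<^sup>2 = 1" "(y $ 3)\<^sup>2 = 1" by linarith+
    then show "y \<in> cube_vertices" by (simp add: cube_vertices_def forall_3 power2_eq_1_iff)
  qed
qed

lemma finite_cube_vertices: "finite cube_vertices"
  unfolding cube_vertices_eq by simp

lemma W_B3_harmonic_subset: "group_harmonic W_B3 \<subseteq> harmonic_B"
proof (rule group_harmonic_subset_B)
  fix g x assume g: "g \<in> W_B3"
  have inv: "(\<Sum>v\<in>tet_vertex ` {..<4}. (v \<bullet> g x) ^ m) = (\<Sum>v\<in>tet_vertex ` {..<4}. (v \<bullet> x) ^ m)" if "even m" for m
    using power_sum_invariant[OF W_B3_vertices(1)[OF g] finite_cube_vertices W_B3_vertices(2)[OF g], of x m] cube_power_sum[OF that] by simp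
  have sq: "g x $ 1 ^ 2 + g x $ 2 ^ 2 + g x $ 3 ^ 2 = x $ 1 ^ 2 + x $ 2 ^ 2 + x $ 3 ^ 2"
    by (rule orthogonal_sum_squares[OF W_B3_vertices(1)[OF g]])
  have qu: "g x $ 1 ^ 4 + g x $ 2 ^ 4 + g x $ 3 ^ 4 = x $ 1 ^ 4 + x $ 2 ^ 4 + x $ 3 ^ 4"
    using inv[of 4] unfolding tet_power_sum quartic_power_sum sq by simp
  show "(g x $ 1 * g x $ 2 * g x $ 3)\<^sup>2 = (x $ 1 * x $ 2 * x $ 3)\<^sup>2"
    using inv[of 6] unfolding tet_power_sum sextic_power_sum sq qu by simp
  fix n :: nat assume "n = 2 \<or> n = 4"
  then show "g x $ 1 ^ n + g x $ 2 ^ n + g x $ 3 ^ n = x $ 1 ^ n + x $ 2 ^ n + x $ 3 ^ n"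
    using sq qu by auto
qed

section \<open>Generators acting on the skeletons\<close>

lemma linear_generators: "linear swap12" "linear swap23" "linear neg12"
  unfolding swap12_def[abs_def] swap23_def[abs_def] neg12_def[abs_def]
  by (rule linearI; simp add: vec_eq_iff forall_3)+

lemma orthogonal_generators:
  "orthogonal_transformation swap12" "orthogonal_transformation swap23" "orthogonal_transformation neg12"
  unfolding orthogonal_transformation_def
  by (simp_all add: linear_generators inner_vec_3) (simp_all add: swap12_def swap23_def neg12_def)

lemma generators_involutive: "swap12 (swap12 x) = x" "swap23 (swap23 x) = x" "neg12 (neg12 x) = x"
  by (simp_all add: swap12_def swap23_def neg12_def vec_eq_iff forall_3)

definition vertex_permuting :: "(real ^ 3 \<Rightarrow> real ^ 3) \<Rightarrow> (nat \<Rightarrow> nat) \<Rightarrow> bool" where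
  "vertex_permuting g \<sigma> \<longleftrightarrow> linear g \<and> (\<forall>x. g (g x) = x) \<and> bij_betw \<sigma> {..<4} {..<4} \<and>
     (\<forall>i<4. g (tet_vertex i) = tet_vertex (\<sigma> i))"

lemma vertex_permuting_generators:
  "\<exists>\<sigma>. vertex_permuting swap12 \<sigma>" "\<exists>\<sigma>. vertex_permuting swap23 \<sigma>" "\<exists>\<sigma>. vertex_permuting neg12 \<sigma>"
proof -
  show "\<exists>\<sigma>. vertex_permuting swap12 \<sigma>"
    by (rule exI[of _ "\<lambda>i. [1, 0, 2, 3] ! i"])
      (auto simp: vertex_permuting_def linear_generators generators_involutive less_4_cases lessThan_4 bij_betw_def inj_on_def
        tet_vertex_simps swap12_def vec_eq_iff forall_3)
  show "\<exists>\<sigma>. vertex_permuting swap23 \<sigma>"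
    by (rule exI[of _ "\<lambda>i. [0, 2, 1, 3] ! i"])
      (auto simp: vertex_permuting_def linear_generators generators_involutive less_4_cases lessThan_4 bij_betw_def inj_on_def
        tet_vertex_simps swap23_def vec_eq_iff forall_3)
  show "\<exists>\<sigma>. vertex_permuting neg12 \<sigma>"
    by (rule exI[of _ "\<lambda>i. [1, 0, 3, 2] ! i"])
      (auto simp: vertex_permuting_def linear_generators generators_involutive less_4_cases lessThan_4 bij_betw_def inj_on_def
        tet_vertex_simps neg12_def vec_eq_iff forall_3)
qed

lemma vertex_permuting_skeleton:
  assumes "vertex_permuting g \<sigma>"
  shows "g ` skeleton r k = skeleton r k" "g ` tetrahedron = tetrahedron"
proof -
  have lin: "linear g" and inv: "\<And>x. g (g x) = x" and bij: "bij_betw \<sigma> {..<4} {..<4}"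
    and gv: "\<And>i. i < 4 \<Longrightarrow> g (tet_vertex i) = tet_vertex (\<sigma> i)"
    using assms by (auto simp: vertex_permuting_def)
  have \<sigma>: "\<sigma> i < 4" if "i < 4" for i using bij that by (auto simp: bij_betw_def)
  have \<sigma>neq: "\<sigma> i \<noteq> \<sigma> j" if "i < 4" "j < 4" "i \<noteq> j" for i j
    using bij that by (auto simp: bij_betw_def inj_on_def)
  have ga: "g (tet_apex r i) = tet_apex r (\<sigma> i)" if "i < 4" for i
    using that by (simp only: tet_apex_eq \<sigma> gv linear_cmul[OF lin])
  have invol: "g ` S = S" if "g ` S \<subseteq> S" for S
  proof
    show "S \<subseteq> g ` S"
    proof
      fix x assume "x \<in> S"
      then have "g x \<in> S" using that by blast
      then show "x \<in> g ` S" using inv[of x] by (metis imageI)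
    qed
  qed (rule that)
  have V: "g ` tet_vertex ` {..<4} = tet_vertex ` {..<4}" by (rule invol) (use gv \<sigma> in auto)
  then show T: "g ` tetrahedron = tetrahedron"
    unfolding tetrahedron_def by (simp add: convex_hull_linear_image[OF lin])
  have pyr: "g ` pyramid r i = pyramid r (\<sigma> i)" if i: "i < 4" for i
  proof -
    have "g ` tet_vertex ` ({..<4} - {i}) = tet_vertex ` \<sigma> ` ({..<4} - {i})"
      unfolding image_image using gv by (intro image_cong) auto
    also have "\<sigma> ` ({..<4} - {i}) = {..<4} - {\<sigma> i}"
      using bij i by (subst inj_on_image_set_diff[of \<sigma> "{..<4}"]) (auto simp: bij_betw_def)
    finally show ?thesis
      unfolding pyramid_def using i by (simp add: convex_hull_linear_image[OF lin] ga)
  qed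
  have solid: "g ` triakis_solid r \<subseteq> triakis_solid r"
  proof (cases "r \<ge> 1")
    case True
    have "g ` (\<Union>i<4. pyramid r i) \<subseteq> (\<Union>i<4. pyramid r i)" using pyr \<sigma> by fastforce
    then show ?thesis using True T by (auto simp: triakis_solid_def image_Un)
  next
    case False
    let ?D = "tetrahedron - (\<Union>i<4. pyramid r i)"
    have "g ` ?D \<subseteq> ?D"
    proof
      fix y assume "y \<in> g ` ?D"
      then obtain x where x: "x \<in> tetrahedron" "\<And>i. i < 4 \<Longrightarrow> x \<notin> pyramid r i" "y = g x" by auto
      have "y \<notin> pyramid r j" if "j < 4" for j
      proof
        assume "y \<in> pyramid r j"
        then have "g y \<in> pyramid r (\<sigma> j)" using pyr[OF that] by blast
        then show False using x(2)[OF \<sigma>[OF that]] x(3) inv by simp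
      qed
      moreover have "y \<in> tetrahedron" using x T by blast
      ultimately show "y \<in> ?D" by auto
    qed
    then have "closure (g ` ?D) \<subseteq> closure ?D" by (rule closure_mono)
    moreover have "g ` closure ?D \<subseteq> closure (g ` ?D)"
      using lin by (intro closure_bounded_linear_image_subset) (simp add: linear_conv_bounded_linear)
    ultimately show ?thesis using False by (auto simp: triakis_solid_def)
  qed
  have verts: "g ` triakis_vertices r \<subseteq> triakis_vertices r"
    unfolding triakis_vertices_def image_Un V using ga \<sigma> by auto
  have edges: "g ` \<Union> (triakis_edges r) \<subseteq> \<Union> (triakis_edges r)"
  proof
    fix y assume "y \<in> g ` \<Union> (triakis_edges r)"
    then obtain x e where x: "x \<in> e" "e \<in> triakis_edges r" "y = g x" by auto
    have "g ` e \<in> triakis_edges r"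
      using x(2) unfolding triakis_edges_def
    proof
      assume "e \<in> {closed_segment (tet_vertex i) (tet_vertex j) | i j. i < 4 \<and> j < 4 \<and> i \<noteq> j}"
      then obtain i j where ij: "e = closed_segment (tet_vertex i) (tet_vertex j)" "i < 4" "j < 4" "i \<noteq> j" by blast
      then have "g ` e = closed_segment (tet_vertex (\<sigma> i)) (tet_vertex (\<sigma> j))"
        by (simp add: closed_segment_linear_image[OF lin, symmetric] gv)
      then show "g ` e \<in> {closed_segment (tet_vertex i) (tet_vertex j) | i j. i < 4 \<and> j < 4 \<and> i \<noteq> j}
          \<union> {closed_segment (tet_vertex i) (tet_apex r j) | i j. i < 4 \<and> j < 4 \<and> i \<noteq> j}"
        using \<sigma>[OF ij(2)] \<sigma>[OF ij(3)] \<sigma>neq[OF ij(2-4)] by blast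
    next
      assume "e \<in> {closed_segment (tet_vertex i) (tet_apex r j) | i j. i < 4 \<and> j < 4 \<and> i \<noteq> j}"
      then obtain i j where ij: "e = closed_segment (tet_vertex i) (tet_apex r j)" "i < 4" "j < 4" "i \<noteq> j" by blast
      then have "g ` e = closed_segment (tet_vertex (\<sigma> i)) (tet_apex r (\<sigma> j))"
        by (simp add: closed_segment_linear_image[OF lin, symmetric] gv ga)
      then show "g ` e \<in> {closed_segment (tet_vertex i) (tet_vertex j) | i j. i < 4 \<and> j < 4 \<and> i \<noteq> j}
          \<union> {closed_segment (tet_vertex i) (tet_apex r j) | i j. i < 4 \<and> j < 4 \<and> i \<noteq> j}"
        using \<sigma>[OF ij(2)] \<sigma>[OF ij(3)] \<sigma>neq[OF ij(2-4)] by blast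
    qed
    then show "y \<in> \<Union> (triakis_edges r)" using x by blast
  qed
  have faces: "g ` \<Union> (triakis_faces r) \<subseteq> \<Union> (triakis_faces r)"
  proof
    fix y assume "y \<in> g ` \<Union> (triakis_faces r)"
    then obtain x e where x: "x \<in> e" "e \<in> triakis_faces r" "y = g x" by auto
    then obtain i j k where ijk: "e = convex hull {tet_vertex i, tet_vertex j, tet_apex r k}"
        "i < 4" "j < 4" "k < 4" "i \<noteq> j" "k \<noteq> i" "k \<noteq> j" unfolding triakis_faces_def by blast
    have "g ` e = convex hull {tet_vertex (\<sigma> i), tet_vertex (\<sigma> j), tet_apex r (\<sigma> k)}"
      unfolding ijk(1) convex_hull_linear_image[OF lin] using ijk by (simp add: gv ga)
    then have "g ` e \<in> triakis_faces r"
      unfolding triakis_faces_def using \<sigma>[OF ijk(2)] \<sigma>[OF ijk(3)] \<sigma>[OF ijk(4)]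
        \<sigma>neq[OF ijk(2,3,5)] \<sigma>neq[OF ijk(4,2,6)] \<sigma>neq[OF ijk(4,3,7)] by blast
    then show "y \<in> \<Union> (triakis_faces r)" using x by blast
  qed
  show "g ` skeleton r k = skeleton r k"
    by (rule invol) (simp add: skeleton_def solid verts edges faces)
qed

lemma generators_in_groups:
  assumes "h = swap12 \<or> h = swap23 \<or> h = neg12"
  shows "h \<in> symmetry_group (skeleton r k)" "h \<in> W_A3" "h \<in> W_B3"
proof -
  have o: "orthogonal_transformation h" using assms orthogonal_generators by auto
  obtain \<sigma> where \<sigma>: "vertex_permuting h \<sigma>" using assms vertex_permuting_generators by blast
  show "h \<in> symmetry_group (skeleton r k)" "h \<in> W_A3"
    using o vertex_permuting_skeleton[OF \<sigma>] by (auto simp: symmetry_group_def W_A3_def)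
  have lin: "linear h" using o by (simp add: orthogonal_transformation_def)
  have inv: "h (h x) = x" for x using assms generators_involutive by auto
  have sub: "h ` cube_vertices \<subseteq> cube_vertices"
    using assms by (auto simp: cube_vertices_def swap12_def swap23_def neg12_def forall_3)
  moreover have "cube_vertices \<subseteq> h ` cube_vertices"
  proof
    fix x assume "x \<in> cube_vertices"
    then have "h x \<in> cube_vertices" using sub by blast
    then show "x \<in> h ` cube_vertices" using inv[of x] by (metis imageI)
  qed
  ultimately have "h ` cube_vertices = cube_vertices" by blast
  then show "h \<in> W_B3"
    using o unfolding W_B3_def symmetry_group_def cube_vertices_def[symmetric]
    by (simp add: convex_hull_linear_image[OF lin])
qed

lemma orthogonal_uminus: "orthogonal_transformation (uminus :: real ^ 3 \<Rightarrow> real ^ 3)"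
  by (simp add: orthogonal_transformation_def linear_uminus)

lemma uminus_W_B3: "uminus \<in> W_B3"
proof -
  have "uminus ` cube_vertices = cube_vertices"
    unfolding cube_vertices_eq image_Un by (simp add: image_image Un_commute)
  then show ?thesis
    using orthogonal_uminus unfolding W_B3_def symmetry_group_def cube_vertices_def[symmetric]
    by (simp add: convex_hull_linear_image[of uminus] linear_uminus)
qed

lemma group_harmonic_W_A3: "group_harmonic W_A3 = harmonic_A"
proof
  show "harmonic_A \<subseteq> group_harmonic W_A3"
    by (rule subsetI, rule harmonic_subset_group_harmonic) (simp_all add: generators_in_groups(2))
qed (rule W_A3_harmonic_subset)

lemma group_harmonic_W_B3: "group_harmonic W_B3 = harmonic_B"
proof
  show "harmonic_B \<subseteq> group_harmonic W_B3"
    by (rule subsetI, rule harmonic_subset_group_harmonic) (simp_all add: generators_in_groups(3) uminus_W_B3)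
qed (rule W_B3_harmonic_subset)

lemma harmonic_A_subset_skeleton: "harmonic_A \<subseteq> group_harmonic (symmetry_group (skeleton r k))"
  by (rule subsetI, rule harmonic_subset_group_harmonic) (simp_all add: generators_in_groups(1))

section \<open>Integration over cells\<close>

lemma hausdorff_isometry:
  fixes g :: "'a::euclidean_space \<Rightarrow> 'a"
  assumes g: "orthogonal_transformation g"
  shows "distr (hausdorff_measure k) borel g = hausdorff_measure k"
proof (rule measure_eqI)
  have cont: "continuous_on UNIV g"
    using g by (simp add: orthogonal_transformation_linear linear_continuous_on linear_linear)
  then have m: "g \<in> borel_measurable borel" by (rule borel_measurable_continuous_onI)
  fix A assume "A \<in> sets (distr (hausdorff_measure k) borel g)"
  then have A: "A \<in> sets borel" by simp
  have A': "g -` A \<in> sets borel" using measurable_sets[OF m A] by simp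
  have surj: "g ` (g -` A) = A" using orthogonal_transformation_surj[OF g] by (rule surj_image_vimage_eq)
  have "hausdorff_outer_measure k (g ` (g -` A)) = ennreal (1 ^ k) * hausdorff_outer_measure k (g -` A)"
    using g orthogonal_transformation_isometry[of g] by (intro hausdorff_outer_measure_similarity) auto
  then have "hausdorff_outer_measure k A = hausdorff_outer_measure k (g -` A)" unfolding surj by simp
  then show "emeasure (distr (hausdorff_measure k) borel g) A = emeasure (hausdorff_measure k) A"
    using A A' m by (subst emeasure_distr) (simp_all add: emeasure_hausdorff_measure cong: measurable_cong_sets)
qed simp

lemma hausdorff_set_integral_isometry:
  fixes g :: "'a::euclidean_space \<Rightarrow> 'a" and h :: "'a \<Rightarrow> real"
  assumes g: "orthogonal_transformation g" and S: "g ` S = S" "S \<in> sets borel" and h: "h \<in> borel_measurable borel"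
  shows "set_lebesgue_integral (hausdorff_measure k) S (\<lambda>y. h (g y)) = set_lebesgue_integral (hausdorff_measure k) S h"
proof -
  have cont: "continuous_on UNIV g"
    using g by (simp add: orthogonal_transformation_linear linear_continuous_on linear_linear)
  then have m: "g \<in> measurable (hausdorff_measure k) borel"
    using borel_measurable_continuous_onI by (simp cong: measurable_cong_sets)
  have iff: "g y \<in> S \<longleftrightarrow> y \<in> S" for y
    using S(1) orthogonal_transformation_inj[OF g] by (metis image_eqI image_iff injD)
  have "set_lebesgue_integral (hausdorff_measure k) S h = (\<integral>y. indicator S y *\<^sub>R h y \<partial>distr (hausdorff_measure k) borel g)"
    unfolding hausdorff_isometry[OF g] set_lebesgue_integral_def ..
  also have "\<dots> = (\<integral>y. indicator S (g y) *\<^sub>R h (g y) \<partial>hausdorff_measure k)"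
    using h S(2) by (intro integral_distr[OF m]) auto
  also have "\<dots> = set_lebesgue_integral (hausdorff_measure k) S (\<lambda>y. h (g y))"
    unfolding set_lebesgue_integral_def by (simp add: indicator_def iff)
  finally show ?thesis by simp
qed

text \<open>The map taking L t to L' t is a similarity with factor c, so the ratio of the two cell
  constants is known although neither constant is.\<close>

lemma hausdorff_cube_image_scaling:
  fixes L L' :: "'a::euclidean_space \<Rightarrow> 'b::euclidean_space"
  assumes L: "linear L" "inj L" and L': "linear L'" and n: "\<And>t. norm (L' t) = c * norm (L t)" and c: "c > 0"
  shows "measure (hausdorff_measure k) (L' ` cbox 0 One) = c ^ k * measure (hausdorff_measure k) (L ` cbox 0 One)"
proof -
  have cpt: "M ` cbox 0 One \<in> sets borel" if "linear M" for M :: "'a \<Rightarrow> 'b"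
    using that by (intro borel_compact compact_continuous_image) (auto simp: linear_continuous_on linear_linear)
  obtain g where g: "linear g" "\<And>t. g (L t) = t"
    using linear_injective_left_inverse[OF L] by (auto simp: fun_eq_iff)
  have "hausdorff_outer_measure k ((L' \<circ> g) ` (L ` cbox 0 One)) = ennreal (c ^ k) * hausdorff_outer_measure k (L ` cbox 0 One)"
  proof (rule hausdorff_outer_measure_similarity[OF _ c])
    fix x y assume "x \<in> L ` cbox 0 One" "y \<in> L ` cbox 0 One"
    then obtain s t where "x = L s" "y = L t" by auto
    then show "dist ((L' \<circ> g) x) ((L' \<circ> g) y) = c * dist x y"
      using n[of "s - t"] L L' by (simp add: g dist_norm linear_diff)
  qed
  moreover have "(L' \<circ> g) ` (L ` cbox 0 One) = L' ` cbox 0 One" by (simp add: image_comp g o_def)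
  ultimately have "emeasure (hausdorff_measure k) (L' ` cbox 0 One) = ennreal (c ^ k) * emeasure (hausdorff_measure k) (L ` cbox 0 One)"
    using cpt L L' by (simp add: emeasure_hausdorff_measure)
  then show ?thesis using c by (simp add: measure_def enn2real_mult)
qed

text \<open>Closed cells overlap at most in images of the null set D - D0, so integrals over S add
  up over the cells. S is merely pinched between the open and the closed cells, which is the form in
  which the excavated solid is known.\<close>

lemma hausdorff_cells:
  fixes L :: "'i \<Rightarrow> 'a::euclidean_space \<Rightarrow> 'b::euclidean_space" and p :: "'i \<Rightarrow> 'b" and D D0 :: "'a set"
  defines "H \<equiv> hausdorff_measure DIM('a) :: 'b measure"
  defines "q \<equiv> \<lambda>i t. p i + L i t"
  defines "c \<equiv> \<lambda>i. measure H (L i ` cbox 0 One)"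
  assumes I: "finite I" and L: "\<And>i. i \<in> I \<Longrightarrow> linear (L i)" "\<And>i. i \<in> I \<Longrightarrow> inj (L i)"
    and D: "compact D" "D0 \<subseteq> D" "D0 \<in> sets borel" "D - D0 \<in> null_sets lborel"
    and disj: "\<And>i j. i \<in> I \<Longrightarrow> j \<in> I \<Longrightarrow> i \<noteq> j \<Longrightarrow> q i ` D0 \<inter> q j ` D0 = {}"
    and S: "S \<in> sets borel" "(\<Union>i\<in>I. q i ` D0) \<subseteq> S" "S \<subseteq> (\<Union>i\<in>I. q i ` D)"
  shows "emeasure H S = (\<Sum>i\<in>I. ennreal (c i) * emeasure lborel D)"
    and "continuous_on UNIV h \<Longrightarrow> set_lebesgue_integral H S h
      = (\<Sum>i\<in>I. c i * set_lebesgue_integral lborel D (\<lambda>t. h (q i t) :: real))"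
proof -
  have Db: "D \<in> sets borel" using D(1) by (rule borel_compact)
  have qb: "q i ` A \<in> sets borel" and eq: "emeasure H (q i ` A) = ennreal (c i) * emeasure lborel A"
    if "i \<in> I" "A \<in> sets borel" for i A
    using affine_hausdorff_integral(3,4)[OF L(1)[OF that(1)] L(2)[OF that(1)] that(2), of "p i"] by (auto simp: q_def c_def H_def)
  have sH: "sets H = sets borel" by (simp add: H_def)
  define U where "U = (\<Union>i\<in>I. q i ` D0)"
  define Z where "Z = (\<Union>i\<in>I. q i ` (D - D0))"
  have Ub: "U \<in> sets borel" unfolding U_def using I qb D by blast
  have DD: "D - D0 \<in> sets borel" using Db D(3) by simp
  have "Z \<in> null_sets H"
    unfolding Z_def
  proof (rule null_sets_UN')
    show "countable I" using I by (rule countable_finite)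
    fix i assume i: "i \<in> I"
    show "q i ` (D - D0) \<in> null_sets H"
      using qb[OF i DD] eq[OF i DD] D(4) by (auto simp: null_sets_def sH)
  qed
  then have ae: "AE x in H. x \<notin> Z" by (rule AE_not_in)
  have SU: "x \<in> S \<longleftrightarrow> x \<in> U" if x: "x \<notin> Z" for x
  proof
    assume "x \<in> S"
    then obtain i t where it: "i \<in> I" "t \<in> D" "x = q i t" using S(3) by auto
    with x have "t \<in> D0" unfolding Z_def by auto
    with it show "x \<in> U" unfolding U_def by auto
  next
    assume "x \<in> U"
    then show "x \<in> S" unfolding U_def using S(2) by auto
  qed
  have aeSU: "AE x in H. x \<in> S \<longleftrightarrow> x \<in> U" using ae by eventually_elim (rule SU)
  have D0D: "emeasure lborel D0 = emeasure lborel D"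
  proof -
    have "emeasure lborel D = emeasure lborel (D0 \<union> (D - D0))" using D(2) by (simp add: Un_absorb1)
    also have "\<dots> = emeasure lborel D0" using D(3,4) by (intro emeasure_Un_null_set) auto
    finally show ?thesis by simp
  qed
  have "emeasure H S = emeasure H U"
    by (rule emeasure_eq_AE[OF aeSU]) (use S Ub sH in auto)
  also have "\<dots> = (\<Sum>i\<in>I. emeasure H (q i ` D0))"
    unfolding U_def using I disj qb D(3)
    by (intro sum_emeasure[symmetric]) (auto simp: sH disjoint_family_on_def)
  also have "\<dots> = (\<Sum>i\<in>I. ennreal (c i) * emeasure lborel D)"
    using eq D(3) by (intro sum.cong) (auto simp: D0D)
  finally show meas: "emeasure H S = (\<Sum>i\<in>I. ennreal (c i) * emeasure lborel D)" .
  assume h: "continuous_on UNIV h"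
  have hm: "h \<in> borel_measurable borel" by (rule borel_measurable_continuous_onI[OF h])
  have cpt: "compact (q i ` D)" if "i \<in> I" for i
    unfolding q_def using L(1)[OF that]
    by (intro compact_continuous_image D continuous_intros) (simp add: linear_continuous_on linear_linear)
  have intg: "set_integrable H (q i ` D0) h" if i: "i \<in> I" for i
  proof -
    obtain M where M: "\<And>x. x \<in> q i ` D \<Longrightarrow> \<bar>h x\<bar> \<le> M"
      using compact_imp_bounded[OF compact_continuous_image[OF continuous_on_subset[OF h subset_UNIV] cpt[OF i]]]
      unfolding bounded_iff by auto
    show ?thesis unfolding set_integrable_def
    proof (rule integrableI_bounded_set_indicator[where B = M])
      show "q i ` D0 \<in> sets H" using qb[OF i D(3)] by (simp add: sH)
      show "h \<in> borel_measurable H" using hm by (simp add: measurable_cong_sets[OF sH refl])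
      have "emeasure lborel D0 < \<infinity>" unfolding D0D using emeasure_bounded_finite[OF compact_imp_bounded[OF D(1)]] .
      then show "emeasure H (q i ` D0) < \<infinity>" using eq[OF i D(3)] by (simp add: ennreal_mult_less_top)
      show "AE x in H. x \<in> q i ` D0 \<longrightarrow> norm (h x) \<le> M"
        using M D(2) by (intro AE_I2) auto
    qed
  qed
  have "set_lebesgue_integral H S h = set_lebesgue_integral H U h"
    using aeSU S Ub hm sH unfolding set_lebesgue_integral_def
    by (intro integral_cong_AE) (auto simp: indicator_def measurable_cong_sets[OF sH refl] elim!: eventually_mono)
  also have "\<dots> = (\<Sum>i\<in>I. set_lebesgue_integral H (q i ` D0) h)"
    unfolding U_def using I disj qb D(3) intg
    by (intro set_integral_finite_Union) (auto simp: sH disjoint_family_on_def)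
  also have "\<dots> = (\<Sum>i\<in>I. c i * set_lebesgue_integral lborel D (\<lambda>t. h (q i t)))"
  proof (rule sum.cong[OF refl])
    fix i assume i: "i \<in> I"
    have "set_lebesgue_integral H (q i ` D0) h = c i * set_lebesgue_integral lborel D0 (\<lambda>t. h (q i t))"
      using affine_hausdorff_integral(5)[OF L(1)[OF i] L(2)[OF i] D(3) hm, of "p i"] by (simp add: q_def c_def H_def)
    also have "set_lebesgue_integral lborel D0 (\<lambda>t. h (q i t)) = set_lebesgue_integral lborel D (\<lambda>t. h (q i t))"
    proof -
      have "continuous_on UNIV (q i)"
        unfolding q_def using L(1)[OF i] by (intro continuous_intros) (simp add: linear_continuous_on linear_linear)
      then have "(\<lambda>t. h (q i t)) \<in> borel_measurable borel"
        by (intro borel_measurable_continuous_onI continuous_on_compose2[OF h]) auto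
      moreover have "AE t in lborel. t \<notin> D - D0" using D(4) by (rule AE_not_in)
      ultimately show ?thesis unfolding set_lebesgue_integral_def using D(2,3) Db
        by (intro integral_cong_AE) (auto simp: indicator_def elim!: eventually_mono)
    qed
    finally show "set_lebesgue_integral H (q i ` D0) h = c i * set_lebesgue_integral lborel D (\<lambda>t. h (q i t))" .
  qed
  finally show "set_lebesgue_integral H S h = (\<Sum>i\<in>I. c i * set_lebesgue_integral lborel D (\<lambda>t. h (q i t)))" .
qed

section \<open>Power integrals over simplices\<close>

lemma beta_integral:
  fixes T :: real
  assumes "T \<ge> 0"
  shows "((\<lambda>t. t ^ a * (T - t) ^ b) has_integral T ^ (a + b + 1) * (fact a * fact b / fact (a + b + 1))) {0..T}"
proof (induction b arbitrary: a)
  case 0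
  have "((\<lambda>t. t ^ a) has_integral (T ^ Suc a / real (Suc a) - 0 ^ Suc a / real (Suc a))) {0..T}"
    using assms by (intro fundamental_theorem_of_calculus)
      (auto intro!: derivative_eq_intros simp: has_real_derivative_iff_has_vector_derivative[symmetric] simp del: power_Suc)
  moreover have "T ^ (a + 0 + 1) * (fact a * fact 0 / fact (a + 0 + 1)) = T ^ Suc a / real (Suc a) - 0 ^ Suc a / real (Suc a)"
    by (simp del: of_nat_Suc)
  ultimately show ?case by simp
next
  case (Suc b)
  \<comment> \<open>F vanishes at both ends, and its derivative links the exponents (a, b + 1) and
    (a + 1, b); this is integration by parts.\<close>
  define F where "F t = t ^ Suc a * (T - t) ^ Suc b / real (Suc a)" for t
  have "((\<lambda>t. t ^ a * (T - t) ^ Suc b - real (Suc b) / real (Suc a) * (t ^ Suc a * (T - t) ^ b)) has_integral (F T - F 0)) {0..T}"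
  proof (rule fundamental_theorem_of_calculus[OF assms])
    fix t assume "t \<in> {0..T}"
    have "(F has_real_derivative (real (Suc a) * t ^ a * (T - t) ^ Suc b - t ^ Suc a * (real (Suc b) * (T - t) ^ b)) / real (Suc a)) (at t within {0..T})"
      unfolding F_def by (auto intro!: derivative_eq_intros simp del: power_Suc of_nat_Suc)
    moreover have "(real (Suc a) * t ^ a * (T - t) ^ Suc b - t ^ Suc a * (real (Suc b) * (T - t) ^ b)) / real (Suc a)
        = t ^ a * (T - t) ^ Suc b - real (Suc b) / real (Suc a) * (t ^ Suc a * (T - t) ^ b)"
      by (simp add: diff_divide_distrib del: power_Suc of_nat_Suc)
    ultimately show "(F has_vector_derivative t ^ a * (T - t) ^ Suc b - real (Suc b) / real (Suc a) * (t ^ Suc a * (T - t) ^ b)) (at t within {0..T})"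
      by (simp only: has_real_derivative_iff_has_vector_derivative)
  qed
  from has_integral_add[OF this has_integral_mult_right[OF Suc.IH[of "Suc a"], of "real (Suc b) / real (Suc a)"]]
  have "((\<lambda>t. t ^ a * (T - t) ^ Suc b) has_integral real (Suc b) / real (Suc a) * (T ^ (Suc a + b + 1) * (fact (Suc a) * fact b / fact (Suc a + b + 1)))) {0..T}"
    by (simp add: F_def del: power_Suc of_nat_Suc)
  moreover have "real (Suc b) / real (Suc a) * (T ^ (Suc a + b + 1) * (fact (Suc a) * fact b / fact (Suc a + b + 1)))
      = T ^ (a + Suc b + 1) * (fact a * fact (Suc b) / fact (a + Suc b + 1))"
    by (simp add: fact_Suc del: of_nat_Suc power_Suc fact_Suc[of "Suc (a + b)"])
  ultimately show ?case by (simp only:)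
qed

lemma set_integral_eq_has_integral:
  fixes f :: "real \<Rightarrow> real"
  assumes "(f has_integral I) {a..b}" "continuous_on {a..b} f"
  shows "set_lebesgue_integral lborel {a..b} f = I"
  using assms borel_integrable_compact[OF compact_Icc assms(2)]
  by (subst set_borel_integral_eq_integral(2)) (auto simp: set_integrable_def integral_unique)

text \<open>The size T is variable because the slices of \<open>tet3\<close> at height s are the
  triangles with T = 1 - s.\<close>

definition triangle :: "real \<Rightarrow> (real \<times> real) set" where
  "triangle T = {(s, t). 0 \<le> s \<and> 0 \<le> t \<and> s + t \<le> T}"

definition tet3 :: "(real \<times> real \<times> real) set" where
  "tet3 = {(s, t, u). 0 \<le> s \<and> 0 \<le> t \<and> 0 \<le> u \<and> s + t + u \<le> 1}"

lemma compact_triangle: "compact (triangle T)"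
proof -
  have "closed (triangle T)"
    unfolding triangle_def case_prod_unfold by (intro closed_Collect_conj closed_Collect_le continuous_intros)
  then have "compact (({0..T} \<times> {0..T}) \<inter> triangle T)" by (intro compact_Int_closed compact_Times) auto
  also have "({0..T} \<times> {0..T}) \<inter> triangle T = triangle T" by (auto simp: triangle_def)
  finally show ?thesis .
qed

lemma compact_tet3: "compact tet3"
proof -
  have "closed tet3"
    unfolding tet3_def case_prod_unfold by (intro closed_Collect_conj closed_Collect_le continuous_intros)
  then have "compact (({0..1} \<times> {0..1} \<times> {0..1}) \<inter> tet3)" by (intro compact_Int_closed compact_Times) auto
  also have "({0..1} \<times> {0..1} \<times> {0..1}) \<inter> tet3 = tet3" by (auto simp: tet3_def)
  finally show ?thesis .
qed

lemma set_integral_product: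
  fixes F :: "'a::euclidean_space \<times> 'b::euclidean_space \<Rightarrow> real"
  assumes "compact D" "continuous_on UNIV F"
  shows "set_lebesgue_integral lborel D F = (\<integral>s. (\<integral>t. indicator D (s, t) * F (s, t) \<partial>lborel) \<partial>lborel)"
proof -
  have "integrable lborel (\<lambda>x. indicator D x *\<^sub>R F x)"
    by (rule borel_integrable_compact[OF assms(1) continuous_on_subset[OF assms(2)]]) auto
  then have int: "integrable (lborel \<Otimes>\<^sub>M lborel) (\<lambda>x. indicator D x *\<^sub>R F x)" by (simp add: lborel_prod)
  have "set_lebesgue_integral lborel D F = (\<integral>x. indicator D x *\<^sub>R F x \<partial>(lborel \<Otimes>\<^sub>M lborel))"
    by (simp add: set_lebesgue_integral_def lborel_prod)
  also have "\<dots> = (\<integral>s. (\<integral>t. indicator D (s, t) *\<^sub>R F (s, t) \<partial>lborel) \<partial>lborel)"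
    by (rule lborel_pair.integral_fst'[OF int, symmetric])
  finally show ?thesis by simp
qed

text \<open>Dirichlet's integral: the inner integral over a slice is a beta integral and leaves a
  power of T - s, so that the outer one is a beta integral as well.\<close>

lemma triangle_integral:
  assumes T: "T \<ge> 0"
  shows "set_lebesgue_integral lborel (triangle T) (\<lambda>(s, t). s ^ a * t ^ b * (T - s - t) ^ c)
    = T ^ (a + b + c + 2) * (fact a * fact b * fact c / fact (a + b + c + 2))"
proof -
  let ?k = "fact b * fact c / fact (b + c + 1) :: real"
  have "set_lebesgue_integral lborel (triangle T) (\<lambda>(s, t). s ^ a * t ^ b * (T - s - t) ^ c)
      = (\<integral>s. (\<integral>t. indicator (triangle T) (s, t) * (s ^ a * t ^ b * (T - s - t) ^ c) \<partial>lborel) \<partial>lborel)"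
    by (subst set_integral_product[OF compact_triangle]) (auto simp: case_prod_beta intro!: continuous_intros)
  also have "\<dots> = (\<integral>s. indicator {0..T} s * (s ^ a * ((T - s) ^ (b + c + 1) * ?k)) \<partial>lborel)"
  proof (rule Bochner_Integration.integral_cong[OF refl])
    fix s :: real
    show "(\<integral>t. indicator (triangle T) (s, t) * (s ^ a * t ^ b * (T - s - t) ^ c) \<partial>lborel)
        = indicator {0..T} s * (s ^ a * ((T - s) ^ (b + c + 1) * ?k))"
    proof (cases "s \<in> {0..T}")
      case True
      have "(\<integral>t. indicator (triangle T) (s, t) * (s ^ a * t ^ b * (T - s - t) ^ c) \<partial>lborel)
          = (\<integral>t. s ^ a * (indicator {0..T - s} t * (t ^ b * ((T - s) - t) ^ c)) \<partial>lborel)"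
        using True by (intro Bochner_Integration.integral_cong) (auto simp: triangle_def indicator_def)
      also have "\<dots> = s ^ a * set_lebesgue_integral lborel {0..T - s} (\<lambda>t. t ^ b * ((T - s) - t) ^ c)"
        by (simp add: set_lebesgue_integral_def)
      also have "set_lebesgue_integral lborel {0..T - s} (\<lambda>t. t ^ b * ((T - s) - t) ^ c) = (T - s) ^ (b + c + 1) * ?k"
        using True by (intro set_integral_eq_has_integral beta_integral continuous_intros) auto
      finally show ?thesis using True by simp
    next
      case False
      then have "indicator (triangle T) (s, t) = (0::real)" for t by (auto simp: triangle_def indicator_def)
      then show ?thesis using False by simp
    qed
  qed
  also have "\<dots> = ?k * set_lebesgue_integral lborel {0..T} (\<lambda>s. s ^ a * (T - s) ^ (b + c + 1))"
    unfolding set_lebesgue_integral_def by (subst integral_mult_right_zero[symmetric]) (simp add: mult_ac)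
  also have "set_lebesgue_integral lborel {0..T} (\<lambda>s. s ^ a * (T - s) ^ (b + c + 1))
      = T ^ (a + (b + c + 1) + 1) * (fact a * fact (b + c + 1) / fact (a + (b + c + 1) + 1))"
    using T by (intro set_integral_eq_has_integral beta_integral continuous_intros)
  finally show ?thesis by (simp add: add.assoc del: fact_Suc)
qed

lemma tet3_integral:
  "set_lebesgue_integral lborel tet3 (\<lambda>(s, t, u). s ^ a * t ^ b * u ^ c) = fact a * fact b * fact c / fact (a + b + c + 3)"
proof -
  let ?k = "fact b * fact c / fact (b + c + 2) :: real"
  have "set_lebesgue_integral lborel tet3 (\<lambda>(s, t, u). s ^ a * t ^ b * u ^ c)
      = (\<integral>s. (\<integral>x. indicator tet3 (s, x) * (s ^ a * fst x ^ b * snd x ^ c) \<partial>lborel) \<partial>lborel)"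
    by (subst set_integral_product[OF compact_tet3]) (auto simp: case_prod_beta intro!: continuous_intros)
  also have "\<dots> = (\<integral>s. indicator {0..1} s * (s ^ a * ((1 - s) ^ (b + c + 2) * ?k)) \<partial>lborel)"
  proof (rule Bochner_Integration.integral_cong[OF refl])
    fix s :: real
    show "(\<integral>x. indicator tet3 (s, x) * (s ^ a * fst x ^ b * snd x ^ c) \<partial>lborel)
        = indicator {0..1} s * (s ^ a * ((1 - s) ^ (b + c + 2) * ?k))"
    proof (cases "s \<in> {0..1}")
      case True
      have "(\<integral>x. indicator tet3 (s, x) * (s ^ a * fst x ^ b * snd x ^ c) \<partial>lborel)
          = (\<integral>x. s ^ a * (indicator (triangle (1 - s)) x * (case x of (t, u) \<Rightarrow> t ^ b * u ^ c * ((1 - s) - t - u) ^ 0)) \<partial>lborel)"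
        using True by (intro Bochner_Integration.integral_cong) (auto simp: tet3_def triangle_def indicator_def)
      also have "\<dots> = s ^ a * set_lebesgue_integral lborel (triangle (1 - s)) (\<lambda>(t, u). t ^ b * u ^ c * ((1 - s) - t - u) ^ 0)"
        by (simp add: set_lebesgue_integral_def)
      also have "\<dots> = s ^ a * ((1 - s) ^ (b + c + 2) * ?k)"
        using True by (subst triangle_integral) auto
      finally show ?thesis using True by simp
    next
      case False
      then have "indicator tet3 (s, x) = (0::real)" for x by (auto simp: tet3_def indicator_def)
      then show ?thesis using False by simp
    qed
  qed
  also have "\<dots> = ?k * set_lebesgue_integral lborel {0..1} (\<lambda>s. s ^ a * (1 - s) ^ (b + c + 2))"
    unfolding set_lebesgue_integral_def by (subst integral_mult_right_zero[symmetric]) (simp add: mult_ac)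
  also have "set_lebesgue_integral lborel {0..1::real} (\<lambda>s. s ^ a * (1 - s) ^ (b + c + 2))
      = 1 ^ (a + (b + c + 2) + 1) * (fact a * fact (b + c + 2) / fact (a + (b + c + 2) + 1))"
    by (intro set_integral_eq_has_integral beta_integral continuous_intros) simp
  finally show ?thesis by (simp add: add.assoc eval_nat_numeral del: fact_Suc)
qed

text \<open>The complete homogeneous symmetric polynomial h_m in two variables; \<open>hsum3\<close>
  is the one in three.\<close>

definition hsum2 :: "nat \<Rightarrow> real \<Rightarrow> real \<Rightarrow> real" where
  "hsum2 m X Y = (\<Sum>k\<le>m. X ^ k * Y ^ (m - k))"

definition hsum3 :: "nat \<Rightarrow> real \<Rightarrow> real \<Rightarrow> real \<Rightarrow> real" where
  "hsum3 m X Y Z = (\<Sum>(a, b, c)\<in>exponents m. X ^ a * Y ^ b * Z ^ c)"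

lemma segment_power_integral:
  "set_lebesgue_integral lborel {0..1} (\<lambda>t. ((1 - t) * X + t * Y) ^ m) = hsum2 m Y X / (m + 1)"
proof -
  have int: "set_integrable lborel {0..1::real} (\<lambda>t. t ^ k * (1 - t) ^ (m - k))" for k
    using borel_integrable_compact[OF compact_Icc, of 0 "1::real" "\<lambda>t. t ^ k * (1 - t) ^ (m - k)"]
    by (simp add: set_integrable_def continuous_intros)
  have "((1 - t) * X + t * Y) ^ m = (\<Sum>k\<le>m. (real (m choose k) * Y ^ k * X ^ (m - k)) * (t ^ k * (1 - t) ^ (m - k)))" for t
    using binomial_ring[of "t * Y" "(1 - t) * X" m] by (simp add: add.commute power_mult_distrib mult_ac)
  then have "set_lebesgue_integral lborel {0..1} (\<lambda>t. ((1 - t) * X + t * Y) ^ m)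
      = set_lebesgue_integral lborel {0..1} (\<lambda>t. \<Sum>k\<le>m. (real (m choose k) * Y ^ k * X ^ (m - k)) * (t ^ k * (1 - t) ^ (m - k)))"
    by simp
  also have "\<dots> = (\<Sum>k\<le>m. (real (m choose k) * Y ^ k * X ^ (m - k)) * set_lebesgue_integral lborel {0..1::real} (\<lambda>t. t ^ k * (1 - t) ^ (m - k)))"
    using int unfolding set_lebesgue_integral_def set_integrable_def
    by (simp add: sum_distrib_left Bochner_Integration.integral_sum mult.left_commute[of "indicator _ _"])
  also have "\<dots> = (\<Sum>k\<le>m. Y ^ k * X ^ (m - k) / (m + 1))"
  proof (rule sum.cong[OF refl])
    fix k assume k: "k \<in> {..m}"
    have "set_lebesgue_integral lborel {0..1::real} (\<lambda>t. t ^ k * (1 - t) ^ (m - k)) = 1 ^ (k + (m - k) + 1) * (fact k * fact (m - k) / fact (k + (m - k) + 1))"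
      by (intro set_integral_eq_has_integral beta_integral continuous_intros) simp
    also have "\<dots> = fact k * fact (m - k) / fact (m + 1)" using k by simp
    finally have *: "set_lebesgue_integral lborel {0..1::real} (\<lambda>t. t ^ k * (1 - t) ^ (m - k)) = fact k * fact (m - k) / fact (m + 1)" .
    have "real (m choose k) = fact m / (fact k * fact (m - k))" using k by (simp add: binomial_fact)
    then show "(real (m choose k) * Y ^ k * X ^ (m - k)) * set_lebesgue_integral lborel {0..1::real} (\<lambda>t. t ^ k * (1 - t) ^ (m - k)) = Y ^ k * X ^ (m - k) / (m + 1)"
      unfolding * by (simp add: fact_Suc del: of_nat_Suc)
  qed
  finally show ?thesis by (simp add: hsum2_def sum_divide_distrib)
qed

text \<open>The multinomial coefficient cancels the factorials of Dirichlet's integral, so every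
  monomial of degree m gets the same coefficient and the sum becomes h_m. The number k is the
  dimension of the simplex.\<close>

lemma set_integral_multinomial:
  fixes y :: "'a::euclidean_space \<Rightarrow> real ^ 3"
  assumes D: "compact D" and y: "continuous_on UNIV y"
    and I: "\<And>a b c. set_lebesgue_integral lborel D (\<lambda>t. monomial3 a b c (y t)) = fact a * fact b * fact c / fact (a + b + c + k)"
  shows "set_lebesgue_integral lborel D (\<lambda>t. (y t $ 1 * X + y t $ 2 * Y + y t $ 3 * Z) ^ m) = fact m / fact (m + k) * hsum3 m X Y Z"
proof -
  let ?z = "vector [X, Y, Z] :: real ^ 3"
  have c: "continuous_on UNIV (\<lambda>t. monomial3 a b c (y t))" for a b c
    unfolding monomial3_def by (intro continuous_intros y)
  have int: "integrable lborel (\<lambda>t. indicator D t * monomial3 a b c (y t))" for a b c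
    using borel_integrable_compact[OF D continuous_on_subset[OF c subset_UNIV]] by simp
  have "set_lebesgue_integral lborel D (\<lambda>t. (y t $ 1 * X + y t $ 2 * Y + y t $ 3 * Z) ^ m)
    = (\<integral>t. (\<Sum>e\<in>exponents m. case e of (a, b, c) \<Rightarrow> (multinom a b c * monomial3 a b c ?z) * (indicator D t * monomial3 a b c (y t))) \<partial>lborel)"
    unfolding set_lebesgue_integral_def
  proof (rule Bochner_Integration.integral_cong[OF refl])
    fix t
    show "indicator D t *\<^sub>R (y t $ 1 * X + y t $ 2 * Y + y t $ 3 * Z) ^ m =
      (\<Sum>e\<in>exponents m. case e of (a, b, c) \<Rightarrow> (multinom a b c * monomial3 a b c ?z) * (indicator D t * monomial3 a b c (y t)))"
      using multinomial_theorem[of "y t" ?z m]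
      by (auto simp: sum_distrib_left case_prod_beta mult_ac intro!: sum.cong)
  qed
  also have "\<dots> = (\<Sum>e\<in>exponents m. \<integral>t. (case e of (a, b, c) \<Rightarrow> (multinom a b c * monomial3 a b c ?z) * (indicator D t * monomial3 a b c (y t))) \<partial>lborel)"
    by (intro Bochner_Integration.integral_sum) (auto intro!: integrable_mult_right int)
  also have "\<dots> = (\<Sum>(a, b, c)\<in>exponents m. fact m / fact (m + k) * (X ^ a * Y ^ b * Z ^ c))"
  proof (rule sum.cong[OF refl], clarify)
    fix a b c assume "(a, b, c) \<in> exponents m"
    then have m: "a + b + c = m" by (simp add: exponents_def)
    have "(\<integral>t. indicator D t * monomial3 a b c (y t) \<partial>lborel) = fact a * fact b * fact c / fact (m + k)"
      using I[of a b c] by (simp add: set_lebesgue_integral_def m)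
    then show "(\<integral>t. (multinom a b c * monomial3 a b c ?z) * (indicator D t * monomial3 a b c (y t)) \<partial>lborel)
        = fact m / fact (m + k) * (X ^ a * Y ^ b * Z ^ c)"
      by (simp add: multinom_def m monomial3_def)
  qed
  also have "\<dots> = fact m / fact (m + k) * hsum3 m X Y Z"
    unfolding hsum3_def sum_distrib_left by (intro sum.cong) auto
  finally show ?thesis .
qed

lemma continuous_on_vector_3:
  assumes "continuous_on S f" "continuous_on S g" "continuous_on S h"
  shows "continuous_on S (\<lambda>x. vector [f x, g x, h x] :: real ^ 3)"
proof -
  have "(\<lambda>x. vector [f x, g x, h x] :: real ^ 3) = (\<lambda>x. f x *\<^sub>R axis 1 1 + g x *\<^sub>R axis 2 1 + h x *\<^sub>R axis 3 1)"
    by (auto simp: fun_eq_iff vec_eq_iff forall_3 axis_def)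
  then show ?thesis using assms by (simp only:) (intro continuous_intros)
qed

lemma triangle_power_integral:
  "set_lebesgue_integral lborel (triangle 1) (\<lambda>(s, t). (s * X + t * Y + (1 - s - t) * Z) ^ m) = fact m / fact (m + 2) * hsum3 m X Y Z"
proof -
  let ?y = "\<lambda>x :: real \<times> real. vector [fst x, snd x, 1 - fst x - snd x] :: real ^ 3"
  have "set_lebesgue_integral lborel (triangle 1) (\<lambda>x. (?y x $ 1 * X + ?y x $ 2 * Y + ?y x $ 3 * Z) ^ m) = fact m / fact (m + 2) * hsum3 m X Y Z"
  proof (rule set_integral_multinomial[OF compact_triangle])
    show "continuous_on UNIV ?y" by (intro continuous_on_vector_3 continuous_intros)
    show "set_lebesgue_integral lborel (triangle 1) (\<lambda>x. monomial3 a b c (?y x)) = fact a * fact b * fact c / fact (a + b + c + 2)" for a b c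
      using triangle_integral[of 1 a b c] by (simp add: monomial3_def case_prod_unfold del: fact_Suc)
  qed
  then show ?thesis by (simp add: case_prod_unfold)
qed

text \<open>The fourth vertex of the simplex is the origin, where the linear form is 0, so h_m in
  four values reduces to h_m in three. This is why the faces and the solid lead to the same
  sums.\<close>

lemma tet3_power_integral:
  "set_lebesgue_integral lborel tet3 (\<lambda>(s, t, u). (s * X + t * Y + u * Z) ^ m) = fact m / fact (m + 3) * hsum3 m X Y Z"
proof -
  let ?y = "\<lambda>x :: real \<times> real \<times> real. vector [fst x, fst (snd x), snd (snd x)] :: real ^ 3"
  have "set_lebesgue_integral lborel tet3 (\<lambda>x. (?y x $ 1 * X + ?y x $ 2 * Y + ?y x $ 3 * Z) ^ m) = fact m / fact (m + 3) * hsum3 m X Y Z"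
  proof (rule set_integral_multinomial[OF compact_tet3])
    show "continuous_on UNIV ?y" by (intro continuous_on_vector_3 continuous_intros)
    show "set_lebesgue_integral lborel tet3 (\<lambda>x. monomial3 a b c (?y x)) = fact a * fact b * fact c / fact (a + b + c + 3)" for a b c
      using tet3_integral[of a b c] by (simp add: monomial3_def case_prod_unfold del: fact_Suc)
  qed
  then show ?thesis by (simp add: case_prod_unfold)
qed

section \<open>From skeletons to moments\<close>

lemma skeleton_probability:
  fixes r :: real and k :: nat
  defines "H \<equiv> hausdorff_measure k :: (real ^ 3) measure" and "S \<equiv> skeleton r k"
  assumes S: "S \<in> sets borel" "bounded S" and m: "0 < emeasure H S" "emeasure H S < \<infinity>"
  obtains P B where "symmetric_probability P B"
    "\<And>g. continuous_on UNIV g \<Longrightarrow> (\<integral>y. g y \<partial>P) = 1 / measure H S * set_lebesgue_integral H S g"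
proof -
  have sH: "sets H = sets borel" by (simp add: H_def)
  have spH: "space H = UNIV" using sets_eq_imp_space_eq[OF sH] by simp
  have mH: "emeasure H S = ennreal (measure H S)" using m(2) by (simp add: emeasure_eq_ennreal_measure)
  then have mpos: "measure H S > 0" using m(1) by simp
  define w where "w y = indicator S y / measure H S" for y
  define P where "P = density H (\<lambda>y. ennreal (w y))"
  have sP: "sets P = sets borel" by (simp add: P_def sH)
  have wm: "w \<in> borel_measurable H" unfolding w_def using S(1) sH by simp
  have w0: "w y \<ge> 0" for y unfolding w_def by simp
  have int: "(\<integral>y. g y \<partial>P) = 1 / measure H S * set_lebesgue_integral H S g" if "continuous_on UNIV g" for g :: "real ^ 3 \<Rightarrow> real"
  proof -
    have gm: "g \<in> borel_measurable H"
      using borel_measurable_continuous_onI[OF that] by (simp add: measurable_cong_sets[OF sH refl])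
    have "(\<integral>y. g y \<partial>P) = (\<integral>y. w y *\<^sub>R g y \<partial>H)"
      unfolding P_def by (rule integral_density[OF gm wm]) (simp add: w0)
    also have "\<dots> = (\<integral>y. (1 / measure H S) * (indicator S y *\<^sub>R g y) \<partial>H)"
      by (simp add: w_def)
    also have "\<dots> = 1 / measure H S * set_lebesgue_integral H S g"
      unfolding set_lebesgue_integral_def by (rule integral_mult_right_zero)
    finally show ?thesis .
  qed
  obtain B where B: "B > 0" "\<And>y. y \<in> S \<Longrightarrow> norm y \<le> B" using S(2) by (auto simp: bounded_pos)
  have "emeasure P UNIV = (\<integral>\<^sup>+y. ennreal (w y) * indicator UNIV y \<partial>H)"
    unfolding P_def using wm spH by (intro emeasure_density) (auto simp: sH)
  also have "\<dots> = (\<integral>\<^sup>+y. ennreal (1 / measure H S) * indicator S y \<partial>H)"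
    by (intro nn_integral_cong) (simp add: w_def indicator_def)
  also have "\<dots> = ennreal (1 / measure H S) * emeasure H S"
    using S(1) sH by (intro nn_integral_cmult_indicator) simp
  also have "\<dots> = 1" using mpos unfolding mH by (subst ennreal_mult[symmetric]) auto
  finally have P1: "emeasure P UNIV = 1" .
  have spP: "space P = UNIV" using sets_eq_imp_space_eq[OF sP] by simp
  have comp: "compact_probability P B"
  proof (rule compact_probability.intro)
    show "finite_measure P" by (rule finite_measureI) (simp add: spP P1)
    show "sets P = sets borel" by (rule sP)
    show "measure P UNIV = 1" by (simp add: measure_def P1)
    show "B > 0" by (rule B)
    have "AE y in H. 0 < ennreal (w y) \<longrightarrow> norm y \<le> B"
      by (intro AE_I2) (auto simp: w_def indicator_def intro: B split: if_splits)
    then show "AE y in P. norm y \<le> B" unfolding P_def by (subst AE_density) (use wm in auto)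
  qed
  interpret compact_probability P B by (rule comp)
  have gen: "set_lebesgue_integral H S (\<lambda>y. h (g y)) = set_lebesgue_integral H S h"
    if "g = swap12 \<or> g = swap23 \<or> g = neg12" "h \<in> borel_measurable borel" for g and h :: "real ^ 3 \<Rightarrow> real"
    unfolding H_def
  proof (rule hausdorff_set_integral_isometry)
    have "g \<in> symmetry_group S" unfolding S_def by (rule generators_in_groups(1)[OF that(1)])
    then show "orthogonal_transformation g" "g ` S = S" by (simp_all add: symmetry_group_def)
  qed (use S that in auto)
  have mom: "moment a b c = 1 / measure H S * set_lebesgue_integral H S (monomial3 a b c)" for a b c
    unfolding moment_def by (rule int[OF continuous_on_monomial3])
  have mm: "monomial3 a b c \<in> borel_measurable borel" for a b c
    by (rule borel_measurable_continuous_onI[OF continuous_on_monomial3])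
  have "symmetric_probability P B"
  proof
    fix a b c
    show "moment b a c = moment a b c"
      using gen[OF _ mm[of b a c], of swap12] by (simp add: mom monomial3_generators)
    show "moment a c b = moment a b c"
      using gen[OF _ mm[of a c b], of swap23] by (simp add: mom monomial3_generators)
    assume "odd (a + b)"
    then have "(-1::real) ^ (a + b) = -1" by simp
    then show "moment a b c = 0"
      using gen[OF _ mm[of a b c], of neg12] by (simp add: mom monomial3_generators set_lebesgue_integral_def)
  qed
  then show ?thesis using int that by blast
qed

definition power_integral :: "real \<Rightarrow> nat \<Rightarrow> nat \<Rightarrow> real ^ 3 \<Rightarrow> real" where
  "power_integral r k m z = set_lebesgue_integral (hausdorff_measure k) (skeleton r k) (\<lambda>y. (y \<bullet> z) ^ m)"

text \<open>The coefficient conditions as values at three points: up to the total measure, 4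
  M_4(1,0,0) - M_4(1,1,0) is twice m_400 - 3 m_220, and 2 M_6(1,1,1) + 18 M_6(1,0,0) - 9 M_6(1,1,0)
  is twice 3 m_600 - 45 m_420 + 90 m_222. The last conclusion holds because every symmetry of S
  preserves all M_m.\<close>

lemma skeleton_harmonic_cases:
  fixes r :: real and k :: nat
  defines "H \<equiv> hausdorff_measure k :: (real ^ 3) measure" and "S \<equiv> skeleton r k" and "M \<equiv> power_integral r k"
  assumes S: "S \<in> sets borel" "bounded S" and m: "0 < emeasure H S" "emeasure H S < \<infinity>"
    and M2: "M 2 (vector [1, 0, 0]) \<noteq> 0" and M4: "4 * M 4 (vector [1, 0, 0]) \<noteq> M 4 (vector [1, 1, 0])"
  shows "M 3 (vector [1, 1, 1]) \<noteq> 0 \<Longrightarrow> distribution_of ` skeleton_harmonic r k = harmonic_A"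
    and "M 3 (vector [1, 1, 1]) = 0 \<Longrightarrow>
      2 * M 6 (vector [1, 1, 1]) + 18 * M 6 (vector [1, 0, 0]) \<noteq> 9 * M 6 (vector [1, 1, 0]) \<Longrightarrow>
      distribution_of ` skeleton_harmonic r k = harmonic_B"
    and "M 5 (vector [1, 1, 1]) \<noteq> 0 \<Longrightarrow> group_harmonic (symmetry_group S) \<subseteq> harmonic_A"
proof -
  obtain P B where sym: "symmetric_probability P B"
    and int: "\<And>g. continuous_on UNIV g \<Longrightarrow> (\<integral>y. g y \<partial>P) = 1 / measure H S * set_lebesgue_integral H S g"
    using skeleton_probability[OF S[unfolded S_def] m[unfolded S_def H_def]] unfolding H_def S_def by blast
  interpret symmetric_probability P B by (rule sym)
  have mpos: "measure H S > 0" using m by (simp add: measure_def enn2real_positive_iff)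
  have harm: "skeleton_harmonic r k = {f. mean_value f}"
  proof -
    have "(\<integral>y. f (x + s *\<^sub>R y) \<partial>P) = 1 / measure H S * set_lebesgue_integral H S (\<lambda>y. f (x + s *\<^sub>R y))"
      if "continuous_on UNIV f" for f x s
      by (rule int) (intro continuous_on_compose2[OF that] continuous_intros, simp)
    then show ?thesis unfolding skeleton_harmonic_def mean_value_def H_def[symmetric] S_def[symmetric] by (simp cong: conj_cong)
  qed
  have pow: "M n z = measure H S * (\<Sum>(a, b, c)\<in>exponents n. multinom a b c * moment a b c * monomial3 a b c z)" for n z
  proof -
    have "(\<integral>y. (y \<bullet> z) ^ n \<partial>P) = 1 / measure H S * M n z"
      unfolding M_def power_integral_def using int[of "\<lambda>y. (y \<bullet> z) ^ n"]
      by (simp add: continuous_intros H_def S_def)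
    then show ?thesis using mpos integral_linear_power[of z n] by (simp add: inner_vec_3 field_simps)
  qed
  note p = pow[of 2, unfolded moment_sum(1)] pow[of 3, unfolded moment_sum(2)] pow[of 4, unfolded moment_sum(3)]
    pow[of 5, unfolded moment_sum(4)] pow[of 6, unfolded moment_sum(5)]
  have e2: "M 2 (vector [1, 0, 0]) = measure H S * moment 2 0 0"
    and e3: "M 3 (vector [1, 1, 1]) = measure H S * (6 * moment 1 1 1)"
    and e4: "M 4 (vector [1, 0, 0]) = measure H S * moment 4 0 0"
    and e4': "M 4 (vector [1, 1, 0]) = measure H S * (2 * moment 4 0 0 + 6 * moment 2 2 0)"
    and e5: "M 5 (vector [1, 1, 1]) = measure H S * (60 * moment 3 1 1)"
    and e6: "M 6 (vector [1, 0, 0]) = measure H S * moment 6 0 0"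
    and e6': "M 6 (vector [1, 1, 0]) = measure H S * (2 * moment 6 0 0 + 30 * moment 4 2 0)"
    and e6'': "M 6 (vector [1, 1, 1]) = measure H S * (3 * moment 6 0 0 + 90 * moment 4 2 0 + 90 * moment 2 2 2)"
    unfolding p by (simp_all add: monomial3_def)
  have n2: "moment 2 0 0 \<noteq> 0" using M2 e2 by auto
  have n4: "moment 4 0 0 \<noteq> 3 * moment 2 2 0"
    using M4 unfolding e4 e4' by auto
  show "distribution_of ` skeleton_harmonic r k = harmonic_A" if "M 3 (vector [1, 1, 1]) \<noteq> 0"
    unfolding harm by (rule mean_value_distributions_A[OF n2 n4]) (use that e3 in auto)
  show "distribution_of ` skeleton_harmonic r k = harmonic_B" if "M 3 (vector [1, 1, 1]) = 0"
      "2 * M 6 (vector [1, 1, 1]) + 18 * M 6 (vector [1, 0, 0]) \<noteq> 9 * M 6 (vector [1, 1, 0])"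
    unfolding harm
  proof (rule mean_value_distributions_B[OF n2 n4])
    show "moment 1 1 1 = 0" using that(1) mpos unfolding e3 by simp
    show "3 * moment 6 0 0 - 45 * moment 4 2 0 + 90 * moment 2 2 2 \<noteq> 0"
    proof
      assume "3 * moment 6 0 0 - 45 * moment 4 2 0 + 90 * moment 2 2 2 = 0"
      then have "measure H S * (2 * (3 * moment 6 0 0 - 45 * moment 4 2 0 + 90 * moment 2 2 2)) = 0" by simp
      then show False using that(2) unfolding e6 e6' e6'' by (simp add: algebra_simps)
    qed
  qed
  show "group_harmonic (symmetry_group S) \<subseteq> harmonic_A" if "M 5 (vector [1, 1, 1]) \<noteq> 0"
  proof (rule group_harmonic_subset_A)
    have n5: "moment 3 1 1 \<noteq> 0" using that e5 by auto
    fix g x assume "g \<in> symmetry_group S"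
    then have g: "orthogonal_transformation g" "g ` S = S" by (simp_all add: symmetry_group_def)
    have inv: "M n (g x) = M n x" for n
    proof -
      have "(\<lambda>y. (y \<bullet> g x) ^ n) \<in> borel_measurable borel"
        by (intro borel_measurable_continuous_onI continuous_intros)
      from hausdorff_set_integral_isometry[OF g S(1) this, of k]
      show ?thesis using g(1) by (simp add: M_def power_integral_def orthogonal_transformation_def S_def)
    qed
    have sq: "g x $ 1 ^ 2 + g x $ 2 ^ 2 + g x $ 3 ^ 2 = x $ 1 ^ 2 + x $ 2 ^ 2 + x $ 3 ^ 2"
      by (rule orthogonal_sum_squares[OF g(1)])
    \<comment> \<open>M_4 is a combination of p_4 and p_2^2 in which p_4 has a nonzero coefficient,
      so a symmetry preserves p_4.\<close>
    have 4: "M 4 y = measure H S * ((moment 4 0 0 - 3 * moment 2 2 0) * (y $ 1 ^ 4 + y $ 2 ^ 4 + y $ 3 ^ 4)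
        + 3 * moment 2 2 0 * (y $ 1 ^ 2 + y $ 2 ^ 2 + y $ 3 ^ 2)\<^sup>2)" for y
      unfolding p by (simp add: monomial3_def power2_eq_square power4_eq_xxxx algebra_simps)
    have "(moment 4 0 0 - 3 * moment 2 2 0) * (g x $ 1 ^ 4 + g x $ 2 ^ 4 + g x $ 3 ^ 4)
        = (moment 4 0 0 - 3 * moment 2 2 0) * (x $ 1 ^ 4 + x $ 2 ^ 4 + x $ 3 ^ 4)"
      using inv[of 4] mpos unfolding 4 sq by simp
    then have "g x $ 1 ^ 4 + g x $ 2 ^ 4 + g x $ 3 ^ 4 = x $ 1 ^ 4 + x $ 2 ^ 4 + x $ 3 ^ 4" using n4 by simp
    then show "g x $ 1 ^ n + g x $ 2 ^ n + g x $ 3 ^ n = x $ 1 ^ n + x $ 2 ^ n + x $ 3 ^ n" if "n = 2 \<or> n = 4" for n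
      using that sq by auto
    have 5: "M 5 y = measure H S * (20 * moment 3 1 1 * (y $ 1 * y $ 2 * y $ 3 * (y $ 1 ^ 2 + y $ 2 ^ 2 + y $ 3 ^ 2)))" for y
      unfolding p by (simp add: monomial3_def power2_eq_square power3_eq_cube algebra_simps)
    have *: "g x $ 1 * g x $ 2 * g x $ 3 * (x $ 1 ^ 2 + x $ 2 ^ 2 + x $ 3 ^ 2)
        = x $ 1 * x $ 2 * x $ 3 * (x $ 1 ^ 2 + x $ 2 ^ 2 + x $ 3 ^ 2)"
      using inv[of 5] mpos n5 unfolding 5 sq by simp
    \<comment> \<open>M_5 is a multiple of x y z p_2. The factor p_2 can be cancelled away from the
      origin, and at the origin both sides are 0.\<close>
    show "g x $ 1 * g x $ 2 * g x $ 3 = x $ 1 * x $ 2 * x $ 3"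
    proof (cases "x $ 1 ^ 2 + x $ 2 ^ 2 + x $ 3 ^ 2 = 0")
      case True
      have z: "y $ 1 = 0" if "y $ 1 ^ 2 + y $ 2 ^ 2 + y $ 3 ^ 2 = 0" for y :: "real ^ 3"
        using that zero_le_power2[of "y $ 1"] zero_le_power2[of "y $ 2"] zero_le_power2[of "y $ 3"]
        by (metis add_nonneg_eq_0_iff add_nonneg_nonneg power_eq_0_iff zero_neq_numeral)
      show ?thesis using z[OF True] z[of "g x"] True sq by simp
    qed (use * in simp)
  qed
qed

text \<open>All parametrizations are multiples, in norm, of one model L0, so the cell constants are
  w i ^ DIM('a) times a common K that depends neither on the cell nor on the integrand.\<close>

lemma similar_cells:
  fixes L :: "'i \<Rightarrow> 'a::euclidean_space \<Rightarrow> 'b::euclidean_space" and L0 :: "'a \<Rightarrow> 'b" and p :: "'i \<Rightarrow> 'b" and D D0 :: "'a set"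
  defines "H \<equiv> hausdorff_measure DIM('a) :: 'b measure"
  defines "q \<equiv> \<lambda>i t. p i + L i t"
  assumes I: "finite I" "I \<noteq> {}" and L: "\<And>i. i \<in> I \<Longrightarrow> linear (L i)" and L0: "linear L0" "inj L0"
    and w: "\<And>i. i \<in> I \<Longrightarrow> w i > 0" "\<And>i t. i \<in> I \<Longrightarrow> norm (L i t) = w i * norm (L0 t)"
    and D: "compact D" "D0 \<subseteq> D" "D0 \<in> sets borel" "D - D0 \<in> null_sets lborel" "emeasure lborel D \<noteq> 0"
    and disj: "\<And>i j. i \<in> I \<Longrightarrow> j \<in> I \<Longrightarrow> q i ` D0 \<inter> q j ` D0 \<noteq> {} \<Longrightarrow> i = j"
    and S: "S \<in> sets borel" "(\<Union>i\<in>I. q i ` D0) \<subseteq> S" "S \<subseteq> (\<Union>i\<in>I. q i ` D)"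
  obtains K where "K > 0" "0 < emeasure H S" "emeasure H S < \<infinity>" "bounded S"
    "\<And>h. continuous_on UNIV h \<Longrightarrow> set_lebesgue_integral H S h
      = K * (\<Sum>i\<in>I. w i ^ DIM('a) * set_lebesgue_integral lborel D (\<lambda>t. h (q i t) :: real))"
proof -
  define K where "K = measure H (L0 ` cbox 0 One)"
  have K: "K > 0" unfolding K_def H_def by (rule affine_hausdorff_integral(1)[OF L0])
  have inj: "inj (L i)" if i: "i \<in> I" for i
  proof -
    have "t = 0" if "L i t = 0" for t
    proof -
      have "norm (L0 t) = 0" using w(1)[OF i] w(2)[OF i, of t] that by simp
      then show ?thesis using L0 by (simp add: linear_injective_0)
    qed
    then show ?thesis using L[OF i] by (simp add: linear_injective_0)
  qed
  have c: "measure H (L i ` cbox 0 One) = w i ^ DIM('a) * K" if "i \<in> I" for i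
    unfolding H_def K_def by (rule hausdorff_cube_image_scaling[OF L0 L[OF that] w(2)[OF that] w(1)[OF that]])
  have dj: "q i ` D0 \<inter> q j ` D0 = {}" if "i \<in> I" "j \<in> I" "i \<noteq> j" for i j using disj that by blast
  have cells1: "emeasure H S = (\<Sum>i\<in>I. ennreal (measure H (L i ` cbox 0 One)) * emeasure lborel D)"
    unfolding H_def by (rule hausdorff_cells(1)[OF I(1) _ _ D(1-4) _ S[unfolded q_def]])
      (simp_all add: L inj dj[unfolded q_def])
  have cells2: "set_lebesgue_integral H S h = (\<Sum>i\<in>I. measure H (L i ` cbox 0 One) * set_lebesgue_integral lborel D (\<lambda>t. h (q i t)))"
    if "continuous_on UNIV h" for h :: "'b \<Rightarrow> real"
    unfolding H_def q_def by (rule hausdorff_cells(2)[OF I(1) _ _ D(1-4) _ S[unfolded q_def] that])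
      (simp_all add: L inj dj[unfolded q_def])
  have finD: "emeasure lborel D < \<infinity>" by (rule emeasure_bounded_finite[OF compact_imp_bounded[OF D(1)]])
  have eS: "emeasure H S = (\<Sum>i\<in>I. ennreal (w i ^ DIM('a) * K) * emeasure lborel D)"
    using cells1 by (simp add: c)
  obtain i0 where i0: "i0 \<in> I" using I(2) by blast
  have "0 < ennreal (w i0 ^ DIM('a) * K) * emeasure lborel D"
    using K w(1)[OF i0] D(5) by (simp add: ennreal_zero_less_mult_iff zero_less_iff_neq_zero)
  also have "\<dots> \<le> emeasure H S"
    unfolding eS using I(1) i0 by (intro member_le_sum) auto
  finally have pos: "0 < emeasure H S" .
  have fin: "emeasure H S < \<infinity>" unfolding eS using finD I(1) by (auto simp: ennreal_mult_less_top intro!: ennreal_sum_less_top)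
  have "bounded (q i ` D)" if "i \<in> I" for i
    unfolding q_def using L[OF that]
    by (intro compact_imp_bounded compact_continuous_image D continuous_intros) (simp add: linear_continuous_on linear_linear)
  then have "bounded (\<Union>i\<in>I. q i ` D)" using I(1) by blast
  then have bdd: "bounded S" using S(3) by (rule bounded_subset)
  have "set_lebesgue_integral H S h = K * (\<Sum>i\<in>I. w i ^ DIM('a) * set_lebesgue_integral lborel D (\<lambda>t. h (q i t)))"
    if "continuous_on UNIV h" for h :: "'b \<Rightarrow> real"
    unfolding cells2[OF that] by (simp add: c sum_distrib_left mult_ac)
  then show ?thesis using that K pos fin bdd by blast
qed

section \<open>Reference simplices and their boundaries\<close>

lemma negligible_imp_null_lborel:
  assumes "negligible N" "N \<in> sets borel"
  shows "N \<in> null_sets lborel"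
  using assms null_sets_completion_iff[of N lborel] by (simp add: negligible_iff_null_sets)

definition open_triangle :: "(real \<times> real) set" where
  "open_triangle = {(s, t). 0 < s \<and> 0 < t \<and> s + t < 1}"

definition open_tet3 :: "(real \<times> real \<times> real) set" where
  "open_tet3 = {(s, t, u). 0 < s \<and> 0 < t \<and> 0 < u \<and> s + t + u < 1}"

lemma open_triangle: "open_triangle \<subseteq> triangle 1" "open_triangle \<in> sets borel" "triangle 1 - open_triangle \<in> null_sets lborel"
proof -
  show "open_triangle \<subseteq> triangle 1" by (auto simp: open_triangle_def triangle_def)
  have "open open_triangle"
    unfolding open_triangle_def case_prod_unfold by (intro open_Collect_conj open_Collect_less continuous_intros)
  then show o: "open_triangle \<in> sets borel" by simp
  have h: "negligible {x :: real \<times> real. (1, 0) \<bullet> x = 0}" "negligible {x :: real \<times> real. (0, 1) \<bullet> x = 0}"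
    "negligible {x :: real \<times> real. (1, 1) \<bullet> x = 1}"
    by (intro negligible_hyperplane; simp add: zero_prod_def)+
  have "negligible (triangle 1 - open_triangle)"
    by (rule negligible_subset[OF negligible_Un[OF h(1) negligible_Un[OF h(2,3)]]])
      (auto simp: triangle_def open_triangle_def inner_Pair)
  then show "triangle 1 - open_triangle \<in> null_sets lborel"
    using o borel_compact[OF compact_triangle] by (intro negligible_imp_null_lborel) auto
qed

lemma open_tet3: "open_tet3 \<subseteq> tet3" "open_tet3 \<in> sets borel" "tet3 - open_tet3 \<in> null_sets lborel"
proof -
  show "open_tet3 \<subseteq> tet3" by (auto simp: open_tet3_def tet3_def)
  have "open open_tet3"
    unfolding open_tet3_def case_prod_unfold by (intro open_Collect_conj open_Collect_less continuous_intros)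
  then show o: "open_tet3 \<in> sets borel" by simp
  have h: "negligible {x :: real \<times> real \<times> real. (1, 0, 0) \<bullet> x = 0}" "negligible {x :: real \<times> real \<times> real. (0, 1, 0) \<bullet> x = 0}"
    "negligible {x :: real \<times> real \<times> real. (0, 0, 1) \<bullet> x = 0}" "negligible {x :: real \<times> real \<times> real. (1, 1, 1) \<bullet> x = 1}"
    by (intro negligible_hyperplane; simp add: zero_prod_def)+
  have "negligible (tet3 - open_tet3)"
    by (rule negligible_subset[OF negligible_Un[OF negligible_Un[OF h(1,2)] negligible_Un[OF h(3,4)]]])
      (auto simp: tet3_def open_tet3_def inner_Pair)
  then show "tet3 - open_tet3 \<in> null_sets lborel"
    using o borel_compact[OF compact_tet3] by (intro negligible_imp_null_lborel) auto
qed

lemma set_integral_nonzero_imp_emeasure: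
  assumes "set_lebesgue_integral lborel D h \<noteq> (0::real)" "D \<in> sets borel"
  shows "emeasure lborel D \<noteq> 0"
proof
  assume "emeasure lborel D = 0"
  then have "AE x in lborel. x \<notin> D" using assms(2) by (intro AE_not_in null_setsI) auto
  then have "AE x in lborel. indicator D x *\<^sub>R h x = 0" by eventually_elim simp
  then have "set_lebesgue_integral lborel D h = 0" unfolding set_lebesgue_integral_def by (rule integral_eq_zero_AE)
  then show False using assms(1) by simp
qed

lemma hsum3_0: "hsum3 0 X Y Z = 1"
proof -
  have "exponents 0 = {(0, 0, 0)}" by (auto simp: exponents_def)
  then show ?thesis by (simp add: hsum3_def)
qed

text \<open>With exponent 0 the power integrals become the volumes of the simplices.\<close>

lemma simplices_nonnull: "emeasure lborel (triangle 1) \<noteq> 0" "emeasure lborel tet3 \<noteq> 0"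
proof -
  have "set_lebesgue_integral lborel (triangle 1) (\<lambda>(s, t). (s * 0 + t * 0 + (1 - s - t) * 0 :: real) ^ 0) \<noteq> 0"
    unfolding triangle_power_integral by (simp add: hsum3_0)
  then show "emeasure lborel (triangle 1) \<noteq> 0"
    by (rule set_integral_nonzero_imp_emeasure) (rule borel_compact[OF compact_triangle])
  have "set_lebesgue_integral lborel tet3 (\<lambda>(s, t, u). (s * 0 + t * 0 + u * 0 :: real) ^ 0) \<noteq> 0"
    unfolding tet3_power_integral by (simp add: hsum3_0)
  then show "emeasure lborel tet3 \<noteq> 0"
    by (rule set_integral_nonzero_imp_emeasure) (rule borel_compact[OF compact_tet3])
qed

lemma hsum2_Suc: "hsum2 (Suc m) X Y = Y * hsum2 m X Y + X ^ Suc m"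
proof -
  have "(\<Sum>k\<le>m. X ^ k * Y ^ (Suc m - k)) = (\<Sum>k\<le>m. Y * (X ^ k * Y ^ (m - k)))"
    by (intro sum.cong refl) (simp add: Suc_diff_le)
  then show ?thesis by (simp add: hsum2_def sum_distrib_left)
qed

lemma hsum3_Suc: "hsum3 (Suc m) X Y Z = X * hsum3 m X Y Z + hsum2 (Suc m) Y Z"
proof -
  have e: "exponents (Suc m) = (\<lambda>(a, b, c). (Suc a, b, c)) ` exponents m \<union> (\<lambda>b. (0, b, Suc m - b)) ` {..Suc m}"
    (is "_ = ?A \<union> ?B")
  proof -
    have "(a, b, c) \<in> exponents (Suc m) \<longleftrightarrow> (a, b, c) \<in> ?A \<union> ?B" for a b c
      by (cases a) (auto simp: exponents_def image_iff)
    then show ?thesis by auto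
  qed
  have "hsum3 (Suc m) X Y Z = (\<Sum>(a, b, c)\<in>?A. X ^ a * Y ^ b * Z ^ c) + (\<Sum>(a, b, c)\<in>?B. X ^ a * Y ^ b * Z ^ c)"
    unfolding hsum3_def e by (rule sum.union_disjoint) auto
  also have "(\<Sum>(a, b, c)\<in>?A. X ^ a * Y ^ b * Z ^ c) = X * hsum3 m X Y Z"
    unfolding hsum3_def sum_distrib_left by (subst sum.reindex) (auto simp: inj_on_def case_prod_beta mult.assoc intro!: sum.cong)
  also have "(\<Sum>(a, b, c)\<in>?B. X ^ a * Y ^ b * Z ^ c) = hsum2 (Suc m) Y Z"
    unfolding hsum2_def by (subst sum.reindex) (auto simp: inj_on_def)
  finally show ?thesis .
qed

text \<open>One triple per face: two vertices i < j of the tetrahedron and an apex k. Fixing the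
  order of i and j lists each of the twelve faces once.\<close>

definition cell_index :: "(nat \<times> nat \<times> nat) set" where
  "cell_index = {(0,1,2),(0,1,3),(0,2,1),(0,2,3),(0,3,1),(0,3,2),(1,2,0),(1,2,3),(1,3,0),(1,3,2),(2,3,0),(2,3,1)}"

lemma cell_index_cases:
  assumes "i < 4" "j < 4" "k < 4" "i \<noteq> j" "k \<noteq> i" "k \<noteq> j"
  shows "(i, j, k) \<in> cell_index \<or> (j, i, k) \<in> cell_index"
  using assms unfolding less_4_cases by (elim disjE) (simp_all add: cell_index_def)

text \<open>The indices of the four vertices add up to 6.\<close>

lemma cell_index_remaining:
  assumes "(i, j, k) \<in> cell_index"
  defines "l \<equiv> 6 - i - j - k"
  shows "distinct [i, j, k, l]" "i < 4" "j < 4" "k < 4" "l < 4" "i + j + k + l = 6" "{..<4} = {i, j, k, l}"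
  using assms(1) unfolding l_def cell_index_def by (auto simp: lessThan_4)

lemma cone_coordinates:
  assumes "(i, j, k) \<in> cell_index" and x: "x = \<alpha> *\<^sub>R tet_vertex i + \<beta> *\<^sub>R tet_vertex j - \<gamma> *\<^sub>R tet_vertex k"
  defines "l \<equiv> 6 - i - j - k"
  shows "tet_vertex i \<bullet> x = 3 * \<alpha> - \<beta> + \<gamma>" "tet_vertex j \<bullet> x = 3 * \<beta> - \<alpha> + \<gamma>"
    "tet_vertex k \<bullet> x = - \<alpha> - \<beta> - 3 * \<gamma>" "tet_vertex l \<bullet> x = - \<alpha> - \<beta> + \<gamma>"
  using cell_index_remaining(1-5)[OF assms(1)] unfolding x l_def
  by (simp_all add: inner_add_right inner_diff_right inner_tet_vertex_tet_vertex)

text \<open>In the interior of the cone the values v_p . x identify the cell: k has the strictly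
  smallest and l the strictly second smallest one, and i < j are the two indices left.\<close>

lemma open_cones_disjoint:
  assumes q: "(i, j, k) \<in> cell_index" "(i', j', k') \<in> cell_index"
    and x: "x = \<alpha> *\<^sub>R tet_vertex i + \<beta> *\<^sub>R tet_vertex j - \<gamma> *\<^sub>R tet_vertex k"
      "x = \<alpha>' *\<^sub>R tet_vertex i' + \<beta>' *\<^sub>R tet_vertex j' - \<gamma>' *\<^sub>R tet_vertex k'"
    and pos: "\<alpha> > 0" "\<beta> > 0" "\<gamma> > 0" "\<alpha>' > 0" "\<beta>' > 0" "\<gamma>' > 0"
  shows "(i, j, k) = (i', j', k')"
proof -
  define l where "l = 6 - i - j - k"
  define l' where "l' = 6 - i' - j' - k'"
  note c = cone_coordinates[OF q(1) x(1), folded l_def]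
  note c' = cone_coordinates[OF q(2) x(2), folded l'_def]
  note r = cell_index_remaining[OF q(1), folded l_def]
  note r' = cell_index_remaining[OF q(2), folded l'_def]
  have m1: "tet_vertex k \<bullet> x < tet_vertex p \<bullet> x" if "p < 4" "p \<noteq> k" for p
  proof -
    have "p \<in> {i, j, k, l}" using that(1) r(7) by auto
    then show ?thesis using that c pos by auto
  qed
  have m1': "tet_vertex k' \<bullet> x < tet_vertex p \<bullet> x" if "p < 4" "p \<noteq> k'" for p
  proof -
    have "p \<in> {i', j', k', l'}" using that(1) r'(7) by auto
    then show ?thesis using that c' pos by auto
  qed
  have k: "k = k'" using m1[of k'] m1'[of k] r(4) r'(4) by force
  have m2: "tet_vertex l \<bullet> x < tet_vertex p \<bullet> x" if "p < 4" "p \<noteq> k" "p \<noteq> l" for p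
  proof -
    have "p \<in> {i, j, k, l}" using that(1) r(7) by auto
    then show ?thesis using that c pos by auto
  qed
  have m2': "tet_vertex l' \<bullet> x < tet_vertex p \<bullet> x" if "p < 4" "p \<noteq> k'" "p \<noteq> l'" for p
  proof -
    have "p \<in> {i', j', k', l'}" using that(1) r'(7) by auto
    then show ?thesis using that c' pos by auto
  qed
  have l: "l = l'" using m2[of l'] m2'[of l] r r' k by force
  have "i + j = i' + j'" using k l r(6) r'(6) by linarith
  then show ?thesis using q k unfolding cell_index_def by auto
qed

section \<open>Cones over the faces\<close>

text \<open>The cone over the face with vertices i, j and apex k. Its coordinates do not involve r,
  since every apex over k lies on the ray of the negative of vertex k.\<close>

definition in_cone :: "nat \<Rightarrow> nat \<Rightarrow> nat \<Rightarrow> real \<Rightarrow> real \<Rightarrow> real \<Rightarrow> real ^ 3 \<Rightarrow> bool" where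
  "in_cone i j k \<alpha> \<beta> \<gamma> x \<longleftrightarrow> (i, j, k) \<in> cell_index \<and> 0 \<le> \<alpha> \<and> 0 \<le> \<beta> \<and> 0 \<le> \<gamma> \<and>
     x = \<alpha> *\<^sub>R tet_vertex i + \<beta> *\<^sub>R tet_vertex j - \<gamma> *\<^sub>R tet_vertex k"

lemma cone_exists:
  assumes k: "k < 4" "\<And>p. p < 4 \<Longrightarrow> tet_vertex k \<bullet> x \<le> tet_vertex p \<bullet> x"
  shows "\<exists>i j \<alpha> \<beta> \<gamma>. in_cone i j k \<alpha> \<beta> \<gamma> x"
proof -
  let ?R = "{..<4} - {k}"
  have "finite ?R" "?R \<noteq> {}" using k(1) by (auto simp: lessThan_4)
  then obtain l where l: "l \<in> ?R" "\<And>p. p \<in> ?R \<Longrightarrow> tet_vertex l \<bullet> x \<le> tet_vertex p \<bullet> x"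
    using ex_min_if_finite[of "(\<lambda>p. tet_vertex p \<bullet> x) ` ?R"] by (metis (no_types, lifting) arg_min_if_finite(1) arg_min_least)
  have "card ({..<4} - {k, l}) = 2" using k(1) l(1) by (subst card_Diff_subset) auto
  then obtain a b where ab: "{..<4} - {k, l} = {a, b}" "a \<noteq> b" by (auto simp: card_2_iff)
  then have mem: "a \<in> {..<4} - {k, l}" "b \<in> {..<4} - {k, l}" by auto
  obtain i j where ij: "(i, j, k) \<in> cell_index" "distinct [i, j, k, l]"
  proof (cases "(a, b, k) \<in> cell_index")
    case True
    then show ?thesis using that[of a b] mem ab(2) l(1) by auto
  next
    case False
    then have "(b, a, k) \<in> cell_index" using cell_index_cases[of a b k] mem ab(2) k(1) by auto
    then show ?thesis using that[of b a] mem ab(2) l(1) by auto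
  qed
  have lt: "i < 4" "j < 4" "l < 4" using cell_index_remaining[OF ij(1)] l(1) by auto
  have "in_cone i j k ((tet_vertex i \<bullet> x - tet_vertex l \<bullet> x) / 4) ((tet_vertex j \<bullet> x - tet_vertex l \<bullet> x) / 4)
      ((tet_vertex l \<bullet> x - tet_vertex k \<bullet> x) / 4) x"
    unfolding in_cone_def using ij l(2)[of i] l(2)[of j] k(2)[of l] lt
    by (auto intro!: tet_decomposition[OF ij(2)] k(1))
  then show ?thesis by blast
qed

lemma argmin_vertex_exists: "\<exists>k<4. \<forall>p<4. tet_vertex k \<bullet> x \<le> tet_vertex p \<bullet> (x :: real ^ 3)"
proof -
  let ?k = "arg_min_on (\<lambda>p. tet_vertex p \<bullet> x) {..<4::nat}"
  have f: "finite {..<4::nat}" "{..<4::nat} \<noteq> {}" by (simp_all add: lessThan_4)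
  have "?k < 4" using arg_min_if_finite(1)[OF f] by simp
  moreover have "tet_vertex ?k \<bullet> x \<le> tet_vertex p \<bullet> x" if "p < 4" for p
    using arg_min_least[OF f, of p "\<lambda>p. tet_vertex p \<bullet> x"] that by simp
  ultimately show ?thesis by blast
qed

lemma in_cone_coordinates:
  assumes "in_cone i j k \<alpha> \<beta> \<gamma> x"
  defines "l \<equiv> 6 - i - j - k"
  shows "tet_vertex i \<bullet> x = 3 * \<alpha> - \<beta> + \<gamma>" "tet_vertex j \<bullet> x = 3 * \<beta> - \<alpha> + \<gamma>"
    "tet_vertex k \<bullet> x = - \<alpha> - \<beta> - 3 * \<gamma>" "tet_vertex l \<bullet> x = - \<alpha> - \<beta> + \<gamma>"
  using assms cone_coordinates[of i j k x \<alpha> \<beta> \<gamma>] unfolding in_cone_def l_def by auto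

lemma tet_vertex_remaining:
  assumes "(i, j, k) \<in> cell_index"
  shows "tet_vertex (6 - i - j - k) = - tet_vertex i - tet_vertex j - tet_vertex k"
  using assms by (auto simp: cell_index_def tet_vertex_simps vec_eq_iff forall_3)

lemma tetrahedron_cone:
  assumes c: "in_cone i j k \<alpha> \<beta> \<gamma> x" and le: "\<alpha> + \<beta> + 3 * \<gamma> \<le> 1"
  shows "x \<in> tetrahedron"
proof -
  define l where "l = 6 - i - j - k"
  have q: "(i, j, k) \<in> cell_index" and n: "0 \<le> \<alpha>" "0 \<le> \<beta>" "0 \<le> \<gamma>"
    and x: "x = \<alpha> *\<^sub>R tet_vertex i + \<beta> *\<^sub>R tet_vertex j - \<gamma> *\<^sub>R tet_vertex k"
    using c by (auto simp: in_cone_def)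
  note r = cell_index_remaining[OF q, folded l_def]
  \<comment> \<open>Since the vertices add up to 0, the term - \<gamma> v_k becomes \<gamma> (v_i +
    v_j + v_l), and the missing weight 1 - \<alpha> - \<beta> - 3 \<gamma> can be spread evenly over
    all four.\<close>
  define e where "e = (1 - \<alpha> - \<beta> - 3 * \<gamma>) / 4"
  define u where "u p = (if p = i then \<alpha> + \<gamma> + e else if p = j then \<beta> + \<gamma> + e else if p = l then \<gamma> + e else e)" for p
  have V: "convex tetrahedron" "\<And>p. p \<in> {i, j, k, l} \<Longrightarrow> tet_vertex p \<in> tetrahedron"
    unfolding tetrahedron_def r(7)[symmetric] by (auto intro: hull_inc)
  have "(\<Sum>p\<in>{i, j, k, l}. u p *\<^sub>R tet_vertex p) \<in> tetrahedron"
  proof (rule convex_sum[OF _ V(1)])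
    show "sum u {i, j, k, l} = 1" using r(1) by (auto simp: u_def e_def field_simps)
    show "u p \<ge> 0" if "p \<in> {i, j, k, l}" for p using n le by (auto simp: u_def e_def)
  qed (use V(2) in auto)
  also have "(\<Sum>p\<in>{i, j, k, l}. u p *\<^sub>R tet_vertex p) = x"
  proof -
    have "(\<Sum>p\<in>{i, j, k, l}. u p *\<^sub>R tet_vertex p) = (\<alpha> + \<gamma> + e) *\<^sub>R tet_vertex i + (\<beta> + \<gamma> + e) *\<^sub>R tet_vertex j
        + e *\<^sub>R tet_vertex k + (\<gamma> + e) *\<^sub>R tet_vertex l"
      using r(1) by (auto simp: u_def)
    also have "\<dots> = x" unfolding x tet_vertex_remaining[OF q, folded l_def] by (simp add: algebra_simps)
    finally show ?thesis .
  qed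
  finally show ?thesis .
qed

section \<open>Pyramids and the solid in cone coordinates\<close>

lemma pyramid_iff:
  assumes q: "(i, j, k) \<in> cell_index"
  defines "l \<equiv> 6 - i - j - k"
  shows "x \<in> pyramid r k \<longleftrightarrow> (\<exists>p q s t. 0 \<le> p \<and> 0 \<le> q \<and> 0 \<le> s \<and> 0 \<le> t \<and> p + q + s + t = 1 \<and>
    x = p *\<^sub>R tet_vertex i + q *\<^sub>R tet_vertex j + s *\<^sub>R tet_vertex l + t *\<^sub>R tet_apex r k)"
proof -
  note r = cell_index_remaining[OF q, folded l_def]
  have "{..<4} - {k} = {i, j, l}" using r(1) unfolding r(7) by auto
  then have P: "pyramid r k = convex hull {tet_apex r k, tet_vertex i, tet_vertex j, tet_vertex l}" by (simp add: pyramid_def)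
  show ?thesis
  proof
    assume "x \<in> pyramid r k"
    then have "x \<in> {u *\<^sub>R tet_apex r k + v *\<^sub>R y |u v y. 0 \<le> u \<and> 0 \<le> v \<and> u + v = 1 \<and> y \<in> convex hull {tet_vertex i, tet_vertex j, tet_vertex l}}"
      unfolding P by (subst (asm) convex_hull_insert) auto
    then obtain u v y where uv: "0 \<le> u" "0 \<le> v" "u + v = 1" "y \<in> convex hull {tet_vertex i, tet_vertex j, tet_vertex l}"
      "x = u *\<^sub>R tet_apex r k + v *\<^sub>R y" by blast
    then obtain a b c where abc: "0 \<le> a" "0 \<le> b" "0 \<le> c" "a + b + c = 1" "y = a *\<^sub>R tet_vertex i + b *\<^sub>R tet_vertex j + c *\<^sub>R tet_vertex l"
      by (auto simp: convex_hull_3)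
    have "v * a + v * b + v * c + u = v * (a + b + c) + u" by (simp add: algebra_simps)
    also have "\<dots> = 1" using abc(4) uv(3) by simp
    finally have "v * a + v * b + v * c + u = 1" .
    then show "\<exists>p q s t. 0 \<le> p \<and> 0 \<le> q \<and> 0 \<le> s \<and> 0 \<le> t \<and> p + q + s + t = 1 \<and>
        x = p *\<^sub>R tet_vertex i + q *\<^sub>R tet_vertex j + s *\<^sub>R tet_vertex l + t *\<^sub>R tet_apex r k"
      using uv abc by (intro exI[of _ "v * a"] exI[of _ "v * b"] exI[of _ "v * c"] exI[of _ u]) (auto simp: algebra_simps)
  next
    assume "\<exists>p q s t. 0 \<le> p \<and> 0 \<le> q \<and> 0 \<le> s \<and> 0 \<le> t \<and> p + q + s + t = 1 \<and>
        x = p *\<^sub>R tet_vertex i + q *\<^sub>R tet_vertex j + s *\<^sub>R tet_vertex l + t *\<^sub>R tet_apex r k"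
    then obtain p q s t where w: "0 \<le> p" "0 \<le> q" "0 \<le> s" "0 \<le> t" "p + q + s + t = 1"
      "x = p *\<^sub>R tet_vertex i + q *\<^sub>R tet_vertex j + s *\<^sub>R tet_vertex l + t *\<^sub>R tet_apex r k" by blast
    let ?u = "[p, q, s, t]" and ?y = "[tet_vertex i, tet_vertex j, tet_vertex l, tet_apex r k]"
    have "(\<Sum>n\<in>{..<4}. ?u ! n *\<^sub>R ?y ! n) \<in> pyramid r k"
    proof (rule convex_sum)
      show "convex (pyramid r k)" by (simp add: pyramid_def)
      show "sum ((!) ?u) {..<4} = 1" using w by (simp add: lessThan_4 numeral_3_eq_3 numeral_2_eq_2)
      fix n :: nat assume "n \<in> {..<4}"
      then have n: "n = 0 \<or> n = 1 \<or> n = 2 \<or> n = 3" by (simp add: lessThan_4)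
      then show "?u ! n \<ge> 0" using w by (auto simp: numeral_3_eq_3 numeral_2_eq_2)
      show "?y ! n \<in> pyramid r k" unfolding P using n by (auto simp: numeral_3_eq_3 numeral_2_eq_2 intro!: hull_inc)
    qed simp
    then show "x \<in> pyramid r k" using w(6) by (simp add: lessThan_4 numeral_3_eq_3 numeral_2_eq_2 add.assoc)
  qed
qed

text \<open>The fourth vertex is eliminated through v_l = - v_i - v_j - v_k. Then s and t are the
  barycentric weights of v_l and of the apex, while \<alpha> + s and \<beta> + s are those of v_i
  and v_j.\<close>

lemma pyramid_cone_iff:
  assumes c: "in_cone i j k \<alpha> \<beta> \<gamma> x" and r: "r > 0"
  shows "x \<in> pyramid r k \<longleftrightarrow> (\<exists>s t. 0 \<le> s \<and> 0 \<le> t \<and> \<alpha> + \<beta> + 3 * s + t = 1 \<and> \<gamma> = s + t * r / 3 \<and> 0 \<le> \<alpha> + s \<and> 0 \<le> \<beta> + s)"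
proof -
  define l where "l = 6 - i - j - k"
  have q: "(i, j, k) \<in> cell_index" and x: "x = \<alpha> *\<^sub>R tet_vertex i + \<beta> *\<^sub>R tet_vertex j - \<gamma> *\<^sub>R tet_vertex k"
    using c by (auto simp: in_cone_def)
  note rr = cell_index_remaining[OF q, folded l_def]
  have ap: "tet_apex r k = (- r / 3) *\<^sub>R tet_vertex k" by (rule tet_apex_eq[OF rr(4)])
  have vl: "tet_vertex l = - tet_vertex i - tet_vertex j - tet_vertex k" unfolding l_def by (rule tet_vertex_remaining[OF q])
  have eq: "p *\<^sub>R tet_vertex i + q *\<^sub>R tet_vertex j + s *\<^sub>R tet_vertex l + t *\<^sub>R tet_apex r k
      = (p - s) *\<^sub>R tet_vertex i + (q - s) *\<^sub>R tet_vertex j - (s + t * r / 3) *\<^sub>R tet_vertex k" for p q s t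
    unfolding ap vl by (simp add: algebra_simps)
  show ?thesis
  proof
    assume "x \<in> pyramid r k"
    then have "\<exists>p q s t. 0 \<le> p \<and> 0 \<le> q \<and> 0 \<le> s \<and> 0 \<le> t \<and> p + q + s + t = 1 \<and>
        x = p *\<^sub>R tet_vertex i + q *\<^sub>R tet_vertex j + s *\<^sub>R tet_vertex l + t *\<^sub>R tet_apex r k"
      unfolding pyramid_iff[OF q, folded l_def] .
    then obtain p q s t where w: "0 \<le> p" "0 \<le> q" "0 \<le> s" "0 \<le> t" "p + q + s + t = 1"
      "x = (p - s) *\<^sub>R tet_vertex i + (q - s) *\<^sub>R tet_vertex j - (s + t * r / 3) *\<^sub>R tet_vertex k"
      unfolding eq by blast
    note c1 = cone_coordinates[OF \<open>(i, j, k) \<in> cell_index\<close> x] and c2 = cone_coordinates[OF \<open>(i, j, k) \<in> cell_index\<close> w(6)]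
    have "\<alpha> = p - s" using c1(1,4) c2(1,4) by argo
    moreover have "\<beta> = q - s" using c1(2,4) c2(2,4) by argo
    moreover have "\<gamma> = s + t * r / 3" using c1(3,4) c2(3,4) by argo
    ultimately
    show "\<exists>s t. 0 \<le> s \<and> 0 \<le> t \<and> \<alpha> + \<beta> + 3 * s + t = 1 \<and> \<gamma> = s + t * r / 3 \<and> 0 \<le> \<alpha> + s \<and> 0 \<le> \<beta> + s"
      using w by (intro exI[of _ s] exI[of _ t]) auto
  next
    assume "\<exists>s t. 0 \<le> s \<and> 0 \<le> t \<and> \<alpha> + \<beta> + 3 * s + t = 1 \<and> \<gamma> = s + t * r / 3 \<and> 0 \<le> \<alpha> + s \<and> 0 \<le> \<beta> + s"
    then obtain s t where "0 \<le> s" "0 \<le> t" "\<alpha> + \<beta> + 3 * s + t = 1" "\<gamma> = s + t * r / 3" "0 \<le> \<alpha> + s" "0 \<le> \<beta> + s" by blast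
    then show "x \<in> pyramid r k"
      unfolding pyramid_iff[OF q, folded l_def] eq x
      by (intro exI[of _ "\<alpha> + s"] exI[of _ "\<beta> + s"] exI[of _ s] exI[of _ t]) auto
  qed
qed

text \<open>The quantity \<open>\<alpha> + \<beta> + 3 * \<gamma> / r\<close> is the gauge of the solid on the cone: it equals 1 on the face.\<close>

lemma pyramid_cone_level:
  assumes c: "in_cone i j k \<alpha> \<beta> \<gamma> x" and r: "r > 0"
  shows "x \<in> pyramid r k \<Longrightarrow> \<exists>s\<ge>0. \<alpha> + \<beta> + 3 * \<gamma> / r = 1 + 3 * s * (1 / r - 1)"
    and "r \<noteq> 1 \<Longrightarrow> 0 \<le> (\<alpha> + \<beta> + 3 * \<gamma> / r - 1) / (1 - r) \<Longrightarrow> 0 \<le> (1 - \<alpha> - \<beta> - 3 * \<gamma>) / (1 - r) \<Longrightarrow> x \<in> pyramid r k"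
proof -
  assume "x \<in> pyramid r k"
  then obtain s t where st: "0 \<le> s" "\<alpha> + \<beta> + 3 * s + t = 1" "\<gamma> = s + t * r / 3"
    using pyramid_cone_iff[OF c r] by blast
  have "3 * \<gamma> / r = 3 * s / r + t" unfolding st(3) using r by (simp add: field_simps)
  then show "\<exists>s\<ge>0. \<alpha> + \<beta> + 3 * \<gamma> / r = 1 + 3 * s * (1 / r - 1)"
    using st r by (intro exI[of _ s]) (simp add: algebra_simps)
next
  assume r1: "r \<noteq> 1" and h: "0 \<le> (\<alpha> + \<beta> + 3 * \<gamma> / r - 1) / (1 - r)" "0 \<le> (1 - \<alpha> - \<beta> - 3 * \<gamma>) / (1 - r)"
  have n: "0 \<le> \<alpha>" "0 \<le> \<beta>" using c by (auto simp: in_cone_def)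
  \<comment> \<open>The solution of the linear system 3 s + t = 1 - \<alpha> - \<beta> and s + t r /
    3 = \<gamma>, whose determinant is a multiple of 1 - r. Dividing by 1 - r in the hypotheses
    treats r < 1 and r > 1 together.\<close>
  define s where "s = r / 3 * ((\<alpha> + \<beta> + 3 * \<gamma> / r - 1) / (1 - r))"
  define t where "t = (1 - \<alpha> - \<beta> - 3 * \<gamma>) / (1 - r)"
  have s0: "s \<ge> 0" unfolding s_def using h(1) r by (intro mult_nonneg_nonneg) auto
  have t0: "t \<ge> 0" unfolding t_def by (rule h(2))
  have s': "s * (1 - r) = (r * \<alpha> + r * \<beta> + 3 * \<gamma> - r) / 3" unfolding s_def using r r1 by (simp add: field_simps)
  have t': "t * (1 - r) = 1 - \<alpha> - \<beta> - 3 * \<gamma>" unfolding t_def using r1 by simp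
  have "(\<alpha> + \<beta> + 3 * s + t) * (1 - r) = (\<alpha> + \<beta>) * (1 - r) + 3 * (s * (1 - r)) + t * (1 - r)" by (simp add: algebra_simps)
  also have "\<dots> = 1 * (1 - r)" unfolding s' t' by (simp add: field_simps)
  finally have e1: "\<alpha> + \<beta> + 3 * s + t = 1" using r1 by simp
  have "(s + t * r / 3) * (1 - r) = s * (1 - r) + (t * (1 - r)) * r / 3" by (simp add: algebra_simps)
  also have "\<dots> = \<gamma> * (1 - r)" unfolding s' t' by (simp add: field_simps)
  finally have e2: "\<gamma> = s + t * r / 3" using r1 by simp
  show "x \<in> pyramid r k" unfolding pyramid_cone_iff[OF c r] using s0 t0 e1 e2 n by (intro exI[of _ s] exI[of _ t]) auto
qed

text \<open>The inequality holds at the generating points and is linear. Hence a pyramid over face k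
  meets only those cones in which k attains the smallest value.\<close>

lemma pyramid_argmin:
  assumes x: "x \<in> pyramid r k" and r: "r > 0" and k: "k < 4" and p: "p < 4"
  shows "tet_vertex k \<bullet> x \<le> tet_vertex p \<bullet> x"
proof -
  let ?h = "{y. (tet_vertex p - tet_vertex k) \<bullet> y \<ge> 0}"
  have "insert (tet_apex r k) (tet_vertex ` ({..<4} - {k})) \<subseteq> ?h"
    using k p r by (auto simp: tet_apex_eq inner_diff_left inner_tet_vertex_tet_vertex)
  then have "pyramid r k \<subseteq> ?h" unfolding pyramid_def by (rule hull_minimal) (rule convex_halfspace_ge)
  then show ?thesis using x by (auto simp: inner_diff_left)
qed

text \<open>The union of the simplices spanned by the origin and the twelve faces.\<close>

definition solid_cells :: "real \<Rightarrow> (real ^ 3) set" where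
  "solid_cells r = {x. \<exists>i j k \<alpha> \<beta> \<gamma>. in_cone i j k \<alpha> \<beta> \<gamma> x \<and> \<alpha> + \<beta> + 3 * \<gamma> / r \<le> 1}"

lemma tetrahedron_diff_pyramids:
  assumes r: "r > 0" and x: "x \<in> tetrahedron" and np: "r < 1 \<Longrightarrow> \<forall>k<4. x \<notin> pyramid r k"
  shows "x \<in> solid_cells r"
proof -
  obtain k where k: "k < 4" "\<And>p. p < 4 \<Longrightarrow> tet_vertex k \<bullet> x \<le> tet_vertex p \<bullet> x" using argmin_vertex_exists[of x] by blast
  obtain i j \<alpha> \<beta> \<gamma> where c: "in_cone i j k \<alpha> \<beta> \<gamma> x" using cone_exists[OF k] by blast
  then have \<gamma>: "\<gamma> \<ge> 0" by (simp add: in_cone_def)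
  have t: "\<alpha> + \<beta> + 3 * \<gamma> \<le> 1" using tetrahedron_halfspaces[OF x k(1)] in_cone_coordinates(3)[OF c] by simp
  have "\<alpha> + \<beta> + 3 * \<gamma> / r \<le> 1"
  proof (cases "r \<ge> 1")
    case True
    have "3 * \<gamma> / r \<le> 3 * \<gamma> / 1" using True \<gamma> by (intro divide_left_mono) auto
    then show ?thesis using t by simp
  next
    case False
    show ?thesis
    proof (rule ccontr)
      assume "\<not> \<alpha> + \<beta> + 3 * \<gamma> / r \<le> 1"
      then have "x \<in> pyramid r k" using False t by (intro pyramid_cone_level(2)[OF c r]) auto
      then show False using np False k(1) by auto
    qed
  qed
  then show ?thesis unfolding solid_cells_def using c by blast
qed

lemma triakis_solid_eq_cells:
  assumes r: "r \<ge> 1"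
  shows "triakis_solid r = solid_cells r"
proof
  have r0: "r > 0" using r by simp
  show "triakis_solid r \<subseteq> solid_cells r"
  proof
    fix x assume "x \<in> triakis_solid r"
    then consider "x \<in> tetrahedron" | k where "k < 4" "x \<in> pyramid r k" using r by (auto simp: triakis_solid_def)
    then show "x \<in> solid_cells r"
    proof cases
      case 1
      then show ?thesis using tetrahedron_diff_pyramids[OF r0 1] r by simp
    next
      case 2
      obtain i j \<alpha> \<beta> \<gamma> where c: "in_cone i j k \<alpha> \<beta> \<gamma> x"
        using cone_exists[OF 2(1) pyramid_argmin[OF 2(2) r0 2(1)]] by blast
      obtain s where s: "s \<ge> 0" "\<alpha> + \<beta> + 3 * \<gamma> / r = 1 + 3 * s * (1 / r - 1)"
        using pyramid_cone_level(1)[OF c r0 2(2)] by blast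
      have "3 * s * (1 / r - 1) \<le> 0" using s(1) r by (intro mult_nonneg_nonpos) auto
      then show ?thesis unfolding solid_cells_def using c s(2) by fastforce
    qed
  qed
  show "solid_cells r \<subseteq> triakis_solid r"
  proof
    fix x assume "x \<in> solid_cells r"
    then obtain i j k \<alpha> \<beta> \<gamma> where c: "in_cone i j k \<alpha> \<beta> \<gamma> x" and l: "\<alpha> + \<beta> + 3 * \<gamma> / r \<le> 1" unfolding solid_cells_def by blast
    have k: "k < 4" using c cell_index_remaining(4) by (auto simp: in_cone_def)
    show "x \<in> triakis_solid r"
    proof (cases "\<alpha> + \<beta> + 3 * \<gamma> \<le> 1")
      case True
      then show ?thesis using tetrahedron_cone[OF c] r by (simp add: triakis_solid_def)
    next
      case False
      have "r \<noteq> 1" using False l by auto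
      then have "x \<in> pyramid r k" using False l r by (intro pyramid_cone_level(2)[OF c r0] divide_nonpos_nonpos) auto
      then show ?thesis using r k by (auto simp: triakis_solid_def)
    qed
  qed
qed

lemma compact_tetrahedron_pyramid: "compact tetrahedron" "compact (pyramid r k)"
  unfolding tetrahedron_def pyramid_def by (rule finite_imp_compact_convex_hull, simp)+

lemma closed_triakis_solid: "closed (triakis_solid r)"
  using compact_tetrahedron_pyramid by (auto simp: triakis_solid_def intro!: compact_imp_closed closed_Un closed_UN)

text \<open>For r < 1 the solid is a closure, so it is only compared from both sides: the closed
  cells contain it, and it contains their interiors, which avoid all pyramids. The differing
  boundary points form a null set.\<close>

lemma excavated_solid_cells:
  assumes r: "0 < r" "r < 1" and cl: "closed (solid_cells r)"
  shows "triakis_solid r \<subseteq> solid_cells r"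
    and "in_cone i j k \<alpha> \<beta> \<gamma> x \<Longrightarrow> 0 < \<alpha> \<Longrightarrow> 0 < \<beta> \<Longrightarrow> 0 < \<gamma> \<Longrightarrow> \<alpha> + \<beta> + 3 * \<gamma> / r < 1 \<Longrightarrow> x \<in> triakis_solid r"
proof -
  have "tetrahedron - (\<Union>i<4. pyramid r i) \<subseteq> solid_cells r"
    using tetrahedron_diff_pyramids[OF r(1)] by auto
  then have "closure (tetrahedron - (\<Union>i<4. pyramid r i)) \<subseteq> solid_cells r" using cl by (rule closure_minimal)
  then show "triakis_solid r \<subseteq> solid_cells r" using r by (simp add: triakis_solid_def)
next
  assume c: "in_cone i j k \<alpha> \<beta> \<gamma> x" and pos: "0 < \<alpha>" "0 < \<beta>" "0 < \<gamma>" and l: "\<alpha> + \<beta> + 3 * \<gamma> / r < 1"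
  have q: "(i, j, k) \<in> cell_index" using c by (simp add: in_cone_def)
  note rr = cell_index_remaining[OF q]
  have "3 * \<gamma> / 1 \<le> 3 * \<gamma> / r" using r pos by (intro divide_left_mono) auto
  then have "x \<in> tetrahedron" using l by (intro tetrahedron_cone[OF c]) simp
  moreover have "x \<notin> pyramid r m" if m: "m < 4" for m
  proof
    assume x: "x \<in> pyramid r m"
    show False
    proof (cases "m = k")
      case True
      obtain s where s: "s \<ge> 0" "\<alpha> + \<beta> + 3 * \<gamma> / r = 1 + 3 * s * (1 / r - 1)"
        using pyramid_cone_level(1)[OF c r(1)] x True by blast
      have "3 * s * (1 / r - 1) \<ge> 0" using s(1) r by (intro mult_nonneg_nonneg) auto
      then show False using s(2) l by simp
    next
      case False
      then have "m = i \<or> m = j \<or> m = 6 - i - j - k" using m rr(7) by auto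
      then show False using pyramid_argmin[OF x r(1) m rr(4)] in_cone_coordinates[OF c] pos by auto
    qed
  qed
  ultimately have "x \<in> tetrahedron - (\<Union>i<4. pyramid r i)" by auto
  then have "x \<in> closure (tetrahedron - (\<Union>i<4. pyramid r i))" by (rule subsetD[OF closure_subset])
  then show "x \<in> triakis_solid r" using r by (simp add: triakis_solid_def)
qed

text \<open>Among the sums of two of the four values v_p . x, the one for i and j is the largest and
  equals the right side.\<close>

lemma cone_pair_sum:
  assumes c: "in_cone i j k \<alpha> \<beta> \<gamma> x" and "p < 4" "q < 4" "p \<noteq> q"
  shows "tet_vertex p \<bullet> x + tet_vertex q \<bullet> x \<le> 2 * (\<alpha> + \<beta> + \<gamma>)"
proof -
  have n: "(i, j, k) \<in> cell_index" "0 \<le> \<alpha>" "0 \<le> \<beta>" "0 \<le> \<gamma>" using c by (auto simp: in_cone_def)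
  have "p \<in> {i, j, k, 6 - i - j - k}" "q \<in> {i, j, k, 6 - i - j - k}" using cell_index_remaining(7)[OF n(1)] assms by auto
  then show ?thesis using in_cone_coordinates[OF c] n assms(4) by auto
qed

text \<open>For \<open>r = 3\<close> the cells of \<open>x\<close> and \<open>- x\<close> are at the same level because the largest sum of two of
  the four coordinates of \<open>x\<close> is the negative of the smallest one.\<close>

lemma cone_uminus:
  assumes c: "in_cone i j k \<alpha> \<beta> \<gamma> x"
  shows "\<exists>i' j' k' \<alpha>' \<beta>' \<gamma>'. in_cone i' j' k' \<alpha>' \<beta>' \<gamma>' (- x) \<and> \<alpha>' + \<beta>' + \<gamma>' = \<alpha> + \<beta> + \<gamma>"
proof -
  obtain m where m: "m < 4" "\<And>p. p < 4 \<Longrightarrow> tet_vertex m \<bullet> (- x) \<le> tet_vertex p \<bullet> (- x)" using argmin_vertex_exists[of "- x"] by blast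
  obtain i' j' \<alpha>' \<beta>' \<gamma>' where c': "in_cone i' j' m \<alpha>' \<beta>' \<gamma>' (- x)" using cone_exists[OF m] by blast
  have q: "(i, j, k) \<in> cell_index" "(i', j', m) \<in> cell_index" using c c' by (auto simp: in_cone_def)
  note r = cell_index_remaining[OF q(1)] and r' = cell_index_remaining[OF q(2)]
  have "2 * (\<alpha>' + \<beta>' + \<gamma>') = tet_vertex m \<bullet> x + tet_vertex (6 - i' - j' - m) \<bullet> x"
    using in_cone_coordinates[OF c'] by simp
  also have "\<dots> \<le> 2 * (\<alpha> + \<beta> + \<gamma>)" using r' by (intro cone_pair_sum[OF c]) auto
  finally have 1: "\<alpha>' + \<beta>' + \<gamma>' \<le> \<alpha> + \<beta> + \<gamma>" by simp
  have "2 * (\<alpha> + \<beta> + \<gamma>) = tet_vertex k \<bullet> (- x) + tet_vertex (6 - i - j - k) \<bullet> (- x)"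
    using in_cone_coordinates[OF c] by simp
  also have "\<dots> \<le> 2 * (\<alpha>' + \<beta>' + \<gamma>')" using r by (intro cone_pair_sum[OF c']) auto
  finally show ?thesis using 1 c' by (intro exI conjI) (assumption, simp)
qed

section \<open>Power integrals of the skeletons\<close>

text \<open>\<Phi> gives the power integrals up to a positive factor that may depend on the degree m
  but not on z; such a factor leaves the vanishing conditions within one degree unchanged.\<close>

definition has_power_sums :: "real \<Rightarrow> nat \<Rightarrow> (nat \<Rightarrow> real ^ 3 \<Rightarrow> real) \<Rightarrow> bool" where
  "has_power_sums r k \<Phi> \<longleftrightarrow> skeleton r k \<in> sets borel \<and> bounded (skeleton r k) \<and>
     0 < emeasure (hausdorff_measure k) (skeleton r k) \<and> emeasure (hausdorff_measure k) (skeleton r k) < \<infinity> \<and>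
     (\<forall>m. \<exists>K>0. \<forall>z. power_integral r k m z = K * \<Phi> m z)"

lemma linear_comb2: "linear (\<lambda>(s, t). s *\<^sub>R u + t *\<^sub>R (v :: 'a::real_vector))"
  by (auto simp: linear_iff algebra_simps)

lemma linear_comb3: "linear (\<lambda>(s, t, w). s *\<^sub>R u + t *\<^sub>R v + w *\<^sub>R (y :: 'a::real_vector))"
  by (auto simp: linear_iff algebra_simps)

text \<open>Common to the faces and to the solid; the last argument is the value of the linear form
  at the apex.\<close>

definition cell_sum :: "real \<Rightarrow> nat \<Rightarrow> real ^ 3 \<Rightarrow> real" where
  "cell_sum r m z = (\<Sum>(i, j, k)\<in>cell_index. hsum3 m (tet_vertex i \<bullet> z) (tet_vertex j \<bullet> z) (- (r / 3) * (tet_vertex k \<bullet> z)))"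

text \<open>The factors are edge lengths: 2 sqrt 2 for the edges of the tetrahedron and sqrt((r^2 -
  2 r + 9) / 3) for those that end in an apex.\<close>

definition edge_sum :: "real \<Rightarrow> nat \<Rightarrow> real ^ 3 \<Rightarrow> real" where
  "edge_sum r m z =
     2 * sqrt 2 * (\<Sum>(i, j)\<in>{(i, j). i < j \<and> j < 4}. hsum2 m (tet_vertex j \<bullet> z) (tet_vertex i \<bullet> z)) +
     sqrt ((r\<^sup>2 - 2 * r + 9) / 3) *
       (\<Sum>(i, j)\<in>{(i, j). i < 4 \<and> j < 4 \<and> i \<noteq> j}. hsum2 m (- (r / 3) * (tet_vertex j \<bullet> z)) (tet_vertex i \<bullet> z))"

definition vertex_sum :: "real \<Rightarrow> nat \<Rightarrow> real ^ 3 \<Rightarrow> real" where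
  "vertex_sum r m z = (\<Sum>i<4. (tet_vertex i \<bullet> z) ^ m) + (\<Sum>i<4. (- (r / 3) * (tet_vertex i \<bullet> z)) ^ m)"

section \<open>Faces and solid\<close>

lemma faces_power_sums:
  assumes r: "r > 0"
  shows "has_power_sums r 2 (cell_sum r)"
proof -
  define L where "L = (\<lambda>(i, j, k) (s, t). s *\<^sub>R (tet_vertex i - tet_apex r k) + t *\<^sub>R (tet_vertex j - tet_apex r k))"
  define p where "p = (\<lambda>(i :: nat, j :: nat, k). tet_apex r k)"
  define q where "q = (\<lambda>c t. p c + L c t)"
  have q_eq: "q (i, j, k) (s, t) = s *\<^sub>R tet_vertex i + t *\<^sub>R tet_vertex j + (1 - s - t) *\<^sub>R tet_apex r k" for i j k s t
    by (simp add: q_def p_def L_def algebra_simps)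
  have lin: "linear (L c)" for c
    by (cases c) (simp add: L_def linear_comb2)
  have ap: "tet_apex r k = (- r / 3) *\<^sub>R tet_vertex k" if "k < 4" for k by (rule tet_apex_eq[OF that])
  have S_eq: "skeleton r 2 = (\<Union>c\<in>cell_index. q c ` triangle 1)"
  proof
    show "skeleton r 2 \<subseteq> (\<Union>c\<in>cell_index. q c ` triangle 1)"
    proof
      fix x assume "x \<in> skeleton r 2"
      then obtain i j k where ijk: "i < 4" "j < 4" "k < 4" "i \<noteq> j" "k \<noteq> i" "k \<noteq> j"
        and x: "x \<in> convex hull {tet_vertex i, tet_vertex j, tet_apex r k}"
        by (auto simp: skeleton_def triakis_faces_def)
      from x obtain u v w where uvw: "0 \<le> u" "0 \<le> v" "0 \<le> w" "u + v + w = 1" "x = u *\<^sub>R tet_vertex i + v *\<^sub>R tet_vertex j + w *\<^sub>R tet_apex r k"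
        by (auto simp: convex_hull_3)
      have w: "w = 1 - u - v" using uvw(4) by simp
      have 1: "x = q (i, j, k) (u, v)" unfolding q_eq uvw(5) w ..
      have 2: "x = q (j, i, k) (v, u)" unfolding q_eq uvw(5) w by (simp add: algebra_simps)
      have 3: "(u, v) \<in> triangle 1" "(v, u) \<in> triangle 1" using uvw by (auto simp: triangle_def)
      show "x \<in> (\<Union>c\<in>cell_index. q c ` triangle 1)" using cell_index_cases[OF ijk] 1 2 3 by blast
    qed
    show "(\<Union>c\<in>cell_index. q c ` triangle 1) \<subseteq> skeleton r 2"
    proof clarify
      fix i j k s t assume c: "(i, j, k) \<in> cell_index" and st: "(s, t) \<in> triangle 1"
      note R = cell_index_remaining(1-4)[OF c]
      have "q (i, j, k) (s, t) \<in> convex hull {tet_vertex i, tet_vertex j, tet_apex r k}"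
        unfolding q_eq convex_hull_3 using st by (force simp: triangle_def)
      moreover have "convex hull {tet_vertex i, tet_vertex j, tet_apex r k} \<in> triakis_faces r"
        unfolding triakis_faces_def using R by auto
      ultimately show "q (i, j, k) (s, t) \<in> skeleton r 2" by (auto simp: skeleton_def)
    qed
  qed
  have fin: "finite cell_index" "cell_index \<noteq> {}" by (auto simp: cell_index_def)
  have cq: "compact (q c ` triangle 1)" for c
    unfolding q_def using lin[of c]
    by (intro compact_continuous_image compact_triangle continuous_intros) (simp add: linear_continuous_on linear_linear)
  have "compact (\<Union>c\<in>cell_index. q c ` triangle 1)" using fin cq by (intro compact_UN) auto
  then have borel: "skeleton r 2 \<in> sets borel" unfolding S_eq by (rule borel_compact)
  \<comment> \<open>The quadratic form |L c (s, t)|^2 is the same for all c: the faces are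
    congruent, and the scaling factor is 1.\<close>
  have nrm: "norm (L c t) = 1 * norm (L (0, 1, 2) t)" if "c \<in> cell_index" for c t
  proof -
    have "L c (s, t) \<bullet> L c (s, t) = (s\<^sup>2 + t\<^sup>2) * (3 - 2 * r / 3 + r\<^sup>2 / 3) + 2 * s * t * (- 1 - 2 * r / 3 + r\<^sup>2 / 3)"
      if "c \<in> cell_index" for c s t
    proof (cases c)
      case (fields i j k)
      note R = cell_index_remaining(1-4)[OF that[unfolded fields]]
      show ?thesis unfolding fields L_def using R
        by (simp add: ap inner_add_left inner_add_right inner_diff_left inner_diff_right inner_tet_vertex_tet_vertex)
          (simp add: power2_eq_square field_simps)
    qed
    from this[OF that, of "fst t" "snd t"] this[of "(0, 1, 2)" "fst t" "snd t"]
    show ?thesis by (simp add: norm_eq cell_index_def)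
  qed
  have inj0: "inj (L (0, 1, 2))"
  proof -
    have "t = 0" if "L (0, 1, 2) t = 0" for t
    proof (cases t)
      case (Pair a b)
      have "L (0, 1, 2) (a, b) = a *\<^sub>R tet_vertex 0 + b *\<^sub>R tet_vertex 1 - (- (a + b) * r / 3) *\<^sub>R tet_vertex 2"
        by (simp add: L_def ap vec_eq_iff forall_3 tet_vertex_simps field_simps)
      from cone_coordinates[OF _ this, unfolded that[unfolded Pair]] show ?thesis
        by (simp add: cell_index_def Pair zero_prod_def)
    qed
    then show ?thesis using lin by (simp add: linear_injective_0)
  qed
  have D2: "DIM(real \<times> real) = 2" by simp
  obtain K where K: "K > 0" "0 < emeasure (hausdorff_measure 2) (skeleton r 2)"
      "emeasure (hausdorff_measure 2) (skeleton r 2) < \<infinity>" "bounded (skeleton r 2)"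
    and int: "\<And>h :: real ^ 3 \<Rightarrow> real. continuous_on UNIV h \<Longrightarrow> set_lebesgue_integral (hausdorff_measure 2) (skeleton r 2) h
      = K * (\<Sum>c\<in>cell_index. 1 ^ 2 * set_lebesgue_integral lborel (triangle 1) (\<lambda>t. h (p c + L c t)))"
  proof (rule similar_cells[where I = cell_index and L = L and ?L0.0 = "L (0, 1, 2)" and p = p and D = "triangle 1" and ?D0.0 = open_triangle
        and S = "skeleton r 2" and w = "\<lambda>_. 1", unfolded D2])
    show "finite cell_index" "cell_index \<noteq> {}" by (fact fin)+
    show "linear (L c)" "linear (L (0, 1, 2))" for c by (rule lin)+
    show "inj (L (0, 1, 2))" by (rule inj0)
    show "norm (L c t) = 1 * norm (L (0, 1, 2) t)" if "c \<in> cell_index" for c t by (rule nrm[OF that])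
    show "compact (triangle 1)" by (rule compact_triangle)
    show "open_triangle \<subseteq> triangle 1" "open_triangle \<in> sets borel" "triangle 1 - open_triangle \<in> null_sets lborel"
      by (rule open_triangle)+
    show "emeasure lborel (triangle 1) \<noteq> 0" by (rule simplices_nonnull)
    show "skeleton r 2 \<in> sets borel" by (rule borel)
    show "skeleton r 2 \<subseteq> (\<Union>c\<in>cell_index. (\<lambda>t. p c + L c t) ` triangle 1)" using S_eq unfolding q_def by simp
    show "(\<Union>c\<in>cell_index. (\<lambda>t. p c + L c t) ` open_triangle) \<subseteq> skeleton r 2" using S_eq open_triangle(1) unfolding q_def by blast
    show "c = c'" if c: "c \<in> cell_index" "c' \<in> cell_index"
      and ne: "(\<lambda>t. p c + L c t) ` open_triangle \<inter> (\<lambda>t. p c' + L c' t) ` open_triangle \<noteq> {}" for c c'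
    proof -
      obtain s t s' t' where st: "q c (s, t) = q c' (s', t')" "(s, t) \<in> open_triangle" "(s', t') \<in> open_triangle"
        using ne by (auto simp: q_def)
      obtain i j k where cc: "c = (i, j, k)" by (cases c)
      obtain i' j' k' where cc': "c' = (i', j', k')" by (cases c')
      have kk: "k < 4" "k' < 4" using cell_index_remaining(4) c cc cc' by auto
      \<comment> \<open>Interior points of a face have positive coordinates in its cone, because the
        apex has a negative coefficient at v_k. This separates the faces even when some of them are
        coplanar.\<close>
      have e: "q c (s, t) = s *\<^sub>R tet_vertex i + t *\<^sub>R tet_vertex j - ((1 - s - t) * r / 3) *\<^sub>R tet_vertex k"
        unfolding cc q_eq ap[OF kk(1)] by simp
      have e': "q c (s, t) = s' *\<^sub>R tet_vertex i' + t' *\<^sub>R tet_vertex j' - ((1 - s' - t') * r / 3) *\<^sub>R tet_vertex k'"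
        unfolding st(1) unfolding cc' q_eq ap[OF kk(2)] by simp
      show ?thesis unfolding cc cc'
        by (rule open_cones_disjoint[OF c[unfolded cc cc'] e e']) (use st(2,3) r in \<open>auto simp: open_triangle_def\<close>)
    qed
  qed (use that in auto)
  have "power_integral r 2 m z = (K * (fact m / fact (m + 2))) * cell_sum r m z" for m z
  proof -
    have "power_integral r 2 m z = K * (\<Sum>c\<in>cell_index. set_lebesgue_integral lborel (triangle 1) (\<lambda>t. (q c t \<bullet> z) ^ m))"
      unfolding power_integral_def q_def by (subst int) (auto intro!: continuous_intros)
    also have "(\<Sum>c\<in>cell_index. set_lebesgue_integral lborel (triangle 1) (\<lambda>t. (q c t \<bullet> z) ^ m))
        = (\<Sum>(i, j, k)\<in>cell_index. fact m / fact (m + 2) * hsum3 m (tet_vertex i \<bullet> z) (tet_vertex j \<bullet> z) (- (r / 3) * (tet_vertex k \<bullet> z)))"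
    proof (rule sum.cong[OF refl])
      fix c assume "c \<in> cell_index"
      moreover obtain i j k where c: "c = (i, j, k)" by (cases c)
      ultimately have k: "k < 4" using cell_index_remaining(4) by auto
      have "(\<lambda>t. (q c t \<bullet> z) ^ m) = (\<lambda>(s, t). (s * (tet_vertex i \<bullet> z) + t * (tet_vertex j \<bullet> z) + (1 - s - t) * (- (r / 3) * (tet_vertex k \<bullet> z))) ^ m)"
        unfolding c by (auto simp: fun_eq_iff q_eq ap[OF k] inner_add_left inner_diff_left mult.assoc)
      then show "set_lebesgue_integral lborel (triangle 1) (\<lambda>t. (q c t \<bullet> z) ^ m) = (case c of (i, j, k) \<Rightarrow> fact m / fact (m + 2) *
          hsum3 m (tet_vertex i \<bullet> z) (tet_vertex j \<bullet> z) (- (r / 3) * (tet_vertex k \<bullet> z)))"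
        unfolding c by (simp only: triangle_power_integral prod.case)
    qed
    also have "\<dots> = fact m / fact (m + 2) * cell_sum r m z"
      unfolding cell_sum_def sum_distrib_left by (intro sum.cong) auto
    finally show ?thesis by simp
  qed
  moreover have "K * (fact m / fact (m + 2)) > 0" for m :: nat using K(1) by simp
  ultimately show ?thesis unfolding has_power_sums_def using K borel by blast
qed

lemma solid_power_sums:
  assumes r: "r > 0"
  shows "has_power_sums r 3 (cell_sum r)"
proof -
  define L where "L = (\<lambda>(i, j, k) (s, t, u). s *\<^sub>R tet_vertex i + t *\<^sub>R tet_vertex j + u *\<^sub>R tet_apex r k)"
  have lin: "linear (L c)" for c
    by (cases c) (simp add: L_def linear_comb3)
  have ap: "tet_apex r k = (- r / 3) *\<^sub>R tet_vertex k" if "k < 4" for k by (rule tet_apex_eq[OF that])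
  have L_cone: "L (i, j, k) (s, t, u) = s *\<^sub>R tet_vertex i + t *\<^sub>R tet_vertex j - (u * r / 3) *\<^sub>R tet_vertex k"
    if "(i, j, k) \<in> cell_index" for i j k s t u
    using cell_index_remaining(4)[OF that] by (simp add: L_def ap)
  have sk: "skeleton r 3 = triakis_solid r" by (simp add: skeleton_def)
  have cells: "solid_cells r = (\<Union>c\<in>cell_index. L c ` tet3)"
  proof
    show "solid_cells r \<subseteq> (\<Union>c\<in>cell_index. L c ` tet3)"
    proof
      fix x assume "x \<in> solid_cells r"
      then obtain i j k \<alpha> \<beta> \<gamma> where c: "in_cone i j k \<alpha> \<beta> \<gamma> x" and l: "\<alpha> + \<beta> + 3 * \<gamma> / r \<le> 1" unfolding solid_cells_def by blast
      have q: "(i, j, k) \<in> cell_index" using c by (simp add: in_cone_def)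
      \<comment> \<open>The apex is -(r / 3) v_k, so the coefficient \<gamma> corresponds to the
        weight 3 \<gamma> / r of the apex.\<close>
      have "x = L (i, j, k) (\<alpha>, \<beta>, 3 * \<gamma> / r)" unfolding L_cone[OF q] using c r by (simp add: in_cone_def)
      moreover have "(\<alpha>, \<beta>, 3 * \<gamma> / r) \<in> tet3" using c l r by (simp add: tet3_def in_cone_def)
      ultimately show "x \<in> (\<Union>c\<in>cell_index. L c ` tet3)" using q by blast
    qed
    show "(\<Union>c\<in>cell_index. L c ` tet3) \<subseteq> solid_cells r"
    proof clarify
      fix i j k s t u assume q: "(i, j, k) \<in> cell_index" and st: "(s, t, u) \<in> tet3"
      have "in_cone i j k s t (u * r / 3) (L (i, j, k) (s, t, u))"
        unfolding in_cone_def L_cone[OF q] using q st r by (simp add: tet3_def)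
      moreover have "s + t + 3 * (u * r / 3) / r \<le> 1" using st r by (simp add: tet3_def)
      ultimately show "L (i, j, k) (s, t, u) \<in> solid_cells r" unfolding solid_cells_def by blast
    qed
  qed
  have fin: "finite cell_index" "cell_index \<noteq> {}" by (auto simp: cell_index_def)
  have "compact (L c ` tet3)" for c
    using lin[of c] by (intro compact_continuous_image compact_tet3) (simp add: linear_continuous_on linear_linear)
  then have "compact (solid_cells r)" unfolding cells using fin by (intro compact_UN) auto
  then have cl: "closed (solid_cells r)" by (rule compact_imp_closed)
  have borel: "skeleton r 3 \<in> sets borel" unfolding sk by (rule borel_closed[OF closed_triakis_solid])
  have sub: "skeleton r 3 \<subseteq> (\<Union>c\<in>cell_index. L c ` tet3)"
    using triakis_solid_eq_cells[of r] excavated_solid_cells(1)[OF r _ cl] unfolding sk cells[symmetric] by (cases "r \<ge> 1") auto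
  have sup: "(\<Union>c\<in>cell_index. L c ` open_tet3) \<subseteq> skeleton r 3"
  proof (cases "r \<ge> 1")
    case True
    then show ?thesis unfolding sk triakis_solid_eq_cells[OF True] cells using open_tet3(1) by blast
  next
    case False
    then have r1: "r < 1" by simp
    show ?thesis
    proof clarify
      fix i j k s t u assume q: "(i, j, k) \<in> cell_index" and st: "(s, t, u) \<in> open_tet3"
      have "in_cone i j k s t (u * r / 3) (L (i, j, k) (s, t, u))"
        unfolding in_cone_def L_cone[OF q] using q st r by (simp add: open_tet3_def)
      then show "L (i, j, k) (s, t, u) \<in> skeleton r 3"
        unfolding sk by (rule excavated_solid_cells(2)[OF r r1 cl]) (use st r in \<open>auto simp: open_tet3_def\<close>)
    qed
  qed
  have nrm: "norm (L c t) = 1 * norm (L (0, 1, 2) t)" if "c \<in> cell_index" for c t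
  proof -
    have "L c (s, t, u) \<bullet> L c (s, t, u) = 3 * (s\<^sup>2 + t\<^sup>2 + (u * r / 3)\<^sup>2) - 2 * s * t + 2 * (s + t) * (u * r / 3)"
      if "c \<in> cell_index" for c s t u
    proof (cases c)
      case (fields i j k)
      note R = cell_index_remaining(1-4)[OF that[unfolded fields]]
      show ?thesis unfolding fields L_cone[OF that[unfolded fields]] using R
        by (simp add: inner_add_left inner_add_right inner_diff_left inner_diff_right inner_tet_vertex_tet_vertex)
          (simp add: power2_eq_square field_simps)
    qed
    from this[OF that, of "fst t" "fst (snd t)" "snd (snd t)"] this[of "(0, 1, 2)" "fst t" "fst (snd t)" "snd (snd t)"]
    show ?thesis by (simp add: norm_eq cell_index_def)
  qed
  have inj0: "inj (L (0, 1, 2))"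
  proof -
    have "t = 0" if "L (0, 1, 2) t = 0" for t
    proof (cases t)
      case (fields a b c)
      have mem: "(0, 1, 2) \<in> cell_index" by (simp add: cell_index_def)
      from cone_coordinates[OF mem L_cone[OF mem, of a b c], unfolded that[unfolded fields]] r show ?thesis
        by (simp add: fields zero_prod_def)
    qed
    then show ?thesis using lin by (simp add: linear_injective_0)
  qed
  have D3: "DIM(real \<times> real \<times> real) = 3" by simp
  obtain K where K: "K > 0" "0 < emeasure (hausdorff_measure 3) (skeleton r 3)"
      "emeasure (hausdorff_measure 3) (skeleton r 3) < \<infinity>" "bounded (skeleton r 3)"
    and int: "\<And>h :: real ^ 3 \<Rightarrow> real. continuous_on UNIV h \<Longrightarrow> set_lebesgue_integral (hausdorff_measure 3) (skeleton r 3) h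
      = K * (\<Sum>c\<in>cell_index. 1 ^ 3 * set_lebesgue_integral lborel tet3 (\<lambda>t. h (0 + L c t)))"
  proof (rule similar_cells[where I = cell_index and L = L and ?L0.0 = "L (0, 1, 2)" and p = "\<lambda>_. 0" and D = tet3 and ?D0.0 = open_tet3
        and S = "skeleton r 3" and w = "\<lambda>_. 1", unfolded D3])
    show "finite cell_index" "cell_index \<noteq> {}" by (fact fin)+
    show "linear (L c)" "linear (L (0, 1, 2))" for c by (rule lin)+
    show "inj (L (0, 1, 2))" by (rule inj0)
    show "norm (L c t) = 1 * norm (L (0, 1, 2) t)" if "c \<in> cell_index" for c t by (rule nrm[OF that])
    show "compact tet3" by (rule compact_tet3)
    show "open_tet3 \<subseteq> tet3" "open_tet3 \<in> sets borel" "tet3 - open_tet3 \<in> null_sets lborel"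
      by (rule open_tet3)+
    show "emeasure lborel tet3 \<noteq> 0" by (rule simplices_nonnull)
    show "skeleton r 3 \<in> sets borel" by (rule borel)
    show "skeleton r 3 \<subseteq> (\<Union>c\<in>cell_index. (\<lambda>t. 0 + L c t) ` tet3)" using sub by simp
    show "(\<Union>c\<in>cell_index. (\<lambda>t. 0 + L c t) ` open_tet3) \<subseteq> skeleton r 3" using sup by simp
    show "c = c'" if c: "c \<in> cell_index" "c' \<in> cell_index"
      and ne: "(\<lambda>t. 0 + L c t) ` open_tet3 \<inter> (\<lambda>t. 0 + L c' t) ` open_tet3 \<noteq> {}" for c c'
    proof -
      obtain s t u s' t' u' where st: "L c (s, t, u) = L c' (s', t', u')" "(s, t, u) \<in> open_tet3" "(s', t', u') \<in> open_tet3"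
        using ne by auto
      obtain i j k where cc: "c = (i, j, k)" by (cases c)
      obtain i' j' k' where cc': "c' = (i', j', k')" by (cases c')
      show ?thesis unfolding cc cc'
        by (rule open_cones_disjoint[OF c[unfolded cc cc'] L_cone[OF c(1)[unfolded cc], of s t u]
              trans[OF st(1)[unfolded cc cc'] L_cone[OF c(2)[unfolded cc'], of s' t' u']]])
          (use st(2,3) r in \<open>auto simp: open_tet3_def\<close>)
    qed
  qed (use that in auto)
  have "power_integral r 3 m z = (K * (fact m / fact (m + 3))) * cell_sum r m z" for m z
  proof -
    have "power_integral r 3 m z = K * (\<Sum>c\<in>cell_index. set_lebesgue_integral lborel tet3 (\<lambda>t. (L c t \<bullet> z) ^ m))"
      unfolding power_integral_def by (subst int) (auto intro!: continuous_intros)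
    also have "(\<Sum>c\<in>cell_index. set_lebesgue_integral lborel tet3 (\<lambda>t. (L c t \<bullet> z) ^ m))
        = (\<Sum>(i, j, k)\<in>cell_index. fact m / fact (m + 3) * hsum3 m (tet_vertex i \<bullet> z) (tet_vertex j \<bullet> z) (- (r / 3) * (tet_vertex k \<bullet> z)))"
    proof (rule sum.cong[OF refl])
      fix c assume "c \<in> cell_index"
      moreover obtain i j k where c: "c = (i, j, k)" by (cases c)
      ultimately have k: "k < 4" using cell_index_remaining(4) by auto
      have "(\<lambda>t. (L c t \<bullet> z) ^ m) = (\<lambda>(s, t, u). (s * (tet_vertex i \<bullet> z) + t * (tet_vertex j \<bullet> z) + u * (- (r / 3) * (tet_vertex k \<bullet> z))) ^ m)"
        unfolding c by (auto simp: fun_eq_iff L_def ap[OF k] inner_add_left inner_diff_left mult.assoc)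
      then show "set_lebesgue_integral lborel tet3 (\<lambda>t. (L c t \<bullet> z) ^ m) = (case c of (i, j, k) \<Rightarrow> fact m / fact (m + 3) *
          hsum3 m (tet_vertex i \<bullet> z) (tet_vertex j \<bullet> z) (- (r / 3) * (tet_vertex k \<bullet> z)))"
        unfolding c by (simp only: tet3_power_integral prod.case)
    qed
    also have "\<dots> = fact m / fact (m + 3) * cell_sum r m z"
      unfolding cell_sum_def sum_distrib_left by (intro sum.cong) auto
    finally show ?thesis by simp
  qed
  moreover have "K * (fact m / fact (m + 3)) > 0" for m :: nat using K(1) by simp
  ultimately show ?thesis unfolding has_power_sums_def using K borel by blast
qed

text \<open>The flag is True for an edge of the tetrahedron, listed once with i < j, and False for
  the edge from vertex i to the apex with index j.\<close>

definition edge_index :: "(nat \<times> nat \<times> bool) set" where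
  "edge_index = (\<lambda>(i, j). (i, j, True)) ` {(i, j). i < j \<and> j < 4} \<union> (\<lambda>(i, j). (i, j, False)) ` {(i, j). i < 4 \<and> j < 4 \<and> i \<noteq> j}"

lemma finite_vertex_pairs: "finite {(i :: nat, j :: nat). i < j \<and> j < 4}" "finite {(i :: nat, j :: nat). i < 4 \<and> j < 4 \<and> i \<noteq> j}"
  by (rule finite_subset[of _ "{..<4} \<times> {..<4}"]; auto)+

text \<open>An interior point x of an edge reveals the edge through the values v_p . x. On an edge
  of the tetrahedron the minimum is attained at the two vertices off the edge; on an edge to the
  apex over j it is attained at j alone, and the maximum at i alone.\<close>

lemma open_edges_disjoint:
  assumes r: "r > 0" and c: "(i, j, b) \<in> edge_index" "(i', j', b') \<in> edge_index"
    and x: "x = (1 - t) *\<^sub>R tet_vertex i + t *\<^sub>R (if b then tet_vertex j else tet_apex r j)"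
      "x = (1 - t') *\<^sub>R tet_vertex i' + t' *\<^sub>R (if b' then tet_vertex j' else tet_apex r j')"
    and t: "0 < t" "t < 1" "0 < t'" "t' < 1"
  shows "(i, j, b) = (i', j', b')"
proof -
  let ?min = "{p. p < 4 \<and> (\<forall>q<4. tet_vertex p \<bullet> x \<le> tet_vertex q \<bullet> x)}"
  let ?max = "{p. p < 4 \<and> (\<forall>q<4. tet_vertex q \<bullet> x \<le> tet_vertex p \<bullet> x)}"
  have T: "?min = {..<4} - {i, j}" if c: "(i, j, True) \<in> edge_index" and x: "x = (1 - t) *\<^sub>R tet_vertex i + t *\<^sub>R tet_vertex j"
    and t: "0 < t" "t < 1" for i j t
  proof -
    have ij: "i < 4" "j < 4" "i \<noteq> j" using c by (auto simp: edge_index_def)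
    have a: "tet_vertex p \<bullet> x = (if p = i then 4 * (1 - t) - 1 else if p = j then 4 * t - 1 else - 1)" if "p < 4" for p
      using that ij unfolding x by (auto simp: inner_add_right inner_tet_vertex_tet_vertex)
    have "card ({..<4} - {i, j}) = 2" using ij by (subst card_Diff_subset) auto
    then obtain q where q: "q < 4" "q \<noteq> i" "q \<noteq> j" by (auto simp: card_2_iff)
    show ?thesis using a[OF q(1)] a q ij t by auto
  qed
  have F: "?min = {j} \<and> ?max = {i}" if c: "(i, j, False) \<in> edge_index" and x: "x = (1 - t) *\<^sub>R tet_vertex i + t *\<^sub>R tet_apex r j"
    and t: "0 < t" "t < 1" for i j t
  proof -
    have ij: "i < 4" "j < 4" "i \<noteq> j" using c by (auto simp: edge_index_def)
    define u where "u = t * r / 3"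
    have a: "tet_vertex p \<bullet> x = - (1 - t) + u + (if p = i then 4 * (1 - t) else if p = j then - 4 * u else 0)" if "p < 4" for p
      using that ij unfolding x u_def by (auto simp: tet_apex_eq inner_add_right inner_diff_right inner_tet_vertex_tet_vertex field_simps)
    have u: "u > 0" using t r by (simp add: u_def)
    have below: "tet_vertex j \<bullet> x < tet_vertex p \<bullet> x" if "p < 4" "p \<noteq> j" for p
      unfolding a[OF that(1)] a[OF ij(2)] using that ij t u by (simp split: if_splits)
    have above: "tet_vertex p \<bullet> x < tet_vertex i \<bullet> x" if "p < 4" "p \<noteq> i" for p
      unfolding a[OF that(1)] a[OF ij(1)] using that ij t u by (simp split: if_splits)
    have "?min = {j}" using below ij(2) by (auto simp: less_le_not_le)
    moreover have "?max = {i}" using above ij(1) by (auto simp: less_le_not_le)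
    ultimately show ?thesis by blast
  qed
  have lt: "i < 4" "j < 4" "i \<noteq> j" "i' < 4" "j' < 4" "i' \<noteq> j'" and ord: "b \<Longrightarrow> i < j" "b' \<Longrightarrow> i' < j'"
    using c by (auto simp: edge_index_def)
  have card2: "card ({..<4} - {a, b}) = 2" if "a < 4" "b < 4" "a \<noteq> b" for a b :: nat
    using that by (subst card_Diff_subset) auto
  consider "b" "b'" | "b" "\<not> b'" | "\<not> b" "b'" | "\<not> b" "\<not> b'" by blast
  then show ?thesis
  proof cases
    case 1
    have "{..<4} - {i, j} = {..<4} - {i', j'}" using T[of i j t] T[of i' j' t'] c x t 1 by simp
    then have "{i, j} = {i', j'}" using lt by blast
    then show ?thesis using ord 1 by (auto simp: doubleton_eq_iff)
  next
    case 2
    have "{..<4} - {i, j} = {j'}" using T[of i j t] F[of i' j' t'] c x t 2 by simp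
    then show ?thesis using card2[of i j] lt by simp
  next
    case 3
    have "{..<4} - {i', j'} = {j}" using T[of i' j' t'] F[of i j t] c x t 3 by simp
    then show ?thesis using card2[of i' j'] lt by simp
  next
    case 4
    then show ?thesis using F[of i j t] F[of i' j' t'] c x t by simp
  qed
qed

lemma edges_power_sums:
  assumes r: "r > 0"
  shows "has_power_sums r 1 (edge_sum r)"
proof -
  define e where "e = (\<lambda>(i :: nat, j, b). if b then tet_vertex j else tet_apex r j)"
  define p where "p = (\<lambda>(i, j :: nat, b :: bool). tet_vertex i)"
  define L where "L = (\<lambda>c t. t *\<^sub>R (e c - p c))"
  define q where "q = (\<lambda>c t. p c + L c t)"
  define w where "w = (\<lambda>c. norm (e c - p c))"
  \<comment> \<open>The model is a unit segment, so the scaling factor w of an edge is its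
    length.\<close>
  let ?L0 = "\<lambda>t. t *\<^sub>R (axis 1 1 :: real ^ 3)"
  have q_eq: "q c t = (1 - t) *\<^sub>R p c + t *\<^sub>R e c" for c t by (simp add: q_def L_def algebra_simps)
  have lin: "linear (L c)" for c unfolding L_def by (simp add: linear_iff algebra_simps)
  have ap: "tet_apex r k = (- r / 3) *\<^sub>R tet_vertex k" if "k < 4" for k by (rule tet_apex_eq[OF that])
  have wT: "w (i, j, True) = 2 * sqrt 2" if "i < 4" "j < 4" "i \<noteq> j" for i j
  proof -
    have "w (i, j, True) = sqrt (2\<^sup>2 * 2)"
      unfolding w_def e_def p_def using that by (simp add: norm_eq_sqrt_inner inner_diff_left inner_diff_right inner_tet_vertex_tet_vertex)
    also have "\<dots> = sqrt (2\<^sup>2) * sqrt 2" by (rule real_sqrt_mult)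
    finally show ?thesis by simp
  qed
  have wF: "w (i, j, False) = sqrt ((r\<^sup>2 - 2 * r + 9) / 3)" if "i < 4" "j < 4" "i \<noteq> j" for i j
    unfolding w_def e_def p_def using that
    by (simp add: norm_eq_sqrt_inner ap inner_diff_left inner_diff_right inner_tet_vertex_tet_vertex)
      (simp add: power2_eq_square field_simps)
  have "r\<^sup>2 - 2 * r + 9 = (r - 1)\<^sup>2 + 8" by (simp add: power2_eq_square algebra_simps)
  then have "r\<^sup>2 - 2 * r + 9 > 0" using zero_le_power2[of "r - 1"] by linarith
  then have wpos: "w c > 0" if "c \<in> edge_index" for c
    using that wT wF by (auto simp: edge_index_def)
  have S_eq: "skeleton r 1 = (\<Union>c\<in>edge_index. q c ` {0..1})"
  proof
    show "skeleton r 1 \<subseteq> (\<Union>c\<in>edge_index. q c ` {0..1})"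
    proof
      fix x assume "x \<in> skeleton r 1"
      then consider i j where "i < 4" "j < 4" "i \<noteq> j" "x \<in> closed_segment (tet_vertex i) (tet_vertex j)"
        | i j where "i < 4" "j < 4" "i \<noteq> j" "x \<in> closed_segment (tet_vertex i) (tet_apex r j)"
        by (auto simp: skeleton_def triakis_edges_def)
      then show "x \<in> (\<Union>c\<in>edge_index. q c ` {0..1})"
      proof cases
        case 1
        show ?thesis
        proof (cases "i < j")
          case True
          have "(i, j, True) \<in> edge_index" using 1 True by (auto simp: edge_index_def)
          moreover have "x \<in> q (i, j, True) ` {0..1}" using 1(4) unfolding closed_segment_def q_eq e_def p_def by auto
          ultimately show ?thesis by blast
        next
          case False
          have "(j, i, True) \<in> edge_index" using 1 False by (auto simp: edge_index_def)
          moreover have "x \<in> closed_segment (tet_vertex j) (tet_vertex i)"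
            using 1(4) closed_segment_commute[of "tet_vertex i" "tet_vertex j"] by blast
          then have "x \<in> q (j, i, True) ` {0..1}" unfolding closed_segment_def q_eq e_def p_def by auto
          ultimately show ?thesis by blast
        qed
      next
        case 2
        have "(i, j, False) \<in> edge_index" using 2 by (auto simp: edge_index_def)
        moreover have "x \<in> q (i, j, False) ` {0..1}" using 2(4) unfolding closed_segment_def q_eq e_def p_def by auto
        ultimately show ?thesis by blast
      qed
    qed
    show "(\<Union>c\<in>edge_index. q c ` {0..1}) \<subseteq> skeleton r 1"
    proof clarify
      fix i j b t assume c: "(i, j, b) \<in> edge_index" and t: "t \<in> {0..1::real}"
      have "q (i, j, b) t \<in> closed_segment (p (i, j, b)) (e (i, j, b))"
        unfolding q_eq closed_segment_def using t by auto
      moreover have "closed_segment (p (i, j, b)) (e (i, j, b)) \<in> triakis_edges r"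
      proof -
        have ij: "i < 4" "j < 4" "i \<noteq> j" using c by (auto simp: edge_index_def)
        then have "closed_segment (tet_vertex i) (tet_vertex j) \<in> triakis_edges r"
          "closed_segment (tet_vertex i) (tet_apex r j) \<in> triakis_edges r" unfolding triakis_edges_def by blast+
        then show ?thesis by (simp add: e_def p_def)
      qed
      ultimately show "q (i, j, b) t \<in> skeleton r 1" by (auto simp: skeleton_def)
    qed
  qed
  have "(0, 1, False) \<in> edge_index" by (auto simp: edge_index_def)
  then have fin: "finite edge_index" "edge_index \<noteq> {}" using finite_vertex_pairs by (auto simp: edge_index_def)
  have cq: "compact (q c ` {0..1})" for c
    unfolding q_eq[abs_def] by (intro compact_continuous_image compact_Icc continuous_intros)
  have "compact (\<Union>c\<in>edge_index. q c ` {0..1})" using fin cq by (intro compact_UN) auto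
  then have borel: "skeleton r 1 \<in> sets borel" unfolding S_eq by (rule borel_compact)
  have null: "{0..1::real} - {0<..<1} \<in> null_sets lborel"
  proof -
    have "{0..1::real} - {0<..<1} = {0, 1}" by auto
    then show ?thesis by (simp add: null_sets_def emeasure_lborel_countable)
  qed
  obtain K where K: "K > 0" "0 < emeasure (hausdorff_measure 1) (skeleton r 1)"
      "emeasure (hausdorff_measure 1) (skeleton r 1) < \<infinity>" "bounded (skeleton r 1)"
    and int: "\<And>h :: real ^ 3 \<Rightarrow> real. continuous_on UNIV h \<Longrightarrow> set_lebesgue_integral (hausdorff_measure 1) (skeleton r 1) h
      = K * (\<Sum>c\<in>edge_index. w c ^ 1 * set_lebesgue_integral lborel {0..1} (\<lambda>t. h (p c + L c t)))"
  proof (rule similar_cells[where I = edge_index and L = L and ?L0.0 = ?L0 and p = p and D = "{0..1::real}" and ?D0.0 = "{0<..<1}"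
        and S = "skeleton r 1" and w = w, unfolded DIM_real])
    show "finite edge_index" "edge_index \<noteq> {}" by (fact fin)+
    show "linear (L c)" for c by (rule lin)
    show "linear ?L0" by (simp add: linear_iff algebra_simps)
    show "inj ?L0" by (auto simp: inj_on_def axis_eq_0_iff)
    show "w c > 0" if "c \<in> edge_index" for c by (rule wpos[OF that])
    show "norm (L c t) = w c * norm (t *\<^sub>R (axis 1 1 :: real ^ 3))" for c t by (simp add: L_def w_def)
    show "compact {0..1::real}" "{0<..<1} \<subseteq> {0..1::real}" "{0<..<1::real} \<in> sets borel" by auto
    show "{0..1::real} - {0<..<1} \<in> null_sets lborel" by (rule null)
    show "emeasure lborel {0..1::real} \<noteq> 0" by simp
    show "skeleton r 1 \<in> sets borel" by (rule borel)
    show "skeleton r 1 \<subseteq> (\<Union>c\<in>edge_index. (\<lambda>t. p c + L c t) ` {0..1})" using S_eq unfolding q_def by simp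
    have "q c ` {0<..<1} \<subseteq> q c ` {0..1}" for c by auto
    then show "(\<Union>c\<in>edge_index. (\<lambda>t. p c + L c t) ` {0<..<1}) \<subseteq> skeleton r 1" using S_eq unfolding q_def by blast
    show "c = c'" if c: "c \<in> edge_index" "c' \<in> edge_index"
      and ne: "(\<lambda>t. p c + L c t) ` {0<..<1} \<inter> (\<lambda>t. p c' + L c' t) ` {0<..<1} \<noteq> {}" for c c'
    proof -
      obtain t t' where t: "q c t = q c' t'" "0 < t" "t < 1" "0 < t'" "t' < 1" using ne by (auto simp: q_def)
      obtain i j b where cc: "c = (i, j, b)" by (cases c)
      obtain i' j' b' where cc': "c' = (i', j', b')" by (cases c')
      show ?thesis unfolding cc cc'
        by (rule open_edges_disjoint[OF r c[unfolded cc cc'], of "q c t" t t'])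
          (use t in \<open>simp_all add: t(1) q_eq cc cc' e_def p_def\<close>)
    qed
  qed (use that in auto)
  have "power_integral r 1 m z = (K / (m + 1)) * edge_sum r m z" for m z
  proof -
    let ?f = "\<lambda>c. w c * set_lebesgue_integral lborel {0..1} (\<lambda>t. (q c t \<bullet> z) ^ m)"
    have f: "?f c = w c * hsum2 m (e c \<bullet> z) (p c \<bullet> z) / (m + 1)" for c
    proof -
      have "(\<lambda>t. (q c t \<bullet> z) ^ m) = (\<lambda>t. ((1 - t) * (p c \<bullet> z) + t * (e c \<bullet> z)) ^ m)" by (simp add: q_eq inner_add_left)
      then show ?thesis by (simp only: segment_power_integral) simp
    qed
    have "power_integral r 1 m z = K * (\<Sum>c\<in>edge_index. ?f c)"
      unfolding power_integral_def q_def by (subst int) (auto intro!: continuous_intros)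
    also have "(\<Sum>c\<in>edge_index. ?f c) = (\<Sum>c\<in>(\<lambda>(i, j). (i, j, True)) ` {(i, j). i < j \<and> j < 4}. ?f c)
        + (\<Sum>c\<in>(\<lambda>(i, j). (i, j, False)) ` {(i, j). i < 4 \<and> j < 4 \<and> i \<noteq> j}. ?f c)"
      unfolding edge_index_def by (rule sum.union_disjoint) (use finite_vertex_pairs in auto)
    also have "(\<Sum>c\<in>(\<lambda>(i, j). (i, j, True)) ` {(i, j). i < j \<and> j < 4}. ?f c)
        = (\<Sum>(i, j)\<in>{(i, j). i < j \<and> j < 4}. 2 * sqrt 2 * hsum2 m (tet_vertex j \<bullet> z) (tet_vertex i \<bullet> z) / (m + 1))"
      by (subst sum.reindex) (auto simp: inj_on_def f wT e_def p_def intro!: sum.cong)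
    also have "(\<Sum>c\<in>(\<lambda>(i, j). (i, j, False)) ` {(i, j). i < 4 \<and> j < 4 \<and> i \<noteq> j}. ?f c)
        = (\<Sum>(i, j)\<in>{(i, j). i < 4 \<and> j < 4 \<and> i \<noteq> j}. sqrt ((r\<^sup>2 - 2 * r + 9) / 3) * hsum2 m (- (r / 3) * (tet_vertex j \<bullet> z)) (tet_vertex i \<bullet> z) / (m + 1))"
      by (subst sum.reindex) (auto simp: inj_on_def f wF e_def p_def ap intro!: sum.cong)
    finally have *: "power_integral r 1 m z = K *
      ((\<Sum>(i, j)\<in>{(i, j). i < j \<and> j < 4}. 2 * sqrt 2 * hsum2 m (tet_vertex j \<bullet> z) (tet_vertex i \<bullet> z) / (m + 1)) +
       (\<Sum>(i, j)\<in>{(i, j). i < 4 \<and> j < 4 \<and> i \<noteq> j}. sqrt ((r\<^sup>2 - 2 * r + 9) / 3) * hsum2 m (- (r / 3) * (tet_vertex j \<bullet> z)) (tet_vertex i \<bullet> z) / (m + 1)))" .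
    have sum: "(\<Sum>(i, j)\<in>A. C * g i j / (m + 1)) = (C * (\<Sum>(i, j)\<in>A. g i j)) / (m + 1)"
      for A :: "(nat \<times> nat) set" and C and g :: "nat \<Rightarrow> nat \<Rightarrow> real"
      by (simp add: sum_distrib_left sum_divide_distrib case_prod_unfold)
    show ?thesis unfolding * sum edge_sum_def by (simp add: add_divide_distrib[symmetric])
  qed
  moreover have "K / (m + 1) > 0" for m :: nat using K(1) by simp
  ultimately show ?thesis unfolding has_power_sums_def using K borel by blast
qed

section \<open>Vertices and the counting measure\<close>

lemma hausdorff_measure_0_singleton: "emeasure (hausdorff_measure 0) {x :: 'a::metric_space} = 1"
proof -
  \<comment> \<open>In dimension 0 even a set of diameter 0 has weight 1, because
    \<open>0 ^ 0 = 1\<close>; only the empty set has weight 0.\<close>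
  have wt: "hausdorff_weight 0 U = (if U = {} then 0 else 1)" for U :: "'a set"
    by (simp add: hausdorff_weight_def unit_ball_vol_0)
  have "hausdorff_premeasure 0 \<delta> {x} = 1" if \<delta>: "\<delta> > 0" for \<delta> :: real
  proof (rule antisym)
    let ?U = "\<lambda>n::nat. if n = 0 then {x} else {}"
    have "hausdorff_premeasure 0 \<delta> {x} \<le> suminf (\<lambda>n. hausdorff_weight 0 (?U n))"
      unfolding hausdorff_premeasure_def by (rule INF_lower) (use \<delta> in auto)
    also have "\<dots> = (\<Sum>n\<in>{0}. hausdorff_weight 0 (?U n))" by (rule suminf_finite) (auto simp: wt)
    finally show "hausdorff_premeasure 0 \<delta> {x} \<le> 1" by (simp add: wt)
    show "1 \<le> hausdorff_premeasure 0 \<delta> {x}"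
      unfolding hausdorff_premeasure_def
    proof (rule INF_greatest)
      fix U :: "nat \<Rightarrow> 'a set"
      assume "U \<in> {U. {x} \<subseteq> (\<Union>n. U n) \<and> (\<forall>n. bounded (U n) \<and> diameter (U n) \<le> \<delta>)}"
      then obtain n where "x \<in> U n" by auto
      then have "1 = hausdorff_weight 0 (U n)" by (auto simp: wt)
      also have "\<dots> = (\<Sum>k\<in>{n}. hausdorff_weight 0 (U k))" by simp
      also have "\<dots> \<le> suminf (\<lambda>n. hausdorff_weight 0 (U n))" by (rule sum_le_suminf) auto
      finally show "1 \<le> suminf (\<lambda>n. hausdorff_weight 0 (U n))" .
    qed
  qed
  then have "hausdorff_outer_measure 0 {x} = 1" unfolding hausdorff_outer_measure_def by (simp cong: SUP_cong_simp)
  then show ?thesis by (simp add: emeasure_hausdorff_measure)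
qed

lemma vertices_power_sums:
  assumes r: "r > 0"
  shows "has_power_sums r 0 (vertex_sum r)"
proof -
  let ?H = "hausdorff_measure 0 :: (real ^ 3) measure"
  have S: "skeleton r 0 = tet_vertex ` {..<4} \<union> tet_apex r ` {..<4}" by (simp add: skeleton_def triakis_vertices_def)
  have fin: "finite (skeleton r 0)" by (simp add: S)
  have borel: "skeleton r 0 \<in> sets borel" using fin by (intro borel_closed finite_imp_closed)
  have em: "emeasure ?H (skeleton r 0) = (\<Sum>x\<in>skeleton r 0. emeasure ?H {x})"
    by (rule emeasure_eq_sum_singleton[OF fin]) simp
  then have em: "emeasure ?H (skeleton r 0) = of_nat (card (skeleton r 0))" by (simp add: hausdorff_measure_0_singleton)
  have c: "card (skeleton r 0) > 0" using fin by (auto simp: card_gt_0_iff S lessThan_4)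
  \<comment> \<open>An apex is a negative multiple of a vertex, so for no r > 0 does it coincide
    with one of the tetrahedron; the eight points stay distinct.\<close>
  have disj: "tet_vertex ` {..<4} \<inter> tet_apex r ` {..<4} = {}"
  proof -
    have "tet_vertex i \<noteq> tet_apex r j" if "i < 4" "j < 4" for i j
    proof
      assume "tet_vertex i = tet_apex r j"
      then have "tet_vertex p \<bullet> tet_vertex i = (- r / 3) * (tet_vertex p \<bullet> tet_vertex j)" for p using that by (simp add: tet_apex_eq)
      from this[of i] this[of j] show False using that r by (auto simp: inner_tet_vertex_tet_vertex split: if_splits)
    qed
    then show ?thesis by auto
  qed
  have inj: "inj_on (tet_apex r) {..<4}"
    using inj_on_tet_vertex r by (auto simp: inj_on_def tet_apex_eq)
  have "power_integral r 0 m z = 1 * vertex_sum r m z" for m z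
  proof -
    have "power_integral r 0 m z = (\<integral>y. (y \<bullet> z) ^ m * indicator (skeleton r 0) y \<partial>?H)"
      unfolding power_integral_def set_lebesgue_integral_def by (simp add: mult.commute)
    also have "\<dots> = (\<Sum>y\<in>skeleton r 0. (y \<bullet> z) ^ m * measure ?H {y})"
      by (rule integral_indicator_finite_real[OF fin]) (auto simp: hausdorff_measure_0_singleton)
    also have "\<dots> = (\<Sum>y\<in>skeleton r 0. (y \<bullet> z) ^ m)" by (simp add: measure_def hausdorff_measure_0_singleton)
    also have "\<dots> = (\<Sum>y\<in>tet_vertex ` {..<4}. (y \<bullet> z) ^ m) + (\<Sum>y\<in>tet_apex r ` {..<4}. (y \<bullet> z) ^ m)"
      unfolding S by (rule sum.union_disjoint) (use disj in auto)
    also have "\<dots> = vertex_sum r m z"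
      unfolding vertex_sum_def sum.reindex[OF inj] sum.reindex[OF inj_on_tet_vertex]
      by (auto simp: tet_apex_eq intro!: sum.cong)
    finally show ?thesis by simp
  qed
  then show ?thesis
    unfolding has_power_sums_def using borel fin c em
    by (auto simp: finite_imp_bounded of_nat_less_top intro!: exI[of _ 1])
qed

section \<open>Evaluation of the power sums\<close>

lemma power_sums_cases:
  assumes \<Phi>: "has_power_sums r k \<Phi>" and 2: "\<Phi> 2 (vector [1, 0, 0]) \<noteq> 0"
    and 4: "4 * \<Phi> 4 (vector [1, 0, 0]) - \<Phi> 4 (vector [1, 1, 0]) \<noteq> 0"
  shows "\<Phi> 3 (vector [1, 1, 1]) \<noteq> 0 \<Longrightarrow> distribution_of ` skeleton_harmonic r k = harmonic_A"
    and "\<Phi> 3 (vector [1, 1, 1]) = 0 \<Longrightarrow>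
      2 * \<Phi> 6 (vector [1, 1, 1]) + 18 * \<Phi> 6 (vector [1, 0, 0]) - 9 * \<Phi> 6 (vector [1, 1, 0]) \<noteq> 0 \<Longrightarrow>
      distribution_of ` skeleton_harmonic r k = harmonic_B"
    and "\<Phi> 5 (vector [1, 1, 1]) \<noteq> 0 \<Longrightarrow> group_harmonic (symmetry_group (skeleton r k)) \<subseteq> harmonic_A"
proof -
  have ex: "\<forall>m. \<exists>K>0. \<forall>z. power_integral r k m z = K * \<Phi> m z" using \<Phi> by (simp add: has_power_sums_def)
  obtain K where K: "\<And>m. K m > 0" "\<And>m z. power_integral r k m z = K m * \<Phi> m z"
    using choice[OF ex] by blast
  have S: "skeleton r k \<in> sets borel" "bounded (skeleton r k)"
    "0 < emeasure (hausdorff_measure k) (skeleton r k)" "emeasure (hausdorff_measure k) (skeleton r k) < \<infinity>"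
    using \<Phi> by (simp_all add: has_power_sums_def)
  have nz: "K m \<noteq> 0" for m using K(1)[of m] by simp
  have p2: "power_integral r k 2 (vector [1, 0, 0]) \<noteq> 0" using 2 nz by (simp add: K(2))
  have p4: "4 * power_integral r k 4 (vector [1, 0, 0]) \<noteq> power_integral r k 4 (vector [1, 1, 0])"
  proof
    assume "4 * power_integral r k 4 (vector [1, 0, 0]) = power_integral r k 4 (vector [1, 1, 0])"
    then have "K 4 * (4 * \<Phi> 4 (vector [1, 0, 0]) - \<Phi> 4 (vector [1, 1, 0])) = 0" by (simp add: K(2) algebra_simps)
    then show False using 4 nz by simp
  qed
  note cases = skeleton_harmonic_cases[OF S p2 p4]
  show "distribution_of ` skeleton_harmonic r k = harmonic_A" if "\<Phi> 3 (vector [1, 1, 1]) \<noteq> 0"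
    using that nz by (intro cases(1)) (simp add: K(2))
  show "distribution_of ` skeleton_harmonic r k = harmonic_B" if 3: "\<Phi> 3 (vector [1, 1, 1]) = 0"
    and 6: "2 * \<Phi> 6 (vector [1, 1, 1]) + 18 * \<Phi> 6 (vector [1, 0, 0]) - 9 * \<Phi> 6 (vector [1, 1, 0]) \<noteq> 0"
  proof (rule cases(2))
    show "power_integral r k 3 (vector [1, 1, 1]) = 0" using 3 by (simp add: K(2))
    show "2 * power_integral r k 6 (vector [1, 1, 1]) + 18 * power_integral r k 6 (vector [1, 0, 0]) \<noteq> 9 * power_integral r k 6 (vector [1, 1, 0])"
    proof
      assume "2 * power_integral r k 6 (vector [1, 1, 1]) + 18 * power_integral r k 6 (vector [1, 0, 0]) = 9 * power_integral r k 6 (vector [1, 1, 0])"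
      then have "K 6 * (2 * \<Phi> 6 (vector [1, 1, 1]) + 18 * \<Phi> 6 (vector [1, 0, 0]) - 9 * \<Phi> 6 (vector [1, 1, 0])) = 0"
        by (simp add: K(2) algebra_simps)
      then show False using 6 nz by simp
    qed
  qed
  show "group_harmonic (symmetry_group (skeleton r k)) \<subseteq> harmonic_A" if "\<Phi> 5 (vector [1, 1, 1]) \<noteq> 0"
    using that nz by (intro cases(3)) (simp add: K(2))
qed

lemma hsum2_0: "hsum2 0 X Y = 1"
  by (simp add: hsum2_def)

text \<open>The recursions with a numeral as degree, so that the simplifier can evaluate h_m for
  concrete m.\<close>

lemmas hsum_numeral = hsum3_0 hsum2_0 hsum2_Suc[of "pred_numeral n" for n, folded numeral_eq_Suc]
  hsum3_Suc[of "pred_numeral n" for n, folded numeral_eq_Suc] hsum2_Suc[of 0] hsum3_Suc[of 0]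

text \<open>The quantities on which \<open>power_sums_cases\<close> decides. The value in degree 3
  has r = 3 as its only positive zero, and the combination in degree 6 is evaluated there as a
  number.\<close>

lemma cell_sum_values:
  "cell_sum r 2 (vector [1, 0, 0]) = 4 / 3 * r\<^sup>2 + 8 / 3 * r + 20"
  "4 * cell_sum r 4 (vector [1, 0, 0]) - cell_sum r 4 (vector [1, 1, 0]) = - (16 / 27) * (r ^ 4 + 2 * r ^ 3 - 3 * r\<^sup>2 + 81)"
  "cell_sum r 3 (vector [1, 1, 1]) = - (8 / 3) * ((r - 3) * (r\<^sup>2 + 5 * r + 12))"
  "2 * cell_sum 3 6 (vector [1, 1, 1]) + 18 * cell_sum 3 6 (vector [1, 0, 0]) - 9 * cell_sum 3 6 (vector [1, 1, 0]) = 1536"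
proof -
  note ev = cell_sum_def cell_index_def inner_tet_vertex hsum_numeral
  show "cell_sum r 2 (vector [1, 0, 0]) = 4 / 3 * r\<^sup>2 + 8 / 3 * r + 20"
    by (simp add: ev) (simp add: field_simps power2_eq_square)
  show "4 * cell_sum r 4 (vector [1, 0, 0]) - cell_sum r 4 (vector [1, 1, 0]) = - (16 / 27) * (r ^ 4 + 2 * r ^ 3 - 3 * r\<^sup>2 + 81)"
    by (simp add: ev) (simp add: field_simps power2_eq_square power3_eq_cube power4_eq_xxxx)
  show "cell_sum r 3 (vector [1, 1, 1]) = - (8 / 3) * ((r - 3) * (r\<^sup>2 + 5 * r + 12))"
    by (simp add: ev) (simp add: field_simps power2_eq_square power3_eq_cube)
  show "2 * cell_sum 3 6 (vector [1, 1, 1]) + 18 * cell_sum 3 6 (vector [1, 0, 0]) - 9 * cell_sum 3 6 (vector [1, 1, 0]) = 1536"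
    by (simp add: ev)
qed

lemma vertex_sum_values:
  "vertex_sum r 2 (vector [1, 0, 0]) = 4 / 9 * r\<^sup>2 + 4"
  "4 * vertex_sum r 4 (vector [1, 0, 0]) - vertex_sum r 4 (vector [1, 1, 0]) = - (16 / 81) * (r ^ 4 + 81)"
  "vertex_sum r 3 (vector [1, 1, 1]) = - (8 / 9) * ((r - 3) * (r\<^sup>2 + 3 * r + 9))"
  "2 * vertex_sum 3 6 (vector [1, 1, 1]) + 18 * vertex_sum 3 6 (vector [1, 0, 0]) - 9 * vertex_sum 3 6 (vector [1, 1, 0]) = 768"
proof -
  note ev = vertex_sum_def lessThan_4 inner_tet_vertex
  show "vertex_sum r 2 (vector [1, 0, 0]) = 4 / 9 * r\<^sup>2 + 4"
    by (simp add: ev) (simp add: field_simps power2_eq_square)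
  show "4 * vertex_sum r 4 (vector [1, 0, 0]) - vertex_sum r 4 (vector [1, 1, 0]) = - (16 / 81) * (r ^ 4 + 81)"
    by (simp add: ev) (simp add: field_simps power4_eq_xxxx)
  show "vertex_sum r 3 (vector [1, 1, 1]) = - (8 / 9) * ((r - 3) * (r\<^sup>2 + 3 * r + 9))"
    by (simp add: ev) (simp add: field_simps power2_eq_square power3_eq_cube)
  show "2 * vertex_sum 3 6 (vector [1, 1, 1]) + 18 * vertex_sum 3 6 (vector [1, 0, 0]) - 9 * vertex_sum 3 6 (vector [1, 1, 0]) = 768"
    by (simp add: ev)
qed

lemma vertex_pairs:
  "{(i, j). i < j \<and> j < 4} = {(0, 1), (0, 2), (0, 3), (1, 2), (1, 3), (2, 3 :: nat)}"
  "{(i, j). i < 4 \<and> j < 4 \<and> i \<noteq> j} = {(0, 1), (0, 2), (0, 3), (1, 2), (1, 3), (2, 3), (1, 0), (2, 0), (3, 0), (2, 1), (3, 1), (3 :: nat, 2 :: nat)}"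
proof -
  have "i < j \<and> j < 4 \<longleftrightarrow> i = 0 \<and> (j = 1 \<or> j = 2 \<or> j = 3) \<or> i = 1 \<and> (j = 2 \<or> j = 3) \<or> i = 2 \<and> j = (3 :: nat)" for i j
    by presburger
  then show p: "{(i, j). i < j \<and> j < 4} = {(0, 1), (0, 2), (0, 3), (1, 2), (1, 3), (2, 3 :: nat)}" by (auto simp del: One_nat_def)
  have "{(i, j). i < 4 \<and> j < 4 \<and> i \<noteq> j} = {(i, j). i < j \<and> j < 4} \<union> {(i, j). j < i \<and> i < (4::nat)}" by auto
  also have "{(i, j). j < i \<and> i < (4::nat)} = prod.swap ` {(i, j). i < j \<and> j < 4}" by auto
  finally show "{(i, j). i < 4 \<and> j < 4 \<and> i \<noteq> j} = {(0, 1), (0, 2), (0, 3), (1, 2), (1, 3), (2, 3), (1, 0), (2, 0), (3, 0), (2, 1), (3, 1), (3 :: nat, 2 :: nat)}"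
    unfolding p by auto
qed

lemma edge_sum_values:
  fixes r :: real
  defines "e \<equiv> sqrt ((r\<^sup>2 - 2 * r + 9) / 3)"
  shows "edge_sum r 2 (vector [1, 0, 0]) = 20 * sqrt 2 + e * (4 / 3 * r\<^sup>2 + 4 / 3 * r + 12)"
    "4 * edge_sum r 4 (vector [1, 0, 0]) - edge_sum r 4 (vector [1, 1, 0])
      = - (48 * sqrt 2 + e * (16 / 27 * (r ^ 4 + r ^ 3 - 3 * r\<^sup>2 + 9 * r + 81)))"
    "edge_sum r 3 (vector [1, 1, 1]) = 96 * sqrt 2 - 8 / 3 * (e * (r ^ 3 + r\<^sup>2 - 3 * r - 27))"
    "edge_sum r 5 (vector [1, 1, 1]) = 1056 * sqrt 2 - 16 / 27 * (e * (5 * r ^ 5 + 5 * r ^ 4 + 3 * r ^ 3 - 9 * r\<^sup>2 - 135 * r - 1215))"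
    "2 * edge_sum r 6 (vector [1, 1, 1]) + 18 * edge_sum r 6 (vector [1, 0, 0]) - 9 * edge_sum r 6 (vector [1, 1, 0])
      = 1536 * sqrt 2 + 128 / 81 * (e * (r ^ 6 + r ^ 5 - 3 * r ^ 4 - 18 * r ^ 3 - 27 * r\<^sup>2 + 81 * r + 729))"
proof -
  note fin = field_simps power2_eq_square power3_eq_cube power4_eq_xxxx
  have es: "edge_sum r m z = 2 * sqrt 2 * (\<Sum>(i, j)\<in>{(i, j). i < j \<and> j < 4}. hsum2 m (tet_vertex j \<bullet> z) (tet_vertex i \<bullet> z)) +
    e * (\<Sum>(i, j)\<in>{(i, j). i < 4 \<and> j < 4 \<and> i \<noteq> j}. hsum2 m (- (r / 3) * (tet_vertex j \<bullet> z)) (tet_vertex i \<bullet> z))" for m z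
    by (simp add: edge_sum_def e_def)
  note ev = es vertex_pairs inner_tet_vertex hsum_numeral
  show "edge_sum r 2 (vector [1, 0, 0]) = 20 * sqrt 2 + e * (4 / 3 * r\<^sup>2 + 4 / 3 * r + 12)"
    by (simp add: ev) (simp add: fin)
  show "4 * edge_sum r 4 (vector [1, 0, 0]) - edge_sum r 4 (vector [1, 1, 0])
      = - (48 * sqrt 2 + e * (16 / 27 * (r ^ 4 + r ^ 3 - 3 * r\<^sup>2 + 9 * r + 81)))"
    by (simp add: ev) (simp add: fin)
  show "edge_sum r 3 (vector [1, 1, 1]) = 96 * sqrt 2 - 8 / 3 * (e * (r ^ 3 + r\<^sup>2 - 3 * r - 27))"
    by (simp add: ev) (simp add: fin)
  show "edge_sum r 5 (vector [1, 1, 1]) = 1056 * sqrt 2 - 16 / 27 * (e * (5 * r ^ 5 + 5 * r ^ 4 + 3 * r ^ 3 - 9 * r\<^sup>2 - 135 * r - 1215))"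
    by (simp add: ev) (simp add: field_simps eval_nat_numeral)
  show "2 * edge_sum r 6 (vector [1, 1, 1]) + 18 * edge_sum r 6 (vector [1, 0, 0]) - 9 * edge_sum r 6 (vector [1, 1, 0])
      = 1536 * sqrt 2 + 128 / 81 * (e * (r ^ 6 + r ^ 5 - 3 * r ^ 4 - 18 * r ^ 3 - 27 * r\<^sup>2 + 81 * r + 729))"
    by (simp add: ev) (simp add: field_simps eval_nat_numeral)
qed

section \<open>The critical parameter\<close>

lemma chi1_unique_root: "\<exists>!s. s > 0 \<and> chi1 s = 0" and r1_bounds: "3.62398 \<le> r1" "r1 < 3.62399" and chi1_r1: "chi1 r1 = 0"
proof -
  have ivt: "\<exists>s. 3.62398 \<le> s \<and> s \<le> 3.62399 \<and> chi1 s = 0"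
  proof (rule IVT')
    show "chi1 3.62398 \<le> 0" "0 \<le> chi1 3.62399" by (simp_all add: chi1_def power_divide)
    show "continuous_on {3.62398..3.62399} chi1" unfolding chi1_def[abs_def] by (intro continuous_intros)
  qed simp
  then obtain s where s: "3.62398 \<le> s" "s \<le> 3.62399" "chi1 s = 0" by blast
  \<comment> \<open>The coefficients of \<open>chi1\<close> change sign once, between r^4 and r^3.
    Division by r^3 therefore leaves nonnegative powers of r with positive coefficients, a constant,
    and negative powers with negative coefficients: a strictly increasing function on r > 0.\<close>
  define f where "f t = t ^ 3 + 2 * t\<^sup>2 + t - 36 - 45 * (1 / t) - 270 * (1 / t)\<^sup>2 - 405 * (1 / t) ^ 3" for t :: real
  have f: "chi1 t = t ^ 3 * f t" if "t > 0" for t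
    unfolding chi1_def f_def using that by (simp add: field_simps eval_nat_numeral)
  have mono: "f t < f u" if "0 < t" "t < u" for t u
  proof -
    have "t ^ 3 < u ^ 3" "t\<^sup>2 < u\<^sup>2" using that by (auto intro!: power_strict_mono)
    moreover have i: "1 / u < 1 / t" "0 < 1 / u" using that by (auto simp: field_simps)
    moreover have "(1 / u)\<^sup>2 < (1 / t)\<^sup>2" "(1 / u) ^ 3 < (1 / t) ^ 3" using i by (auto intro!: power_strict_mono simp del: power_one_over)
    ultimately show ?thesis unfolding f_def using that by linarith
  qed
  have uniq: "t = u" if "t > 0" "chi1 t = 0" "u > 0" "chi1 u = 0" for t u
  proof -
    have "f t = 0" "f u = 0" using that f by auto
    then show ?thesis using mono[of t u] mono[of u t] that by linarith
  qed
  show ex1: "\<exists>!s. s > 0 \<and> chi1 s = 0" using s uniq by (intro ex1I[of _ s]) auto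
  have r1: "r1 = s" unfolding r1_def using s uniq by (intro the_equality) auto
  have "chi1 3.62399 \<noteq> 0" by (simp add: chi1_def power_divide)
  then have "s \<noteq> 3.62399" using s(3) by metis
  then show "3.62398 \<le> r1" "r1 < 3.62399" "chi1 r1 = 0" using s unfolding r1 less_le by blast+
qed

text \<open>The value vanishes iff e c = 36 sqrt 2. Squaring gives (r^2 - 2 r + 9) c^2 = 3 * 36^2 *
  2 = 7776, and the difference of the two sides is \<open>chi1 r\<close> times r^2 - 2 r + 3, which
  is positive. Going back from the squares uses that c is nonnegative at \<open>r1\<close>, which
  holds because c has the factor r - 3.\<close>

lemma edge_sum_3_zero_iff:
  assumes r: "r > 0"
  shows "edge_sum r 3 (vector [1, 1, 1]) = 0 \<longleftrightarrow> r = r1"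
proof -
  define e where "e = sqrt ((r\<^sup>2 - 2 * r + 9) / 3)"
  define c where "c = r ^ 3 + r\<^sup>2 - 3 * r - 27"
  have "r\<^sup>2 - 2 * r + 9 = (r - 1)\<^sup>2 + 8" by (simp add: power2_eq_square algebra_simps)
  then have q: "r\<^sup>2 - 2 * r + 9 > 0" using zero_le_power2[of "r - 1"] by linarith
  have e: "e \<ge> 0" "e\<^sup>2 = (r\<^sup>2 - 2 * r + 9) / 3" using q by (simp_all add: e_def)
  have id: "(r\<^sup>2 - 2 * r + 9) * c\<^sup>2 - 7776 = chi1 r * (r\<^sup>2 - 2 * r + 3)"
    unfolding c_def chi1_def by (simp add: algebra_simps eval_nat_numeral)
  have "r\<^sup>2 - 2 * r + 3 = (r - 1)\<^sup>2 + 2" by (simp add: power2_eq_square algebra_simps)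
  then have q3: "r\<^sup>2 - 2 * r + 3 > 0" using zero_le_power2[of "r - 1"] by linarith
  have sq: "(e * c)\<^sup>2 = (36 * sqrt 2)\<^sup>2 \<longleftrightarrow> chi1 r = 0"
  proof -
    have "(e * c)\<^sup>2 = (36 * sqrt 2)\<^sup>2 \<longleftrightarrow> (r\<^sup>2 - 2 * r + 9) * c\<^sup>2 - 7776 = 0"
      unfolding power_mult_distrib e(2) by (simp add: field_simps)
    then show ?thesis unfolding id using q3 by simp
  qed
  have zero: "edge_sum r 3 (vector [1, 1, 1]) = 0 \<longleftrightarrow> e * c = 36 * sqrt 2"
    unfolding edge_sum_values e_def[symmetric] c_def[symmetric] by (auto simp: field_simps)
  show ?thesis
  proof
    assume "edge_sum r 3 (vector [1, 1, 1]) = 0"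
    then have "chi1 r = 0" using sq unfolding zero by simp
    moreover have "r1 > 0" using r1_bounds(1) by simp
    ultimately show "r = r1" using chi1_unique_root chi1_r1 r by blast
  next
    assume r1: "r = r1"
    then have "chi1 r = 0" "r > 3" using chi1_r1 r1_bounds by simp_all
    have "c = (r - 3) * (r\<^sup>2 + 4 * r + 9)" unfolding c_def by (simp add: algebra_simps eval_nat_numeral)
    then have "c \<ge> 0" using \<open>r > 3\<close> by simp
    then have "e * c \<ge> 0" using e(1) by simp
    moreover have "(e * c)\<^sup>2 = (36 * sqrt 2)\<^sup>2" using sq \<open>chi1 r = 0\<close> by simp
    moreover have "0 \<le> 36 * sqrt (2::real)" by simp
    ultimately have "e * c = 36 * sqrt 2" using power2_eq_imp_eq by blast
    then show "edge_sum r 3 (vector [1, 1, 1]) = 0" unfolding zero .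
  qed
qed

lemma edge_sum_nonzero:
  assumes r: "r > 0"
  shows "edge_sum r 2 (vector [1, 0, 0]) \<noteq> 0" "4 * edge_sum r 4 (vector [1, 0, 0]) - edge_sum r 4 (vector [1, 1, 0]) \<noteq> 0"
    "r = r1 \<Longrightarrow> edge_sum r 5 (vector [1, 1, 1]) \<noteq> 0"
    "r = r1 \<Longrightarrow> 2 * edge_sum r 6 (vector [1, 1, 1]) + 18 * edge_sum r 6 (vector [1, 0, 0]) - 9 * edge_sum r 6 (vector [1, 1, 0]) \<noteq> 0"
proof -
  define e where "e = sqrt ((r\<^sup>2 - 2 * r + 9) / 3)"
  note val = edge_sum_values[of r, folded e_def]
  have "r\<^sup>2 - 2 * r + 9 = (r - 1)\<^sup>2 + 8" by (simp add: power2_eq_square algebra_simps)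
  then have q: "r\<^sup>2 - 2 * r + 9 > 0" using zero_le_power2[of "r - 1"] by linarith
  have e: "e > 0" using q by (simp add: e_def)
  have s2: "sqrt 2 > 0" by simp
  have "e * (4 / 3 * r\<^sup>2 + 4 / 3 * r + 12) > 0" using e r by (intro mult_pos_pos add_pos_pos) auto
  then show "edge_sum r 2 (vector [1, 0, 0]) \<noteq> 0" unfolding val using s2 by linarith
  have "r ^ 4 + r ^ 3 - 3 * r\<^sup>2 + 9 * r + 81 = (r\<^sup>2 - 3 / 2)\<^sup>2 + r ^ 3 + 9 * r + 315 / 4"
    by (simp add: power2_eq_square field_simps eval_nat_numeral)
  also have "\<dots> > 0" using r by (intro add_pos_pos add_nonneg_pos) auto
  finally have "e * (16 / 27 * (r ^ 4 + r ^ 3 - 3 * r\<^sup>2 + 9 * r + 81)) > 0" using e by (intro mult_pos_pos) auto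
  then show "4 * edge_sum r 4 (vector [1, 0, 0]) - edge_sum r 4 (vector [1, 1, 0]) \<noteq> 0" unfolding val using s2 by linarith
  assume r1: "r = r1"
  \<comment> \<open>Since \<open>r1\<close> exceeds 3, polynomials in r are rewritten in u = r - 3 >
    0, where all their coefficients turn out to be positive.\<close>
  define u where "u = r - 3"
  have u: "u > 0" "r = 3 + u" using r1 r1_bounds by (simp_all add: u_def)
  have z: "e * (r ^ 3 + r\<^sup>2 - 3 * r - 27) = 36 * sqrt 2" using edge_sum_3_zero_iff[OF r] r1 unfolding val by simp
  have "r ^ 6 + r ^ 5 - 3 * r ^ 4 - 18 * r ^ 3 - 27 * r\<^sup>2 + 81 * r + 729
      = u ^ 6 + 19 * u ^ 5 + 147 * u ^ 4 + 576 * u ^ 3 + 1134 * u\<^sup>2 + 972 * u + 972"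
    unfolding u(2) by (simp add: algebra_simps eval_nat_numeral)
  also have "\<dots> > 0" using u(1) by (intro add_pos_pos) auto
  finally have "e * (r ^ 6 + r ^ 5 - 3 * r ^ 4 - 18 * r ^ 3 - 27 * r\<^sup>2 + 81 * r + 729) > 0" using e by simp
  then show "2 * edge_sum r 6 (vector [1, 1, 1]) + 18 * edge_sum r 6 (vector [1, 0, 0]) - 9 * edge_sum r 6 (vector [1, 1, 0]) \<noteq> 0"
    unfolding val using s2 by linarith
  \<comment> \<open>At \<open>r1\<close> one has 36 sqrt 2 = e (r^3 + r^2 - 3 r - 27). Inserted into
    1056 sqrt 2, this turns the vanishing of the value in degree 5 into the equality of the quintic
    with (1056 / 36) * (27 / 16) = 99 / 2 times that cubic.\<close>
  have "(5 * r ^ 5 + 5 * r ^ 4 + 3 * r ^ 3 - 9 * r\<^sup>2 - 135 * r - 1215) - 99 / 2 * (r ^ 3 + r\<^sup>2 - 3 * r - 27)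
      = 5 * u ^ 5 + 80 * u ^ 4 + 927 / 2 * u ^ 3 + 1143 * u\<^sup>2 + 972 * u"
    unfolding u(2) by (simp add: field_simps eval_nat_numeral)
  also have "\<dots> > 0" using u(1) by (intro add_pos_pos) auto
  finally have "e * ((5 * r ^ 5 + 5 * r ^ 4 + 3 * r ^ 3 - 9 * r\<^sup>2 - 135 * r - 1215) - 99 / 2 * (r ^ 3 + r\<^sup>2 - 3 * r - 27)) > 0"
    using e by simp
  then have "e * (5 * r ^ 5 + 5 * r ^ 4 + 3 * r ^ 3 - 9 * r\<^sup>2 - 135 * r - 1215) > 99 / 2 * (e * (r ^ 3 + r\<^sup>2 - 3 * r - 27))"
    by (simp only: right_diff_distrib mult.left_commute[of e])
  then show "edge_sum r 5 (vector [1, 1, 1]) \<noteq> 0" unfolding val z by simp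
qed

section \<open>Central symmetry at r = 3\<close>

lemma uminus_symmetry:
  fixes S :: "(real ^ 3) set"
  assumes "\<And>x. x \<in> S \<Longrightarrow> - x \<in> S"
  shows "uminus \<in> symmetry_group S"
proof -
  have "x \<in> uminus ` S" if "x \<in> S" for x using assms[OF that] by (metis image_eqI minus_minus)
  then have "uminus ` S = S" using assms by auto
  then show ?thesis by (simp add: symmetry_group_def orthogonal_uminus)
qed

text \<open>For r = 3 the gauge \<alpha> + \<beta> + 3 \<gamma> / r is the plain sum of the cone
  coordinates, and the faces form its level set 1; \<open>cone_uminus\<close> then applies.\<close>

lemma faces_3_iff:
  "x \<in> skeleton 3 2 \<longleftrightarrow> (\<exists>i j k \<alpha> \<beta> \<gamma>. in_cone i j k \<alpha> \<beta> \<gamma> x \<and> \<alpha> + \<beta> + \<gamma> = 1)"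
proof
  assume "x \<in> skeleton 3 2"
  then obtain i j k where ijk: "i < 4" "j < 4" "k < 4" "i \<noteq> j" "k \<noteq> i" "k \<noteq> j"
    and x: "x \<in> convex hull {tet_vertex i, tet_vertex j, tet_apex 3 k}"
    by (auto simp: skeleton_def triakis_faces_def)
  from x obtain u v w where uvw: "0 \<le> u" "0 \<le> v" "0 \<le> w" "u + v + w = 1" "x = u *\<^sub>R tet_vertex i + v *\<^sub>R tet_vertex j - w *\<^sub>R tet_vertex k"
    using ijk(3) by (auto simp: convex_hull_3 tet_apex_eq)
  show "\<exists>i j k \<alpha> \<beta> \<gamma>. in_cone i j k \<alpha> \<beta> \<gamma> x \<and> \<alpha> + \<beta> + \<gamma> = 1"
  proof (cases "(i, j, k) \<in> cell_index")
    case True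
    then have "in_cone i j k u v w x" using uvw by (simp add: in_cone_def)
    then show ?thesis using uvw(4) by blast
  next
    case False
    then have "in_cone j i k v u w x" using uvw cell_index_cases[OF ijk] by (auto simp: in_cone_def)
    then show ?thesis using uvw(4) by (intro exI conjI) (assumption, simp)
  qed
next
  assume "\<exists>i j k \<alpha> \<beta> \<gamma>. in_cone i j k \<alpha> \<beta> \<gamma> x \<and> \<alpha> + \<beta> + \<gamma> = 1"
  then obtain i j k \<alpha> \<beta> \<gamma> where c: "in_cone i j k \<alpha> \<beta> \<gamma> x" "\<alpha> + \<beta> + \<gamma> = 1" by blast
  then have q: "(i, j, k) \<in> cell_index" and n: "0 \<le> \<alpha>" "0 \<le> \<beta>" "0 \<le> \<gamma>" by (simp_all add: in_cone_def)
  note R = cell_index_remaining(1-4)[OF q]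
  have "x = \<alpha> *\<^sub>R tet_vertex i + \<beta> *\<^sub>R tet_vertex j + \<gamma> *\<^sub>R tet_apex 3 k" using c(1) R by (simp add: in_cone_def tet_apex_eq)
  then have "x \<in> convex hull {tet_vertex i, tet_vertex j, tet_apex 3 k}"
    unfolding convex_hull_3 using c(2) n by blast
  moreover have "convex hull {tet_vertex i, tet_vertex j, tet_apex 3 k} \<in> triakis_faces 3"
    unfolding triakis_faces_def using R by auto
  ultimately show "x \<in> skeleton 3 2" by (auto simp: skeleton_def)
qed

lemma uminus_skeleton_3:
  assumes "k = 0 \<or> k = 2 \<or> k = 3"
  shows "uminus \<in> symmetry_group (skeleton 3 k)"
proof (rule uminus_symmetry)
  fix x assume x: "x \<in> skeleton 3 k"
  consider "k = 0" | "k = 2" | "k = 3" using assms by blast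
  then show "- x \<in> skeleton 3 k"
  proof cases
    case 1
    have "tet_apex 3 ` {..<4} = uminus ` tet_vertex ` {..<4}"
      unfolding image_image by (intro image_cong refl) (simp add: tet_apex_eq)
    then show ?thesis using x 1 by (auto simp: skeleton_def triakis_vertices_def)
  next
    case 2
    obtain i j l \<alpha> \<beta> \<gamma> where c: "in_cone i j l \<alpha> \<beta> \<gamma> x" "\<alpha> + \<beta> + \<gamma> = 1" using x unfolding 2 faces_3_iff by blast
    show ?thesis unfolding 2 faces_3_iff using cone_uminus[OF c(1)] unfolding c(2) .
  next
    case 3
    have s: "skeleton 3 3 = solid_cells 3" using triakis_solid_eq_cells[of 3] by (simp add: skeleton_def)
    obtain i j l \<alpha> \<beta> \<gamma> where c: "in_cone i j l \<alpha> \<beta> \<gamma> x" "\<alpha> + \<beta> + \<gamma> \<le> 1" using x unfolding 3 s solid_cells_def by auto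
    obtain i' j' l' \<alpha>' \<beta>' \<gamma>' where "in_cone i' j' l' \<alpha>' \<beta>' \<gamma>' (- x)" "\<alpha>' + \<beta>' + \<gamma>' = \<alpha> + \<beta> + \<gamma>"
      using cone_uminus[OF c(1)] by blast
    then show ?thesis unfolding 3 s solid_cells_def using c(2) by fastforce
  qed
qed

lemma harmonic_B_subset_skeleton_3:
  assumes "k = 0 \<or> k = 2 \<or> k = 3"
  shows "harmonic_B \<subseteq> group_harmonic (symmetry_group (skeleton 3 k))"
  using harmonic_subset_group_harmonic[OF generators_in_groups(1) generators_in_groups(1) generators_in_groups(1)] uminus_skeleton_3[OF assms]
  by blast

section \<open>Determination of the spaces of harmonic functions\<close>

lemma centered_skeleton_distributions:
  assumes r: "r > 0" and k: "k = 0 \<or> k = 2 \<or> k = 3"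
  shows "distribution_of ` skeleton_harmonic r k = (if r = 3 then harmonic_B else harmonic_A)"
proof -
  define \<Phi> where "\<Phi> = (if k = 0 then vertex_sum r else cell_sum r)"
  have \<Phi>: "has_power_sums r k \<Phi>"
    using k vertices_power_sums[OF r] faces_power_sums[OF r] solid_power_sums[OF r] by (auto simp: \<Phi>_def)
  have p4: "r ^ 4 + 2 * r ^ 3 - 3 * r\<^sup>2 + 81 > 0" "r ^ 4 + 81 > 0"
  proof -
    have "r ^ 4 + 2 * r ^ 3 - 3 * r\<^sup>2 + 81 = (r\<^sup>2 - 3 / 2)\<^sup>2 + 2 * r ^ 3 + 315 / 4"
      by (simp add: power2_eq_square field_simps eval_nat_numeral)
    also have "\<dots> > 0" using r by (intro add_pos_pos add_nonneg_pos) auto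
    finally show "r ^ 4 + 2 * r ^ 3 - 3 * r\<^sup>2 + 81 > 0" .
    show "r ^ 4 + 81 > 0" using r by (intro add_pos_pos) auto
  qed
  have p2: "4 / 3 * r\<^sup>2 + 8 / 3 * r + 20 > 0" "4 / 9 * r\<^sup>2 + 4 > 0" using r by (auto intro!: add_pos_pos)
  have p3: "r\<^sup>2 + 5 * r + 12 > 0" "r\<^sup>2 + 3 * r + 9 > 0" using r by (auto intro!: add_pos_pos)
  have 2: "\<Phi> 2 (vector [1, 0, 0]) \<noteq> 0"
    using p2 by (auto simp: \<Phi>_def cell_sum_values vertex_sum_values)
  have 4: "4 * \<Phi> 4 (vector [1, 0, 0]) - \<Phi> 4 (vector [1, 1, 0]) \<noteq> 0"
  proof (cases "k = 0")
    case True
    then have "\<Phi> = vertex_sum r" by (simp add: \<Phi>_def)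
    then show ?thesis using p4 by (simp only: vertex_sum_values) simp
  next
    case False
    then have "\<Phi> = cell_sum r" by (simp add: \<Phi>_def)
    then show ?thesis using p4 by (simp only: cell_sum_values) simp
  qed
  have 3: "\<Phi> 3 (vector [1, 1, 1]) = 0 \<longleftrightarrow> r = 3"
    using p3 by (auto simp: \<Phi>_def cell_sum_values vertex_sum_values)
  have 6: "2 * \<Phi> 6 (vector [1, 1, 1]) + 18 * \<Phi> 6 (vector [1, 0, 0]) - 9 * \<Phi> 6 (vector [1, 1, 0]) \<noteq> 0" if "r = 3"
  proof (cases "k = 0")
    case True
    then have "\<Phi> = vertex_sum 3" using that by (simp add: \<Phi>_def)
    then show ?thesis by (simp only: vertex_sum_values)
  next
    case False
    then have "\<Phi> = cell_sum 3" using that by (simp add: \<Phi>_def)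
    then show ?thesis by (simp only: cell_sum_values)
  qed
  show ?thesis using power_sums_cases(1,2)[OF \<Phi> 2 4] 3 6 by auto
qed

lemma edge_skeleton_distributions:
  assumes r: "r > 0"
  shows "distribution_of ` skeleton_harmonic r 1 = (if r = r1 then harmonic_B else harmonic_A)"
    and "r = r1 \<Longrightarrow> group_harmonic (symmetry_group (skeleton r 1)) \<subseteq> harmonic_A"
  using power_sums_cases[OF edges_power_sums[OF r] edge_sum_nonzero(1,2)[OF r]] edge_sum_nonzero(3,4)[OF r] edge_sum_3_zero_iff[OF r]
  by auto

lemma harmonic_A_psubset_B: "harmonic_A \<subset> harmonic_B"
proof -
  have "harmonic_A \<subseteq> harmonic_B" using rec_A_imp_B by (auto simp: harmonic_A_def harmonic_B_def)
  then show ?thesis using xyz_harmonic_B by blast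
qed

theorem theorem2p1:
  fixes r :: real
  assumes "r > 0"
  shows "(\<exists>!s. s > 0 \<and> chi1 s = 0) \<and> 3.62398 \<le> r1 \<and> r1 < 3.62399 \<and>
         (\<forall>k \<in> {0, 1, 2, 3 :: nat}.
            (group_harmonic (symmetry_group (skeleton r k)) \<subset> distribution_of ` skeleton_harmonic r k
               \<longleftrightarrow> k = 1 \<and> r = r1) \<and>
            distribution_of ` skeleton_harmonic r k =
              (if (k = 1 \<and> r = r1) \<or> (k \<in> {0, 2, 3} \<and> r = 3)
               then group_harmonic W_B3 else group_harmonic W_A3))"
proof (intro conjI ballI)
  show "\<exists>!s. s > 0 \<and> chi1 s = 0" "3.62398 \<le> r1" "r1 < 3.62399" by (fact chi1_unique_root r1_bounds)+
  fix k :: nat assume "k \<in> {0, 1, 2, 3}"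
  then consider (even) "k = 0 \<or> k = 2 \<or> k = 3" | (edge) "k = 1" by auto
  then have "(group_harmonic (symmetry_group (skeleton r k)) \<subset> distribution_of ` skeleton_harmonic r k \<longleftrightarrow> k = 1 \<and> r = r1) \<and>
      distribution_of ` skeleton_harmonic r k = (if (k = 1 \<and> r = r1) \<or> (k \<in> {0, 2, 3} \<and> r = 3) then harmonic_B else harmonic_A)"
  proof cases
    case even
    \<comment> \<open>At r = 3 this rests on the central symmetry of the skeleton, otherwise on its
      invariance under W(A_3) alone.\<close>
    have "distribution_of ` skeleton_harmonic r k \<subseteq> group_harmonic (symmetry_group (skeleton r k))"
      unfolding centered_skeleton_distributions[OF assms even]
      using harmonic_A_subset_skeleton[of r k] harmonic_B_subset_skeleton_3[OF even] by auto
    then show ?thesis using even centered_skeleton_distributions[OF assms even] by auto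
  next
    case edge
    \<comment> \<open>At r = \<open>r1\<close> the harmonic distributions of the symmetry group lie
      in \<open>harmonic_A\<close>, which is strictly smaller than \<open>harmonic_B\<close>. For
      other r the mean value functions give just \<open>harmonic_A\<close>, which is contained in
      those distributions.\<close>
    show ?thesis
      using edge_skeleton_distributions[OF assms] harmonic_A_psubset_B harmonic_A_subset_skeleton[of r 1] unfolding edge by auto
  qed
  then show "(group_harmonic (symmetry_group (skeleton r k)) \<subset> distribution_of ` skeleton_harmonic r k) = (k = 1 \<and> r = r1)"
    "distribution_of ` skeleton_harmonic r k = (if (k = 1 \<and> r = r1) \<or> (k \<in> {0, 2, 3} \<and> r = 3) then group_harmonic W_B3 else group_harmonic W_A3)"
    unfolding group_harmonic_W_A3 group_harmonic_W_B3 by blast+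
qed

end
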